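(* For the stable pairs $\rho_i=(\mathcal{Q}_i=\mathcal{O}_{l_0}(p_i),s)\in P_2(\mathbb{P}^3,\beta=H^2)^{\mathbb{T}}$, $i=0,1$, one has $$\mathrm{T}_{\rho_i}P_2(\mathbb{P}^3,\beta=H^2)^{\mathbb{T}}=\mathbb{C}^5,\qquad \mathrm{Obs}_{\rho_i}P_2(\mathbb{P}^3,\beta=H^2)^{\mathbb{T}}=\mathbb{C}^3.$$
   Context: We work over $\mathbb{C}$, with homogeneous coordinates $[z_0;z_1;z_2;z_3]$ on $\mathbb{P}^3$; $l_0=\{z_2=z_3=0\}$, $p_0=[1;0;0;0]$, $p_1=[0;1;0;0]$, and $H$ is the hyperplane class, so $H^2$ is the class of a line. The torus $\mathbb{T}=(\mathbb{C}^* )^3$ acts on $\mathbb{P}^3$ by $t\cdot[z_0;z_1;z_2;z_3]=[z_0;t_1z_1;t_2z_2;t_3z_3]$. $P_n(\mathbb{P}^3,\beta)$ is the Pandharipande–Thomas moduli space of stable pairs $\mathcal{O}_{\mathbb{P}^3}\xrightarrow{s}\mathcal{Q}$, with $\mathcal{Q}$ pure of dimension $1$, $\mathrm{coker}(s)$ of dimension zero and $\chi(\mathcal{Q}(m))=m\cdot\beta+n$; $P_n(\mathbb{P}^3,\beta)^{\mathbb{T}}$ denotes its fixed locus under the induced action of $\mathbb{T}$. For $\rho_i$, the section $s$ gives an exact sequence $0\to\mathcal{O}_{l_0}\to\mathcal{O}_{l_0}(p_i)\to\mathcal{Z}\to0$ with $\mathcal{Z}$ the structure sheaf of one point. $\mathrm{T}_{\rho_i}$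 and $\mathrm{Obs}_{\rho_i}$ denote the tangent and obstruction spaces at $\rho_i$; they are computed as $\mathrm{Ext}^0(I^\bullet,\mathcal{Q}_i)$ and $\mathrm{Ext}^1(I^\bullet,\mathcal{Q}_i)$ respectively, where $I^\bullet=\{\mathcal{O}_{\mathbb{P}^3}\xrightarrow{s}\mathcal{Q}_i\}$ is the associated two-term complex in $D^b(\mathbb{P}^3)$, with $\mathcal{O}_{\mathbb{P}^3}$ in degree $0$. *)

theory Defs
  imports "HOL-Analysis.Finite_Cartesian_Product" "HOL-Library.Numeral_Type" "HOL-Algebra.Module"
begin

section \<open>Projective three-space with its Zariski topology\<close>

text \<open>The four homogeneous coordinates are indexed by the type \<open>4\<close>, whose elements are
  \<open>0, 1, 2, 3\<close>.  Points are the closed points, as for a classical variety.\<close>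

quotient_type proj3 = "complex^4" / partial: "\<lambda>v w. v \<noteq> 0 \<and> w \<noteq> 0 \<and> (\<exists>c. w = c *s v)"
proof (rule part_equivpI)
  show "\<exists>v::complex^4. v \<noteq> 0 \<and> v \<noteq> 0 \<and> (\<exists>c. v = c *s v)"
    by (rule exI[of _ "1"], intro conjI exI[of _ 1])
      (auto simp: vec_eq_iff)
  show "symp (\<lambda>v w::complex^4. v \<noteq> 0 \<and> w \<noteq> 0 \<and> (\<exists>c. w = c *s v))"
  proof (rule sympI)
    fix v w :: "complex^4"
    assume "v \<noteq> 0 \<and> w \<noteq> 0 \<and> (\<exists>c. w = c *s v)"
    then obtain c where c: "v \<noteq> 0" "w \<noteq> 0" "w = c *s v" by blast
    then have "c \<noteq> 0" by auto
    then have "v = inverse c *s w" using c by (simp add: vec_eq_iff)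
    then show "w \<noteq> 0 \<and> v \<noteq> 0 \<and> (\<exists>c. v = c *s w)" using c by blast
  qed
  show "transp (\<lambda>v w::complex^4. v \<noteq> 0 \<and> w \<noteq> 0 \<and> (\<exists>c. w = c *s v))"
    by (rule transpI) (metis vector_smult_assoc)
qed

definition coords_of :: "proj3 \<Rightarrow> complex^4 \<Rightarrow> bool" where
  "coords_of x v \<longleftrightarrow> v \<noteq> 0 \<and> abs_proj3 v = x"

inductive homog_poly :: "nat \<Rightarrow> (complex^4 \<Rightarrow> complex) \<Rightarrow> bool" where
  const: "homog_poly 0 (\<lambda>_. c)"
| coord: "homog_poly 1 (\<lambda>v. v $ i)"
| add: "homog_poly d P \<Longrightarrow> homog_poly d Q \<Longrightarrow> homog_poly d (\<lambda>v. P v + Q v)"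
| mult: "homog_poly d P \<Longrightarrow> homog_poly e Q \<Longrightarrow> homog_poly (d + e) (\<lambda>v. P v * Q v)"

lemma homog_poly_scale: "homog_poly d P \<Longrightarrow> P (c *s v) = c ^ d * P v"
  by (induction rule: homog_poly.induct) (auto simp: algebra_simps power_add)

lemma coords_of_ex: "\<exists>v. coords_of x v"
  by (induction x rule: proj3.abs_induct) (auto simp: coords_of_def)

lemma coords_of_scale:
  assumes "coords_of x v" "coords_of x w"
  shows "\<exists>c. c \<noteq> 0 \<and> w = c *s v"
proof -
  have "abs_proj3 v = abs_proj3 w" "v \<noteq> 0" "w \<noteq> 0" using assms by (auto simp: coords_of_def)
  moreover have "v \<noteq> 0 \<and> v \<noteq> 0 \<and> (\<exists>c. v = c *s v)" if "v \<noteq> 0" for v :: "complex^4"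
    using that by (metis vector_smult_lid)
  ultimately have "\<exists>c. w = c *s v"
    using Quotient3_rel[OF Quotient3_proj3, of v w] by blast
  with \<open>w \<noteq> 0\<close> show ?thesis by (metis vector_smult_lzero)
qed

lemma homog_poly_coords_nz:
  assumes "homog_poly d P" "coords_of x v" "coords_of x w"
  shows "P v \<noteq> 0 \<longleftrightarrow> P w \<noteq> 0"
proof -
  from coords_of_scale[OF assms(2,3)] obtain c where "c \<noteq> 0" "w = c *s v" by blast
  then show ?thesis using homog_poly_scale[OF assms(1), of c v] by simp
qed

instantiation proj3 :: topological_space
begin

definition open_proj3 :: "proj3 set \<Rightarrow> bool" where
  "open_proj3 U \<longleftrightarrow> (\<exists>T. (\<forall>P\<in>T. \<exists>d. homog_poly d P) \<and>
     - U = {x. \<forall>P\<in>T. \<forall>v. coords_of x v \<longrightarrow> P v = 0})"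

instance
proof
  show "open (UNIV :: proj3 set)"
    unfolding open_proj3_def
    by (rule exI[of _ "{\<lambda>_. 1}"]) (auto intro: homog_poly.const simp: coords_of_ex)
next
  fix U V :: "proj3 set"
  assume "open U" "open V"
  then obtain S T where S: "\<forall>P\<in>S. \<exists>d. homog_poly d P"
      "- U = {x. \<forall>P\<in>S. \<forall>v. coords_of x v \<longrightarrow> P v = 0}"
    and T: "\<forall>P\<in>T. \<exists>d. homog_poly d P"
      "- V = {x. \<forall>P\<in>T. \<forall>v. coords_of x v \<longrightarrow> P v = 0}"
    unfolding open_proj3_def by blast
  let ?R = "{\<lambda>v. P v * Q v |P Q. P \<in> S \<and> Q \<in> T}"
  have eq: "x \<in> - (U \<inter> V) \<longleftrightarrow> (\<forall>P\<in>?R. \<forall>v. coords_of x v \<longrightarrow> P v = 0)" for x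
  proof -
    obtain v where v: "coords_of x v" using coords_of_ex by blast
    have U: "x \<in> - U \<longleftrightarrow> (\<forall>P\<in>S. P v = 0)"
      unfolding S(2) using S(1) v by (auto dest: homog_poly_coords_nz[OF _ v])
    have V: "x \<in> - V \<longleftrightarrow> (\<forall>P\<in>T. P v = 0)"
      unfolding T(2) using T(1) v by (auto dest: homog_poly_coords_nz[OF _ v])
    have R: "(\<forall>P\<in>?R. \<forall>v. coords_of x v \<longrightarrow> P v = 0) \<longleftrightarrow> (\<forall>P\<in>S. \<forall>Q\<in>T. P v * Q v = 0)"
    proof
      assume L: "\<forall>P\<in>S. \<forall>Q\<in>T. P v * Q v = 0"
      show "\<forall>P\<in>?R. \<forall>v. coords_of x v \<longrightarrow> P v = 0"
      proof (intro ballI allI impI)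
        fix R w assume "R \<in> ?R" and w: "coords_of x w"
        then obtain P Q where PQ: "P \<in> S" "Q \<in> T" "R = (\<lambda>v. P v * Q v)" by blast
        have "P v = 0 \<or> Q v = 0" using L[rule_format, OF PQ(1,2)] by simp
        then have "P w = 0 \<or> Q w = 0" 
          using PQ(1,2) S(1) T(1) homog_poly_coords_nz[OF _ v w] by blast
        then show "R w = 0" using PQ(3) by auto
      qed
    qed (use v in fast)
    show ?thesis unfolding R using U V by (simp only: Compl_Int Un_iff mult_eq_0_iff) blast
  qed
  have "\<forall>P\<in>?R. \<exists>d. homog_poly d P"
    using S(1) T(1) homog_poly.mult by blast
  moreover have "- (U \<inter> V) = {x. \<forall>P\<in>?R. \<forall>v. coords_of x v \<longrightarrow> P v = 0}"
  proof (rule Set.set_eqI)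
    fix x
    show "x \<in> - (U \<inter> V) \<longleftrightarrow> x \<in> {x. \<forall>P\<in>?R. \<forall>v. coords_of x v \<longrightarrow> P v = 0}"
      unfolding mem_Collect_eq[of x "\<lambda>x. \<forall>P\<in>?R. \<forall>v. coords_of x v \<longrightarrow> P v = 0"] by (rule eq)
  qed
  ultimately show "open (U \<inter> V)"
    unfolding open_proj3_def by (rule exI[of _ ?R, OF conjI])
next
  fix K :: "proj3 set set"
  assume "\<forall>U\<in>K. open U"
  let ?Z = "\<lambda>T. {x. \<forall>P\<in>T. \<forall>v. coords_of x v \<longrightarrow> P v = 0}"
  let ?T = "{P. (\<exists>d. homog_poly d P) \<and> (\<forall>x\<in>- \<Union>K. \<forall>v. coords_of x v \<longrightarrow> P v = 0)}"
  have "x \<notin> ?Z ?T" if x: "x \<in> U" "U \<in> K" for x U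
  proof -
    obtain T where T: "\<forall>P\<in>T. \<exists>d. homog_poly d P" "- U = ?Z T"
      using \<open>\<forall>U\<in>K. open U\<close> x(2) unfolding open_proj3_def by meson
    from x(1) have "x \<notin> ?Z T" unfolding T(2)[symmetric] by simp
    then obtain P v where P: "P \<in> T" "coords_of x v" "P v \<noteq> 0" by blast
    have "\<forall>y\<in>- \<Union>K. \<forall>v. coords_of y v \<longrightarrow> P v = 0"
    proof
      fix y assume "y \<in> - \<Union>K"
      then have "y \<in> ?Z T" unfolding T(2)[symmetric] using x(2) by blast
      then show "\<forall>v. coords_of y v \<longrightarrow> P v = 0" using P(1) by blast
    qed
    then have "P \<in> ?T" using P(1) T(1) by blast
    then show ?thesis using P(2,3) by blast
  qed
  then have "- \<Union>K = ?Z ?T" by blast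
  then show "open (\<Union>K)"
    unfolding open_proj3_def by (intro exI[of _ ?T] conjI) (blast, assumption)
qed

end

definition coord_point :: "4 \<Rightarrow> proj3" where
  "coord_point i = abs_proj3 (axis i 1)"

definition line0 :: "proj3 set" where
  "line0 = {x. \<forall>v. coords_of x v \<longrightarrow> v $ 2 = 0 \<and> v $ 3 = 0}"


section \<open>Regular functions and the structure sheaf\<close>

text \<open>For a locally closed set \<open>A\<close>, the regular functions on the (reduced) variety \<open>A\<close>.  Here and
  below a function on a set is represented by its extension by zero.\<close>

definition regular_on :: "proj3 set \<Rightarrow> (proj3 \<Rightarrow> complex) set" where
  "regular_on A = {f. (\<forall>x. x \<notin> A \<longrightarrow> f x = 0) \<and>
     (\<forall>x\<in>A. \<exists>V d P Q. open V \<and> x \<in> V \<and> homog_poly d P \<and> homog_poly d Q \<and>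
        (\<forall>y\<in>A \<inter> V. \<forall>v. coords_of y v \<longrightarrow> Q v \<noteq> 0 \<and> f y = P v / Q v))}"

definition on_set :: "proj3 set \<Rightarrow> (proj3 \<Rightarrow> complex) \<Rightarrow> proj3 \<Rightarrow> complex" where
  "on_set A f = (\<lambda>x. if x \<in> A then f x else 0)"

definition struct_ring :: "proj3 set \<Rightarrow> (proj3 \<Rightarrow> complex) ring" where
  "struct_ring U = \<lparr>carrier = regular_on U, mult = (\<lambda>f g x. f x * g x), one = on_set U (\<lambda>_. 1),
     zero = (\<lambda>_. 0), add = (\<lambda>f g x. f x + g x)\<rparr>"


section \<open>Sheaves of modules over the structure sheaf\<close>

text \<open>\<open>sec F U\<close> is the module of sections over \<open>U\<close> (the ring fields \<open>mult\<close> and \<open>one\<close> of the record play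
  no role).  Only the values at open sets \<open>V \<subseteq> U\<close> and at sections in the carriers carry meaning; the same
  applies to morphisms.\<close>

record 'a osheaf =
  sec :: "proj3 set \<Rightarrow> (proj3 \<Rightarrow> complex, 'a) module"
  res :: "proj3 set \<Rightarrow> proj3 set \<Rightarrow> 'a \<Rightarrow> 'a"

definition O_module :: "'a osheaf \<Rightarrow> bool" where
  "O_module F \<longleftrightarrow>
    (\<forall>U. open U \<longrightarrow> Module.module (struct_ring U) (sec F U)) \<and>
    (\<forall>U V. open U \<longrightarrow> open V \<longrightarrow> V \<subseteq> U \<longrightarrow>
       (\<forall>m\<in>carrier (sec F U). res F U V m \<in> carrier (sec F V)) \<and>
       (\<forall>m\<in>carrier (sec F U). \<forall>n\<in>carrier (sec F U).
          res F U V (m \<oplus>\<^bsub>sec F U\<^esub> n) = res F U V m \<oplus>\<^bsub>sec F V\<^esub> res F U V n) \<and>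
       (\<forall>f\<in>regular_on U. \<forall>m\<in>carrier (sec F U).
          res F U V (f \<odot>\<^bsub>sec F U\<^esub> m) = on_set V f \<odot>\<^bsub>sec F V\<^esub> res F U V m)) \<and>
    (\<forall>U. open U \<longrightarrow> (\<forall>m\<in>carrier (sec F U). res F U U m = m)) \<and>
    (\<forall>U V W. open U \<longrightarrow> open V \<longrightarrow> open W \<longrightarrow> W \<subseteq> V \<longrightarrow> V \<subseteq> U \<longrightarrow>
       (\<forall>m\<in>carrier (sec F U). res F V W (res F U V m) = res F U W m)) \<and>
    (\<forall>C m. (\<forall>V\<in>C. open V \<and> m V \<in> carrier (sec F V)) \<longrightarrow>
       (\<forall>V\<in>C. \<forall>W\<in>C. res F V (V \<inter> W) (m V) = res F W (V \<inter> W) (m W)) \<longrightarrow>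
       (\<exists>!n. n \<in> carrier (sec F (\<Union>C)) \<and> (\<forall>V\<in>C. res F (\<Union>C) V n = m V)))"

type_synonym 'a omap = "proj3 set \<Rightarrow> 'a \<Rightarrow> 'a"

definition O_hom :: "'a osheaf \<Rightarrow> 'a osheaf \<Rightarrow> 'a omap \<Rightarrow> bool" where
  "O_hom F G \<phi> \<longleftrightarrow>
    (\<forall>U. open U \<longrightarrow>
       (\<forall>m\<in>carrier (sec F U). \<phi> U m \<in> carrier (sec G U)) \<and>
       (\<forall>m\<in>carrier (sec F U). \<forall>n\<in>carrier (sec F U).
          \<phi> U (m \<oplus>\<^bsub>sec F U\<^esub> n) = \<phi> U m \<oplus>\<^bsub>sec G U\<^esub> \<phi> U n) \<and>
       (\<forall>f\<in>regular_on U. \<forall>m\<in>carrier (sec F U).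
          \<phi> U (f \<odot>\<^bsub>sec F U\<^esub> m) = f \<odot>\<^bsub>sec G U\<^esub> \<phi> U m)) \<and>
    (\<forall>U V. open U \<longrightarrow> open V \<longrightarrow> V \<subseteq> U \<longrightarrow>
       (\<forall>m\<in>carrier (sec F U). \<phi> V (res F U V m) = res G U V (\<phi> U m)))"


section \<open>Bounded complexes\<close>

record 'a ocomplex =
  obj :: "int \<Rightarrow> 'a osheaf"
  diff :: "int \<Rightarrow> 'a omap"

definition bounded_complex :: "'a ocomplex \<Rightarrow> bool" where
  "bounded_complex K \<longleftrightarrow>
    (\<forall>i. O_module (obj K i) \<and> O_hom (obj K i) (obj K (i + 1)) (diff K i)) \<and>
    (\<forall>i U. open U \<longrightarrow> (\<forall>m\<in>carrier (sec (obj K i) U).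
       diff K (i + 1) U (diff K i U m) = \<zero>\<^bsub>sec (obj K (i + 2)) U\<^esub>)) \<and>
    (\<exists>N. \<forall>i. \<bar>i\<bar> > N \<longrightarrow> (\<forall>U. open U \<longrightarrow>
       carrier (sec (obj K i) U) = {\<zero>\<^bsub>sec (obj K i) U\<^esub>}))"

type_synonym 'a cmap = "int \<Rightarrow> 'a omap"

definition chain_map :: "'a ocomplex \<Rightarrow> 'a ocomplex \<Rightarrow> 'a cmap \<Rightarrow> bool" where
  "chain_map K L \<phi> \<longleftrightarrow>
    (\<forall>i. O_hom (obj K i) (obj L i) (\<phi> i)) \<and>
    (\<forall>i U. open U \<longrightarrow> (\<forall>m\<in>carrier (sec (obj K i) U).
       \<phi> (i + 1) U (diff K i U m) = diff L i U (\<phi> i U m)))"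

definition cmap_comp :: "'a cmap \<Rightarrow> 'a cmap \<Rightarrow> 'a cmap" where
  "cmap_comp \<psi> \<phi> = (\<lambda>i U m. \<psi> i U (\<phi> i U m))"

definition cmap_add :: "'a ocomplex \<Rightarrow> 'a cmap \<Rightarrow> 'a cmap \<Rightarrow> 'a cmap" where
  "cmap_add L \<phi> \<psi> = (\<lambda>i U m. \<phi> i U m \<oplus>\<^bsub>sec (obj L i) U\<^esub> \<psi> i U m)"

definition cmap_scale :: "'a ocomplex \<Rightarrow> complex \<Rightarrow> 'a cmap \<Rightarrow> 'a cmap" where
  "cmap_scale L c \<phi> = (\<lambda>i U m. on_set U (\<lambda>_. c) \<odot>\<^bsub>sec (obj L i) U\<^esub> \<phi> i U m)"

definition cmap_zero :: "'a ocomplex \<Rightarrow> 'a cmap" where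
  "cmap_zero L = (\<lambda>i U m. \<zero>\<^bsub>sec (obj L i) U\<^esub>)"

definition homotopic :: "'a ocomplex \<Rightarrow> 'a ocomplex \<Rightarrow> 'a cmap \<Rightarrow> 'a cmap \<Rightarrow> bool" where
  "homotopic K L \<phi> \<psi> \<longleftrightarrow> (\<exists>h.
    (\<forall>i. O_hom (obj K i) (obj L (i - 1)) (h i)) \<and>
    (\<forall>i U. open U \<longrightarrow> (\<forall>m\<in>carrier (sec (obj K i) U).
       \<phi> i U m = \<psi> i U m \<oplus>\<^bsub>sec (obj L i) U\<^esub>
         (diff L (i - 1) U (h i U m) \<oplus>\<^bsub>sec (obj L i) U\<^esub> h (i + 1) U (diff K i U m)))))"

definition cycles :: "'a ocomplex \<Rightarrow> int \<Rightarrow> proj3 set \<Rightarrow> 'a set" where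
  "cycles K i U =
    {m \<in> carrier (sec (obj K i) U). diff K i U m = \<zero>\<^bsub>sec (obj K (i + 1)) U\<^esub>}"

definition boundaries :: "'a ocomplex \<Rightarrow> int \<Rightarrow> proj3 set \<Rightarrow> 'a set" where
  "boundaries K i U = diff K (i - 1) U ` carrier (sec (obj K (i - 1)) U)"

text \<open>Isomorphism on cohomology sheaves, expressed at the stalks: the two clauses say that the induced
  map on the stalk at \<open>x\<close> of the \<open>i\<close>-th cohomology is injective and surjective.\<close>

definition quasi_iso :: "'a ocomplex \<Rightarrow> 'a ocomplex \<Rightarrow> 'a cmap \<Rightarrow> bool" where
  "quasi_iso K L \<phi> \<longleftrightarrow> chain_map K L \<phi> \<and>
    (\<forall>i U x. open U \<longrightarrow> x \<in> U \<longrightarrow>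
      (\<forall>m\<in>cycles K i U. \<phi> i U m \<in> boundaries L i U \<longrightarrow>
         (\<exists>V. open V \<and> x \<in> V \<and> V \<subseteq> U \<and> res (obj K i) U V m \<in> boundaries K i V)) \<and>
      (\<forall>n\<in>cycles L i U. \<exists>V. open V \<and> x \<in> V \<and> V \<subseteq> U \<and>
         (\<exists>m\<in>cycles K i V. \<exists>b\<in>boundaries L i V.
            res (obj L i) U V n = \<phi> i V m \<oplus>\<^bsub>sec (obj L i) V\<^esub> b)))"

definition shift :: "int \<Rightarrow> 'a ocomplex \<Rightarrow> 'a ocomplex" where
  "shift k K = \<lparr>obj = (\<lambda>i. obj K (i + k)),
     diff = (\<lambda>i U m. if even k then diff K (i + k) U m
       else \<ominus>\<^bsub>sec (obj K (i + k + 1)) U\<^esub> diff K (i + k) U m)\<rparr>"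


section \<open>Morphisms in the bounded derived category\<close>

text \<open>Morphisms \<open>K \<rightarrow> L\<close> are classes of roofs \<open>K \<leftarrow> J \<rightarrow> L\<close> with the left leg a quasi-isomorphism.
  The middle term \<open>J\<close> runs over bounded complexes of sheaves of modules with sections in the type
  \<open>'a\<close>; since \<open>J\<close> is quasi-isomorphic to \<open>K\<close>, it has coherent cohomology as soon as \<open>K\<close> has, so that
  this is the morphism space in the bounded derived category of modules with coherent cohomology,
  which is equivalent to the bounded derived category of coherent sheaves.\<close>

type_synonym 'a roof = "'a ocomplex \<times> 'a cmap \<times> 'a cmap"

definition roofs :: "'a ocomplex \<Rightarrow> 'a ocomplex \<Rightarrow> 'a roof set" where
  "roofs K L = {(J, s, f). bounded_complex J \<and> quasi_iso J K s \<and> chain_map J L f}"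

definition roof_rel :: "'a ocomplex \<Rightarrow> 'a ocomplex \<Rightarrow> ('a roof \<times> 'a roof) set" where
  "roof_rel K L = {((J, s, f), (J', s', f')).
    (J, s, f) \<in> roofs K L \<and> (J', s', f') \<in> roofs K L \<and>
    (\<exists>M u u'. bounded_complex M \<and> chain_map M J u \<and> chain_map M J' u' \<and>
       quasi_iso M K (cmap_comp s u) \<and>
       homotopic M K (cmap_comp s u) (cmap_comp s' u') \<and>
       homotopic M L (cmap_comp f u) (cmap_comp f' u'))}"

text \<open>The vector space structure: any two classes have representatives with a common left leg.  The
  fields \<open>mult\<close> and \<open>one\<close> of the record play no role.\<close>

definition derived_hom :: "'a ocomplex \<Rightarrow> 'a ocomplex \<Rightarrow> (complex, 'a roof set) module" where
  "derived_hom K L = \<lparr>carrier = roofs K L // roof_rel K L,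
     mult = undefined, one = undefined,
     zero = roof_rel K L `` {(K, (\<lambda>i U m. m), cmap_zero L)},
     add = (\<lambda>X Y. THE Z. \<exists>J s f g. (J, s, f) \<in> X \<and> (J, s, g) \<in> Y \<and>
       Z = roof_rel K L `` {(J, s, cmap_add L f g)}),
     smult = (\<lambda>c X. THE Z. \<exists>J s f. (J, s, f) \<in> X \<and>
       Z = roof_rel K L `` {(J, s, cmap_scale L c f)})\<rparr>"

definition Ext :: "int \<Rightarrow> 'a ocomplex \<Rightarrow> 'a ocomplex \<Rightarrow> (complex, 'a roof set) module" where
  "Ext k K L = derived_hom K (shift k L)"

definition iso_to_Cn :: "(complex, 'v) module \<Rightarrow> 'n::finite itself \<Rightarrow> bool" where
  "iso_to_Cn E n \<longleftrightarrow> (\<exists>\<phi> :: complex^'n \<Rightarrow> 'v. bij_betw \<phi> UNIV (carrier E) \<and>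
     (\<forall>x y. \<phi> (x + y) = \<phi> x \<oplus>\<^bsub>E\<^esub> \<phi> y) \<and> (\<forall>c x. \<phi> (c *s x) = c \<odot>\<^bsub>E\<^esub> \<phi> x))"


section \<open>The stable pairs\<close>

text \<open>All sheaves have sections in the type \<open>proj3 \<Rightarrow> complex\<close>.  For the sheaves that occur below
  the sections are genuine functions; for the middle terms of roofs the type only serves as a
  universe.  It is large enough: the Zariski topology is Noetherian and has continuum many open
  sets, so every roof between sheaves with at most continuum many sections is dominated by one
  whose middle term has at most continuum many sections.\<close>

definition function_sheaf :: "(proj3 set \<Rightarrow> (proj3 \<Rightarrow> complex) set) \<Rightarrow> (proj3 \<Rightarrow> complex) osheaf"
  where
  "function_sheaf S = \<lparr>sec = (\<lambda>U. \<lparr>carrier = S U, mult = (\<lambda>f g x. f x * g x),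
       one = on_set U (\<lambda>_. 1), zero = (\<lambda>_. 0), add = (\<lambda>f g x. f x + g x),
       smult = (\<lambda>f g x. f x * g x)\<rparr>),
     res = (\<lambda>U V. on_set V)\<rparr>"

definition struct_sheaf :: "(proj3 \<Rightarrow> complex) osheaf" where
  "struct_sheaf = function_sheaf regular_on"

definition zero_sheaf :: "(proj3 \<Rightarrow> complex) osheaf" where
  "zero_sheaf = function_sheaf (\<lambda>_. {\<lambda>_. 0})"

text \<open>The sheaf of a divisor \<open>p\<close> on the line \<open>line0\<close>, pushed forward to projective space: it is
  inverse to the ideal sheaf of \<open>p\<close>, so its sections are the functions \<open>g\<close>, regular away from \<open>p\<close>,
  such that \<open>h * g\<close> extends regularly over \<open>p\<close> for each local regular function \<open>h\<close> vanishing at \<open>p\<close>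
  (i.e. \<open>g\<close> has at most a simple pole at \<open>p\<close>).  Taking \<open>V\<close> not containing \<open>p\<close> and \<open>h = 1\<close>
  on \<open>V\<close> yields regularity away from \<open>p\<close>.  Sections are represented with value \<open>0\<close> at \<open>p\<close>, where they may
  have a pole.\<close>

definition point_twist :: "proj3 \<Rightarrow> (proj3 \<Rightarrow> complex) osheaf" where
  "point_twist p = function_sheaf (\<lambda>U. {g. (\<forall>x. x \<notin> U \<inter> line0 - {p} \<longrightarrow> g x = 0) \<and>
     (\<forall>V h. open V \<longrightarrow> V \<subseteq> U \<longrightarrow> h \<in> regular_on (V \<inter> line0) \<longrightarrow> h p = 0 \<longrightarrow>
        (\<exists>k\<in>regular_on (V \<inter> line0). \<forall>x\<in>V \<inter> line0 - {p}. k x = h x * g x))})"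

definition canonical_section :: "proj3 \<Rightarrow> (proj3 \<Rightarrow> complex) omap" where
  "canonical_section p = (\<lambda>U f. on_set (line0 - {p}) f)"

definition sheaf_complex :: "(proj3 \<Rightarrow> complex) osheaf \<Rightarrow> (proj3 \<Rightarrow> complex) ocomplex" where
  "sheaf_complex F = \<lparr>obj = (\<lambda>i. if i = 0 then F else zero_sheaf), diff = (\<lambda>i U m. \<lambda>_. 0)\<rparr>"

type_synonym opair = "(proj3 \<Rightarrow> complex) osheaf \<times> (proj3 \<Rightarrow> complex) omap"

definition pair_complex :: "opair \<Rightarrow> (proj3 \<Rightarrow> complex) ocomplex" where
  "pair_complex \<rho> = \<lparr>obj = (\<lambda>i. if i = 0 then struct_sheaf else if i = 1 then fst \<rho> else zero_sheaf),
     diff = (\<lambda>i. if i = 0 then snd \<rho> else (\<lambda>U m. \<lambda>_. 0))\<rparr>"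

definition tangent_space :: "opair \<Rightarrow> (complex, (proj3 \<Rightarrow> complex) roof set) module" where
  "tangent_space \<rho> = Ext 0 (pair_complex \<rho>) (sheaf_complex (fst \<rho>))"

definition obstruction_space :: "opair \<Rightarrow> (complex, (proj3 \<Rightarrow> complex) roof set) module" where
  "obstruction_space \<rho> = Ext 1 (pair_complex \<rho>) (sheaf_complex (fst \<rho>))"

definition rho :: "4 \<Rightarrow> opair" where
  "rho i = (point_twist (coord_point i), canonical_section (coord_point i))"

end

theory Submission
  imports Defs "HOL-Computational_Algebra.Fundamental_Theorem_Algebra"
begin

text \<open>Let \<open>z\<^sub>b\<close> be the coordinate of the line that vanishes at the marked point \<open>p\<close>; multiplication by it turns
 the sheaf \<open>Q\<close> of the pair into \<open>O(1)\<close> on the line.  A roof \<open>I \<leftarrow> J \<rightarrow> Q[k]\<close> amounts to a map \<open>f\<close> from the term of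
 \<open>J\<close> in degree \<open>-k\<close> to \<open>Q\<close> that kills boundaries, and it is determined by the values of \<open>f\<close> on a few cochains that
 exist locally in every \<open>J\<close>.  Off \<open>p\<close>, where \<open>I\<close> is the ideal of the line, these are lifts \<open>x\<close>, \<open>y\<close> of the generators
 \<open>X = z\<^sub>2/z\<^sub>b\<close>, \<open>Y = z\<^sub>3/z\<^sub>b\<close> and a cochain \<open>e\<close> with \<open>de = Y x - X y\<close>; near \<open>p\<close>, with \<open>m\<close> a lift of the generator of
 the cohomology in degree \<open>1\<close>, these are cochains with boundaries \<open>z\<^sub>2/z\<^sub>a m\<close>, \<open>z\<^sub>3/z\<^sub>a m\<close>, \<open>z\<^sub>b/z\<^sub>a m\<close>.

 For \<open>k = 0\<close> the values of \<open>f\<close> on \<open>x\<close> and \<open>y\<close> are linear forms on the line, and the value on the last cochain has a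
 residue at \<open>p\<close>: this gives \<open>2 + 2 + 1 = 5\<close> numbers.  For \<open>k = 1\<close> the value on \<open>e\<close> is a quadratic form: \<open>3\<close> numbers.
 All values occur on the resolution \<open>O(-1) \<rightarrow> O\<^sup>3 \<rightarrow> O(1)\<close>.  Two roofs are dominated by a third one whose term in
 degree \<open>1\<close> is the extension by zero of \<open>O\<close> from a neighbourhood of \<open>p\<close>, and there a map with vanishing values is
 null-homotopic: for \<open>k = 0\<close> directly, for \<open>k = 1\<close> because the values of the homotopy on lifts of \<open>X\<close> and \<open>Y\<close> are
 sections of torsors under \<open>Q\<close>, and \<open>H\<^sup>1(Q) = 0\<close>.\<close>

subsection \<open>Forms and twisted functions\<close>

text \<open>On the resolution the numbers are quick to see: Q is O(1) on the line, so O(1), O^3,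
  O(-1) have 1, 6, 3 independent maps to Q. Composing with the differentials gives multiplication by
  \<open>zc b\<close> in the third component, which is injective, and then 0, because
  \<open>zc 2\<close> and \<open>zc 3\<close> vanish on the line. This leaves 6 - 1 = 5 and 3; the
  number lost is the coefficient of \<open>zc b\<close> in the third component, and the residue is
  the one that stays. Geometrically, four of the five move the line and the fifth moves the point on
  it. The obstacle is that morphisms are classes of roofs whose middle term is an arbitrary bounded
  complex of modules, and nothing makes the resolution map to it. Hence the numbers have to be read
  off inside every middle term, and independence of the lifts is proved by hand: boundaries are
  killed, and the remaining coefficients vanish on the line or at p. Lifts of the generator in
  degree 1 exist only near p; the extension by zero turns a section near p into a map of sheaves on
  all of projective space.\<close>

type_synonym fn = "proj3 => complex"

abbreviation onl :: "proj3 set => proj3 set" where "onl U \<equiv> U \<inter> line0"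

abbreviation car :: "'a osheaf => proj3 set => 'a set" where "car F U \<equiv> carrier (sec F U)"
abbreviation zs :: "'a osheaf => proj3 set => 'a" where "zs F U \<equiv> \<zero>\<^bsub>sec F U\<^esub>"
abbreviation sadd ("(_ \<boxplus>[_,_] _)" [65, 0, 0, 66] 65) where "m \<boxplus>[F,U] n \<equiv> m \<oplus>\<^bsub>sec F U\<^esub> n"
abbreviation ssmult ("(_ \<cdot>[_,_] _)" [70, 0, 0, 71] 70) where "f \<cdot>[F,U] m \<equiv> f \<odot>\<^bsub>sec F U\<^esub> m"

lemmas osf = on_set_def fun_eq_iff

definition rep :: "proj3 => complex^4" where
 "rep x = (SOME v. coords_of x v)"

text \<open>Depends on the chosen representative: a section of O(1) trivialised point by point, not
  a function of the point. Quotients of equal degree and the vanishing of forms do not depend on the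
  choice.\<close>

definition zc :: "4 => fn" where
 "zc i x = rep x $ i"

lemma coords_of_rep: "coords_of x (rep x)"
 unfolding rep_def by (rule someI_ex) (rule coords_of_ex)

lemma rep_nonzero: "rep x \<noteq> 0"
 using coords_of_rep[of x] by (simp add: coords_of_def)

lemma abs_rep: "abs_proj3 (rep x) = x"
 using coords_of_rep[of x] by (simp add: coords_of_def)

lemma coords_of_iff_scale: "coords_of x v \<longleftrightarrow> (\<exists>c. c \<noteq> 0 \<and> v = c *s rep x)"
proof
 assume "coords_of x v" thus "\<exists>c. c \<noteq> 0 \<and> v = c *s rep x"
  using coords_of_scale[OF coords_of_rep] by blast
next
 assume "\<exists>c. c \<noteq> 0 \<and> v = c *s rep x"
 then obtain c where c: "c \<noteq> 0" "v = c *s rep x" by blast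
 have v: "v \<noteq> 0" using c rep_nonzero[of x] by (simp add: vec_eq_iff)
 have "abs_proj3 (rep x) = abs_proj3 v"
  by (rule Quotient3_rel_abs[OF Quotient3_proj3]) (use c v rep_nonzero in blast)
 thus "coords_of x v" using v by (simp add: coords_of_def abs_rep)
qed

lemma rep_abs_scale: "v \<noteq> 0 ==> \<exists>c. c \<noteq> 0 \<and> v = c *s rep (abs_proj3 v)"
 using coords_of_iff_scale[of "abs_proj3 v" v] by (simp add: coords_of_def)

lemma exhaust4: "(i::4) = 0 \<or> i = 1 \<or> i = 2 \<or> i = 3"
proof (induct i)
 case (of_int z)
 hence "z = 0 \<or> z = 1 \<or> z = 2 \<or> z = 3" by auto
 thus ?case by auto
qed

lemma zc_nonzero: "\<exists>i. zc i x \<noteq> 0"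
 using rep_nonzero[of x] by (auto simp: zc_def vec_eq_iff)

lemma rep_proj_eqI:
 assumes "rep y = c *s rep x"
 shows "x = y"
proof -
 have "c \<noteq> 0" using assms rep_nonzero[of y] by auto
 hence "coords_of x (rep y)" unfolding coords_of_iff_scale using assms by blast
 thus ?thesis using abs_rep[of y] by (simp add: coords_of_def)
qed

section \<open>Forms: division by a coordinate and restriction to lines\<close>

lemma homog_zero: "homog_poly d (\<lambda>_. 0)"
proof (induction d)
 case (Suc d)
 from homog_poly.mult[OF this homog_poly.coord[of 0]] show ?case by simp
qed (rule homog_poly.const)

lemma homog_cmult: "homog_poly d P ==> homog_poly d (\<lambda>v. c * P v)"
 using homog_poly.mult[OF homog_poly.const[of c], of d P] by simp

lemma homog_diff: "homog_poly d P ==> homog_poly d Q ==> homog_poly d (\<lambda>v. P v - Q v)"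
 using homog_poly.add[OF _ homog_cmult[of d Q "-1"], of P] by simp

lemma homog_power: "homog_poly d P ==> homog_poly (k * d) (\<lambda>v. P v ^ k)"
proof (induction k)
 case (Suc k) thus ?case using homog_poly.mult[of d P "k * d" "\<lambda>v. P v ^ k"] by simp
qed (simp add: homog_poly.const)

lemma homog_subst:
 assumes "homog_poly d P" "\<And>i. homog_poly 1 (\<lambda>v. T v $ i)"
 shows "homog_poly d (\<lambda>v. P (T v))"
 using assms(1) by induction (auto intro: homog_poly.intros assms(2)[unfolded One_nat_def])

text \<open>Induction on the form, with the product rule PQ = P'Q' + z_i (AQ + P'B), where P' and Q'
  arise by setting the coordinate \<open>i\<close> to 0. The clause for \<open>d = 0\<close>
  compensates the truncated \<open>d - 1\<close>: there the quotient would have degree -1.\<close>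

lemma homog_divide_coord:
 assumes "homog_poly d P"
 shows "\<exists>A. (d = 0 --> A = (\<lambda>_. 0)) \<and> homog_poly (d - 1) A \<and>
  (\<forall>v. P v = P (\<chi> j. if j = i then 0 else v $ j) + v $ i * A v)"
 using assms
proof induction
 case (const c)
 show ?case by (rule exI[of _ "\<lambda>_. 0"]) (simp add: homog_poly.const)
next
 case (coord k)
 show ?case
  by (rule exI[of _ "if k = i then (\<lambda>_. 1) else (\<lambda>_. 0)"]) (auto intro: homog_poly.const)
next
 case (add d P Q)
 let ?r = "\<lambda>v::complex^4. \<chi> j. if j = i then 0 else v $ j"
 from add.IH(1) obtain A where A: "(d = 0 --> A = (\<lambda>_. 0)) \<and> homog_poly (d - 1) A \<and> (\<forall>v. P v = P (?r v) + v $ i * A v)"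
  by (elim exE)
 from add.IH(2) obtain B where B: "(d = 0 --> B = (\<lambda>_. 0)) \<and> homog_poly (d - 1) B \<and> (\<forall>v. Q v = Q (?r v) + v $ i * B v)"
  by (elim exE)
 have eq: "P v + Q v = P (?r v) + Q (?r v) + v $ i * (A v + B v)" for v
  using A[THEN conjunct2, THEN conjunct2, rule_format, of v] B[THEN conjunct2, THEN conjunct2, rule_format, of v]
  by (simp only: distrib_left add_ac)
 show ?case
 proof (rule exI[of _ "\<lambda>v. A v + B v"], intro conjI allI impI)
  show "homog_poly (d - 1) (\<lambda>v. A v + B v)" using A B homog_poly.add by blast
  show "(\<lambda>v. A v + B v) = (\<lambda>_. 0)" if "d = 0" using that A B by simp
  show "P v + Q v = P (?r v) + Q (?r v) + v $ i * (A v + B v)" for v by (rule eq)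
 qed
next
 case (mult d P e Q)
 let ?r = "\<lambda>v::complex^4. \<chi> j. if j = i then 0 else v $ j"
 from mult.IH(1) obtain A where A: "(d = 0 --> A = (\<lambda>_. 0)) \<and> homog_poly (d - 1) A \<and> (\<forall>v. P v = P (?r v) + v $ i * A v)"
  by (elim exE)
 from mult.IH(2) obtain B where B: "(e = 0 --> B = (\<lambda>_. 0)) \<and> homog_poly (e - 1) B \<and> (\<forall>v. Q v = Q (?r v) + v $ i * B v)"
  by (elim exE)
 have AB: "d = 0 --> A = (\<lambda>_. 0)" "e = 0 --> B = (\<lambda>_. 0)"
  "homog_poly (d - 1) A" "homog_poly (e - 1) B" using A B by simp_all
 have eqP: "P v = P (?r v) + v $ i * A v" for v using A by (elim conjE) (erule allE)
 have eqQ: "Q v = Q (?r v) + v $ i * B v" for v using B by (elim conjE) (erule allE)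
 have r1: "homog_poly 1 (\<lambda>v. ?r v $ j)" for j
  by (cases "j = i") (auto intro: homog_zero homog_poly.coord[unfolded One_nat_def])
 have Pr: "homog_poly d (\<lambda>v. P (?r v))" by (rule homog_subst[OF mult.hyps(1) r1])
 have 1: "homog_poly (d + e - 1) (\<lambda>v. A v * Q v)"
 proof (cases "d = 0")
  case True thus ?thesis using AB(1) by (simp add: homog_zero)
 next
  case False thus ?thesis using homog_poly.mult[OF AB(3) mult.hyps(2)] by simp
 qed
 have 2: "homog_poly (d + e - 1) (\<lambda>v. P (?r v) * B v)"
 proof (cases "e = 0")
  case True thus ?thesis using AB(2) by (simp add: homog_zero)
 next
  case False thus ?thesis using homog_poly.mult[OF Pr AB(4)] by simp
 qed
 have 3: "P v * Q v = P (?r v) * Q (?r v) + v $ i * (A v * Q v + P (?r v) * B v)" for v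
 proof -
  have "P v * Q v = P (?r v) * Q v + v $ i * A v * Q v"
   by (subst eqP[of v]) (simp only: distrib_right)
  also have "P (?r v) * Q v = P (?r v) * (Q (?r v) + v $ i * B v)" by (subst eqQ[of v]) (rule refl)
  finally show ?thesis by (simp only: distrib_left add_ac mult_ac)
 qed
 show ?case
 proof (rule exI[of _ "\<lambda>v. A v * Q v + P (?r v) * B v"], intro conjI allI impI)
  show "homog_poly (d + e - 1) (\<lambda>v. A v * Q v + P (?r v) * B v)" by (rule homog_poly.add[OF 1 2])
  show "P v * Q v = P (?r v) * Q (?r v) + v $ i * (A v * Q v + P (?r v) * B v)" for v by (rule 3)
 qed (use AB(1,2) in simp)
qed

lemma homog_on_line:
 assumes "homog_poly d P"
 shows "\<exists>p::complex poly. \<forall>t. P (v + t *s w) = poly p t"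
 using assms
proof induction
 case (const c) show ?case by (rule exI[of _ "[:c:]"]) simp
next
 case (coord i) show ?case by (rule exI[of _ "[:v $ i, w $ i:]"]) simp
next
 case (add d P Q) thus ?case by (metis poly_add)
next
 case (mult d P e Q) thus ?case by (metis poly_mult)
qed

text \<open>On the line through \<open>v\<close> in the direction \<open>w\<close> each form is a
  polynomial in \<open>t\<close>, nonzero by hypothesis; so is their product, which therefore has a
  non-root.\<close>

lemma homog_avoid:
 assumes "\<And>P. P \<in> set Ps ==> \<exists>d. homog_poly d P" "\<And>P. P \<in> set Ps ==> \<exists>s. P (v + s *s w) \<noteq> 0"
 shows "\<exists>t. \<forall>P\<in>set Ps. P (v + t *s w) \<noteq> 0"
proof -
 have "\<exists>q::complex poly. q \<noteq> 0 \<and> (\<forall>t. poly q t \<noteq> 0 --> (\<forall>P\<in>set Ps. P (v + t *s w) \<noteq> 0))"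
  using assms
 proof (induction Ps)
  case Nil show ?case by (rule exI[of _ 1]) simp
 next
  case (Cons P Ps)
  then obtain q where q: "q \<noteq> 0" "\<forall>t. poly q t \<noteq> 0 --> (\<forall>P\<in>set Ps. P (v + t *s w) \<noteq> 0)" by auto
  obtain d where "homog_poly d P" using Cons.prems(1) by auto
  from homog_on_line[OF this] obtain p where p: "\<forall>t. P (v + t *s w) = poly p t" by blast
  obtain s where "P (v + s *s w) \<noteq> 0" using Cons.prems(2) by auto
  hence "p \<noteq> 0" using p by auto
  thus ?case using q p by (intro exI[of _ "p * q"]) auto
 qed
 then obtain q :: "complex poly" where q: "q \<noteq> 0"
  "\<forall>t. poly q t \<noteq> 0 --> (\<forall>P\<in>set Ps. P (v + t *s w) \<noteq> 0)" by blast
 have "\<exists>t. poly q t \<noteq> 0" using q(1) poly_all_0_iff_0 by blast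
 thus ?thesis using q(2) by blast
qed

lemma homog_common_nonzero:
 assumes "homog_poly d P" "homog_poly e Q" "P v \<noteq> 0" "Q w \<noteq> 0" "v \<noteq> 0"
 shows "\<exists>t. let u = v + t *s (w - v) in u \<noteq> 0 \<and> P u \<noteq> 0 \<and> Q u \<noteq> 0"
proof -
 obtain i where i: "v $ i \<noteq> 0" using assms(5) by (auto simp: vec_eq_iff)
 \<comment> \<open>A coordinate of \<open>v\<close> joins the forms to be avoided, so that the
   vector found is not 0.\<close>
 have "\<exists>t. \<forall>R\<in>set [P, Q, \<lambda>v. v $ i]. R (v + t *s (w - v)) \<noteq> 0"
 proof (rule homog_avoid)
  fix R assume "R \<in> set [P, Q, \<lambda>v. v $ i]"
  hence R: "R = P \<or> R = Q \<or> R = (\<lambda>v. v $ i)" by auto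
  show "\<exists>d. homog_poly d R" using R assms(1,2) homog_poly.coord by blast
  have "R (v + 0 *s (w - v)) \<noteq> 0 \<or> R (v + 1 *s (w - v)) \<noteq> 0"
   using R assms(3,4) i by (elim disjE) simp_all
  thus "\<exists>s. R (v + s *s (w - v)) \<noteq> 0" by blast
 qed
 then obtain t where t: "P (v + t *s (w - v)) \<noteq> 0" "Q (v + t *s (w - v)) \<noteq> 0"
   "(v + t *s (w - v)) $ i \<noteq> 0" by auto
 have "v + t *s (w - v) \<noteq> 0" using t(3) by (metis zero_index)
 thus ?thesis using t by (auto simp: Let_def)
qed

text \<open>Sections of \<open>O(n)\<close> on \<open>A\<close>, evaluated at the chosen representatives of the points.\<close>

definition tw :: "int => proj3 set => fn set" where
 "tw n A = {f. (\<forall>x. x \<notin> A --> f x = 0) \<and>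
  (\<forall>x\<in>A. \<exists>V d e P S. open V \<and> x \<in> V \<and> homog_poly d P \<and> homog_poly e S \<and> int d = int e + n \<and>
    (\<forall>y\<in>A \<inter> V. S (rep y) \<noteq> 0 \<and> f y = P (rep y) / S (rep y)))}"

lemma tw_outside: "f \<in> tw n A ==> x \<notin> A ==> f x = 0"
 by (simp add: tw_def)

lemma tw_fraction:
 assumes "f \<in> tw n A" "x \<in> A"
 shows "\<exists>V d e P S. open V \<and> x \<in> V \<and> homog_poly d P \<and> homog_poly e S \<and> int d = int e + n \<and>
    (\<forall>y\<in>A \<inter> V. S (rep y) \<noteq> 0 \<and> f y = P (rep y) / S (rep y))"
 using assms by (simp add: tw_def)

lemma twI:
 assumes "\<And>x. x \<notin> A ==> f x = 0"
  and "\<And>x. x \<in> A ==> \<exists>V d e P S. open V \<and> x \<in> V \<and> homog_poly d P \<and> homog_poly e S \<and> int d = int e + n \<and>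
    (\<forall>y\<in>A \<inter> V. S (rep y) \<noteq> 0 \<and> f y = P (rep y) / S (rep y))"
 shows "f \<in> tw n A"
 using assms by (simp add: tw_def)

text \<open>A fraction of two forms of equal degree is invariant under scaling, so it may be tested
  at \<open>rep\<close> alone.\<close>

lemma regular_on_eq_tw: "regular_on A = tw 0 A"
proof (intro equalityI subsetI)
 fix f assume f: "f \<in> regular_on A"
 show "f \<in> tw 0 A"
 proof (rule twI)
  show "f x = 0" if "x \<notin> A" for x using f that by (simp add: regular_on_def)
  fix x assume "x \<in> A"
  then obtain V d P Q where V: "open V" "x \<in> V" "homog_poly d P" "homog_poly d Q"
   "\<forall>y\<in>A \<inter> V. \<forall>v. coords_of y v --> Q v \<noteq> 0 \<and> f y = P v / Q v"
   using f unfolding regular_on_def by blast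
  have "\<forall>y\<in>A \<inter> V. Q (rep y) \<noteq> 0 \<and> f y = P (rep y) / Q (rep y)" using V(5) coords_of_rep by blast
  thus "\<exists>V d e P S. open V \<and> x \<in> V \<and> homog_poly d P \<and> homog_poly e S \<and> int d = int e + 0 \<and>
    (\<forall>y\<in>A \<inter> V. S (rep y) \<noteq> 0 \<and> f y = P (rep y) / S (rep y))"
   using V(1-4) by (intro exI[of _ V] exI[of _ d] exI[of _ P] exI[of _ Q]) simp
 qed
next
 fix f assume f: "f \<in> tw 0 A"
 have "\<exists>V d P Q. open V \<and> x \<in> V \<and> homog_poly d P \<and> homog_poly d Q \<and>
    (\<forall>y\<in>A \<inter> V. \<forall>v. coords_of y v --> Q v \<noteq> 0 \<and> f y = P v / Q v)" if "x \<in> A" for x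
 proof -
  from tw_fraction[OF f that] obtain V d e P S where V: "open V" "x \<in> V" "homog_poly d P" "homog_poly e S" "int d = int e + 0"
    "\<forall>y\<in>A \<inter> V. S (rep y) \<noteq> 0 \<and> f y = P (rep y) / S (rep y)" by (elim exE conjE)
  have e: "e = d" using V(5) by simp
  have "\<forall>y\<in>A \<inter> V. \<forall>v. coords_of y v --> S v \<noteq> 0 \<and> f y = P v / S v"
  proof (intro ballI allI impI)
   fix y v assume y: "y \<in> A \<inter> V" and "coords_of y v"
   then obtain c where c: "c \<noteq> 0" "v = c *s rep y" using coords_of_iff_scale by blast
   show "S v \<noteq> 0 \<and> f y = P v / S v" using V(6)[rule_format, OF y] c
    homog_poly_scale[OF V(3)] homog_poly_scale[OF V(4)] e by simp
  qed
  thus ?thesis using V(1-4) e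
   by (intro exI[of _ V] exI[of _ d] exI[of _ P] exI[of _ S]) simp
 qed
 thus "f \<in> regular_on A" using tw_outside[OF f] unfolding regular_on_def by blast
qed

lemma tw_zero: "(\<lambda>_. 0) \<in> tw n A"
proof (rule twI)
 fix x
 have 1: "homog_poly (nat (\<bar>n\<bar>)) (\<lambda>v. (v::complex^4) $ i ^ nat \<bar>n\<bar>)" for i
  using homog_power[OF homog_poly.coord[of i], of "nat \<bar>n\<bar>"] by simp
 obtain i where i: "zc i x \<noteq> 0" using zc_nonzero by blast
 let ?V = "- {y. \<forall>P\<in>{\<lambda>v::complex^4. v $ i}. \<forall>v. coords_of y v --> P v = 0}"
 have o: "open ?V" unfolding open_proj3_def
  by (rule exI[of _ "{\<lambda>v. v $ i}"]) (use homog_poly.coord[of i] in auto)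
 have iff: "y \<in> ?V \<longleftrightarrow> zc i y \<noteq> 0" for y
  using coords_of_rep[of y] coords_of_iff_scale[of y] by (auto simp: zc_def)
 show "\<exists>V d e P S. open V \<and> x \<in> V \<and> homog_poly d P \<and> homog_poly e S \<and> int d = int e + n \<and>
    (\<forall>y\<in>A \<inter> V. S (rep y) \<noteq> 0 \<and> 0 = P (rep y) / S (rep y))"
  \<comment> \<open>The zero function as 0 divided by the power |n| of a coordinate: then the degree
    n + |n| of the numerator is a natural number also for negative n.\<close>
  by (rule exI[of _ ?V], rule exI[of _ "nat (n + \<bar>n\<bar>)"], rule exI[of _ "nat \<bar>n\<bar>"], rule exI[of _ "\<lambda>_. 0"],
    rule exI[of _ "\<lambda>v. v $ i ^ nat \<bar>n\<bar>"]) (use o iff i 1[of i] homog_zero in \<open>auto simp: zc_def\<close>)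
qed simp

lemma tw_add:
 assumes "f \<in> tw n A" "g \<in> tw n A"
 shows "(\<lambda>x. f x + g x) \<in> tw n A"
proof (rule twI)
 fix x assume x: "x \<in> A"
 from tw_fraction[OF assms(1) x] obtain V d e P S where V: "open V" "x \<in> V" "homog_poly d P" "homog_poly e S" "int d = int e + n"
  and fV: "\<forall>y\<in>A \<inter> V. S (rep y) \<noteq> 0 \<and> f y = P (rep y) / S (rep y)" by (elim exE conjE)
 from tw_fraction[OF assms(2) x] obtain W k l Q T where W: "open W" "x \<in> W" "homog_poly k Q" "homog_poly l T" "int k = int l + n"
  and gW: "\<forall>y\<in>A \<inter> W. T (rep y) \<noteq> 0 \<and> g y = Q (rep y) / T (rep y)" by (elim exE conjE)
 have k: "e + k = d + l" using V(5) W(5) by simp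
 have h: "homog_poly (d + l) (\<lambda>v. P v * T v + S v * Q v)"
  using homog_poly.add[OF homog_poly.mult[OF V(3) W(4)] homog_poly.mult[OF V(4) W(3), unfolded k]] .
 show "\<exists>V d e P S. open V \<and> x \<in> V \<and> homog_poly d P \<and> homog_poly e S \<and> int d = int e + n \<and>
    (\<forall>y\<in>A \<inter> V. S (rep y) \<noteq> 0 \<and> f y + g y = P (rep y) / S (rep y))"
 proof (intro exI conjI)
  show "open (V \<inter> W)" by (rule open_Int[OF V(1) W(1)])
  show "x \<in> V \<inter> W" using V W by simp
  show "homog_poly (d + l) (\<lambda>v. P v * T v + S v * Q v)" by (rule h)
  show "homog_poly (e + l) (\<lambda>v. S v * T v)" by (rule homog_poly.mult[OF V(4) W(4)])
  show "int (d + l) = int (e + l) + n" using V(5) by simp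
  show "\<forall>y\<in>A \<inter> (V \<inter> W). S (rep y) * T (rep y) \<noteq> 0 \<and> f y + g y =
    (P (rep y) * T (rep y) + S (rep y) * Q (rep y)) / (S (rep y) * T (rep y))"
   using fV gW by (auto simp: field_simps)
 qed
qed (use assms in \<open>simp add: tw_outside\<close>)

lemma tw_mult:
 assumes "f \<in> tw n A" "g \<in> tw m A"
 shows "(\<lambda>x. f x * g x) \<in> tw (n + m) A"
proof (rule twI)
 fix x assume x: "x \<in> A"
 from tw_fraction[OF assms(1) x] obtain V d e P S where V: "open V" "x \<in> V" "homog_poly d P" "homog_poly e S" "int d = int e + n"
  and fV: "\<forall>y\<in>A \<inter> V. S (rep y) \<noteq> 0 \<and> f y = P (rep y) / S (rep y)" by (elim exE conjE)
 from tw_fraction[OF assms(2) x] obtain W k l Q T where W: "open W" "x \<in> W" "homog_poly k Q" "homog_poly l T" "int k = int l + m"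
  and gW: "\<forall>y\<in>A \<inter> W. T (rep y) \<noteq> 0 \<and> g y = Q (rep y) / T (rep y)" by (elim exE conjE)
 show "\<exists>V d e P S. open V \<and> x \<in> V \<and> homog_poly d P \<and> homog_poly e S \<and> int d = int e + (n + m) \<and>
    (\<forall>y\<in>A \<inter> V. S (rep y) \<noteq> 0 \<and> f y * g y = P (rep y) / S (rep y))"
 proof (intro exI conjI)
  show "open (V \<inter> W)" by (rule open_Int[OF V(1) W(1)])
  show "x \<in> V \<inter> W" using V W by simp
  show "homog_poly (d + k) (\<lambda>v. P v * Q v)" by (rule homog_poly.mult[OF V(3) W(3)])
  show "homog_poly (e + l) (\<lambda>v. S v * T v)" by (rule homog_poly.mult[OF V(4) W(4)])
  show "int (d + k) = int (e + l) + (n + m)" using V(5) W(5) by simp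
  show "\<forall>y\<in>A \<inter> (V \<inter> W). S (rep y) * T (rep y) \<noteq> 0 \<and> f y * g y =
    (P (rep y) * Q (rep y)) / (S (rep y) * T (rep y))"
   using fV gW by auto
 qed
qed (use assms in \<open>simp add: tw_outside\<close>)

lemma tw_form:
 assumes "homog_poly d P" "int d = n"
 shows "on_set A (\<lambda>x. P (rep x)) \<in> tw n A"
proof (rule twI)
 fix x assume "x \<in> A"
 show "\<exists>V d e P' S. open V \<and> x \<in> V \<and> homog_poly d P' \<and> homog_poly e S \<and> int d = int e + n \<and>
    (\<forall>y\<in>A \<inter> V. S (rep y) \<noteq> 0 \<and> on_set A (\<lambda>x. P (rep x)) y = P' (rep y) / S (rep y))"
  by (rule exI[of _ UNIV], rule exI[of _ d], rule exI[of _ 0], rule exI[of _ P], rule exI[of _ "\<lambda>_. 1"])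
   (use assms in \<open>auto simp: on_set_def intro: homog_poly.const\<close>)
qed (simp add: on_set_def)

lemma tw_const: "on_set A (\<lambda>_. c) \<in> tw 0 A"
 using tw_form[OF homog_poly.const, of 0 A c] by simp

lemma tw_coord: "on_set A (zc i) \<in> tw 1 A"
 using tw_form[OF homog_poly.coord, of 1 A i] unfolding zc_def[abs_def] by simp

lemma tw_restrict:
 assumes "f \<in> tw n A" "B \<subseteq> A"
 shows "on_set B f \<in> tw n B"
proof (rule twI)
 fix x assume "x \<in> B"
 hence "x \<in> A" using assms(2) by blast
 from tw_fraction[OF assms(1) this] obtain V d e P S where V: "open V" "x \<in> V" "homog_poly d P" "homog_poly e S" "int d = int e + n"
  "\<forall>y\<in>A \<inter> V. S (rep y) \<noteq> 0 \<and> f y = P (rep y) / S (rep y)" by (elim exE conjE)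
 show "\<exists>V d e P S. open V \<and> x \<in> V \<and> homog_poly d P \<and> homog_poly e S \<and> int d = int e + n \<and>
    (\<forall>y\<in>B \<inter> V. S (rep y) \<noteq> 0 \<and> on_set B f y = P (rep y) / S (rep y))"
  by (rule exI[of _ V], rule exI[of _ d], rule exI[of _ e], rule exI[of _ P], rule exI[of _ S])
   (use V assms(2) in \<open>auto simp: on_set_def\<close>)
qed (simp add: on_set_def)

lemma tw_local:
 assumes "\<And>x. x \<notin> A ==> f x = 0"
  and "\<And>x. x \<in> A ==> \<exists>V g. open V \<and> x \<in> V \<and> g \<in> tw n (A \<inter> V) \<and> (\<forall>y\<in>A \<inter> V. f y = g y)"
 shows "f \<in> tw n A"
proof (rule twI)
 fix x assume x: "x \<in> A"
 from assms(2)[OF x] obtain U g where U: "open U" "x \<in> U" "g \<in> tw n (A \<inter> U)" "\<forall>y\<in>A \<inter> U. f y = g y" by (elim exE conjE)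
 have "x \<in> A \<inter> U" using x U(2) by simp
 from tw_fraction[OF U(3) this] obtain V d e P S where V: "open V" "x \<in> V" "homog_poly d P" "homog_poly e S" "int d = int e + n"
  "\<forall>y\<in>(A \<inter> U) \<inter> V. S (rep y) \<noteq> 0 \<and> g y = P (rep y) / S (rep y)" by (elim exE conjE)
 show "\<exists>V d e P S. open V \<and> x \<in> V \<and> homog_poly d P \<and> homog_poly e S \<and> int d = int e + n \<and>
    (\<forall>y\<in>A \<inter> V. S (rep y) \<noteq> 0 \<and> f y = P (rep y) / S (rep y))"
  by (rule exI[of _ "U \<inter> V"], rule exI[of _ d], rule exI[of _ e], rule exI[of _ P], rule exI[of _ S])
   (use V U in auto)
qed (rule assms(1))

lemma tw_inverse:
 assumes "f \<in> tw n A" "\<And>x. x \<in> A ==> f x \<noteq> 0"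
 shows "on_set A (\<lambda>x. 1 / f x) \<in> tw (- n) A"
proof (rule twI)
 fix x assume x: "x \<in> A"
 from tw_fraction[OF assms(1) x] obtain V d e P S where V: "open V" "x \<in> V" "homog_poly d P" "homog_poly e S" "int d = int e + n"
  and fV: "\<forall>y\<in>A \<inter> V. S (rep y) \<noteq> 0 \<and> f y = P (rep y) / S (rep y)" by (elim exE conjE)
 have "P (rep y) \<noteq> 0" if "y \<in> A \<inter> V" for y using fV that assms(2)[of y] by auto
 thus "\<exists>V d e P S. open V \<and> x \<in> V \<and> homog_poly d P \<and> homog_poly e S \<and> int d = int e + - n \<and>
    (\<forall>y\<in>A \<inter> V. S (rep y) \<noteq> 0 \<and> on_set A (\<lambda>x. 1 / f x) y = P (rep y) / S (rep y))"
  by (intro exI[of _ V] exI[of _ e] exI[of _ d] exI[of _ S] exI[of _ P]) (use V fV in \<open>auto simp: on_set_def\<close>)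
qed (simp add: on_set_def)

lemma tw_cmult:
 assumes "f \<in> tw n A" shows "(\<lambda>x. c * f x) \<in> tw n A"
proof -
 have "(\<lambda>x. on_set A (\<lambda>_. c) x * f x) = (\<lambda>x. c * f x)"
  using tw_outside[OF assms] by (auto simp: osf)
 thus ?thesis using tw_mult[OF tw_const[of A c] assms] by simp
qed

lemma tw_diff: "f \<in> tw n A ==> g \<in> tw n A ==> (\<lambda>x. f x - g x) \<in> tw n A"
 using tw_add[OF _ tw_cmult[of g n A "-1"], of f] by simp

lemma tw_uminus: "g \<in> tw n A ==> (\<lambda>x. - g x) \<in> tw n A"
 using tw_cmult[of g n A "-1"] by simp

lemma tw_divide:
 assumes "f \<in> tw n A" "g \<in> tw m A" "\<And>x. x \<in> A ==> g x \<noteq> 0" "k = n - m"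
 shows "(\<lambda>x. f x / g x) \<in> tw k A"
proof -
 have "(\<lambda>x. f x * on_set A (\<lambda>x. 1 / g x) x) \<in> tw (n + - m) A"
  by (rule tw_mult[OF assms(1) tw_inverse[OF assms(2,3)]])
 moreover have "(\<lambda>x. f x * on_set A (\<lambda>x. 1 / g x) x) = (\<lambda>x. f x / g x)"
  using tw_outside[OF assms(1)] by (auto simp: osf)
 ultimately show ?thesis using assms(4) by simp
qed

section \<open>Open sets, irreducibility and the identity theorem\<close>

lemma open_form_nonzero:
 assumes "homog_poly d P" shows "open {x. P (rep x) \<noteq> 0}"
 unfolding open_proj3_def
proof (rule exI[of _ "{P}"], intro conjI)
 show "\<forall>P\<in>{P}. \<exists>d. homog_poly d P" using assms by blast
 have "(\<forall>v. coords_of x v --> P v = 0) \<longleftrightarrow> P (rep x) = 0" for x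
  using coords_of_rep[of x] homog_poly_coords_nz[OF assms, of x] by blast
 thus "- {x. P (rep x) \<noteq> 0} = {x. \<forall>P\<in>{P}. \<forall>v. coords_of x v --> P v = 0}" by auto
qed

lemma open_coord_nonzero: "open {x. zc i x \<noteq> 0}"
 unfolding zc_def by (rule open_form_nonzero[OF homog_poly.coord])

lemma open_contains_form_nonzero:
 assumes "open (U::proj3 set)" "x \<in> U"
 shows "\<exists>d P. homog_poly d P \<and> P (rep x) \<noteq> 0 \<and> {y. P (rep y) \<noteq> 0} \<subseteq> U"
proof -
 from assms(1) obtain T where T: "\<forall>P\<in>T. \<exists>d. homog_poly d P"
  "- U = {x. \<forall>P\<in>T. \<forall>v. coords_of x v --> P v = 0}" unfolding open_proj3_def by (elim exE conjE)
 have "x \<notin> - U" using assms(2) by simp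
 then obtain P v where P: "P \<in> T" "coords_of x v" "P v \<noteq> 0" unfolding T(2) by blast
 obtain d where d: "homog_poly d P" using T(1) P(1) by blast
 have "P (rep x) \<noteq> 0" using homog_poly_coords_nz[OF d P(2) coords_of_rep] P(3) by simp
 moreover have "y \<in> U" if "P (rep y) \<noteq> 0" for y
 proof (rule ccontr)
  assume "y \<notin> U"
  hence "y \<in> - U" by simp
  thus False unfolding T(2) using P(1) coords_of_rep[of y] that by blast
 qed
 ultimately show ?thesis using d by blast
qed

text \<open>One family for the two spaces on which sections are compared: \<open>{}\<close> gives
  all of projective space, \<open>{2, 3}\<close> the line.\<close>

definition lin_sub :: "4 set => proj3 set" where
 "lin_sub I = {x. \<forall>i\<in>I. zc i x = 0}"

lemma lin_sub_empty: "lin_sub {} = UNIV" by (simp add: lin_sub_def)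

lemma line0_eq: "line0 = lin_sub {2, 3}"
proof -
 have "(\<forall>v. coords_of x v --> v $ 2 = 0 \<and> v $ 3 = 0) \<longleftrightarrow> zc 2 x = 0 \<and> zc 3 x = 0" for x
  using coords_of_rep[of x] coords_of_iff_scale[of x] by (auto simp: zc_def)
 thus ?thesis by (auto simp: line0_def lin_sub_def)
qed

lemma mem_line0: "x \<in> line0 \<longleftrightarrow> zc 2 x = 0 \<and> zc 3 x = 0"
 by (auto simp: line0_eq lin_sub_def)

text \<open>Each open set contains the complement of the zeros of a form. On the line joining
  representatives of the two points, which stays in the cone over the subspace, a general point is a
  zero of neither form.\<close>

lemma lin_sub_irreducible:
 assumes "open U" "open V" "U \<inter> lin_sub I \<noteq> {}" "V \<inter> lin_sub I \<noteq> {}"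
 shows "U \<inter> V \<inter> lin_sub I \<noteq> {}"
proof -
 obtain x y where x: "x \<in> U" "x \<in> lin_sub I" and y: "y \<in> V" "y \<in> lin_sub I" using assms(3,4) by blast
 obtain d P where P: "homog_poly d P" "P (rep x) \<noteq> 0" "{y. P (rep y) \<noteq> 0} \<subseteq> U"
  using open_contains_form_nonzero[OF assms(1) x(1)] by blast
 obtain e Q where Q: "homog_poly e Q" "Q (rep y) \<noteq> 0" "{y. Q (rep y) \<noteq> 0} \<subseteq> V"
  using open_contains_form_nonzero[OF assms(2) y(1)] by blast
 from homog_common_nonzero[OF P(1) Q(1) P(2) Q(2) rep_nonzero]
 obtain t where t: "rep x + t *s (rep y - rep x) \<noteq> 0" "P (rep x + t *s (rep y - rep x)) \<noteq> 0"
  "Q (rep x + t *s (rep y - rep x)) \<noteq> 0" by (auto simp: Let_def)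
 define u where "u = rep x + t *s (rep y - rep x)"
 obtain c where c: "c \<noteq> 0" "u = c *s rep (abs_proj3 u)" using rep_abs_scale t(1) unfolding u_def by blast
 have Pz: "P (rep (abs_proj3 u)) \<noteq> 0"
 proof
  assume "P (rep (abs_proj3 u)) = 0"
  hence "P u = 0" by (subst c(2)) (simp only: homog_poly_scale[OF P(1)], simp)
  thus False using t(2) by (simp add: u_def)
 qed
 have Qz: "Q (rep (abs_proj3 u)) \<noteq> 0"
 proof
  assume "Q (rep (abs_proj3 u)) = 0"
  hence "Q u = 0" by (subst c(2)) (simp only: homog_poly_scale[OF Q(1)], simp)
  thus False using t(3) by (simp add: u_def)
 qed
 have "u $ i = 0" if "i \<in> I" for i using x(2) y(2) that by (simp add: u_def lin_sub_def zc_def)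
 moreover have "u $ i = c * zc i (abs_proj3 u)" for i by (subst c(2)) (simp add: zc_def)
 ultimately have "abs_proj3 u \<in> lin_sub I" using c(1) by (simp add: lin_sub_def)
 thus ?thesis using Pz Qz P(3) Q(3) by blast
qed

lemma open_meet_line0:
 "open U ==> open V ==> U \<inter> line0 \<noteq> {} ==> V \<inter> line0 \<noteq> {} ==> U \<inter> V \<inter> line0 \<noteq> {}"
 unfolding line0_eq by (rule lin_sub_irreducible)

lemma form_zero_on_open:
 assumes "homog_poly d P" "open U" "U \<inter> lin_sub I \<noteq> {}" "\<And>x. x \<in> U \<inter> lin_sub I ==> P (rep x) = 0"
  and "\<And>i. i \<in> I ==> v $ i = 0" "v \<noteq> 0"
 shows "P v = 0"
proof (rule ccontr)
 assume nz: "P v \<noteq> 0"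
 obtain c where c: "c \<noteq> 0" "v = c *s rep (abs_proj3 v)" using rep_abs_scale[OF assms(6)] by blast
 have "P (rep (abs_proj3 v)) \<noteq> 0"
 proof
  assume "P (rep (abs_proj3 v)) = 0"
  hence "P v = 0" by (subst c(2)) (simp only: homog_poly_scale[OF assms(1)], simp)
  thus False using nz by simp
 qed
 moreover have "abs_proj3 v \<in> lin_sub I"
 proof -
  have "v $ i = c * zc i (abs_proj3 v)" for i by (subst c(2)) (simp add: zc_def)
  thus ?thesis using assms(5) c(1) by (auto simp: lin_sub_def)
 qed
 ultimately have "U \<inter> {x. P (rep x) \<noteq> 0} \<inter> lin_sub I \<noteq> {}"
  by (intro lin_sub_irreducible assms open_form_nonzero[OF assms(1)]) blast
 thus False using assms(4) by blast
qed

text \<open>The identity theorem: near \<open>x\<close> the numerator of \<open>f\<close> vanishes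
  on a nonempty open part of the irreducible subspace, hence on the whole cone over it.\<close>

lemma tw_zero_on_open:
 assumes "f \<in> tw n (U \<inter> lin_sub I)" "open U" "open U'" "U' \<inter> lin_sub I \<noteq> {}"
  "\<And>x. x \<in> U' \<inter> lin_sub I ==> x \<in> U ==> f x = 0"
 shows "f = (\<lambda>_. 0)"
proof
 fix x show "f x = 0"
 proof (cases "x \<in> U \<inter> lin_sub I")
  case True
  from tw_fraction[OF assms(1) True] obtain V d e P S where V: "open V" "x \<in> V" "homog_poly d P" "homog_poly e S"
   "\<forall>y\<in>U \<inter> lin_sub I \<inter> V. S (rep y) \<noteq> 0 \<and> f y = P (rep y) / S (rep y)" by (elim exE conjE)
  have ne: "(U \<inter> V) \<inter> U' \<inter> lin_sub I \<noteq> {}"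
   using True V(1,2) assms(2-4) by (intro lin_sub_irreducible open_Int) auto
  have "P (rep x) = 0"
  proof (rule form_zero_on_open[OF V(3) _ ne])
   fix y assume y: "y \<in> U \<inter> V \<inter> U' \<inter> lin_sub I"
   thus "P (rep y) = 0" using V(5)[rule_format, of y] assms(5)[of y] by auto
  next
   show "open (U \<inter> V \<inter> U')" using V(1) assms(2,3) by (intro open_Int)
   show "rep x $ i = 0" if "i \<in> I" for i using True that by (simp add: lin_sub_def zc_def)
  qed (simp_all add: rep_nonzero)
  thus ?thesis using V(5) True V(2) by auto
 qed (rule tw_outside[OF assms(1)])
qed

lemma open_compl_line0: "open (- line0)"
proof -
 have "- line0 = {x. zc 2 x \<noteq> 0} \<union> {x. zc 3 x \<noteq> 0}" by (auto simp: mem_line0)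
 thus ?thesis using open_coord_nonzero by (metis open_Un)
qed

lemma form_zero_everywhere:
 assumes "homog_poly d P" "open U" "U \<noteq> {}" "\<And>x. x \<in> U ==> P (rep x) = 0" "v \<noteq> 0"
 shows "P v = 0"
 by (rule form_zero_on_open[OF assms(1,2), of "{}"]) (use assms in \<open>simp_all add: lin_sub_empty\<close>)

section \<open>The ideal of the line, its syzygies, and extension of sections off the line\<close>

lemma tw_fraction_open:
 assumes "f \<in> tw n U" "open U" "x \<in> U"
 shows "\<exists>V d e P S. open V \<and> x \<in> V \<and> V \<subseteq> U \<and> homog_poly d P \<and> homog_poly e S \<and> int d = int e + n \<and>
    (\<forall>y\<in>V. S (rep y) \<noteq> 0 \<and> f y = P (rep y) / S (rep y))"
proof -
 from tw_fraction[OF assms(1,3)] obtain V d e P S where V: "open V" "x \<in> V" "homog_poly d P" "homog_poly e S" "int d = int e + n"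
   "\<forall>y\<in>U \<inter> V. S (rep y) \<noteq> 0 \<and> f y = P (rep y) / S (rep y)" by (elim exE conjE)
 show ?thesis
  by (rule exI[of _ "U \<inter> V"], rule exI[of _ d], rule exI[of _ e], rule exI[of _ P], rule exI[of _ S])
   (use V assms in auto)
qed

text \<open>Division by \<open>v $ 2\<close>, then of the remainder by \<open>v $ 3\<close>; what is
  left is the value of \<open>P\<close> at a vector of the cone over the line, hence 0.\<close>

lemma form_ideal_line0:
 assumes "homog_poly d P" "\<forall>v. v \<noteq> 0 --> v $ 2 = 0 --> v $ 3 = 0 --> P v = 0"
 shows "\<exists>A B. homog_poly (d - 1) A \<and> homog_poly (d - 1) B \<and> (d = 0 --> A = (\<lambda>_. 0) \<and> B = (\<lambda>_. 0)) \<and>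
  (\<forall>v. v \<noteq> 0 --> P v = v $ 2 * A v + v $ 3 * B v)"
proof -
 let ?r = "\<lambda>v::complex^4. (\<chi> j. if j = 2 then 0 else v $ j) :: complex^4"
 let ?q = "\<lambda>v::complex^4. (\<chi> j. if j = 3 then 0 else v $ j) :: complex^4"
 obtain A where A: "(d = 0 --> A = (\<lambda>_. 0)) \<and> homog_poly (d - 1) A \<and> (\<forall>v. P v = P (?r v) + v $ 2 * A v)"
  using homog_divide_coord[OF assms(1), of 2] by (elim exE)
 have r1: "homog_poly 1 (\<lambda>v. ?r v $ j)" for j
  by (cases "j = 2") (auto intro: homog_zero homog_poly.coord[unfolded One_nat_def])
 obtain B where B: "(d = 0 --> B = (\<lambda>_. 0)) \<and> homog_poly (d - 1) B \<and> (\<forall>v. P (?r v) = P (?r (?q v)) + v $ 3 * B v)"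
  using homog_divide_coord[OF homog_subst[OF assms(1) r1], of 3] by (elim exE)
 \<comment> \<open>The hypothesis speaks of nonzero vectors. At 0 a form of positive degree vanishes
   by scaling, and a constant equals its value at \<open>axis 0 1\<close>.\<close>
 have P0: "P u = 0" if "u $ 2 = 0" "u $ 3 = 0" for u
 proof (cases "u = 0")
  case False thus ?thesis using assms(2) that by blast
 next
  case True
  show ?thesis
  proof (cases "d = 0")
   case False
   have "P (0 *s (1::complex^4)) = 0" unfolding homog_poly_scale[OF assms(1)] using False by simp
   thus ?thesis using True by simp
  next
   case d: True
   have "P u = 0 ^ d * P (axis 0 1)" unfolding homog_poly_scale[OF assms(1), symmetric] using True by simp
   moreover have "P (axis 0 1) = 0" by (rule assms(2)[rule_format]) (auto simp: axis_def vec_eq_iff)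
   ultimately show ?thesis by simp
  qed
 qed
 have eq: "P v = v $ 2 * A v + v $ 3 * B v" for v
 proof -
  have "P v = P (?r v) + v $ 2 * A v" using A by (elim conjE) (erule allE)
  moreover have "P (?r v) = P (?r (?q v)) + v $ 3 * B v" using B by (elim conjE) (erule allE)
  moreover have "P (?r (?q v)) = 0" by (rule P0) simp_all
  ultimately show ?thesis by simp
 qed
 show ?thesis
  by (rule exI[of _ A], rule exI[of _ B], intro conjI impI allI)
   (use A[THEN conjunct1] A[THEN conjunct2, THEN conjunct1] B[THEN conjunct1] B[THEN conjunct2, THEN conjunct1] eq in simp_all)
qed

text \<open>At a point of the line the numerator of a local fraction lies in the ideal of the line.
  At any other point \<open>zc 2\<close> or \<open>zc 3\<close> is invertible, and \<open>g\<close>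
  is divided by it.\<close>

lemma tw_ideal_line0:
 assumes "g \<in> tw n V" "open V" "x \<in> V" "\<And>y. y \<in> onl V ==> g y = 0"
 shows "\<exists>V' \<alpha> \<beta>. open V' \<and> x \<in> V' \<and> V' \<subseteq> V \<and> \<alpha> \<in> tw (n - 1) V' \<and> \<beta> \<in> tw (n - 1) V' \<and>
  (\<forall>y\<in>V'. g y = \<alpha> y * zc 2 y + \<beta> y * zc 3 y)"
proof (cases "x \<in> line0")
 case True
 from tw_fraction_open[OF assms(1-3)] obtain V' d e P S where V: "open V'" "x \<in> V'" "V' \<subseteq> V" "homog_poly d P" "homog_poly e S" "int d = int e + n"
  and f: "\<forall>y\<in>V'. S (rep y) \<noteq> 0 \<and> g y = P (rep y) / S (rep y)" by (elim exE conjE)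
 have P0: "P v = 0" if "v \<noteq> 0" "v $ 2 = 0" "v $ 3 = 0" for v
 proof (rule form_zero_on_open[OF V(4,1), of "{2,3}"])
  show "V' \<inter> lin_sub {2, 3} \<noteq> {}" using True V(2) unfolding line0_eq by blast
  fix y assume "y \<in> V' \<inter> lin_sub {2, 3}"
  hence y: "y \<in> V'" "y \<in> onl V" using V(3) unfolding line0_eq by auto
  have "S (rep y) \<noteq> 0 \<and> g y = P (rep y) / S (rep y)" using f y by blast
  thus "P (rep y) = 0" using assms(4)[OF y(2)] by auto
 qed (use that in auto)
 have "\<forall>v. v \<noteq> 0 --> v $ 2 = 0 --> v $ 3 = 0 --> P v = 0" using P0 by blast
 from form_ideal_line0[OF V(4) this] obtain A B where AB: "homog_poly (d - 1) A" "homog_poly (d - 1) B"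
  "d = 0 --> A = (\<lambda>_. 0) \<and> B = (\<lambda>_. 0)" "\<forall>v. v \<noteq> 0 --> P v = v $ 2 * A v + v $ 3 * B v" by (elim exE conjE)
 have Snz: "on_set V' (\<lambda>y. S (rep y)) y \<noteq> 0" if "y \<in> V'" for y using f that by (simp add: on_set_def)
 have mem: "(\<lambda>y. on_set V' (\<lambda>y. C (rep y)) y / on_set V' (\<lambda>y. S (rep y)) y) \<in> tw (n - 1) V'"
  if "homog_poly (d - 1) C" "d = 0 --> C = (\<lambda>_. 0)" for C
 proof (cases "d = 0")
  case True thus ?thesis using that(2) tw_zero[of "n - 1" V'] by (simp add: on_set_def)
 next
  case False
  show ?thesis by (rule tw_divide[OF tw_form[OF that(1) refl] tw_form[OF V(5) refl] Snz]) (use False V(6) in auto)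
 qed
 show ?thesis
 proof (rule exI[of _ V'], rule exI, rule exI, intro conjI)
  show "(\<lambda>y. on_set V' (\<lambda>y. A (rep y)) y / on_set V' (\<lambda>y. S (rep y)) y) \<in> tw (n - 1) V'" using mem AB by blast
  show "(\<lambda>y. on_set V' (\<lambda>y. B (rep y)) y / on_set V' (\<lambda>y. S (rep y)) y) \<in> tw (n - 1) V'" using mem AB by blast
  show "\<forall>y\<in>V'. g y = on_set V' (\<lambda>y. A (rep y)) y / on_set V' (\<lambda>y. S (rep y)) y * zc 2 y +
    on_set V' (\<lambda>y. B (rep y)) y / on_set V' (\<lambda>y. S (rep y)) y * zc 3 y"
  proof
   fix y assume y: "y \<in> V'"
   have "g y = P (rep y) / S (rep y)" "S (rep y) \<noteq> 0" using f y by auto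
   moreover have "P (rep y) = zc 2 y * A (rep y) + zc 3 y * B (rep y)" using AB(4) rep_nonzero[of y] by (simp add: zc_def)
   ultimately show "g y = on_set V' (\<lambda>y. A (rep y)) y / on_set V' (\<lambda>y. S (rep y)) y * zc 2 y +
    on_set V' (\<lambda>y. B (rep y)) y / on_set V' (\<lambda>y. S (rep y)) y * zc 3 y" using y by (simp add: on_set_def add_divide_distrib mult.commute)
  qed
 qed (use V in auto)
next
 case False
 then obtain i where i: "i = 2 \<or> i = 3" "zc i x \<noteq> 0" by (auto simp: mem_line0)
 define V' where "V' = V \<inter> {y. zc i y \<noteq> 0}"
 have o: "open V'" unfolding V'_def by (intro open_Int assms open_coord_nonzero)
 have g: "(\<lambda>y. on_set V' g y / on_set V' (zc i) y) \<in> tw (n - 1) V'"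
  by (rule tw_divide[OF tw_restrict[OF assms(1)] tw_coord]) (auto simp: V'_def on_set_def)
 have x: "x \<in> V'" using i assms(3) by (simp add: V'_def)
 have eq: "g y = on_set V' g y / on_set V' (zc i) y * zc i y" if "y \<in> V'" for y
  using that by (auto simp: on_set_def V'_def)
 show ?thesis
 proof (cases "i = 2")
  case True
  show ?thesis by (rule exI[of _ V'], rule exI[of _ "\<lambda>y. on_set V' g y / on_set V' (zc i) y"], rule exI[of _ "\<lambda>_. 0"])
   (use o x g eq True tw_zero in \<open>auto simp: V'_def\<close>)
 next
  case False
  hence "i = 3" using i by simp
  thus ?thesis by (intro exI[of _ V'] exI[of _ "\<lambda>_. 0"] exI[of _ "\<lambda>y. on_set V' g y / on_set V' (zc i) y"])
   (use o x g eq tw_zero in \<open>auto simp: V'_def\<close>)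
 qed
qed

text \<open>The fraction that represents \<open>g\<close> on the line makes sense on the open set
  where its denominator is nonzero.\<close>

lemma tw_extend_from_line0:
 assumes "g \<in> tw n (onl V)" "open V" "x \<in> V" "x \<in> line0"
 shows "\<exists>V' G. open V' \<and> x \<in> V' \<and> V' \<subseteq> V \<and> G \<in> tw n V' \<and> (\<forall>y\<in> onl V'. G y = g y)"
proof -
 have "x \<in> onl V" using assms by simp
 from tw_fraction[OF assms(1) this] obtain W d e P S where W: "open W" "x \<in> W" "homog_poly d P" "homog_poly e S" "int d = int e + n"
  and f: "\<forall>y\<in> onl V \<inter> W. S (rep y) \<noteq> 0 \<and> g y = P (rep y) / S (rep y)" by (elim exE conjE)
 define V' where "V' = V \<inter> W \<inter> {y. S (rep y) \<noteq> 0}"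
 have o: "open V'" unfolding V'_def by (intro open_Int assms W open_form_nonzero[OF W(4)])
 have G: "(\<lambda>y. on_set V' (\<lambda>y. P (rep y)) y / on_set V' (\<lambda>y. S (rep y)) y) \<in> tw n V'"
  by (rule tw_divide[OF tw_form[OF W(3) refl] tw_form[OF W(4) refl]]) (use W(5) in \<open>auto simp: V'_def on_set_def\<close>)
 have "x \<in> V'" using assms W f by (simp add: V'_def)
 moreover have "\<forall>y\<in> onl V'. on_set V' (\<lambda>y. P (rep y)) y / on_set V' (\<lambda>y. S (rep y)) y = g y"
 proof
  fix y assume y: "y \<in> onl V'"
  hence "S (rep y) \<noteq> 0 \<and> g y = P (rep y) / S (rep y)" using f by (simp add: V'_def)
  thus "on_set V' (\<lambda>y. P (rep y)) y / on_set V' (\<lambda>y. S (rep y)) y = g y" using y by (simp add: on_set_def)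
 qed
 moreover have "V' \<subseteq> V" by (auto simp: V'_def)
 ultimately show ?thesis using o G by blast
qed

lemma zc_coord_point: "zc i (coord_point i) \<noteq> 0" "j \<noteq> i ==> zc j (coord_point i) = 0"
proof -
 have "axis i 1 \<noteq> (0::complex^4)" by (auto simp: axis_def vec_eq_iff)
 from rep_abs_scale[OF this] obtain c where c: "c \<noteq> 0" "axis i 1 = c *s rep (coord_point i)" by (auto simp: coord_point_def)
 have e: "axis i 1 $ j = c * zc j (coord_point i)" for j by (subst c(2)) (simp add: zc_def)
 show "zc i (coord_point i) \<noteq> 0" using e[of i] by auto
 show "zc j (coord_point i) = 0" if "j \<noteq> i" using e[of j] that c(1) by (simp add: axis_def)
qed

text \<open>Exactness of the Koszul complex: the coordinates 2 and 3 form a regular sequence.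
  Setting the coordinate 2 to 0 in the relation leaves the numerator of \<beta> times the coordinate
  3, so that numerator is divisible by the coordinate 2; cancelling \<open>zc 2\<close> then gives
  \<alpha>.\<close>

lemma tw_syzygy:
 assumes "\<alpha> \<in> tw n V" "\<beta> \<in> tw n V" "open V" "x \<in> V" "\<And>y. y \<in> V ==> \<alpha> y * zc 2 y + \<beta> y * zc 3 y = 0"
 shows "\<exists>V' \<gamma>. open V' \<and> x \<in> V' \<and> V' \<subseteq> V \<and> \<gamma> \<in> tw (n - 1) V' \<and>
  (\<forall>y\<in>V'. \<alpha> y = - (\<gamma> y * zc 3 y) \<and> \<beta> y = \<gamma> y * zc 2 y)"
proof -
 have "\<exists>V' \<gamma>. open V' \<and> x \<in> V' \<and> V' \<subseteq> V \<and> \<gamma> \<in> tw (n - 1) V' \<and> (\<forall>y\<in>V'. \<beta> y = \<gamma> y * zc 2 y)"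
 proof -
  from tw_fraction_open[OF assms(1,3,4)] obtain V1 d e P S where V1: "open V1" "x \<in> V1" "V1 \<subseteq> V" "homog_poly d P" "homog_poly e S" "int d = int e + n"
   and f1: "\<forall>y\<in>V1. S (rep y) \<noteq> 0 \<and> \<alpha> y = P (rep y) / S (rep y)" by (elim exE conjE)
  from tw_fraction_open[OF assms(2,3,4)] obtain V2 k l Q T where V2: "open V2" "x \<in> V2" "V2 \<subseteq> V" "homog_poly k Q" "homog_poly l T" "int k = int l + n"
   and f2: "\<forall>y\<in>V2. T (rep y) \<noteq> 0 \<and> \<beta> y = Q (rep y) / T (rep y)" by (elim exE conjE)
  let ?r = "\<lambda>v::complex^4. (\<chi> j. if j = 2 then 0 else v $ j) :: complex^4"
  have h: "homog_poly (k + e) (\<lambda>v. Q v * S v)" by (rule homog_poly.mult[OF V2(4) V1(5)])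
  have h1: "homog_poly (d + l + 1) (\<lambda>v. P v * T v * v $ 2)"
   by (rule homog_poly.mult[OF homog_poly.mult[OF V1(4) V2(5)] homog_poly.coord])
  have h2: "homog_poly (k + e + 1) (\<lambda>v. Q v * S v * v $ 3)" by (rule homog_poly.mult[OF h homog_poly.coord])
  have de: "d + l + 1 = k + e + 1" using V1(6) V2(6) by simp
  have R: "P v * T v * v $ 2 + Q v * S v * v $ 3 = 0" if "v \<noteq> 0" for v
  proof (rule form_zero_everywhere[OF homog_poly.add[OF h1[unfolded de] h2] open_Int[OF V1(1) V2(1)] _ _ that])
   show "V1 \<inter> V2 \<noteq> {}" using V1(2) V2(2) by blast
   fix y assume y: "y \<in> V1 \<inter> V2"
   have "P (rep y) / S (rep y) * zc 2 y + Q (rep y) / T (rep y) * zc 3 y = 0" "S (rep y) \<noteq> 0" "T (rep y) \<noteq> 0"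
    using assms(5)[of y] f1 f2 y V1(3) by auto
   thus "P (rep y) * T (rep y) * rep y $ 2 + Q (rep y) * S (rep y) * rep y $ 3 = 0"
    by (simp add: zc_def field_simps)
  qed
  obtain A where A: "(k + e = 0 --> A = (\<lambda>_. 0)) \<and> homog_poly (k + e - 1) A \<and> (\<forall>v. Q v * S v = Q (?r v) * S (?r v) + v $ 2 * A v)"
   using homog_divide_coord[OF h, of 2] by (elim exE)
  have r1: "homog_poly 1 (\<lambda>v. ?r v $ j)" for j
   by (cases "j = 2") (auto intro: homog_zero homog_poly.coord[unfolded One_nat_def])
  have hr: "homog_poly (k + e) (\<lambda>v. Q (?r v) * S (?r v))" by (rule homog_subst[OF h r1])
  have Qr: "Q (?r v) * S (?r v) = 0" if "v \<noteq> 0" for v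
  proof (rule form_zero_everywhere[OF hr open_coord_nonzero[of 3] _ _ that])
   have "zc 3 (coord_point 3) \<noteq> 0" by (rule zc_coord_point)
   thus "{x. zc 3 x \<noteq> 0} \<noteq> {}" by blast
   fix y assume "y \<in> {x. zc 3 x \<noteq> 0}"
   hence y: "rep y $ 3 \<noteq> 0" by (simp add: zc_def)
   hence "?r (rep y) $ 3 \<noteq> 0" by simp
   hence "?r (rep y) \<noteq> 0" by (metis zero_index)
   from R[OF this] y show "Q (?r (rep y)) * S (?r (rep y)) = 0" by simp
  qed
  have QA: "Q v * S v = v $ 2 * A v" if "v \<noteq> 0" for v
  proof -
   have "Q v * S v = Q (?r v) * S (?r v) + v $ 2 * A v" using A by (elim conjE) (erule allE)
   thus ?thesis using Qr[OF that] by simp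
  qed
  define V' where "V' = V1 \<inter> V2"
  have Tnz: "on_set V' (\<lambda>y. S (rep y) * T (rep y)) y \<noteq> 0" if "y \<in> V'" for y using f1 f2 that by (simp add: on_set_def V'_def)
  let ?g = "\<lambda>y. on_set V' (\<lambda>y. A (rep y)) y / on_set V' (\<lambda>y. S (rep y) * T (rep y)) y"
  have "?g \<in> tw (n - 1) V'"
  proof (cases "k + e = 0")
   case True thus ?thesis using A[THEN conjunct1] tw_zero[of "n - 1" V'] by (simp add: on_set_def)
  next
   case False
   show ?thesis by (rule tw_divide[OF tw_form[OF A[THEN conjunct2, THEN conjunct1] refl] tw_form[OF homog_poly.mult[OF V1(5) V2(5)] refl] Tnz])
    (use False V2(6) in auto)
  qed
  moreover have "\<beta> y = ?g y * zc 2 y" if "y \<in> V'" for y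
  proof -
   have e: "\<beta> y = Q (rep y) / T (rep y)" "T (rep y) \<noteq> 0" "S (rep y) \<noteq> 0" using f1 f2 that by (auto simp: V'_def)
   have "Q (rep y) * S (rep y) = zc 2 y * A (rep y)" using QA[OF rep_nonzero] by (simp add: zc_def)
   moreover have "\<beta> y = (Q (rep y) * S (rep y)) / (S (rep y) * T (rep y))" using e by simp
   ultimately show ?thesis using that by (simp add: on_set_def mult.commute)
  qed
  moreover have "open V'" "x \<in> V'" "V' \<subseteq> V" using V1 V2 by (auto simp: V'_def)
  ultimately show ?thesis by blast
 qed
 then obtain V' \<gamma> where V': "open V'" "x \<in> V'" "V' \<subseteq> V" "\<gamma> \<in> tw (n - 1) V'" and b: "\<forall>y\<in>V'. \<beta> y = \<gamma> y * zc 2 y" by blast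
 have *: "(\<lambda>y. on_set V' \<alpha> y + \<gamma> y * on_set V' (zc 3) y) \<in> tw n V'"
  using tw_add[OF tw_restrict[OF assms(1) V'(3)]] tw_mult[OF V'(4) tw_coord[of V' 3]] by simp
 \<comment> \<open>By cancellation this function is 0 where \<open>zc 2\<close> is nonzero; the
   identity theorem extends the vanishing to \<open>V'\<close>.\<close>
 have "(\<lambda>y. on_set V' \<alpha> y + \<gamma> y * on_set V' (zc 3) y) = (\<lambda>_. 0)"
 proof (rule tw_zero_on_open[of _ n V' "{}" "{x. zc 2 x \<noteq> 0}"])
  show "(\<lambda>y. on_set V' \<alpha> y + \<gamma> y * on_set V' (zc 3) y) \<in> tw n (V' \<inter> lin_sub {})" using * by (simp add: lin_sub_empty)
  have "zc 2 (coord_point 2) \<noteq> 0" by (rule zc_coord_point)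
  thus "{x. zc 2 x \<noteq> 0} \<inter> lin_sub {} \<noteq> {}" by (auto simp: lin_sub_empty)
  fix y assume y: "y \<in> {x. zc 2 x \<noteq> 0} \<inter> lin_sub {}" "y \<in> V'"
  hence "zc 2 y * (\<alpha> y + \<gamma> y * zc 3 y) = 0" using assms(5)[of y] b V'(3) by (auto simp: algebra_simps)
  thus "on_set V' \<alpha> y + \<gamma> y * on_set V' (zc 3) y = 0" using y by (simp add: on_set_def)
 qed (use V' open_coord_nonzero in auto)
 hence "on_set V' \<alpha> y + \<gamma> y * on_set V' (zc 3) y = 0" for y by (simp add: fun_eq_iff)
 from this have "\<alpha> y = - (\<gamma> y * zc 3 y)" if "y \<in> V'" for y using that eq_neg_iff_add_eq_0[of "\<alpha> y" "\<gamma> y * zc 3 y"] by (metis on_set_def)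
 thus ?thesis using V' b by blast
qed

subsection \<open>The marked line\<close>

lemma homog_degree0: "homog_poly d P ==> d = 0 ==> \<exists>c. P = (\<lambda>_. c)"
proof (induction rule: homog_poly.induct)
 case (add d P Q)
 then obtain c e where "P = (\<lambda>_. c)" "Q = (\<lambda>_. e)" by blast
 thus ?case by (intro exI[of _ "c + e"]) simp
next
 case (mult d P e Q)
 then obtain c k where "P = (\<lambda>_. c)" "Q = (\<lambda>_. k)" by auto
 thus ?case by (intro exI[of _ "c * k"]) simp
qed auto

text \<open>The marked point of the line is \<open>coord_point a\<close>; on the line it is the zero of the coordinate \<open>z\<^sub>b\<close>.\<close>

locale marked_line =
 fixes a b :: 4
 assumes ab: "(a = 0 \<and> b = 1) \<or> (a = 1 \<and> b = 0)"
begin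

definition pt :: proj3 where "pt = coord_point a"

lemma ab_distinct: "a \<noteq> b" "a \<noteq> 2" "a \<noteq> 3" "b \<noteq> 2" "b \<noteq> 3"
 using ab by auto

lemma ab_cases: "j = a \<or> j = b \<or> j = 2 \<or> j = 3"
 using exhaust4[of j] ab by auto

text \<open>The affine cone over the line.\<close>

definition in_plane :: "complex^4 => bool" where "in_plane v \<longleftrightarrow> v $ 2 = 0 \<and> v $ 3 = 0"

lemma in_plane_eqI: "in_plane v ==> in_plane w ==> v $ a = w $ a ==> v $ b = w $ b ==> v = w"
 unfolding vec_eq_iff in_plane_def using ab_cases by metis

lemma rep_in_plane: "x \<in> line0 ==> in_plane (rep x)"
 by (simp add: mem_line0 in_plane_def zc_def)

lemma zc_pt: "zc a pt \<noteq> 0" "j \<noteq> a ==> zc j pt = 0"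
 unfolding pt_def by (rule zc_coord_point)+

lemma pt_line0: "pt \<in> line0"
 using zc_pt(2) ab_distinct by (simp add: mem_line0)

lemma line0_b_zero: "x \<in> line0 ==> zc b x = 0 ==> x = pt"
proof (rule rep_proj_eqI)
 assume x: "x \<in> line0" "zc b x = 0"
 have nz: "zc a x \<noteq> 0" using zc_nonzero[of x] ab_cases x by (metis mem_line0)
 show "rep pt = (zc a pt / zc a x) *s rep x"
  by (rule in_plane_eqI) (use x nz rep_in_plane[OF pt_line0] rep_in_plane[OF x(1)] zc_pt(2)[of b] ab_distinct in \<open>auto simp: in_plane_def zc_def\<close>)
qed

lemma line0_b_nonzero: "x \<in> line0 ==> zc b x \<noteq> 0 \<longleftrightarrow> x \<noteq> pt"
 using line0_b_zero zc_pt(2)[of b] ab_distinct by blast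

section \<open>Forms on the line: division by the equation of a point\<close>

lemma point_in_line0:
 assumes "in_plane v" "v \<noteq> 0"
 shows "\<exists>x c. x \<in> line0 \<and> c \<noteq> 0 \<and> v = c *s rep x"
proof -
 obtain c where c: "c \<noteq> 0" "v = c *s rep (abs_proj3 v)" using rep_abs_scale[OF assms(2)] by blast
 have e: "v $ j = c * zc j (abs_proj3 v)" for j by (subst c(2)) (simp add: zc_def)
 have "abs_proj3 v \<in> line0" using e[of 2] e[of 3] assms(1) c(1) by (simp add: mem_line0 in_plane_def)
 thus ?thesis using c by blast
qed

text \<open>The equation of \<open>q\<close> on the line: up to a factor the only linear form in the
  coordinates \<open>a\<close> and \<open>b\<close> that vanishes at \<open>q\<close>.\<close>

definition lf :: "proj3 => complex^4 => complex" where
 "lf q v = v $ a * zc b q - v $ b * zc a q"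

lemma homog_lf: "homog_poly 1 (lf q)"
proof -
 have "homog_poly 1 (\<lambda>v. zc b q * v $ a - zc a q * v $ b)" by (intro homog_diff homog_cmult homog_poly.coord)
 moreover have "(\<lambda>v. zc b q * v $ a - zc a q * v $ b) = lf q" by (auto simp: lf_def fun_eq_iff algebra_simps)
 ultimately show ?thesis by simp
qed

lemma lf_zero_iff:
 assumes "q \<in> line0" "x \<in> line0" shows "lf q (rep x) = 0 \<longleftrightarrow> x = q"
proof
 assume l: "lf q (rep x) = 0"
 have nq: "zc a q \<noteq> 0 \<or> zc b q \<noteq> 0" using zc_nonzero[of q] ab_cases assms(1) by (metis mem_line0)
 have nx: "zc a x \<noteq> 0 \<or> zc b x \<noteq> 0" using zc_nonzero[of x] ab_cases assms(2) by (metis mem_line0)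
 have l': "zc a x * zc b q = zc b x * zc a q" using l by (simp add: lf_def zc_def)
 show "x = q"
 proof (cases "zc a x = 0")
  case True
  hence "zc b x \<noteq> 0" "zc a q = 0" using nx l' by auto
  thus ?thesis by (intro rep_proj_eqI[of _ "zc b q / zc b x"] in_plane_eqI)
   (use True rep_in_plane assms in \<open>auto simp: in_plane_def zc_def\<close>)
 next
  case False
  show ?thesis by (intro rep_proj_eqI[of _ "zc a q / zc a x"] in_plane_eqI)
   (use False l' rep_in_plane assms in \<open>auto simp: in_plane_def zc_def field_simps\<close>)
 qed
qed (simp add: lf_def zc_def)

text \<open>In suitable linear coordinates of the plane the equation of \<open>q\<close> is itself a
  coordinate, and \<open>homog_divide_coord\<close> applies. The choice of \<open>c\<close> with
  \<open>zc c q \<noteq> 0\<close> makes these coordinates independent.\<close>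

lemma form_divide_lf_aux:
 assumes F: "homog_poly d F" "F (rep q) = 0" and q: "q \<in> line0" and c: "(c = a \<and> e = b) \<or> (c = b \<and> e = a)" and nz: "zc c q \<noteq> 0"
 shows "\<exists>A. (d = 0 --> A = (\<lambda>_. 0)) \<and> homog_poly (d - 1) A \<and>
  (\<forall>v. in_plane v --> F v = (v $ c * zc e q - v $ e * zc c q) * A v)"
proof -
 \<comment> \<open>\<open>S\<close> sends \<open>v\<close> to the equation of \<open>q\<close>
   (coordinate 0) and to \<open>v $ c\<close> (coordinate 1); \<open>T\<close> inverts it on the
   plane.\<close>
 define T :: "complex^4 => complex^4" where
  "T u = (\<chi> j. if j = c then u $ 1 else if j = e then (1 / zc c q) * (zc e q * u $ 1 - u $ 0) else 0)" for u
 define S :: "complex^4 => complex^4" where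
  "S v = (\<chi> j. if j = 0 then zc e q * v $ c - zc c q * v $ e else if j = 1 then v $ c else 0)" for v
 have hT: "homog_poly 1 (\<lambda>u. T u $ j)" for j
 proof -
  consider "j = c" | "j \<noteq> c" "j = e" | "j \<noteq> c" "j \<noteq> e" by blast
  thus ?thesis
  proof cases
   case 1 thus ?thesis using homog_poly.coord[of 1] by (simp add: T_def)
  next
   case 2
   have "homog_poly 1 (\<lambda>u. (1 / zc c q) * (zc e q * u $ 1 - u $ 0))" by (intro homog_cmult homog_diff homog_poly.coord)
   thus ?thesis using 2 by (simp add: T_def)
  next
   case 3 thus ?thesis using homog_zero[of 1] by (simp add: T_def)
  qed
 qed
 have hS: "homog_poly 1 (\<lambda>v. S v $ j)" for j
 proof -
  consider "j = 0" | "j = 1" | "j \<noteq> 0" "j \<noteq> 1" by blast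
  thus ?thesis
  proof cases
   case 1
   have "homog_poly 1 (\<lambda>v::complex^4. zc e q * v $ c - zc c q * v $ e)" by (intro homog_cmult homog_diff homog_poly.coord)
   thus ?thesis using 1 by (simp add: S_def)
  next
   case 2 thus ?thesis using homog_poly.coord[of c] by (simp add: S_def)
  next
   case 3 thus ?thesis using homog_zero[of 1] by (simp add: S_def)
  qed
 qed
 let ?r = "\<lambda>v::complex^4. (\<chi> j. if j = 0 then 0 else v $ j) :: complex^4"
 obtain A where A: "(d = 0 --> A = (\<lambda>_. 0)) \<and> homog_poly (d - 1) A \<and> (\<forall>u. F (T u) = F (T (?r u)) + u $ 0 * A u)"
  using homog_divide_coord[OF homog_subst[OF F(1) hT], of 0] by (elim exE)
 have ce: "c \<noteq> e" using c ab_distinct by auto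
 have TS: "T (S v) = v" if "in_plane v" for v
 proof (rule in_plane_eqI)
  show "in_plane (T (S v))" using c ab_distinct by (auto simp: in_plane_def T_def)
  have "T (S v) $ c = v $ c" "T (S v) $ e = v $ e" using ce nz by (simp_all add: T_def S_def)
  thus "T (S v) $ a = v $ a" "T (S v) $ b = v $ b" using c by auto
 qed (rule that)
 have T0: "F (T (?r u)) = 0" for u
 proof -
  have "T (?r u) = (u $ 1 / zc c q) *s rep q"
  proof (rule in_plane_eqI)
   show "in_plane (T (?r u))" using c ab_distinct by (auto simp: in_plane_def T_def)
   show "in_plane ((u $ 1 / zc c q) *s rep q)" using rep_in_plane[OF q] by (simp add: in_plane_def)
   have "T (?r u) $ c = ((u $ 1 / zc c q) *s rep q) $ c" "T (?r u) $ e = ((u $ 1 / zc c q) *s rep q) $ e"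
    using ce nz by (simp_all add: T_def zc_def)
   thus "T (?r u) $ a = ((u $ 1 / zc c q) *s rep q) $ a" "T (?r u) $ b = ((u $ 1 / zc c q) *s rep q) $ b"
    using c by auto
  qed
  thus ?thesis using homog_poly_scale[OF F(1)] F(2) by simp
 qed
 have eq: "F v = (v $ c * zc e q - v $ e * zc c q) * A (S v)" if "in_plane v" for v
 proof -
  have "F (T (S v)) = F (T (?r (S v))) + S v $ 0 * A (S v)" using A by (elim conjE) (erule allE)
  hence "F v = S v $ 0 * A (S v)" unfolding T0 TS[OF that] by simp
  thus ?thesis by (simp add: S_def mult.commute)
 qed
 show ?thesis
 proof (rule exI[of _ "\<lambda>v. A (S v)"], intro conjI allI impI)
  show "homog_poly (d - 1) (\<lambda>v. A (S v))" using A homog_subst[OF _ hS] by blast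
  show "F v = (v $ c * zc e q - v $ e * zc c q) * A (S v)" if "in_plane v" for v by (rule eq[OF that])
 qed (use A[THEN conjunct1] in auto)
qed

lemma form_divide_lf:
 assumes F: "homog_poly d F" "F (rep q) = 0" and q: "q \<in> line0"
 shows "\<exists>A. (d = 0 --> A = (\<lambda>_. 0)) \<and> homog_poly (d - 1) A \<and> (\<forall>v. in_plane v --> F v = lf q v * A v)"
proof -
 have nq: "zc a q \<noteq> 0 \<or> zc b q \<noteq> 0" using zc_nonzero[of q] ab_cases q by (metis mem_line0)
 thus ?thesis
 proof
  assume "zc a q \<noteq> 0"
  from form_divide_lf_aux[OF F q _ this, of b] show ?thesis unfolding lf_def by simp
 next
  assume "zc b q \<noteq> 0"
  from form_divide_lf_aux[OF F q _ this, of a]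
  obtain A where A: "(d = 0 --> A = (\<lambda>_. 0)) \<and> homog_poly (d - 1) A \<and>
   (\<forall>v. in_plane v --> F v = (v $ b * zc a q - v $ a * zc b q) * A v)" by auto
  show ?thesis
  proof (rule exI[of _ "\<lambda>v. - 1 * A v"], intro conjI allI impI)
   show "homog_poly (d - 1) (\<lambda>v. - 1 * A v)" using A homog_cmult by blast
   show "F v = lf q v * (- 1 * A v)" if "in_plane v" for v
   proof -
    have "F v = (v $ b * zc a q - v $ a * zc b q) * A v" using A that by (elim conjE allE) (erule mp)
    thus ?thesis by (simp add: lf_def algebra_simps)
   qed
  qed (use A in auto)
 qed
qed

lemma form_factor_lf:
 assumes "homog_poly e S" "in_plane w" "S w \<noteq> 0" "q \<in> line0"
 shows "\<exists>k S'. k \<le> e \<and> homog_poly (e - k) S' \<and> S' (rep q) \<noteq> 0 \<and> (\<forall>v. in_plane v --> S v = lf q v ^ k * S' v)"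
 using assms(1,3)
proof (induction e arbitrary: S rule: less_induct)
 case (less e)
 show ?case
 proof (cases "S (rep q) = 0")
  case False
  thus ?thesis by (intro exI[of _ 0] exI[of _ S]) (use less in simp)
 next
  case True
  from form_divide_lf[OF less.prems(1) True assms(4)] obtain A where A: "e = 0 --> A = (\<lambda>_. 0)" "homog_poly (e - 1) A" "\<forall>v. in_plane v --> S v = lf q v * A v"
   by (elim exE conjE)
  have Sw: "S w = lf q w * A w" using A(3) assms(2) by blast
  hence e: "e > 0" using A(1) less.prems(2) by (cases "e = 0") auto
  have "A w \<noteq> 0" using Sw less.prems(2) by auto
  from less.IH[OF _ A(2) this] e obtain k S' where k: "k \<le> e - 1" "homog_poly (e - 1 - k) S'" "S' (rep q) \<noteq> 0" "\<forall>v. in_plane v --> A v = lf q v ^ k * S' v"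
   by auto
  have "S v = lf q v ^ Suc k * S' v" if "in_plane v" for v using A(3) k(4) that by simp
  thus ?thesis using k e by (intro exI[of _ "Suc k"] exI[of _ S']) auto
 qed
qed

section \<open>Zeros of forms, global sections and principal parts on the line\<close>

lemma finite_form_zeros:
 assumes "homog_poly e S" "in_plane w" "S w \<noteq> 0"
 shows "finite {x \<in> line0. S (rep x) = 0}"
 using assms(1,3)
proof (induction e arbitrary: S rule: less_induct)
 case (less e)
 show ?case
 proof (cases "{x \<in> line0. S (rep x) = 0} = {}")
  case False
  then obtain q where q: "q \<in> line0" "S (rep q) = 0" by blast
  from form_divide_lf[OF less.prems(1) q(2,1)] obtain A where A: "e = 0 --> A = (\<lambda>_. 0)" "homog_poly (e - 1) A" "\<forall>v. in_plane v --> S v = lf q v * A v"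
   by (elim exE conjE)
  have Sw: "S w = lf q w * A w" using A(3) assms(2) by blast
  hence e: "e > 0" using A(1) less.prems(2) by (cases "e = 0") auto
  have "A w \<noteq> 0" using Sw less.prems(2) by auto
  from less.IH[OF _ A(2) this] e have "finite {x \<in> line0. A (rep x) = 0}" by simp
  moreover have "{x \<in> line0. S (rep x) = 0} \<subseteq> insert q {x \<in> line0. A (rep x) = 0}"
   using A(3) rep_in_plane lf_zero_iff[OF q(1)] by auto
  ultimately show ?thesis using finite_subset by blast
 qed (simp only: finite.emptyI)
qed

lemma finite_line0_diff:
 assumes "open U" "onl U \<noteq> {}" shows "finite (line0 - U)"
proof -
 obtain x where x: "x \<in> U" "x \<in> line0" using assms(2) by blast
 obtain d P where P: "homog_poly d P" "P (rep x) \<noteq> 0" "{y. P (rep y) \<noteq> 0} \<subseteq> U"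
  using open_contains_form_nonzero[OF assms(1) x(1)] by blast
 have "line0 - U \<subseteq> {x \<in> line0. P (rep x) = 0}" using P(3) by auto
 thus ?thesis using finite_form_zeros[OF P(1) rep_in_plane[OF x(2)] P(2)] finite_subset by blast
qed

text \<open>In the two affine charts the form becomes the polynomials \<open>p\<close> and
  \<open>q\<close>. If \<open>p\<close> has no root it is constant, and then \<open>q\<close> is a
  constant times the monomial of degree \<open>e > 0\<close>, which vanishes at 0.\<close>

lemma form_has_zero:
 assumes "homog_poly e S" "e > 0"
 shows "\<exists>q\<in>line0. S (rep q) = 0"
proof -
 have ex: "\<exists>q\<in>line0. S (rep q) = 0" if v: "in_plane v" "v \<noteq> 0" "S v = 0" for v
 proof -
  obtain x c where x: "x \<in> line0" "c \<noteq> 0" "v = c *s rep x" using point_in_line0[OF v(1,2)] by (elim exE conjE)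
  have "c ^ e * S (rep x) = 0" using homog_poly_scale[OF assms(1), of c "rep x"] x(3) v(3) by simp
  thus ?thesis using x by auto
 qed
 define va vb :: "complex^4" where "va = axis a 1" and "vb = axis b 1"
 have pl: "in_plane (va + t *s vb)" "in_plane (vb + t *s va)" for t using ab_distinct by (simp_all add: in_plane_def va_def vb_def axis_def)
 have nz: "va + t *s vb \<noteq> 0" "vb + t *s va \<noteq> 0" for t
 proof -
  have "(va + t *s vb) $ a = 1" "(vb + t *s va) $ b = 1" using ab_distinct by (simp_all add: va_def vb_def axis_def)
  thus "va + t *s vb \<noteq> 0" "vb + t *s va \<noteq> 0" by (metis zero_index zero_neq_one)+
 qed
 obtain p where p: "\<forall>t. S (vb + t *s va) = poly p t" using homog_on_line[OF assms(1)] by blast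
 obtain q where q: "\<forall>t. S (va + t *s vb) = poly q t" using homog_on_line[OF assms(1)] by blast
 show ?thesis
 proof (cases "\<exists>t. poly p t = 0")
  case True thus ?thesis using ex[OF pl(2) nz(2)] p by metis
 next
  case False
  hence "constant (poly p)" using fundamental_theorem_of_algebra by blast
  hence c: "poly p t = poly p 0" for t by (auto simp: constant_def)
  have "poly q s = poly (monom (poly p 0) e) s" if "s \<noteq> 0" for s
  proof -
   have "va + s *s vb = s *s (vb + (1 / s) *s va)" using that by (simp add: vec_eq_iff field_simps)
   hence "S (va + s *s vb) = s ^ e * poly p (1 / s)" using homog_poly_scale[OF assms(1)] p by simp
   thus ?thesis using q c[of "1 / s"] by (simp add: poly_monom)
  qed
  hence "- {0} \<subseteq> {s. poly (q - monom (poly p 0) e) s = 0}" by auto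
  moreover have "infinite (- {0::complex})" by (simp add: infinite_UNIV_char_0 Compl_eq_Diff_UNIV)
  ultimately have "infinite {s. poly (q - monom (poly p 0) e) s = 0}" using finite_subset by blast
  hence "q = monom (poly p 0) e" using poly_roots_finite[of "q - monom (poly p 0) e"] by auto
  hence "poly q 0 = 0" using assms(2) by (simp add: poly_monom)
  hence "S (va + 0 *s vb) = 0" using q[rule_format, of 0] by (simp only:)
  thus ?thesis using ex[OF pl(1) nz(1)] by blast
 qed
qed

text \<open>Induction on the degree \<open>e\<close> of a denominator of \<open>G\<close> that is
  valid on one nonempty open part. If \<open>e > 0\<close>, the denominator has a zero
  \<open>q\<close> on the line; comparison with a fraction valid at \<open>q\<close> shows that the
  numerator vanishes there as well, and the equation of \<open>q\<close> cancels. If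
  \<open>e = 0\<close>, the fraction is a form and equals \<open>G\<close> by the identity
  theorem.\<close>

lemma tw_line0_global:
 assumes G: "G \<in> tw (int n) line0"
 shows "\<exists>F. homog_poly n F \<and> (\<forall>x\<in>line0. G x = F (rep x))"
proof -
 have claim: "\<exists>F. homog_poly n F \<and> (\<forall>x\<in>line0. G x = F (rep x))"
  if "homog_poly (e + n) P" "homog_poly e S" "open V" "onl V \<noteq> {}"
   "\<forall>y\<in> onl V. S (rep y) \<noteq> 0 \<and> G y = P (rep y) / S (rep y)" for e P S V
  using that
 proof (induction e arbitrary: P S V)
  case 0
  obtain c where c: "S = (\<lambda>_. c)" using homog_degree0[OF 0(2)] by auto
  have hF: "homog_poly n (\<lambda>v. (1 / c) * P v)" using 0(1) by (simp only: homog_cmult add_0)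
  have "(\<lambda>x. G x - on_set line0 (\<lambda>x. (1 / c) * P (rep x)) x) = (\<lambda>_. 0)"
  proof (rule tw_zero_on_open[of _ "int n" UNIV "{2,3}" V])
   show "(\<lambda>x. G x - on_set line0 (\<lambda>x. (1 / c) * P (rep x)) x) \<in> tw (int n) (UNIV \<inter> lin_sub {2,3})"
    using tw_diff[OF G tw_form[OF hF refl]] by (simp add: line0_eq)
   show "V \<inter> lin_sub {2, 3} \<noteq> {}" using 0(4) by (simp add: line0_eq)
   fix x assume "x \<in> V \<inter> lin_sub {2, 3}"
   thus "G x - on_set line0 (\<lambda>x. (1 / c) * P (rep x)) x = 0" using 0(5) c by (simp add: line0_eq on_set_def)
  qed (use 0(3) in auto)
  hence "G x = (1 / c) * P (rep x)" if "x \<in> line0" for x using that by (auto simp: fun_eq_iff on_set_def)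
  thus ?case using hF by blast
 next
  case (Suc e)
  obtain q where q: "q \<in> line0" "S (rep q) = 0" using form_has_zero[OF Suc.prems(2)] by auto
  from form_divide_lf[OF Suc.prems(2) q(2,1)] obtain S' where S': "homog_poly e S'" "\<forall>v. in_plane v --> S v = lf q v * S' v" by auto
  from tw_fraction[OF G q(1)] obtain W d k Q T where W: "open W" "q \<in> W" "homog_poly d Q" "homog_poly k T" "int d = int k + int n"
   and f: "\<forall>y\<in>line0 \<inter> W. T (rep y) \<noteq> 0 \<and> G y = Q (rep y) / T (rep y)" by (elim exE conjE)
  have deg: "Suc e + n + k = d + Suc e" using W(5) by simp
  have h: "homog_poly (Suc e + n + k) (\<lambda>v. P v * T v - Q v * S v)"
   using homog_diff[OF homog_poly.mult[OF Suc.prems(1) W(4)]] homog_poly.mult[OF W(3) Suc.prems(2)] unfolding deg by blast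
  have ne: "V \<inter> W \<inter> line0 \<noteq> {}" using open_meet_line0[OF Suc.prems(3) W(1) Suc.prems(4)] q(1) W(2) by blast
  have "P (rep q) * T (rep q) - Q (rep q) * S (rep q) = 0"
  proof (rule form_zero_on_open[OF h open_Int[OF Suc.prems(3) W(1)], of "{2,3}"])
   show "V \<inter> W \<inter> lin_sub {2, 3} \<noteq> {}" using ne by (simp add: line0_eq)
   fix x assume "x \<in> V \<inter> W \<inter> lin_sub {2, 3}"
   hence "x \<in> onl V" "x \<in> line0 \<inter> W" by (auto simp: line0_eq)
   hence "S (rep x) \<noteq> 0 \<and> G x = P (rep x) / S (rep x)" "T (rep x) \<noteq> 0 \<and> G x = Q (rep x) / T (rep x)"
    using Suc.prems(5) f by blast+
   thus "P (rep x) * T (rep x) - Q (rep x) * S (rep x) = 0" by (simp add: field_simps)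
  next
   show "rep q $ i = 0" if "i \<in> {2, 3}" for i using that q(1) by (auto simp: mem_line0 zc_def)
  qed (rule rep_nonzero)
  hence "P (rep q) = 0" using q f W(2) by auto
  from form_divide_lf[OF Suc.prems(1) this q(1)] obtain P' where P': "homog_poly (e + n) P'" "\<forall>v. in_plane v --> P v = lf q v * P' v" by auto
  have "\<forall>y\<in> onl V. S' (rep y) \<noteq> 0 \<and> G y = P' (rep y) / S' (rep y)"
  proof
   fix y assume y: "y \<in> onl V"
   hence pl: "in_plane (rep y)" using rep_in_plane by blast
   have "S (rep y) \<noteq> 0 \<and> G y = P (rep y) / S (rep y)" using Suc.prems(5) y by blast
   thus "S' (rep y) \<noteq> 0 \<and> G y = P' (rep y) / S' (rep y)" using P'(2) S'(2) pl by simp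
  qed
  thus ?case by (rule Suc.IH[OF P'(1) S'(1) Suc.prems(3,4)])
 qed
 have pt: "pt \<in> line0" by (rule pt_line0)
 from tw_fraction[OF G pt] obtain V d e P S where V: "open V" "pt \<in> V" "homog_poly d P" "homog_poly e S" "int d = int e + int n"
  and f: "\<forall>y\<in>line0 \<inter> V. S (rep y) \<noteq> 0 \<and> G y = P (rep y) / S (rep y)" by (elim exE conjE)
 have "d = e + n" using V(5) by simp
 thus ?thesis using claim[of e P S V] V pt f by blast
qed

lemma form_in_plane:
 assumes "homog_poly (Suc n) F"
 shows "\<exists>c A. homog_poly n A \<and> (\<forall>v. in_plane v --> F v = c * (v $ b) ^ Suc n + v $ a * A v)"
proof -
 let ?r = "\<lambda>v::complex^4. (\<chi> j. if j = a then 0 else v $ j) :: complex^4"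
 obtain A where A: "(Suc n = 0 --> A = (\<lambda>_. 0)) \<and> homog_poly (Suc n - 1) A \<and> (\<forall>v. F v = F (?r v) + v $ a * A v)"
  using homog_divide_coord[OF assms, of a] by (elim exE)
 have "F v = F (axis b 1) * (v $ b) ^ Suc n + v $ a * A v" if "in_plane v" for v
 proof -
  have "?r v = (v $ b) *s axis b 1"
   by (rule in_plane_eqI) (use that ab_distinct in \<open>auto simp: in_plane_def axis_def\<close>)
  hence r: "F (?r v) = (v $ b) ^ Suc n * F (axis b 1)" using homog_poly_scale[OF assms] by simp
  have "F v = F (?r v) + v $ a * A v" using A by (elim conjE) (erule allE)
  thus ?thesis unfolding r by simp
 qed
 thus ?thesis using A[THEN conjunct2, THEN conjunct1] by (intro exI[of _ "F (axis b 1)"] exI[of _ A]) simp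
qed

lemma form1_in_plane:
 assumes "homog_poly 1 F"
 shows "\<exists>x0 x1. \<forall>v. in_plane v --> F v = x0 * v $ b + x1 * v $ a"
proof -
 obtain c A where A: "homog_poly 0 A" "\<forall>v. in_plane v --> F v = c * (v $ b) ^ Suc 0 + v $ a * A v"
  using form_in_plane[OF assms[unfolded One_nat_def]] by blast
 obtain k where k: "A = (\<lambda>_. k)" using homog_degree0[OF A(1)] by auto
 show ?thesis by (rule exI[of _ c], rule exI[of _ k]) (use A(2) k in simp)
qed

lemma form2_in_plane:
 assumes "homog_poly 2 F"
 shows "\<exists>x0 x1 x2. \<forall>v. in_plane v --> F v = x0 * (v $ b)\<^sup>2 + x1 * v $ a * v $ b + x2 * (v $ a)\<^sup>2"
proof -
 have "homog_poly (Suc 1) F" using assms by (simp add: numeral_2_eq_2)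
 from form_in_plane[OF this]
 obtain c A where A: "homog_poly 1 A" "\<forall>v. in_plane v --> F v = c * (v $ b) ^ Suc 1 + v $ a * A v" by blast
 obtain k l where "\<forall>v. in_plane v --> A v = k * v $ b + l * v $ a" using form1_in_plane[OF A(1)] by blast
 thus ?thesis using A(2)
  by (intro exI[of _ c] exI[of _ k] exI[of _ l]) (simp add: power2_eq_square algebra_simps)
qed

text \<open>Partial fractions: \<open>P / (lf q ^ k * S')\<close> is the sum of
  \<open>C / lf q ^ k\<close> and \<open>P' / S'\<close>, by induction on \<open>k\<close>.\<close>

lemma principal_part_fraction:
 assumes "homog_poly (k + e + n) P" "homog_poly e S'" "S' (rep q) \<noteq> 0" "q \<in> line0"
 shows "\<exists>C P'. homog_poly (k + n) C \<and> homog_poly (e + n) P' \<and>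
  (\<forall>v. in_plane v --> P v = C v * S' v + lf q v ^ k * P' v)"
 using assms(1)
proof (induction k arbitrary: P)
 case 0
 thus ?case by (intro exI[of _ "\<lambda>_. 0"] exI[of _ P]) (simp add: homog_zero)
next
 case (Suc k)
 obtain i where i: "zc i q \<noteq> 0" using zc_nonzero by blast
 \<comment> \<open>\<open>D\<close> has the degree of \<open>P / S'\<close> and the same value at
   \<open>q\<close>, so \<open>P - D * S'\<close> is divisible by the equation of
   \<open>q\<close>.\<close>
 define D where "D v = (P (rep q) / (S' (rep q) * zc i q ^ (Suc k + n))) * v $ i ^ (Suc k + n)" for v :: "complex^4"
 have D: "homog_poly (Suc k + n) D" unfolding D_def[abs_def]
  using homog_power[OF homog_poly.coord[of i], of "Suc k + n"] unfolding mult_1_right by (rule homog_cmult)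
 have h: "homog_poly (Suc k + e + n) (\<lambda>v. P v - D v * S' v)"
  using homog_diff[OF Suc.prems] homog_poly.mult[OF D assms(2)] by (simp add: ac_simps)
 have "P (rep q) - D (rep q) * S' (rep q) = 0" using i assms(3) by (simp add: D_def zc_def)
 from form_divide_lf[OF h this assms(4)] obtain A where A: "homog_poly (k + e + n) A"
  "\<forall>v. in_plane v --> P v - D v * S' v = lf q v * A v" by auto
 from Suc.IH[OF A(1)] obtain C P' where C: "homog_poly (k + n) C" "homog_poly (e + n) P'"
  "\<forall>v. in_plane v --> A v = C v * S' v + lf q v ^ k * P' v" by blast
 have hC: "homog_poly (Suc k + n) (\<lambda>v. D v + lf q v * C v)"
  using homog_poly.add[OF D] homog_poly.mult[OF homog_lf C(1)] by simp
 have "P v = (D v + lf q v * C v) * S' v + lf q v ^ Suc k * P' v" if "in_plane v" for v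
 proof -
  have "P v = D v * S' v + lf q v * A v" using A(2) that by (metis add.commute diff_add_cancel)
  thus ?thesis using C(3) that by (simp add: algebra_simps)
 qed
 thus ?case using hC C(2) by blast
qed

text \<open>The denominator is a power of the equation of \<open>q\<close> times a form that is
  nonzero at \<open>q\<close>, and partial fractions separate the pole at \<open>q\<close> from the
  rest. The pole part is regular on the line outside \<open>q\<close>, as the Cousin problem
  requires.\<close>

lemma principal_part:
 assumes "G \<in> tw (int n) (onl A)" "open A" "onl A \<noteq> {}" "q \<in> line0"
 shows "\<exists>\<psi> N g. \<psi> \<in> tw (int n) (line0 - {q}) \<and> open N \<and> q \<in> N \<and> g \<in> tw (int n) (onl N) \<and>
  (\<forall>y\<in>N \<inter> A \<inter> line0 - {q}. G y - \<psi> y = g y)"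
proof -
 obtain x where "x \<in> onl A" using assms(3) by blast
 from tw_fraction[OF assms(1) this] obtain V d e P S where V: "open V" "x \<in> V" "homog_poly d P" "homog_poly e S" "int d = int e + int n"
  and f: "\<forall>y\<in> onl A \<inter> V. S (rep y) \<noteq> 0 \<and> G y = P (rep y) / S (rep y)" by (elim exE conjE)
 have xL: "x \<in> line0" "x \<in> A" using \<open>x \<in> onl A\<close> by auto
 have "S (rep x) \<noteq> 0" using f xL V(2) by blast
 from form_factor_lf[OF V(4) rep_in_plane[OF xL(1)] this assms(4)] obtain k S' where
  S': "k \<le> e" "homog_poly (e - k) S'" "S' (rep q) \<noteq> 0" "\<forall>v. in_plane v --> S v = lf q v ^ k * S' v" by blast
 have "d = k + (e - k) + n" using V(5) S'(1) by simp
 from principal_part_fraction[OF V(3)[unfolded this] S'(2,3) assms(4)] obtain C P' where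
  C: "homog_poly (k + n) C" "homog_poly (e - k + n) P'" "\<forall>v. in_plane v --> P v = C v * S' v + lf q v ^ k * P' v" by blast
 have lfnz: "lf q (rep y) \<noteq> 0 \<longleftrightarrow> y \<noteq> q" if "y \<in> line0" for y using lf_zero_iff[OF assms(4) that] by simp
 define \<psi> where "\<psi> = (\<lambda>y. on_set (line0 - {q}) (\<lambda>y. C (rep y)) y / on_set (line0 - {q}) (\<lambda>y. lf q (rep y) ^ k) y)"
 have hk: "homog_poly k (\<lambda>v. lf q v ^ k)" using homog_power[OF homog_lf, of k q] by simp
 have psi: "\<psi> \<in> tw (int n) (line0 - {q})" unfolding \<psi>_def
  by (rule tw_divide[OF tw_form[OF C(1) refl] tw_form[OF hk refl]]) (use lfnz in \<open>auto simp: on_set_def\<close>)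
 define N where "N = {y. S' (rep y) \<noteq> 0}"
 have oN: "open N" unfolding N_def by (rule open_form_nonzero[OF S'(2)])
 define g where "g = (\<lambda>y. on_set (onl N) (\<lambda>y. P' (rep y)) y / on_set (onl N) (\<lambda>y. S' (rep y)) y)"
 have g: "g \<in> tw (int n) (onl N)" unfolding g_def
  by (rule tw_divide[OF tw_form[OF C(2) refl] tw_form[OF S'(2) refl]]) (auto simp: on_set_def N_def)
 define B where "B = N \<inter> A \<inter> {y. lf q (rep y) \<noteq> 0}"
 have oB: "open B" unfolding B_def by (intro open_Int oN assms open_form_nonzero[OF homog_lf])
 have BL: "onl B = N \<inter> A \<inter> line0 - {q}" using lfnz by (auto simp: B_def)
 define u where "u = (\<lambda>y. on_set (onl B) G y - on_set (onl B) \<psi> y - on_set (onl B) g y)"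
 have "u = (\<lambda>_. 0)"
 proof (rule tw_zero_on_open[of _ "int n" B "{2,3}" "V \<inter> A"])
  have "u \<in> tw (int n) (onl B)" unfolding u_def
   by (intro tw_diff tw_restrict[OF assms(1)] tw_restrict[OF psi] tw_restrict[OF g]) (use BL in auto)
  thus "u \<in> tw (int n) (B \<inter> lin_sub {2, 3})" by (simp add: line0_eq)
  show "V \<inter> A \<inter> lin_sub {2, 3} \<noteq> {}" using V(2) xL unfolding line0_eq by blast
  fix y assume y: "y \<in> V \<inter> A \<inter> lin_sub {2, 3}" "y \<in> B"
  hence yL: "y \<in> line0" by (simp add: line0_eq)
  hence pl: "in_plane (rep y)" by (rule rep_in_plane)
  have "y \<in> onl A \<inter> V" using y yL by auto
  hence 1: "S (rep y) \<noteq> 0" "G y = P (rep y) / S (rep y)" using f by auto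
  have q: "y \<noteq> q" "y \<in> N" using BL y(2) yL by auto
  hence 2: "\<psi> y = C (rep y) / lf q (rep y) ^ k" "g y = P' (rep y) / S' (rep y)" "lf q (rep y) \<noteq> 0" "S' (rep y) \<noteq> 0"
   using yL lfnz by (auto simp: \<psi>_def g_def on_set_def N_def)
  have "G y = (C (rep y) * S' (rep y) + lf q (rep y) ^ k * P' (rep y)) / (lf q (rep y) ^ k * S' (rep y))"
   using 1 C(3) S'(4) pl by auto
  also have "\<dots> = \<psi> y + g y" unfolding 2(1,2) using 2(3,4) by (simp add: add_divide_distrib)
  finally show "u y = 0" using y yL by (simp add: u_def on_set_def)
 qed (use oB V(1) assms(2) in auto)
 hence "u y = 0" for y by simp
 hence "G y - \<psi> y = g y" if "y \<in> N \<inter> A \<inter> line0 - {q}" for y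
  using that BL unfolding u_def on_set_def by (metis eq_iff_diff_eq_0)
 moreover have "q \<in> N" using S'(3) by (simp add: N_def)
 ultimately show ?thesis using psi oN g by blast
qed

end

subsection \<open>Sheaves of modules\<close>

lemma struct_ring_simps [simp]:
 "carrier (struct_ring U) = regular_on U" "\<zero>\<^bsub>struct_ring U\<^esub> = (\<lambda>_. 0)" "\<one>\<^bsub>struct_ring U\<^esub> = on_set U (\<lambda>_. 1)"
 "f \<oplus>\<^bsub>struct_ring U\<^esub> g = (\<lambda>x. f x + g x)" "f \<otimes>\<^bsub>struct_ring U\<^esub> g = (\<lambda>x. f x * g x)"
 by (simp_all add: struct_ring_def)

lemma regular_outside: "f \<in> regular_on U ==> x \<notin> U ==> f x = 0"
 by (simp add: regular_on_def)

lemma regular_const: "on_set U (\<lambda>_. c) \<in> regular_on U"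
 unfolding regular_on_eq_tw by (rule tw_const)

lemma regular_mult: "f \<in> regular_on U ==> g \<in> regular_on U ==> (\<lambda>x. f x * g x) \<in> regular_on U"
 using tw_mult[of f 0 U g 0] unfolding regular_on_eq_tw by simp

lemma regular_add: "f \<in> regular_on U ==> g \<in> regular_on U ==> (\<lambda>x. f x + g x) \<in> regular_on U"
 unfolding regular_on_eq_tw by (rule tw_add)

lemma regular_diff: "f \<in> regular_on U ==> g \<in> regular_on U ==> (\<lambda>x. f x - g x) \<in> regular_on U"
 unfolding regular_on_eq_tw by (rule tw_diff)

lemma regular_uminus: "f \<in> regular_on U ==> (\<lambda>x. - f x) \<in> regular_on U"
 unfolding regular_on_eq_tw by (rule tw_uminus)

lemma regular_zero: "(\<lambda>_. 0) \<in> regular_on U"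
 unfolding regular_on_eq_tw by (rule tw_zero)

lemma regular_restrict: "f \<in> regular_on U ==> V \<subseteq> U ==> on_set V f \<in> regular_on V"
 unfolding regular_on_eq_tw by (rule tw_restrict)

lemma regular_divide:
 "f \<in> tw n U ==> g \<in> tw n U ==> (\<And>x. x \<in> U ==> g x \<noteq> 0) ==> (\<lambda>x. f x / g x) \<in> regular_on U"
 unfolding regular_on_eq_tw by (rule tw_divide) auto

lemma cring_struct_ring: "cring (struct_ring U)"
proof (rule cringI)
 show "abelian_group (struct_ring U)"
 proof (rule abelian_groupI)
  fix x assume "x \<in> carrier (struct_ring U)"
  thus "\<exists>y\<in>carrier (struct_ring U). y \<oplus>\<^bsub>struct_ring U\<^esub> x = \<zero>\<^bsub>struct_ring U\<^esub>"
   by (intro bexI[of _ "\<lambda>y. - x y"]) (auto intro: regular_uminus)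
 qed (auto intro: regular_add regular_zero simp: algebra_simps)
 show "comm_monoid (struct_ring U)"
  by (rule comm_monoidI) (auto intro: regular_mult regular_const[unfolded on_set_def] simp: algebra_simps on_set_def regular_outside fun_eq_iff)
qed (auto simp: algebra_simps)

lemma on_set_subset: "V \<subseteq> U ==> on_set V (on_set U g) = on_set V g"
 by (auto simp: osf)

lemma on_set_in [simp]: "x \<in> U ==> on_set U f x = f x"
 by (simp add: on_set_def)

lemma function_sheaf_simps [simp]:
 "car (function_sheaf S) U = S U"
 "\<zero>\<^bsub>sec (function_sheaf S) U\<^esub> = (\<lambda>_. 0)"
 "f \<oplus>\<^bsub>sec (function_sheaf S) U\<^esub> g = (\<lambda>x. f x + g x)"
 "f \<odot>\<^bsub>sec (function_sheaf S) U\<^esub> g = (\<lambda>x. f x * g x)"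
 "res (function_sheaf S) U V = on_set V"
 by (simp_all add: function_sheaf_def)

lemma O_module_function_sheaf:
 assumes zero: "\<And>U. open U ==> (\<lambda>_. 0) \<in> S U"
  and add: "\<And>U f g. open U ==> f \<in> S U ==> g \<in> S U ==> (\<lambda>x. f x + g x) \<in> S U"
  and mult: "\<And>U f g. open U ==> f \<in> regular_on U ==> g \<in> S U ==> (\<lambda>x. f x * g x) \<in> S U"
  and out: "\<And>U f x. open U ==> f \<in> S U ==> x \<notin> U ==> f x = 0"
  and restr: "\<And>U V f. open U ==> open V ==> V \<subseteq> U ==> f \<in> S U ==> on_set V f \<in> S V"
  and loc: "\<And>U f. open U ==> (\<And>x. x \<notin> U ==> f x = 0) ==>
   (\<And>x. x \<in> U ==> \<exists>V. open V \<and> x \<in> V \<and> V \<subseteq> U \<and> on_set V f \<in> S V) ==> f \<in> S U"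
 shows "O_module (function_sheaf S)"
 unfolding O_module_def
proof (intro conjI allI impI ballI)
 fix U :: "proj3 set" assume U: "open U"
 have inv: "(\<lambda>y. - x y) \<in> S U" if "x \<in> S U" for x
 proof -
  have "(\<lambda>y. on_set U (\<lambda>_. -1) y * x y) = (\<lambda>y. - x y)" using out[OF U that] by (auto simp: osf)
  thus ?thesis using mult[OF U regular_const that, of "-1"] by simp
 qed
 show "Module.module (struct_ring U) (sec (function_sheaf S) U)"
 proof (rule Module.moduleI[OF cring_struct_ring])
  show "abelian_group (sec (function_sheaf S) U)"
  proof (rule abelian_groupI)
   fix x assume "x \<in> car (function_sheaf S) U"
   thus "\<exists>y\<in>car (function_sheaf S) U. y \<oplus>\<^bsub>sec (function_sheaf S) U\<^esub> x = \<zero>\<^bsub>sec (function_sheaf S) U\<^esub>"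
    by (intro bexI[of _ "\<lambda>y. - x y"]) (auto intro: inv)
  qed (auto intro: add zero U simp: algebra_simps)
  fix x assume "x \<in> car (function_sheaf S) U"
  thus "\<one>\<^bsub>struct_ring U\<^esub> \<odot>\<^bsub>sec (function_sheaf S) U\<^esub> x = x"
   using out[OF U] by (auto simp: osf)
 qed (auto intro: mult U simp: algebra_simps)
next
 fix U :: "proj3 set" and m assume "open U" "m \<in> car (function_sheaf S) U"
 thus "res (function_sheaf S) U U m = m" using out by (auto simp: osf)
next
 fix C m
 assume C: "\<forall>V\<in>C. open V \<and> m V \<in> car (function_sheaf S) V"
  and comp: "\<forall>V\<in>C. \<forall>W\<in>C. res (function_sheaf S) V (V \<inter> W) (m V) = res (function_sheaf S) W (V \<inter> W) (m W)"
 have o: "open (\<Union>C)" using C by blast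
 have mS: "m V \<in> S V" "open V" if "V \<in> C" for V using C that by auto
 have eq: "m V x = m W x" if "V \<in> C" "W \<in> C" "x \<in> V" "x \<in> W" for V W x
 proof -
  have "on_set (V \<inter> W) (m V) = on_set (V \<inter> W) (m W)" using comp that(1,2) by auto
  from fun_cong[OF this, of x] show ?thesis using that(3,4) by simp
 qed
 define n where "n x = (if x \<in> \<Union>C then m (SOME V. V \<in> C \<and> x \<in> V) x else 0)" for x
 have n: "n x = m V x" if "V \<in> C" "x \<in> V" for V x
 proof -
  have "(SOME V. V \<in> C \<and> x \<in> V) \<in> C \<and> x \<in> (SOME V. V \<in> C \<and> x \<in> V)" by (rule someI[of _ V]) (use that in simp)
  thus ?thesis using eq[of "SOME V. V \<in> C \<and> x \<in> V" V x] that by (auto simp: n_def)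
 qed
 have nV: "on_set V n = m V" if "V \<in> C" for V
  using n[OF that] out[OF mS(2)[OF that] mS(1)[OF that]] by (auto simp: osf)
 have nS: "n \<in> S (\<Union>C)"
 proof (rule loc[OF o])
  fix x assume "x \<in> \<Union>C"
  then obtain V where "V \<in> C" "x \<in> V" by blast
  thus "\<exists>V. open V \<and> x \<in> V \<and> V \<subseteq> \<Union>C \<and> on_set V n \<in> S V" using nV mS by (intro exI[of _ V]) auto
 qed (simp add: n_def)
 have uniq: "k = n" if "k \<in> S (\<Union>C)" "\<forall>V\<in>C. on_set V k = m V" for k
 proof
  fix x show "k x = n x"
  proof (cases "x \<in> \<Union>C")
   case True
   then obtain V where V: "V \<in> C" "x \<in> V" by blast
   thus ?thesis using fun_cong[OF bspec[OF that(2) V(1)], of x] n[OF V] by simp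
  next
   case False thus ?thesis using out[OF o that(1)] by (simp add: n_def)
  qed
 qed
 show "\<exists>!n. n \<in> car (function_sheaf S) (\<Union>C) \<and> (\<forall>V\<in>C. res (function_sheaf S) (\<Union>C) V n = m V)"
  unfolding function_sheaf_simps
 proof (rule ex1I[of _ n])
  show "n \<in> S (\<Union>C) \<and> (\<forall>V\<in>C. on_set V n = m V)" using nS nV by blast
  show "k = n" if "k \<in> S (\<Union>C) \<and> (\<forall>V\<in>C. on_set V k = m V)" for k using uniq that by blast
 qed
next
 fix U V :: "proj3 set" and m assume "open U" "open V" "V \<subseteq> U" "m \<in> car (function_sheaf S) U"
 thus "res (function_sheaf S) U V m \<in> car (function_sheaf S) V" using restr by simp
qed (auto simp: osf)

lemma O_module_tw: "O_module (function_sheaf (tw n))"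
proof (rule O_module_function_sheaf)
 show "(\<lambda>x. f x * g x) \<in> tw n U" if "f \<in> regular_on U" "g \<in> tw n U" for U f g
  using tw_mult[of f 0 U g n] that unfolding regular_on_eq_tw by simp
 show "f \<in> tw n U" if "open U" "\<And>x. x \<notin> U ==> f x = 0"
   "\<And>x. x \<in> U ==> \<exists>V. open V \<and> x \<in> V \<and> V \<subseteq> U \<and> on_set V f \<in> tw n V" for U f
 proof (rule tw_local)
  fix x assume "x \<in> U"
  from that(3)[OF this] obtain V where V: "open V" "x \<in> V" "V \<subseteq> U" "on_set V f \<in> tw n V" by blast
  moreover have "U \<inter> V = V" using V(3) by blast
  ultimately show "\<exists>V g. open V \<and> x \<in> V \<and> g \<in> tw n (U \<inter> V) \<and> (\<forall>y\<in>U \<inter> V. f y = g y)"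
   by (intro exI[of _ V] exI[of _ "on_set V f"]) auto
 qed (rule that(2))
qed (auto intro: tw_zero tw_add tw_restrict simp: tw_outside)

lemma O_module_struct_sheaf: "O_module struct_sheaf"
 using O_module_tw[of 0] unfolding struct_sheaf_def by (simp add: regular_on_eq_tw[abs_def])

lemma O_module_zero_sheaf: "O_module zero_sheaf"
 unfolding zero_sheaf_def
 by (rule O_module_function_sheaf) (auto simp: osf, metis)

definition ext_zero :: "proj3 set => proj3 set => fn set" where
 "ext_zero N U = (if U \<subseteq> N then regular_on U else {\<lambda>_. 0})"

lemma ext_zero_regular: "ext_zero N U \<subseteq> regular_on U"
 by (auto simp: ext_zero_def regular_zero)

text \<open>Because projective space is irreducible, a section of the extension by zero of \<open>\<O>\<^sub>N\<close>
 over an open set not contained in \<open>N\<close> vanishes.\<close>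

lemma O_module_ext_zero: "O_module (function_sheaf (ext_zero N))"
proof (rule O_module_function_sheaf)
 show "on_set V f \<in> ext_zero N V" if "open U" "open V" "V \<subseteq> U" "f \<in> ext_zero N U" for U V f
 proof (cases "U \<subseteq> N")
  case True thus ?thesis using that regular_restrict[of f U V] by (auto simp: ext_zero_def)
 next
  case False hence "f = (\<lambda>_. 0)" using that by (simp add: ext_zero_def)
  hence "on_set V f = (\<lambda>_. 0)" by (auto simp: on_set_def)
  thus ?thesis by (auto simp: ext_zero_def regular_zero)
 qed
 show "f \<in> ext_zero N U" if U: "open U" "\<And>x. x \<notin> U ==> f x = 0"
   "\<And>x. x \<in> U ==> \<exists>V. open V \<and> x \<in> V \<and> V \<subseteq> U \<and> on_set V f \<in> ext_zero N V" for U f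
 proof (cases "f = (\<lambda>_. 0)")
  case True thus ?thesis by (auto simp: ext_zero_def regular_zero)
 next
  case False
  then obtain x where x: "f x \<noteq> 0" by auto
  hence "x \<in> U" using U(2) by blast
  from U(3)[OF this] obtain V where V: "open V" "x \<in> V" "V \<subseteq> U" "on_set V f \<in> ext_zero N V" by blast
  have "y \<in> N" if y: "y \<in> U" for y
  proof (rule ccontr)
   assume yN: "y \<notin> N"
   from U(3)[OF y] obtain W where W: "open W" "y \<in> W" "W \<subseteq> U" "on_set W f \<in> ext_zero N W" by blast
   have "\<not> W \<subseteq> N" using W(2) yN by blast
   hence "on_set W f = (\<lambda>_. 0)" using W(4) by (simp add: ext_zero_def)
   hence W0: "f z = 0" if "z \<in> W" for z using that by (metis on_set_in)
   have "on_set V f = (\<lambda>_. 0)"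
   proof (rule tw_zero_on_open[of _ 0 V "{}" W])
    have "on_set V f \<in> regular_on V" using V(4) ext_zero_regular by blast
    thus "on_set V f \<in> tw 0 (V \<inter> lin_sub {})" by (simp add: lin_sub_empty regular_on_eq_tw)
   qed (use V(1) W W0 in \<open>auto simp: lin_sub_empty on_set_def\<close>)
   thus False using x V(2) by (metis on_set_in)
  qed
  hence "U \<subseteq> N" by blast
  moreover have "f \<in> regular_on U" unfolding regular_on_eq_tw
  proof (rule tw_local)
   fix z assume "z \<in> U"
   from U(3)[OF this] obtain W where W: "open W" "z \<in> W" "W \<subseteq> U" "on_set W f \<in> ext_zero N W" by blast
   moreover have "U \<inter> W = W" using W(3) by blast
   ultimately show "\<exists>V g. open V \<and> z \<in> V \<and> g \<in> tw 0 (U \<inter> V) \<and> (\<forall>y\<in>U \<inter> V. f y = g y)"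
    using ext_zero_regular[of N W] by (intro exI[of _ W] exI[of _ "on_set W f"]) (auto simp: regular_on_eq_tw)
  qed (rule U(2))
  ultimately show ?thesis by (simp add: ext_zero_def)
 qed
qed (auto simp: ext_zero_def regular_zero intro: regular_add regular_mult regular_outside split: if_splits)

section \<open>The sheaf of the pair as O(1) on the line\<close>

definition qsec :: "proj3 => proj3 set => fn set" where
 "qsec p U = {g. (\<forall>x. x \<notin> onl U - {p} --> g x = 0) \<and>
  (\<forall>V h. open V --> V \<subseteq> U --> h \<in> regular_on (onl V) --> h p = 0 -->
    (\<exists>k\<in>regular_on (onl V). \<forall>x\<in> onl V - {p}. k x = h x * g x))}"

abbreviation Qsh :: "proj3 => fn osheaf" where "Qsh p \<equiv> function_sheaf (qsec p)"
abbreviation Ip :: "4 => fn ocomplex" where "Ip a \<equiv> pair_complex (rho a)"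

lemma point_twist_eq: "point_twist p = Qsh p"
 unfolding point_twist_def qsec_def[abs_def] by (rule refl)

context marked_line begin

abbreviation onp :: "proj3 set => proj3 set" where "onp U \<equiv> U \<inter> line0 - {pt}"

definition qfun :: "proj3 set => fn => fn" where
 "qfun U G = on_set (onp U) (\<lambda>x. G x / zc b x)"

text \<open>Multiplication by the coordinate \<open>z\<^sub>b\<close>, which vanishes exactly at the marked point, identifies
 the twisted sheaf with the sheaf of sections of the hyperplane bundle of the line.\<close>

lemma qsec_iff:
 assumes U: "open U"
 shows "g \<in> qsec pt U \<longleftrightarrow> (\<exists>G\<in>tw 1 (onl U). g = qfun U G)"
proof
 assume g: "g \<in> qsec pt U"
 have out: "g x = 0" if "x \<notin> onp U" for x using g that by (simp add: qsec_def)
 have ext: "\<exists>k\<in>regular_on (onl V). \<forall>x\<in> onp V. k x = h x * g x"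
  if "open V" "V \<subseteq> U" "h \<in> regular_on (onl V)" "h pt = 0" for V h
  using g that unfolding qsec_def by blast
 define A where "A = U \<inter> {x. zc a x \<noteq> 0}"
 have oA: "open A" unfolding A_def by (intro open_Int U open_coord_nonzero)
 \<comment> \<open>\<open>zc b / zc a\<close> vanishes at the marked point, so it is an admissible
   test function; the extension \<open>k\<close> of its product with \<open>g\<close> supplies the
   value of \<open>zc b * g\<close> at that point.\<close>
 have h: "(\<lambda>x. on_set (onl A) (zc b) x / on_set (onl A) (zc a) x) \<in> regular_on (onl A)"
  by (rule regular_divide[OF tw_coord tw_coord]) (auto simp: A_def)
 obtain k where k: "k \<in> regular_on (onl A)"
  "\<forall>x\<in> onp A. k x = on_set (onl A) (zc b) x / on_set (onl A) (zc a) x * g x"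
 proof -
  have "A \<subseteq> U" by (auto simp: A_def)
  moreover have "on_set (onl A) (zc b) pt / on_set (onl A) (zc a) pt = 0"
   using zc_pt(2)[of b] ab_distinct by (simp add: on_set_def)
  ultimately show ?thesis using ext[OF oA _ h] that by blast
 qed
 define G where "G x = (if x = pt \<and> x \<in> U then k pt * zc a pt else zc b x * g x)" for x
 have GA: "G x = k x * zc a x" if "x \<in> onl A" for x
  using that k(2)[rule_format, of x] zc_pt(1) by (auto simp: G_def A_def)
 have "G \<in> tw 1 (onl U)"
 proof (rule tw_local)
  show "G x = 0" if "x \<notin> onl U" for x using out[of x] that pt_line0 by (auto simp: G_def)
  fix x assume x: "x \<in> onl U"
  show "\<exists>V F. open V \<and> x \<in> V \<and> F \<in> tw 1 (onl U \<inter> V) \<and> (\<forall>y\<in> onl U \<inter> V. G y = F y)"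
  proof (cases "x = pt")
   case True
   have "(\<lambda>y. k y * on_set (onl A) (zc a) y) \<in> tw (0 + 1) (onl A)"
    using k(1) by (intro tw_mult tw_coord) (simp add: regular_on_eq_tw)
   moreover have "onl U \<inter> A = onl A" by (auto simp: A_def)
   ultimately show ?thesis using oA True x zc_pt(1) GA by (intro exI[of _ A] exI[of _ "\<lambda>y. k y * on_set (onl A) (zc a) y"]) (auto simp: A_def)
  next
   case False
   define B where "B = U \<inter> {x. zc b x \<noteq> 0}"
   have oB: "open B" unfolding B_def by (intro open_Int U open_coord_nonzero)
   have pB: "pt \<notin> B" using zc_pt(2)[of b] ab_distinct by (auto simp: B_def)
   obtain l where l: "l \<in> regular_on (onl B)" "\<forall>x\<in> onp B. l x = on_set (onl B) (\<lambda>_. 1) x * g x"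
   proof -
    have "B \<subseteq> U" by (auto simp: B_def)
    moreover have "on_set (onl B) (\<lambda>_. 1) pt = (0::complex)" using pB by (simp add: on_set_def)
    ultimately show ?thesis using ext[OF oB _ regular_const] that by blast
   qed
   have "(\<lambda>y. l y * on_set (onl B) (zc b) y) \<in> tw (0 + 1) (onl B)"
    using l(1) by (intro tw_mult tw_coord) (simp add: regular_on_eq_tw)
   moreover have "onl U \<inter> B = onl B" by (auto simp: B_def)
   moreover have "x \<in> B" using False x line0_b_nonzero by (auto simp: B_def)
   moreover have "G y = l y * on_set (onl B) (zc b) y" if "y \<in> onl B" for y
    using l(2)[rule_format, of y] that pB by (auto simp: G_def)
   ultimately show ?thesis using oB by (intro exI[of _ B] exI[of _ "\<lambda>y. l y * on_set (onl B) (zc b) y"]) auto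
  qed
 qed
 moreover have "g = qfun U G"
  using out line0_b_nonzero by (auto simp: qfun_def fun_eq_iff on_set_def G_def)
 ultimately show "\<exists>G\<in>tw 1 (onl U). g = qfun U G" by blast
next
 assume "\<exists>G\<in>tw 1 (onl U). g = qfun U G"
 then obtain G where G: "G \<in> tw 1 (onl U)" and g: "g = qfun U G" by blast
 show "g \<in> qsec pt U" unfolding qsec_def mem_Collect_eq
 proof (intro conjI allI impI)
  show "g x = 0" if "x \<notin> onp U" for x unfolding g qfun_def on_set_def using that by (rule if_not_P)
  fix V h assume V: "open V" "V \<subseteq> U" "h \<in> regular_on (onl V)" "h pt = 0"
  have gV: "h x * g x = h x * G x / zc b x" if "x \<in> onp V" for x
   unfolding g qfun_def using that V(2) by (auto simp: on_set_def)
  have loc: "\<exists>N l. open N \<and> x \<in> N \<and> l \<in> tw 0 (onl V \<inter> N) \<and> (\<forall>y\<in> onl V \<inter> N - {pt}. l y = h y * g y)"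
   if x: "x \<in> onl V" for x
  proof (cases "x = pt")
   case False
   define B where "B = {x. zc b x \<noteq> 0}"
   have "(\<lambda>y. on_set (onl V \<inter> B) h y * (on_set (onl V \<inter> B) G y / on_set (onl V \<inter> B) (zc b) y)) \<in> tw (0 + 0) (onl V \<inter> B)"
    by (intro tw_mult tw_divide[where n = 1 and m = 1] tw_coord tw_restrict[OF G] tw_restrict[OF V(3)[unfolded regular_on_eq_tw]])
     (use V in \<open>auto simp: B_def\<close>)
   moreover have "x \<in> B" using line0_b_nonzero x False by (auto simp: B_def)
   moreover have "open B" unfolding B_def by (rule open_coord_nonzero)
   ultimately show ?thesis using gV
    by (intro exI[of _ B] exI[of _ "\<lambda>y. on_set (onl V \<inter> B) h y * (on_set (onl V \<inter> B) G y / on_set (onl V \<inter> B) (zc b) y)"]) auto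
  next
   case True
   from tw_fraction[OF V(3)[unfolded regular_on_eq_tw] x] obtain W d e P S where W: "open W" "x \<in> W" "homog_poly d P" "homog_poly e S" "int d = int e + 0"
    and f: "\<forall>y\<in> onl V \<inter> W. S (rep y) \<noteq> 0 \<and> h y = P (rep y) / S (rep y)" by (elim exE conjE)
   have "P (rep pt) = 0" using f x W(2) V(4) True by auto
   \<comment> \<open>The numerator of \<open>h\<close> vanishes at the marked point, hence contains
     the factor \<open>lf pt\<close>; on the line this is \<open>- zc a pt\<close> times
     \<open>zc b\<close>, and it cancels the pole of \<open>g\<close>.\<close>
   from form_divide_lf[OF W(3) this pt_line0] obtain A where A: "(d = 0 --> A = (\<lambda>_. 0))" "homog_poly (d - 1) A" "\<forall>v. in_plane v --> P v = lf pt v * A v"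
    by (elim exE conjE)
   let ?B = "onl V \<inter> W"
   define l where "l = (\<lambda>y. (on_set ?B (\<lambda>y. - zc a pt * A (rep y)) y * on_set ?B G y) / on_set ?B (\<lambda>y. S (rep y)) y)"
   have Am: "on_set ?B (\<lambda>y. - zc a pt * A (rep y)) \<in> tw (int d - 1) ?B"
   proof (cases "d = 0")
    case True thus ?thesis using A(1) tw_zero[of "int d - 1" ?B] by (simp add: on_set_def)
   next
    case False thus ?thesis by (intro tw_form[OF homog_cmult[OF A(2)]]) auto
   qed
   have "l \<in> tw 0 ?B" unfolding l_def
    by (rule tw_divide[OF tw_mult[OF Am tw_restrict[OF G]] tw_form[OF W(4) refl]]) (use V(2) W(5) f in auto)
   moreover have "l y = h y * g y" if "y \<in> ?B - {pt}" for y
   proof -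
    have yL: "y \<in> line0" "y \<noteq> pt" using that by auto
    have "P (rep y) = lf pt (rep y) * A (rep y)" using A(3) rep_in_plane[OF yL(1)] by blast
    moreover have "lf pt (rep y) = - zc b y * zc a pt" using zc_pt(2)[of b] ab_distinct by (simp add: lf_def zc_def)
    moreover have "zc b y \<noteq> 0" using line0_b_nonzero yL by blast
    moreover have "S (rep y) \<noteq> 0" "h y = P (rep y) / S (rep y)" using f that by auto
    ultimately have "- zc a pt * A (rep y) * G y / S (rep y) = h y * G y / zc b y" by simp
    also have "\<dots> = h y * g y" using gV[of y] that by simp
    finally show ?thesis using that by (simp add: l_def)
   qed
   ultimately show ?thesis using W(1,2) by (intro exI[of _ W] exI[of _ l]) auto
  qed
  \<comment> \<open>Away from the marked point the extension is \<open>h * g\<close>; its value at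
    that point is taken from any local extension.\<close>
  define k where "k = (if pt \<in> V then (\<lambda>x. if x = pt then (SOME c. \<exists>N l. open N \<and> pt \<in> N \<and> l \<in> tw 0 (onl V \<inter> N) \<and> (\<forall>y\<in> onl V \<inter> N - {pt}. l y = h y * g y) \<and> c = l pt) else h x * g x) else (\<lambda>x. h x * g x))"
  have kV: "k x = h x * g x" if "x \<in> onp V" for x using that by (simp add: k_def)
  have "k \<in> tw 0 (onl V)"
  proof (rule tw_local)
   show "k x = 0" if "x \<notin> onl V" for x using that pt_line0 regular_outside[OF V(3)] by (auto simp: k_def)
   fix x assume x: "x \<in> onl V"
   show "\<exists>N F. open N \<and> x \<in> N \<and> F \<in> tw 0 (onl V \<inter> N) \<and> (\<forall>y\<in> onl V \<inter> N. k y = F y)"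
   proof (cases "x = pt")
    case True
    have "\<exists>c. \<exists>N l. open N \<and> pt \<in> N \<and> l \<in> tw 0 (onl V \<inter> N) \<and> (\<forall>y\<in> onl V \<inter> N - {pt}. l y = h y * g y) \<and> c = l pt"
     using loc[OF x] unfolding True by blast
    from someI_ex[OF this] obtain N l where N: "open N" "pt \<in> N" "l \<in> tw 0 (onl V \<inter> N)" "\<forall>y\<in> onl V \<inter> N - {pt}. l y = h y * g y"
     and kp: "(SOME c. \<exists>N l. open N \<and> pt \<in> N \<and> l \<in> tw 0 (onl V \<inter> N) \<and> (\<forall>y\<in> onl V \<inter> N - {pt}. l y = h y * g y) \<and> c = l pt) = l pt"
     by (elim exE conjE)
    have "k pt = l pt" using kp x True by (simp add: k_def)
    hence "\<forall>y\<in> onl V \<inter> N. k y = l y" using N(4) kV by (metis DiffI IntD1 IntD2 IntI singletonD)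
    thus ?thesis using N(1-3) True by blast
   next
    case False
    obtain N l where N: "open N" "x \<in> N" "l \<in> tw 0 (onl V \<inter> N)" "\<forall>y\<in> onl V \<inter> N - {pt}. l y = h y * g y"
     using loc[OF x] by (elim exE conjE)
    let ?N = "N \<inter> {x. zc b x \<noteq> 0}"
    have "pt \<notin> ?N" using zc_pt(2)[of b] ab_distinct by simp
    hence "k y = l y" if "y \<in> onl V \<inter> ?N" for y
    proof -
     have "y \<noteq> pt" using that \<open>pt \<notin> ?N\<close> by blast
     thus ?thesis using that kV[of y] N(4) by simp
    qed
    moreover have "on_set (onl V \<inter> ?N) l \<in> tw 0 (onl V \<inter> ?N)" by (rule tw_restrict[OF N(3)]) auto
    moreover have "open ?N" by (intro open_Int N open_coord_nonzero)
    moreover have "x \<in> ?N" using line0_b_nonzero x False N(2) by auto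
    ultimately show ?thesis by (intro exI[of _ ?N] exI[of _ "on_set (onl V \<inter> ?N) l"]) auto
   qed
  qed
  thus "\<exists>k\<in>regular_on (onl V). \<forall>x\<in> onp V. k x = h x * g x"
   using kV unfolding regular_on_eq_tw by blast
 qed
qed

end

text \<open>Written with the scalar -1, so that morphisms and restrictions respect it because they
  respect sums and scalars.\<close>

definition sub :: "'a osheaf => proj3 set => 'a => 'a => 'a" where
 "sub F U m n = m \<boxplus>[F,U] (on_set U (\<lambda>_. - 1) \<cdot>[F,U] n)"

section \<open>Calculus with the sections of a sheaf of modules\<close>

context
 fixes F :: "'a osheaf" and U :: "proj3 set"
 assumes F: "O_module F" and U: "open U"
begin

lemma om_module: "Module.module (struct_ring U) (sec F U)"
 using F U by (simp add: O_module_def)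

lemma om_abelian_group: "abelian_group (sec F U)"
 using om_module by (simp add: Module.module_def)

lemma om_add: "m \<in> car F U ==> n \<in> car F U ==> m \<boxplus>[F,U] n \<in> car F U"
 by (rule abelian_monoid.a_closed[OF abelian_group.axioms(1)[OF om_abelian_group]])

lemma om_zero: "zs F U \<in> car F U"
 by (rule abelian_monoid.zero_closed[OF abelian_group.axioms(1)[OF om_abelian_group]])

lemma om_smult: "f \<in> regular_on U ==> m \<in> car F U ==> f \<cdot>[F,U] m \<in> car F U"
 using Module.module.smult_closed[OF om_module] by simp

lemma om_comm: "m \<in> car F U ==> n \<in> car F U ==> m \<boxplus>[F,U] n = n \<boxplus>[F,U] m"
 by (rule abelian_monoid.a_comm[OF abelian_group.axioms(1)[OF om_abelian_group]])

lemma om_assoc: "m \<in> car F U ==> n \<in> car F U ==> k \<in> car F U ==>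
  (m \<boxplus>[F,U] n) \<boxplus>[F,U] k = m \<boxplus>[F,U] (n \<boxplus>[F,U] k)"
 by (rule abelian_monoid.a_assoc[OF abelian_group.axioms(1)[OF om_abelian_group]])

lemma om_lcomm: "m \<in> car F U ==> n \<in> car F U ==> k \<in> car F U ==>
  m \<boxplus>[F,U] (n \<boxplus>[F,U] k) = n \<boxplus>[F,U] (m \<boxplus>[F,U] k)"
 by (rule abelian_monoid.a_lcomm[OF abelian_group.axioms(1)[OF om_abelian_group]])

lemma om_zero_left: "m \<in> car F U ==> zs F U \<boxplus>[F,U] m = m"
 by (rule abelian_monoid.l_zero[OF abelian_group.axioms(1)[OF om_abelian_group]])

lemma om_zero_right: "m \<in> car F U ==> m \<boxplus>[F,U] (zs F U) = m"
 by (rule abelian_monoid.r_zero[OF abelian_group.axioms(1)[OF om_abelian_group]])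

lemma om_smult_smult: "f \<in> regular_on U ==> g \<in> regular_on U ==> m \<in> car F U ==>
  f \<cdot>[F,U] (g \<cdot>[F,U] m) = (\<lambda>x. f x * g x) \<cdot>[F,U] m"
 using Module.module.smult_assoc1[OF om_module, of f g m] by simp

lemma om_smult_add: "f \<in> regular_on U ==> m \<in> car F U ==> n \<in> car F U ==>
  f \<cdot>[F,U] (m \<boxplus>[F,U] n) = (f \<cdot>[F,U] m) \<boxplus>[F,U] (f \<cdot>[F,U] n)"
 using Module.module.smult_r_distr[OF om_module, of f m n] by simp

lemma om_add_smult: "f \<in> regular_on U ==> g \<in> regular_on U ==> m \<in> car F U ==>
  (f \<cdot>[F,U] m) \<boxplus>[F,U] (g \<cdot>[F,U] m) = (\<lambda>x. f x + g x) \<cdot>[F,U] m"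
 using Module.module.smult_l_distr[OF om_module, of f g m] by simp

lemma om_one_smult: "m \<in> car F U ==> on_set U (\<lambda>_. 1) \<cdot>[F,U] m = m"
 using Module.module.smult_one[OF om_module, of m] by simp

lemma om_zero_smult: "m \<in> car F U ==> (\<lambda>_. 0) \<cdot>[F,U] m = zs F U"
 using Module.module.smult_l_null[OF om_module, of m] by simp

lemma om_smult_zero: "f \<in> regular_on U ==> f \<cdot>[F,U] (zs F U) = zs F U"
 using Module.module.smult_r_null[OF om_module, of f] by simp

lemma om_sub: "m \<in> car F U ==> n \<in> car F U ==> sub F U m n \<in> car F U"
 unfolding sub_def by (intro om_add om_smult regular_const)

lemma om_neg_cancel: "n \<in> car F U ==> n \<boxplus>[F,U] (on_set U (\<lambda>_. - 1) \<cdot>[F,U] n) = zs F U"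
proof -
 assume n: "n \<in> car F U"
 have "(\<lambda>x. on_set U (\<lambda>_. 1) x + on_set U (\<lambda>_. - 1) x) = (\<lambda>_. 0 :: complex)" by (auto simp: on_set_def)
 thus ?thesis using om_add_smult[OF regular_const regular_const n, of 1 "-1"] om_one_smult[OF n] om_zero_smult[OF n] by simp
qed

lemma om_sub_self: "n \<in> car F U ==> sub F U n n = zs F U"
 unfolding sub_def by (rule om_neg_cancel)

lemma om_sub_add: "m \<in> car F U ==> n \<in> car F U ==> n \<boxplus>[F,U] sub F U m n = m"
 unfolding sub_def
 by (subst om_lcomm) (simp_all add: om_neg_cancel om_zero_right om_smult regular_const)

lemma om_sub_eq:
 assumes "m \<in> car F U" "n \<in> car F U" "k \<in> car F U"
 shows "sub F U m n = k \<longleftrightarrow> m = n \<boxplus>[F,U] k"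
proof
 assume "sub F U m n = k" thus "m = n \<boxplus>[F,U] k" using om_sub_add[OF assms(1,2)] by simp
next
 let ?n = "on_set U (\<lambda>_. - 1) \<cdot>[F,U] n"
 have n: "?n \<in> car F U" by (intro om_smult regular_const assms)
 assume "m = n \<boxplus>[F,U] k"
 hence "sub F U m n = (n \<boxplus>[F,U] k) \<boxplus>[F,U] ?n" by (simp add: sub_def)
 also have "\<dots> = k \<boxplus>[F,U] (n \<boxplus>[F,U] ?n)" using assms n by (simp add: om_comm[of n k] om_assoc)
 also have "\<dots> = k" using assms by (simp add: om_neg_cancel om_zero_right)
 finally show "sub F U m n = k" .
qed

lemma om_smult_sub: "f \<in> regular_on U ==> m \<in> car F U ==> n \<in> car F U ==>
  f \<cdot>[F,U] sub F U m n = sub F U (f \<cdot>[F,U] m) (f \<cdot>[F,U] n)"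
 unfolding sub_def
 by (simp add: om_smult_add om_smult_smult om_smult regular_const mult.commute)

lemma om_res: "open V ==> V \<subseteq> U ==> m \<in> car F U ==> res F U V m \<in> car F V"
 using F U by (simp add: O_module_def)

lemma om_res_add: "open V ==> V \<subseteq> U ==> m \<in> car F U ==> n \<in> car F U ==>
  res F U V (m \<boxplus>[F,U] n) = res F U V m \<boxplus>[F,V] res F U V n"
 using F U by (simp add: O_module_def)

lemma om_res_smult: "open V ==> V \<subseteq> U ==> f \<in> regular_on U ==> m \<in> car F U ==>
  res F U V (f \<cdot>[F,U] m) = on_set V f \<cdot>[F,V] res F U V m"
 using F U by (simp add: O_module_def)

lemma om_res_id: "m \<in> car F U ==> res F U U m = m"
 using F U by (simp add: O_module_def)

lemma om_res_res: "open V ==> open W ==> W \<subseteq> V ==> V \<subseteq> U ==> m \<in> car F U ==>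
  res F V W (res F U V m) = res F U W m"
 using F U by (simp add: O_module_def)

lemma om_res_sub: "open V ==> V \<subseteq> U ==> m \<in> car F U ==> n \<in> car F U ==>
  res F U V (sub F U m n) = sub F V (res F U V m) (res F U V n)"
 unfolding sub_def by (simp add: om_res_add om_res_smult om_smult regular_const on_set_subset)

end

lemma om_res_zero:
 assumes "O_module F" "open U" "open V" "V \<subseteq> U"
 shows "res F U V (zs F U) = zs F V"
proof -
 have "res F U V ((\<lambda>_. 0) \<cdot>[F,U] (zs F U)) = (\<lambda>_. 0) \<cdot>[F,V] res F U V (zs F U)"
  using om_res_smult[OF assms(1,2,3,4) regular_zero om_zero[OF assms(1,2)]] by (simp add: on_set_def)
 thus ?thesis using om_smult_zero[OF assms(1,2) regular_zero]
  om_zero_smult[OF assms(1,3) om_res[OF assms(1,2,3,4) om_zero[OF assms(1,2)]]] by simp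
qed

lemma om_glue:
 assumes "O_module F" "\<And>V. V \<in> C ==> open V \<and> m V \<in> car F V"
  and "\<And>V W. V \<in> C ==> W \<in> C ==> res F V (V \<inter> W) (m V) = res F W (V \<inter> W) (m W)"
 shows "\<exists>!n. n \<in> car F (\<Union>C) \<and> (\<forall>V\<in>C. res F (\<Union>C) V n = m V)"
proof -
 have 1: "(\<forall>V\<in>C. open V \<and> m V \<in> car F V) -->
   (\<forall>V\<in>C. \<forall>W\<in>C. res F V (V \<inter> W) (m V) = res F W (V \<inter> W) (m W)) -->
   (\<exists>!n. n \<in> car F (\<Union>C) \<and> (\<forall>V\<in>C. res F (\<Union>C) V n = m V))"
  using assms(1) unfolding O_module_def by (elim conjE) (erule allE, erule allE)
 show ?thesis by (rule 1[THEN mp, THEN mp]) (use assms(2,3) in blast)+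
qed

text \<open>Uniqueness in the gluing axiom, for the cover by all open sets on which the restrictions
  agree.\<close>

lemma om_locally_equal:
 assumes "O_module F" "open U" "m \<in> car F U" "n \<in> car F U"
  and "\<And>x. x \<in> U ==> \<exists>V. open V \<and> x \<in> V \<and> V \<subseteq> U \<and> res F U V m = res F U V n"
 shows "m = n"
proof -
 define C where "C = {V. open V \<and> V \<subseteq> U \<and> res F U V m = res F U V n}"
 have C: "\<Union>C = U" using assms(5) unfolding C_def by blast
 have "\<exists>!k. k \<in> car F (\<Union>C) \<and> (\<forall>V\<in>C. res F (\<Union>C) V k = res F U V m)"
 proof (rule om_glue[OF assms(1)])
  show "open V \<and> res F U V m \<in> car F V" if "V \<in> C" for V
   using that om_res[OF assms(1,2) _ _ assms(3), of V] unfolding C_def by blast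
  show "res F V (V \<inter> W) (res F U V m) = res F W (V \<inter> W) (res F U W m)" if "V \<in> C" "W \<in> C" for V W
  proof -
   have VW: "open V" "open W" "V \<subseteq> U" "W \<subseteq> U" using that by (auto simp: C_def)
   have "res F V (V \<inter> W) (res F U V m) = res F U (V \<inter> W) m" "res F W (V \<inter> W) (res F U W m) = res F U (V \<inter> W) m"
    by (rule om_res_res[OF assms(1,2) _ _ _ _ assms(3)]; use VW in \<open>auto intro: open_Int\<close>)+
   thus ?thesis by simp
  qed
 qed
 moreover have "m \<in> car F (\<Union>C) \<and> (\<forall>V\<in>C. res F (\<Union>C) V m = res F U V m)" unfolding C using assms(3) by simp
 moreover have "n \<in> car F (\<Union>C) \<and> (\<forall>V\<in>C. res F (\<Union>C) V n = res F U V m)" unfolding C using assms(4) by (simp add: C_def)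
 ultimately show ?thesis by (elim ex1E) metis
qed

lemma O_homI:
 assumes "\<And>U m. open U ==> m \<in> car F U ==> \<phi> U m \<in> car G U"
  and "\<And>U m n. open U ==> m \<in> car F U ==> n \<in> car F U ==>
   \<phi> U (m \<boxplus>[F,U] n) = \<phi> U m \<boxplus>[G,U] \<phi> U n"
  and "\<And>U f m. open U ==> f \<in> regular_on U ==> m \<in> car F U ==>
   \<phi> U (f \<cdot>[F,U] m) = f \<cdot>[G,U] \<phi> U m"
  and "\<And>U V m. open U ==> open V ==> V \<subseteq> U ==> m \<in> car F U ==> \<phi> V (res F U V m) = res G U V (\<phi> U m)"
 shows "O_hom F G \<phi>"
 unfolding O_hom_def using assms by simp

lemma hom_closed: "O_hom F G \<phi> ==> open U ==> m \<in> car F U ==> \<phi> U m \<in> car G U"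
 by (simp add: O_hom_def)

lemma hom_add: "O_hom F G \<phi> ==> open U ==> m \<in> car F U ==> n \<in> car F U ==>
  \<phi> U (m \<boxplus>[F,U] n) = \<phi> U m \<boxplus>[G,U] \<phi> U n"
 by (simp add: O_hom_def)

lemma hom_smult: "O_hom F G \<phi> ==> open U ==> f \<in> regular_on U ==> m \<in> car F U ==>
  \<phi> U (f \<cdot>[F,U] m) = f \<cdot>[G,U] \<phi> U m"
 by (simp add: O_hom_def)

lemma hom_res: "O_hom F G \<phi> ==> open U ==> open V ==> V \<subseteq> U ==> m \<in> car F U ==>
  \<phi> V (res F U V m) = res G U V (\<phi> U m)"
 by (simp add: O_hom_def)

lemma hom_sub: "O_module F ==> O_hom F G \<phi> ==> open U ==> m \<in> car F U ==> n \<in> car F U ==>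
  \<phi> U (sub F U m n) = sub G U (\<phi> U m) (\<phi> U n)"
 unfolding sub_def by (simp add: hom_add hom_smult om_smult regular_const)

lemma hom_zero:
 assumes "O_module F" "O_module G" "O_hom F G \<phi>" "open U"
 shows "\<phi> U (zs F U) = zs G U"
proof -
 have "\<phi> U ((\<lambda>_. 0) \<cdot>[F,U] (zs F U)) = (\<lambda>_. 0) \<cdot>[G,U] \<phi> U (zs F U)"
  by (rule hom_smult[OF assms(3,4) regular_zero om_zero[OF assms(1,4)]])
 thus ?thesis using om_smult_zero[OF assms(1,4) regular_zero]
  om_zero_smult[OF assms(2,4) hom_closed[OF assms(3,4) om_zero[OF assms(1,4)]]] by simp
qed

lemma O_hom_comp: "O_hom F G \<phi> ==> O_hom G H \<psi> ==> O_hom F H (\<lambda>U m. \<psi> U (\<phi> U m))"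
 by (simp add: O_hom_def)

section \<open>New sheaves from old: subsheaves, maps from extensions by zero, direct sums\<close>

definition subsheaf :: "'a osheaf => (proj3 set => 'a => bool) => 'a osheaf" where
 "subsheaf F P = \<lparr>sec = (\<lambda>U. (sec F U)\<lparr>carrier := {m \<in> car F U. P U m}\<rparr>), res = res F\<rparr>"

lemma subsheaf_simps [simp]:
 "car (subsheaf F P) U = {m \<in> car F U. P U m}"
 "zs (subsheaf F P) U = zs F U"
 "m \<boxplus>[subsheaf F P,U] n = m \<boxplus>[F,U] n"
 "f \<cdot>[subsheaf F P,U] m = f \<cdot>[F,U] m"
 "res (subsheaf F P) U V = res F U V"
 by (simp_all add: subsheaf_def)

lemma O_module_subsheaf:
 assumes F: "O_module F"
  and zero: "\<And>U. open U ==> P U (zs F U)"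
  and add: "\<And>U m n. open U ==> m \<in> car F U ==> n \<in> car F U ==> P U m ==> P U n ==> P U (m \<boxplus>[F,U] n)"
  and smult: "\<And>U f m. open U ==> f \<in> regular_on U ==> m \<in> car F U ==> P U m ==> P U (f \<cdot>[F,U] m)"
  and restr: "\<And>U V m. open U ==> open V ==> V \<subseteq> U ==> m \<in> car F U ==> P U m ==> P V (res F U V m)"
  and loc: "\<And>U m. open U ==> m \<in> car F U ==>
   (\<And>x. x \<in> U ==> \<exists>V. open V \<and> x \<in> V \<and> V \<subseteq> U \<and> P V (res F U V m)) ==> P U m"
 shows "O_module (subsheaf F P)"
 unfolding O_module_def
proof (intro conjI allI impI ballI)
 fix U :: "proj3 set" assume U: "open U"
 note cl = om_add[OF F U] om_smult[OF F U] om_zero[OF F U]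
 show "Module.module (struct_ring U) (sec (subsheaf F P) U)"
 proof (rule Module.moduleI[OF cring_struct_ring])
  show "abelian_group (sec (subsheaf F P) U)"
  proof (rule abelian_groupI)
   fix x assume "x \<in> car (subsheaf F P) U"
   hence x: "x \<in> car F U" "P U x" by simp_all
   let ?n = "on_set U (\<lambda>_. - 1) \<cdot>[F,U] x"
   have n: "?n \<in> car F U" by (intro om_smult F U regular_const x)
   have "P U ?n" by (rule smult[OF U regular_const x])
   moreover have "?n \<boxplus>[F,U] x = zs F U"
    using om_comm[OF F U n x(1)] om_neg_cancel[OF F U x(1)] by simp
   ultimately show "\<exists>y\<in>car (subsheaf F P) U. y \<boxplus>[subsheaf F P,U] x = zs (subsheaf F P) U"
    using n by (intro bexI[of _ ?n]) simp_all
  qed (simp_all add: cl add[OF U] zero[OF U] om_assoc[OF F U] om_zero_left[OF F U] om_comm[OF F U] om_lcomm[OF F U] om_zero_right[OF F U])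
 qed (simp_all add: cl smult[OF U] om_smult_smult[OF F U] om_add_smult[OF F U] om_smult_add[OF F U] om_one_smult[OF F U])
next
 fix U V :: "proj3 set" and m assume "open U" "open V" "V \<subseteq> U" "m \<in> car (subsheaf F P) U"
 thus "res (subsheaf F P) U V m \<in> car (subsheaf F P) V"
  by (simp add: om_res[OF F] restr)
next
 fix C m
 assume C: "\<forall>V\<in>C. open V \<and> m V \<in> car (subsheaf F P) V"
  and comp: "\<forall>V\<in>C. \<forall>W\<in>C. res (subsheaf F P) V (V \<inter> W) (m V) = res (subsheaf F P) W (V \<inter> W) (m W)"
 have "\<exists>!n. n \<in> car F (\<Union>C) \<and> (\<forall>V\<in>C. res F (\<Union>C) V n = m V)"
 proof (rule om_glue[OF F])
  show "open V \<and> m V \<in> car F V" if "V \<in> C" for V using C that by simp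
  show "res F V (V \<inter> W) (m V) = res F W (V \<inter> W) (m W)" if "V \<in> C" "W \<in> C" for V W
   using comp that unfolding subsheaf_simps by blast
 qed
 then obtain n where n: "n \<in> car F (\<Union>C)" "\<forall>V\<in>C. res F (\<Union>C) V n = m V"
  and uniq: "\<forall>k. k \<in> car F (\<Union>C) \<and> (\<forall>V\<in>C. res F (\<Union>C) V k = m V) --> k = n" by (elim ex1E) blast
 have "P (\<Union>C) n"
 proof (rule loc)
  show "open (\<Union>C)" using C by blast
  fix x assume "x \<in> \<Union>C"
  then obtain V where V: "V \<in> C" "x \<in> V" by blast
  have "P V (m V)" "open V" using C V(1) by simp_all
  thus "\<exists>V. open V \<and> x \<in> V \<and> V \<subseteq> \<Union>C \<and> P V (res F (\<Union>C) V n)" using V n(2) by (intro exI[of _ V]) auto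
 qed (rule n(1))
 hence nP: "n \<in> {m \<in> car F (\<Union>C). P (\<Union>C) m} \<and> (\<forall>V\<in>C. res F (\<Union>C) V n = m V)"
  using n by blast
 show "\<exists>!n. n \<in> car (subsheaf F P) (\<Union>C) \<and> (\<forall>V\<in>C. res (subsheaf F P) (\<Union>C) V n = m V)"
  unfolding subsheaf_simps by (rule ex1I[of _ n], rule nP) (use uniq in blast)
qed (simp_all add: om_res_add[OF F] om_res_smult[OF F] om_res_id[OF F] om_res_res[OF F])

text \<open>Equality of two maps is a local condition because sections of \<open>G\<close> are
  determined locally. The term of degree 0 of the common roof is such an equalizer.\<close>

lemma O_module_equalizer:
 assumes F: "O_module F" and G: "O_module G" and h: "O_hom F G \<phi>" "O_hom F G \<psi>"
 shows "O_module (subsheaf F (\<lambda>U m. \<phi> U m = \<psi> U m))"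
proof (rule O_module_subsheaf[OF F])
 fix U m assume U: "open U" "m \<in> car F U"
  and loc: "\<And>x. x \<in> U ==> \<exists>V. open V \<and> x \<in> V \<and> V \<subseteq> U \<and> \<phi> V (res F U V m) = \<psi> V (res F U V m)"
 show "\<phi> U m = \<psi> U m"
 proof (rule om_locally_equal[OF G U(1) hom_closed[OF h(1) U] hom_closed[OF h(2) U]])
  fix x assume "x \<in> U"
  from loc[OF this] obtain V where V: "open V" "x \<in> V" "V \<subseteq> U" "\<phi> V (res F U V m) = \<psi> V (res F U V m)" by (elim exE conjE)
  thus "\<exists>V. open V \<and> x \<in> V \<and> V \<subseteq> U \<and> res G U V (\<phi> U m) = res G U V (\<psi> U m)"
   by (intro exI[of _ V]) (simp add: hom_res[OF h(1) U(1) _ _ U(2), symmetric] hom_res[OF h(2) U(1) _ _ U(2), symmetric])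
 qed
next
 show "\<phi> U (zs F U) = \<psi> U (zs F U)" if "open U" for U
  using hom_zero[OF F G h(1) that] hom_zero[OF F G h(2) that] by simp
qed (simp_all add: hom_add[OF h(1)] hom_add[OF h(2)] hom_smult[OF h(1)] hom_smult[OF h(2)] hom_res[OF h(1)] hom_res[OF h(2)])

lemma O_hom_from_subsheaf: "O_hom F G \<phi> ==> O_hom (subsheaf F P) G \<phi>"
 by (simp add: O_hom_def)

lemma O_hom_to_subsheaf: "O_hom F G \<phi> ==> (\<And>U m. open U ==> m \<in> car F U ==> P U (\<phi> U m)) ==> O_hom F (subsheaf G P) \<phi>"
 by (simp add: O_hom_def)

text \<open>The map that sends 1 over \<open>N\<close> to \<open>m\<close>. An open set not
  contained in \<open>N\<close> carries only the zero section of the extension by zero, so a section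
  over \<open>N\<close> alone defines a map on all of projective space.\<close>

definition gen_hom :: "'a osheaf => proj3 set => 'a => proj3 set => fn => 'a" where
 "gen_hom F N m U c = (if U \<subseteq> N then c \<cdot>[F,U] res F N U m else (zs F U))"

lemma O_hom_gen_hom:
 assumes F: "O_module F" and N: "open N" and m: "m \<in> car F N"
 shows "O_hom (function_sheaf (ext_zero N)) F (gen_hom F N m)"
proof (rule O_homI)
 fix U c assume U: "open U" and c: "c \<in> car (function_sheaf (ext_zero N)) U"
 show "gen_hom F N m U c \<in> car F U"
  using c by (auto simp: gen_hom_def ext_zero_def om_zero[OF F U] om_smult[OF F U] om_res[OF F N U _ m] split: if_splits)
 {
  fix e assume e: "e \<in> car (function_sheaf (ext_zero N)) U"
  show "gen_hom F N m U (c \<boxplus>[function_sheaf (ext_zero N),U] e) = gen_hom F N m U c \<boxplus>[F,U] gen_hom F N m U e"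
  proof (cases "U \<subseteq> N")
   case True
   thus ?thesis using c e om_add_smult[OF F U _ _ om_res[OF F N U True m], of c e] by (simp add: gen_hom_def ext_zero_def)
  qed (simp add: gen_hom_def om_zero[OF F U] om_zero_left[OF F U])
 }
 {
  fix f assume f: "f \<in> regular_on U"
  show "gen_hom F N m U (f \<cdot>[function_sheaf (ext_zero N),U] c) = f \<cdot>[F,U] gen_hom F N m U c"
  proof (cases "U \<subseteq> N")
   case True
   thus ?thesis using c om_smult_smult[OF F U f _ om_res[OF F N U True m], of c] by (simp add: gen_hom_def ext_zero_def)
  qed (simp add: gen_hom_def om_smult_zero[OF F U f])
 }
 fix V assume V: "open V" "V \<subseteq> U"
 show "gen_hom F N m V (res (function_sheaf (ext_zero N)) U V c) = res F U V (gen_hom F N m U c)"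
 proof (cases "U \<subseteq> N")
  case True
  hence "c \<in> regular_on U" using c by (simp add: ext_zero_def)
  thus ?thesis using True V om_res_smult[OF F U V _ om_res[OF F N U True m], of c] om_res_res[OF F N U V(1) V(2) True m]
   by (simp add: gen_hom_def order_trans[OF V(2) True])
 next
  case False
  hence "c = (\<lambda>_. 0)" using c by (simp add: ext_zero_def)
  hence "on_set V c = (\<lambda>_. 0)" by (auto simp: on_set_def)
  thus ?thesis using False om_res_zero[OF F U V] om_zero_smult[OF F V(1) om_res[OF F N V(1) _ m]]
   by (simp add: gen_hom_def)
 qed
qed

lemma infinite_proj3: "infinite (UNIV :: proj3 set)"
proof
 assume fin: "finite (UNIV :: proj3 set)"
 have "t \<in> (\<lambda>x. zc 1 x / zc 0 x) ` UNIV" for t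
 proof -
  define v :: "complex^4" where "v = axis 0 1 + t *s axis 1 1"
  have v: "v $ 0 = 1" "v $ 1 = t" by (simp_all add: v_def axis_def)
  hence "v \<noteq> 0" by (metis zero_index zero_neq_one)
  from rep_abs_scale[OF this] obtain c where c: "c \<noteq> 0" "v = c *s rep (abs_proj3 v)" by blast
  have "v $ j = c * zc j (abs_proj3 v)" for j by (subst c(2)) (simp add: zc_def)
  hence "t = (c * zc 1 (abs_proj3 v)) / (c * zc 0 (abs_proj3 v))" using v by (metis div_by_1)
  thus ?thesis using c(1) by simp
 qed
 hence "(UNIV :: complex set) = (\<lambda>x. zc 1 x / zc 0 x) ` UNIV" by blast
 hence "finite (UNIV :: complex set)" using fin by (metis finite_imageI)
 thus False using infinite_UNIV_char_0 by blast
qed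

text \<open>A pair of sections is coded as one function on \<open>proj3\<close>, so that direct sums stay in the universe of the
 middle terms of roofs.\<close>

definition halves :: "proj3 + proj3 => proj3" where
 "halves = (SOME f. bij f)"

lemma bij_halves: "bij halves"
proof -
 have "(card_of (UNIV <+> UNIV :: (proj3 + proj3) set), card_of (UNIV :: proj3 set)) \<in> ordIso"
  by (rule card_of_Plus_infinite1[OF infinite_proj3 card_of_mono1[OF subset_refl]])
 hence "\<exists>f. bij_betw f (UNIV <+> UNIV :: (proj3 + proj3) set) (UNIV :: proj3 set)"
  by (simp only: card_of_ordIso)
 hence "\<exists>f :: proj3 + proj3 => proj3. bij f" by (simp add: UNIV_Plus_UNIV)
 thus ?thesis unfolding halves_def by (rule someI_ex)
qed

definition pr :: "fn => fn => fn" where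
 "pr m n x = (case inv_into UNIV halves x of Inl y => m y | Inr y => n y)"

definition p1 :: "fn => fn" where "p1 k y = k (halves (Inl y))"

definition p2 :: "fn => fn" where "p2 k y = k (halves (Inr y))"

lemma p1_pr [simp]: "p1 (pr m n) = m"
 by (simp add: p1_def pr_def fun_eq_iff inv_f_f[OF bij_is_inj[OF bij_halves]])

lemma p2_pr [simp]: "p2 (pr m n) = n"
 by (simp add: p2_def pr_def fun_eq_iff inv_f_f[OF bij_is_inj[OF bij_halves]])

lemma pr_p1_p2 [simp]: "pr (p1 k) (p2 k) = k"
proof
 fix x
 have "halves (inv_into UNIV halves x) = x" by (rule surj_f_inv_f[OF bij_is_surj[OF bij_halves]])
 thus "pr (p1 k) (p2 k) x = k x" by (cases "inv_into UNIV halves x") (simp_all add: pr_def p1_def p2_def)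
qed

lemma pr_eq [simp]: "pr m n = k \<longleftrightarrow> m = p1 k \<and> n = p2 k"
 by (metis p1_pr p2_pr pr_p1_p2)

type_synonym fsheaf = "fn osheaf"

definition dirsum :: "fsheaf => fsheaf => fsheaf" where
 "dirsum F G = \<lparr>sec = (\<lambda>U. (sec F U)\<lparr>carrier := {k. p1 k \<in> car F U \<and> p2 k \<in> car G U},
  zero := pr (zs F U) (zs G U),
  add := (\<lambda>k l. pr (p1 k \<boxplus>[F,U] p1 l) (p2 k \<boxplus>[G,U] p2 l)),
  smult := (\<lambda>f k. pr (f \<cdot>[F,U] p1 k) (f \<cdot>[G,U] p2 k))\<rparr>),
 res = (\<lambda>U V k. pr (res F U V (p1 k)) (res G U V (p2 k)))\<rparr>"

lemma dirsum_simps [simp]: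
 "car (dirsum F G) U = {k. p1 k \<in> car F U \<and> p2 k \<in> car G U}"
 "zs (dirsum F G) U = pr (zs F U) (zs G U)"
 "k \<boxplus>[dirsum F G,U] l = pr (p1 k \<boxplus>[F,U] p1 l) (p2 k \<boxplus>[G,U] p2 l)"
 "f \<cdot>[dirsum F G,U] k = pr (f \<cdot>[F,U] p1 k) (f \<cdot>[G,U] p2 k)"
 "res (dirsum F G) U V k = pr (res F U V (p1 k)) (res G U V (p2 k))"
 by (simp_all add: dirsum_def)

lemma O_module_dirsum:
 assumes F: "O_module F" and G: "O_module G"
 shows "O_module (dirsum F G)"
 unfolding O_module_def
proof (intro conjI allI impI ballI)
 fix U :: "proj3 set" assume U: "open U"
 show "Module.module (struct_ring U) (sec (dirsum F G) U)"
 proof (rule Module.moduleI[OF cring_struct_ring])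
  show "abelian_group (sec (dirsum F G) U)"
  proof (rule abelian_groupI)
   fix x assume "x \<in> car (dirsum F G) U"
   hence x: "p1 x \<in> car F U" "p2 x \<in> car G U" by simp_all
   let ?m = "on_set U (\<lambda>_. - 1) \<cdot>[F,U] p1 x" and ?n = "on_set U (\<lambda>_. - 1) \<cdot>[G,U] p2 x"
   have n: "?m \<in> car F U" "?n \<in> car G U" by (intro om_smult F G U regular_const x)+
   have "?m \<boxplus>[F,U] p1 x = zs F U" "?n \<boxplus>[G,U] p2 x = zs G U"
    using om_comm[OF F U n(1) x(1)] om_neg_cancel[OF F U x(1)] om_comm[OF G U n(2) x(2)] om_neg_cancel[OF G U x(2)] by simp_all
   thus "\<exists>y\<in>car (dirsum F G) U. y \<boxplus>[dirsum F G,U] x = zs (dirsum F G) U"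
    using n by (intro bexI[of _ "pr ?m ?n"]) simp_all
  qed (simp_all add: om_add[OF F U] om_add[OF G U] om_zero[OF F U] om_zero[OF G U] om_assoc[OF F U] om_assoc[OF G U]
   om_zero_left[OF F U] om_zero_left[OF G U] om_comm[OF F U] om_comm[OF G U] om_lcomm[OF F U] om_lcomm[OF G U]
   om_zero_right[OF F U] om_zero_right[OF G U])
 qed (simp_all add: om_smult[OF F U] om_smult[OF G U] om_smult_smult[OF F U] om_add_smult[OF F U] om_smult_add[OF F U] om_one_smult[OF F U]
   om_smult_smult[OF G U] om_add_smult[OF G U] om_smult_add[OF G U] om_one_smult[OF G U])
next
 fix C m
 assume C: "\<forall>V\<in>C. open V \<and> m V \<in> car (dirsum F G) V"
  and comp: "\<forall>V\<in>C. \<forall>W\<in>C. res (dirsum F G) V (V \<inter> W) (m V) = res (dirsum F G) W (V \<inter> W) (m W)"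
 have c1: "res F V (V \<inter> W) (p1 (m V)) = res F W (V \<inter> W) (p1 (m W))" if "V \<in> C" "W \<in> C" for V W
  using arg_cong[OF comp[rule_format, OF that], of p1] by simp
 have c2: "res G V (V \<inter> W) (p2 (m V)) = res G W (V \<inter> W) (p2 (m W))" if "V \<in> C" "W \<in> C" for V W
  using arg_cong[OF comp[rule_format, OF that], of p2] by simp
 have "\<exists>!n. n \<in> car F (\<Union>C) \<and> (\<forall>V\<in>C. res F (\<Union>C) V n = p1 (m V))"
  by (rule om_glue[OF F _ c1]) (use C in auto)
 then obtain n where n: "n \<in> car F (\<Union>C)" "\<forall>V\<in>C. res F (\<Union>C) V n = p1 (m V)"
  and nu: "\<forall>k. k \<in> car F (\<Union>C) \<and> (\<forall>V\<in>C. res F (\<Union>C) V k = p1 (m V)) --> k = n" by (elim ex1E) blast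
 have "\<exists>!n. n \<in> car G (\<Union>C) \<and> (\<forall>V\<in>C. res G (\<Union>C) V n = p2 (m V))"
  by (rule om_glue[OF G _ c2]) (use C in auto)
 then obtain l where l: "l \<in> car G (\<Union>C)" "\<forall>V\<in>C. res G (\<Union>C) V l = p2 (m V)"
  and lu: "\<forall>k. k \<in> car G (\<Union>C) \<and> (\<forall>V\<in>C. res G (\<Union>C) V k = p2 (m V)) --> k = l" by (elim ex1E) blast
 show "\<exists>!n. n \<in> car (dirsum F G) (\<Union>C) \<and> (\<forall>V\<in>C. res (dirsum F G) (\<Union>C) V n = m V)"
 proof (rule ex1I[of _ "pr n l"])
  show "pr n l \<in> car (dirsum F G) (\<Union>C) \<and> (\<forall>V\<in>C. res (dirsum F G) (\<Union>C) V (pr n l) = m V)"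
   using n l by simp
  fix k assume k: "k \<in> car (dirsum F G) (\<Union>C) \<and> (\<forall>V\<in>C. res (dirsum F G) (\<Union>C) V k = m V)"
  have "\<forall>V\<in>C. res F (\<Union>C) V (p1 k) = p1 (m V)" "\<forall>V\<in>C. res G (\<Union>C) V (p2 k) = p2 (m V)"
   using k by simp_all
  hence "p1 k = n" "p2 k = l" using nu lu k by simp_all
  thus "k = pr n l" by (metis pr_p1_p2)
 qed
qed (simp_all add: om_res_add[OF F] om_res_smult[OF F] om_res_id[OF F] om_res_res[OF F] om_res[OF F]
  om_res_add[OF G] om_res_smult[OF G] om_res_id[OF G] om_res_res[OF G] om_res[OF G])

lemma O_hom_p1: "O_hom (dirsum F G) F (\<lambda>U. p1)"
 by (simp add: O_hom_def)

lemma O_hom_p2: "O_hom (dirsum F G) G (\<lambda>U. p2)"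
 by (simp add: O_hom_def)

lemma O_hom_pr: "O_hom H F \<phi> ==> O_hom H G \<psi> ==> O_hom H (dirsum F G) (\<lambda>U m. pr (\<phi> U m) (\<psi> U m))"
 by (simp add: O_hom_def)

subsection \<open>Resolutions of the pair\<close>

lemma bounded_complex_module: "bounded_complex K ==> O_module (obj K i)"
 by (simp add: bounded_complex_def)

lemma bounded_complex_hom: "bounded_complex K ==> i + 1 = j ==> O_hom (obj K i) (obj K j) (diff K i)"
 by (auto simp: bounded_complex_def)

lemma bounded_complex_dd: "bounded_complex K ==> i + 1 = j ==> open U ==> m \<in> car (obj K i) U ==>
  diff K j U (diff K i U m) = zs (obj K (i + 2)) U"
 by (auto simp: bounded_complex_def)

context marked_line begin

lemma rho_fst: "fst (rho a) = Qsh pt"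
 by (simp add: rho_def pt_def point_twist_eq)

lemma I_obj: "obj (Ip a) 0 = function_sheaf regular_on"
 "obj (Ip a) 1 = Qsh pt"
 "i \<noteq> 0 ==> i \<noteq> 1 ==> obj (Ip a) i = function_sheaf (\<lambda>_. {\<lambda>_. 0})"
 by (simp_all add: pair_complex_def struct_sheaf_def rho_fst zero_sheaf_def)

lemma I_diff: "diff (Ip a) 0 = (\<lambda>U f. on_set (line0 - {pt}) f)"
 "i \<noteq> 0 ==> diff (Ip a) i = (\<lambda>U m. \<lambda>_. 0)"
 by (simp_all add: pair_complex_def rho_def canonical_section_def[abs_def] pt_def)

text \<open>For \<open>c = b\<close> and \<open>i = 2, 3\<close> these are the X and Y of the
  overview; near the marked point the denominator is \<open>zc a\<close>.\<close>

definition ratio :: "4 => 4 => proj3 set => fn" where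
 "ratio i c V = on_set V (\<lambda>y. zc i y / zc c y)"

lemma ratio_regular: "V \<subseteq> {y. zc c y \<noteq> 0} ==> ratio i c V \<in> regular_on V"
proof -
 assume V: "V \<subseteq> {y. zc c y \<noteq> 0}"
 have "(\<lambda>y. on_set V (zc i) y / on_set V (zc c) y) \<in> regular_on V"
  by (rule regular_divide[OF tw_coord tw_coord]) (use V in auto)
 moreover have "(\<lambda>y. on_set V (zc i) y / on_set V (zc c) y) = ratio i c V" by (auto simp: ratio_def osf)
 ultimately show ?thesis by simp
qed

lemma ratio_restrict: "V' \<subseteq> V ==> on_set V' (ratio i c V) = ratio i c V'"
 by (simp add: ratio_def on_set_subset)

lemma ratio_in: "y \<in> V ==> ratio i c V y = zc i y / zc c y"
 by (simp add: ratio_def)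

abbreviation Db :: "proj3 set" where "Db \<equiv> {y. zc b y \<noteq> 0}"
abbreviation Da :: "proj3 set" where "Da \<equiv> {y. zc a y \<noteq> 0}"

lemma open_Da: "open Da" and open_Db: "open Db"
 by (rule open_coord_nonzero)+

lemma pt_Db: "pt \<notin> Db" and pt_Da: "pt \<in> Da"
 using zc_pt ab_distinct by auto

lemma line0_Db: "y \<in> line0 ==> y \<noteq> pt ==> y \<in> Db"
 using line0_b_nonzero by simp

lemma ideal_line0_ratio:
 assumes "g \<in> regular_on V" "open V" "V \<subseteq> {y. zc c y \<noteq> 0}" "x \<in> V" "\<forall>y\<in> onl V. g y = 0"
 shows "\<exists>V' \<alpha> \<beta>. open V' \<and> x \<in> V' \<and> V' \<subseteq> V \<and> \<alpha> \<in> regular_on V' \<and> \<beta> \<in> regular_on V' \<and>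
  (\<forall>y\<in>V'. g y = \<alpha> y * ratio 2 c V' y + \<beta> y * ratio 3 c V' y)"
proof -
 from tw_ideal_line0[OF assms(1)[unfolded regular_on_eq_tw] assms(2,4) bspec[OF assms(5)]]
 obtain V' \<alpha> \<beta> where V': "open V'" "x \<in> V'" "V' \<subseteq> V" and h: "\<alpha> \<in> tw (-1) V'" "\<beta> \<in> tw (-1) V'"
  "\<forall>y\<in>V'. g y = \<alpha> y * zc 2 y + \<beta> y * zc 3 y" by auto
 have "(\<lambda>y. \<alpha> y * on_set V' (zc c) y) \<in> regular_on V'" "(\<lambda>y. \<beta> y * on_set V' (zc c) y) \<in> regular_on V'"
  using tw_mult[OF h(1) tw_coord[of V' c]] tw_mult[OF h(2) tw_coord[of V' c]] by (simp_all add: regular_on_eq_tw)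
 moreover have "\<forall>y\<in>V'. g y = \<alpha> y * on_set V' (zc c) y * ratio 2 c V' y + \<beta> y * on_set V' (zc c) y * ratio 3 c V' y"
  using h(3) V'(3) assms(3) by (auto simp: ratio_def)
 ultimately show ?thesis using V' by (intro exI[of _ V'] exI[of _ "\<lambda>y. \<alpha> y * on_set V' (zc c) y"] exI[of _ "\<lambda>y. \<beta> y * on_set V' (zc c) y"]) simp
qed

lemma syzygy_ratio:
 assumes "\<alpha> \<in> regular_on V" "\<beta> \<in> regular_on V" "open V" "V \<subseteq> {y. zc c y \<noteq> 0}" "x \<in> V"
  "\<forall>y\<in>V. \<alpha> y * ratio 2 c V y + \<beta> y * ratio 3 c V y = 0"
 shows "\<exists>V' \<gamma>. open V' \<and> x \<in> V' \<and> V' \<subseteq> V \<and> \<gamma> \<in> regular_on V' \<and>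
  (\<forall>y\<in>V'. \<alpha> y = - (\<gamma> y * ratio 3 c V' y) \<and> \<beta> y = \<gamma> y * ratio 2 c V' y)"
proof -
 have "\<alpha> y * zc 2 y + \<beta> y * zc 3 y = 0" if "y \<in> V" for y
  using bspec[OF assms(6) that] assms(4) that by (auto simp: ratio_def field_simps)
 from tw_syzygy[OF assms(1,2)[unfolded regular_on_eq_tw] assms(3,5) this]
 obtain V' \<gamma> where V': "open V'" "x \<in> V'" "V' \<subseteq> V" and h: "\<gamma> \<in> tw (-1) V'"
  "\<forall>y\<in>V'. \<alpha> y = - (\<gamma> y * zc 3 y) \<and> \<beta> y = \<gamma> y * zc 2 y" by auto
 have "(\<lambda>y. \<gamma> y * on_set V' (zc c) y) \<in> regular_on V'"
  using tw_mult[OF h(1) tw_coord[of V' c]] by (simp add: regular_on_eq_tw)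
 moreover have "\<forall>y\<in>V'. \<alpha> y = - (\<gamma> y * on_set V' (zc c) y * ratio 3 c V' y) \<and> \<beta> y = \<gamma> y * on_set V' (zc c) y * ratio 2 c V' y"
  using h(2) V'(3) assms(4) by (auto simp: ratio_def)
 ultimately show ?thesis using V' by (intro exI[of _ V'] exI[of _ "\<lambda>y. \<gamma> y * on_set V' (zc c) y"]) simp
qed

lemma regular_zero_on_line0:
 assumes "g \<in> regular_on V" "open V" "\<And>y. y \<in> onl V ==> y \<noteq> pt ==> g y = 0" "y \<in> onl V"
 shows "g y = 0"
proof -
 have "on_set (onl V) g = (\<lambda>_. 0)"
 proof (rule tw_zero_on_open[of _ 0 V "{2,3}" "V \<inter> Db"])
  show "on_set (onl V) g \<in> tw 0 (V \<inter> lin_sub {2, 3})"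
   using assms(1) unfolding line0_eq regular_on_eq_tw by (rule tw_restrict) simp
  have "coord_point b \<in> onl Db" using zc_coord_point[of b] ab_distinct zc_coord_point(2)[of _ b] by (auto simp: mem_line0)
  hence "V \<inter> Db \<inter> line0 \<noteq> {}" using assms(2,4) open_Db by (intro open_meet_line0) auto
  thus "V \<inter> Db \<inter> lin_sub {2, 3} \<noteq> {}" by (simp add: line0_eq)
  show "open (V \<inter> Db)" by (intro open_Int assms open_Db)
  fix x assume "x \<in> V \<inter> Db \<inter> lin_sub {2, 3}"
  thus "on_set (onl V) g x = 0" using assms(3)[of x] pt_Db by (auto simp: line0_eq on_set_def)
 qed (rule assms(2))
 hence "on_set (onl V) g y = 0" by simp
 thus ?thesis using assms(4) by simp
qed

end

text \<open>The left leg of a roof. The terms of \<open>J\<close> are arbitrary, so every cochain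
  has to come from the quasi-isomorphism: the cohomology of the complex of the pair is the ideal of
  the line in degree 0 and a sheaf supported at the marked point in degree 1.\<close>

locale resolved = marked_line +
 fixes J :: "fn ocomplex" and s :: "fn cmap"
 assumes bc: "bounded_complex J" and qi: "quasi_iso J (Ip a) s"
begin

abbreviation C :: "int => proj3 set => fn set" where "C i U \<equiv> car (obj J i) U"
abbreviation d :: "int => proj3 set => fn => fn" where "d i U m \<equiv> diff J i U m"
abbreviation z :: "int => proj3 set => fn" where "z i U \<equiv> (zs (obj J i) U)"
abbreviation ad where "ad i U m n \<equiv> m \<boxplus>[obj J i,U] n"
abbreviation sm where "sm i U f m \<equiv> f \<cdot>[obj J i,U] m"
abbreviation sb where "sb i U m n \<equiv> sub (obj J i) U m n"
abbreviation rs where "rs i U V m \<equiv> res (obj J i) U V m"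

lemma omJ: "O_module (obj J i)"
 by (rule bounded_complex_module[OF bc])

lemma hom_d: "O_hom (obj J (-2)) (obj J (-1)) (diff J (-2))" "O_hom (obj J (-1)) (obj J 0) (diff J (-1))"
 "O_hom (obj J 0) (obj J 1) (diff J 0)" "O_hom (obj J 1) (obj J 2) (diff J 1)"
 by (rule bounded_complex_hom[OF bc], simp)+

lemma dd: "open U ==> m \<in> C (-2) U ==> d (-1) U (d (-2) U m) = z 0 U"
 "open U ==> m \<in> C (-1) U ==> d 0 U (d (-1) U m) = z 1 U"
 "open U ==> m \<in> C 0 U ==> d 1 U (d 0 U m) = z 2 U"
 using bounded_complex_dd[OF bc, of "-2" "-1" U m] bounded_complex_dd[OF bc, of "-1" 0 U m] bounded_complex_dd[OF bc, of 0 1 U m]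
 by simp_all

lemma chain_s: "chain_map J (Ip a) s"
 using qi by (simp add: quasi_iso_def)

lemma hom_s: "O_hom (obj J 0) (function_sheaf regular_on) (s 0)" "O_hom (obj J 1) (Qsh pt) (s 1)"
 using chain_s unfolding chain_map_def by (metis I_obj(1), metis I_obj(2))

lemma s_d0: "open U ==> m \<in> C 0 U ==> s 1 U (d 0 U m) = on_set (line0 - {pt}) (s 0 U m)"
proof -
 assume "open U" "m \<in> C 0 U"
 hence "s (0 + 1) U (d 0 U m) = diff (Ip a) 0 U (s 0 U m)" using chain_s unfolding chain_map_def by blast
 thus ?thesis by (simp add: I_diff)
qed

lemma s_dm1: "open U ==> m \<in> C (-1) U ==> s 0 U (d (-1) U m) = (\<lambda>_. 0)"
proof -
 assume "open U" "m \<in> C (-1) U"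
 hence "s (-1 + 1) U (d (-1) U m) = diff (Ip a) (-1) U (s (-1) U m)" using chain_s unfolding chain_map_def by blast
 thus ?thesis by (simp add: I_diff)
qed

lemma s0_reg: "open U ==> m \<in> C 0 U ==> s 0 U m \<in> regular_on U"
 using hom_closed[OF hom_s(1)] by simp

lemma s1_qsec: "open U ==> m \<in> C 1 U ==> s 1 U m \<in> qsec pt U"
 using hom_closed[OF hom_s(2)] by simp

lemma s_add: "open U ==> m \<in> C 0 U ==> n \<in> C 0 U ==> s 0 U (ad 0 U m n) = (\<lambda>x. s 0 U m x + s 0 U n x)"
 "open U ==> m \<in> C 1 U ==> n \<in> C 1 U ==> s 1 U (ad 1 U m n) = (\<lambda>x. s 1 U m x + s 1 U n x)"
 using hom_add[OF hom_s(1)] hom_add[OF hom_s(2)] by simp_all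

lemma s_smult: "open U ==> f \<in> regular_on U ==> m \<in> C 0 U ==> s 0 U (sm 0 U f m) = (\<lambda>x. f x * s 0 U m x)"
 "open U ==> f \<in> regular_on U ==> m \<in> C 1 U ==> s 1 U (sm 1 U f m) = (\<lambda>x. f x * s 1 U m x)"
 using hom_smult[OF hom_s(1)] hom_smult[OF hom_s(2)] by simp_all

lemma s_res: "open U ==> open V ==> V \<subseteq> U ==> m \<in> C 0 U ==> s 0 V (rs 0 U V m) = on_set V (s 0 U m)"
 "open U ==> open V ==> V \<subseteq> U ==> m \<in> C 1 U ==> s 1 V (rs 1 U V m) = on_set V (s 1 U m)"
 using hom_res[OF hom_s(1)] hom_res[OF hom_s(2)] by simp_all

lemma s_sub: "open U ==> m \<in> C 0 U ==> n \<in> C 0 U ==> s 0 U (sb 0 U m n) = (\<lambda>x. s 0 U m x - s 0 U n x)"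
proof -
 assume U: "open U" "m \<in> C 0 U" "n \<in> C 0 U"
 have "s 0 U (sb 0 U m n) = (\<lambda>x. s 0 U m x + on_set U (\<lambda>_. - 1) x * s 0 U n x)"
  by (simp add: sub_def s_add s_smult om_smult[OF omJ] regular_const U)
 thus ?thesis using regular_outside[OF s0_reg[OF U(1,3)]] by (auto simp: osf)
qed

lemma qi_inj:
 assumes "open U" "x \<in> U" "m \<in> cycles J i U" "s i U m \<in> boundaries (Ip a) i U"
 shows "\<exists>V. open V \<and> x \<in> V \<and> V \<subseteq> U \<and> rs i U V m \<in> boundaries J i V"
 by (rule qi[unfolded quasi_iso_def, THEN conjunct2, THEN spec, THEN spec, THEN spec, THEN mp, THEN mp, THEN conjunct1, THEN bspec, THEN mp])
  (rule assms)+

lemma qi_surj: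
 assumes "open U" "x \<in> U" "n \<in> cycles (Ip a) i U"
 shows "\<exists>V. open V \<and> x \<in> V \<and> V \<subseteq> U \<and>
    (\<exists>m\<in>cycles J i V. \<exists>b\<in>boundaries (Ip a) i V.
      res (obj (Ip a) i) U V n = s i V m \<boxplus>[obj (Ip a) i,V] b)"
 by (rule qi[unfolded quasi_iso_def, THEN conjunct2, THEN spec, THEN spec, THEN spec, THEN mp, THEN mp, THEN conjunct2, THEN bspec])
  (rule assms)+

lemma exact_neg:
 assumes "i < 0" "open V" "e \<in> C i V" "d i V e = z (i + 1) V" "x \<in> V"
 shows "\<exists>V' t. open V' \<and> x \<in> V' \<and> V' \<subseteq> V \<and> t \<in> C (i - 1) V' \<and> d (i - 1) V' t = rs i V V' e"
proof -
 have hs: "O_hom (obj J i) (obj (Ip a) i) (s i)" using chain_s by (simp add: chain_map_def)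
 have cy: "e \<in> cycles J i V" using assms by (simp add: cycles_def)
 have bd: "s i V e \<in> boundaries (Ip a) i V"
 proof -
  have "s i V e = (\<lambda>_. 0)" using hom_closed[OF hs assms(2,3)] assms(1) by (simp add: I_obj)
  thus ?thesis using assms(1) by (simp add: boundaries_def I_obj I_diff)
 qed
 from qi_inj[OF assms(2,5) cy bd] obtain V' where V': "open V'" "x \<in> V'" "V' \<subseteq> V" "rs i V V' e \<in> boundaries J i V'"
  by (elim exE conjE)
 obtain t where "t \<in> C (i - 1) V'" "rs i V V' e = d (i - 1) V' t" using V'(4) unfolding boundaries_def by (elim imageE)
 thus ?thesis using V' by (intro exI[of _ V'] exI[of _ t]) simp
qed

lemma exact_m1:
 assumes "open V" "e \<in> C (-1) V" "d (-1) V e = z 0 V" "x \<in> V"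
 shows "\<exists>V' t. open V' \<and> x \<in> V' \<and> V' \<subseteq> V \<and> t \<in> C (-2) V' \<and> d (-2) V' t = rs (-1) V V' e"
 using exact_neg[of "-1" V e x] assms by simp

lemma exact_0:
 assumes "open V" "e \<in> C 0 V" "d 0 V e = z 1 V" "s 0 V e = (\<lambda>_. 0)" "x \<in> V"
 shows "\<exists>V' t. open V' \<and> x \<in> V' \<and> V' \<subseteq> V \<and> t \<in> C (-1) V' \<and> d (-1) V' t = rs 0 V V' e"
proof -
 have cy: "e \<in> cycles J 0 V" using assms by (simp add: cycles_def)
 have bd: "s 0 V e \<in> boundaries (Ip a) 0 V"
  using assms(4) by (simp add: boundaries_def I_obj I_diff)
 from qi_inj[OF assms(1,5) cy bd] obtain V' where V': "open V'" "x \<in> V'" "V' \<subseteq> V" "rs 0 V V' e \<in> boundaries J 0 V'"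
  by (elim exE conjE)
 have "rs 0 V V' e \<in> d (-1) V' ` C (-1) V'" using V'(4) unfolding boundaries_def by simp
 then obtain t where "t \<in> C (-1) V'" "rs 0 V V' e = d (-1) V' t" by (elim imageE)
 thus ?thesis using V' by (intro exI[of _ V'] exI[of _ t]) simp
qed

lemma surj_0:
 assumes "open V" "g \<in> regular_on V" "\<forall>y\<in> onp V. g y = 0" "x \<in> V"
 shows "\<exists>V' m. open V' \<and> x \<in> V' \<and> V' \<subseteq> V \<and> m \<in> C 0 V' \<and> d 0 V' m = z 1 V' \<and> s 0 V' m = on_set V' g"
proof -
 have "on_set (line0 - {pt}) g = (\<lambda>_. 0)" using assms(3) regular_outside[OF assms(2)] by (auto simp: osf)
 hence cy: "g \<in> cycles (Ip a) 0 V" using assms(2) by (simp add: cycles_def I_obj I_diff)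
 from qi_surj[OF assms(1,4) cy] obtain V' m b where V': "open V'" "x \<in> V'" "V' \<subseteq> V" and m: "m \<in> cycles J 0 V'"
  and b: "b \<in> boundaries (Ip a) 0 V'"
   "res (obj (Ip a) 0) V V' g = s 0 V' m \<oplus>\<^bsub>sec (obj (Ip a) 0) V'\<^esub> b" by (elim exE conjE bexE)
 have "b = (\<lambda>_. 0)" using b(1) by (auto simp: boundaries_def I_diff)
 hence "s 0 V' m = on_set V' g" using b(2) by (simp add: I_obj)
 thus ?thesis using V' m by (intro exI[of _ V'] exI[of _ m]) (simp add: cycles_def)
qed

text \<open>Injectivity on cohomology in degree 1 gives some cochain with boundary \<open>c\<close>.
  Its image differs from \<open>g\<close> by a function that vanishes on the line, which is the
  image of a cycle by surjectivity in degree 0; subtracting the cycle makes the image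
  \<open>g\<close> itself. The prescribed image is what later allows lifts in two complexes to be
  matched.\<close>

lemma lift_boundary:
 assumes "open V" "c \<in> C 1 V" "d 1 V c = z 2 V" "g \<in> regular_on V" "s 1 V c = on_set (line0 - {pt}) g" "x \<in> V"
 shows "\<exists>V' j. open V' \<and> x \<in> V' \<and> V' \<subseteq> V \<and> j \<in> C 0 V' \<and> d 0 V' j = rs 1 V V' c \<and> s 0 V' j = on_set V' g"
proof -
 have cy: "c \<in> cycles J 1 V" using assms by (simp add: cycles_def)
 have bd: "s 1 V c \<in> boundaries (Ip a) 1 V"
  using assms(4,5) by (auto simp: boundaries_def I_obj I_diff)
 from qi_inj[OF assms(1,6) cy bd] obtain V1 where V1: "open V1" "x \<in> V1" "V1 \<subseteq> V" "rs 1 V V1 c \<in> boundaries J 1 V1"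
  by (elim exE conjE)
 have "rs 1 V V1 c \<in> d 0 V1 ` C 0 V1" using V1(4) unfolding boundaries_def by simp
 then obtain j where j: "j \<in> C 0 V1" "rs 1 V V1 c = d 0 V1 j" by (elim imageE)
 define n where "n = (\<lambda>y. s 0 V1 j y - on_set V1 g y)"
 have n: "n \<in> regular_on V1" unfolding n_def by (intro regular_diff s0_reg V1 j regular_restrict[OF assms(4)])
 have e: "on_set (line0 - {pt}) (s 0 V1 j) = on_set V1 (on_set (line0 - {pt}) g)"
  using s_d0[OF V1(1) j(1)] s_res(2)[OF assms(1) V1(1,3) assms(2)] j(2) assms(5) by simp
 have "\<forall>y\<in> onp V1. n y = 0"
 proof
  show "n y = 0" if "y \<in> onp V1" for y using fun_cong[OF e, of y] that by (simp add: n_def)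
 qed
 from surj_0[OF V1(1) n this V1(2)] obtain V2 m where V2: "open V2" "x \<in> V2" "V2 \<subseteq> V1"
  and m: "m \<in> C 0 V2" "d 0 V2 m = z 1 V2" "s 0 V2 m = on_set V2 n" by blast
 let ?j = "sb 0 V2 (rs 0 V1 V2 j) m"
 have rj: "rs 0 V1 V2 j \<in> C 0 V2" by (rule om_res[OF omJ V1(1) V2(1,3) j(1)])
 have dj: "d 0 V2 (rs 0 V1 V2 j) = rs 1 V V2 c"
  using hom_res[OF hom_d(3) V1(1) V2(1,3) j(1)] j(2) om_res_res[OF omJ assms(1) V1(1) V2(1) V2(3) V1(3) assms(2)] by simp
 have c2: "rs 1 V V2 c \<in> C 1 V2" using om_res[OF omJ assms(1) V2(1) _ assms(2)] V2(3) V1(3) by blast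
 have "d 0 V2 ?j = sb 1 V2 (rs 1 V V2 c) (z 1 V2)" using hom_sub[OF omJ hom_d(3) V2(1) rj m(1)] dj m(2) by simp
 also have "\<dots> = rs 1 V V2 c" using om_sub_eq[OF omJ V2(1) c2 om_zero[OF omJ V2(1)] c2] om_zero_left[OF omJ V2(1) c2] by simp
 finally have "d 0 V2 ?j = rs 1 V V2 c" .
 moreover have "s 0 V2 ?j = on_set V2 g"
  using s_sub[OF V2(1) rj m(1)] s_res(1)[OF V1(1) V2(1,3) j(1)] m(3) V2(3) by (auto simp: n_def osf)
 moreover have "?j \<in> C 0 V2" by (rule om_sub[OF omJ V2(1) rj m(1)])
 ultimately show ?thesis using V2 V1(3) by (intro exI[of _ V2] exI[of _ ?j]) auto
qed

lemma surj_1: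
 assumes "open V" "g \<in> qsec pt V" "x \<in> V"
 shows "\<exists>V' m h. open V' \<and> x \<in> V' \<and> V' \<subseteq> V \<and> m \<in> C 1 V' \<and> d 1 V' m = z 2 V' \<and> h \<in> regular_on V' \<and>
  on_set V' g = (\<lambda>y. s 1 V' m y + on_set (line0 - {pt}) h y)"
proof -
 have cy: "g \<in> cycles (Ip a) 1 V" using assms(2) by (simp add: cycles_def I_obj I_diff)
 from qi_surj[OF assms(1,3) cy] obtain V' m b where V': "open V'" "x \<in> V'" "V' \<subseteq> V" and m: "m \<in> cycles J 1 V'"
  and b: "b \<in> boundaries (Ip a) 1 V'"
   "res (obj (Ip a) 1) V V' g = s 1 V' m \<oplus>\<^bsub>sec (obj (Ip a) 1) V'\<^esub> b" by (elim exE conjE bexE)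
 obtain h where "h \<in> regular_on V'" "b = on_set (line0 - {pt}) h" using b(1) by (auto simp: boundaries_def I_diff I_obj)
 thus ?thesis using V' m b(2) by (intro exI[of _ V'] exI[of _ m] exI[of _ h]) (simp add: cycles_def I_obj)
qed

end

lemma on_set_out: "x \<notin> A ==> on_set A f x = 0"
 by (simp add: on_set_def)

lemma open_tw_nonzero:
 assumes "f \<in> tw n U" "open U" shows "open {x \<in> U. f x \<noteq> 0}"
proof (subst open_subopen, intro ballI)
 fix x assume x: "x \<in> {x \<in> U. f x \<noteq> 0}"
 hence "x \<in> U" by simp
 from tw_fraction_open[OF assms this] obtain V d e P S where V: "open V" "x \<in> V" "V \<subseteq> U" "homog_poly d P"
  and f: "\<forall>y\<in>V. S (rep y) \<noteq> 0 \<and> f y = P (rep y) / S (rep y)" by (elim exE conjE)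
 show "\<exists>T. open T \<and> x \<in> T \<and> T \<subseteq> {x \<in> U. f x \<noteq> 0}"
  by (rule exI[of _ "V \<inter> {y. P (rep y) \<noteq> 0}"], intro conjI open_Int V open_form_nonzero[OF V(4)]) (use V f x in auto)
qed

lemma om_sub_sub:
 assumes F: "O_module F" and U: "open U" and m: "p \<in> car F U" "q \<in> car F U" "r \<in> car F U"
 shows "sub F U (sub F U p q) (sub F U p r) = sub F U r q"
proof (subst om_sub_eq[OF F U])
 have s: "sub F U p q \<in> car F U" "sub F U p r \<in> car F U" "sub F U r q \<in> car F U"
  by (intro om_sub F U m)+
 thus "sub F U p q \<in> car F U" "sub F U p r \<in> car F U" "sub F U r q \<in> car F U" .
 have "q \<boxplus>[F,U] (sub F U p r \<boxplus>[F,U] sub F U r q) = sub F U p r \<boxplus>[F,U] r"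
  using om_lcomm[OF F U m(2) s(2,3)] om_sub_add[OF F U m(3,2)] by simp
 also have "\<dots> = p" using om_comm[OF F U s(2) m(3)] om_sub_add[OF F U m(1,3)] by simp
 finally show "sub F U p q = sub F U p r \<boxplus>[F,U] sub F U r q"
  by (subst om_sub_eq[OF F U m(1,2)]) (simp_all add: om_add[OF F U] s)
qed

context resolved begin

definition cmb :: "proj3 set => fn => fn => fn => fn => fn" where
 "cmb V f m g n = ad 0 V (sm 0 V f m) (sm 0 V g n)"

context
 fixes V f g m n
 assumes V: "open V" and fg: "f \<in> regular_on V" "g \<in> regular_on V" and mn: "m \<in> C 0 V" "n \<in> C 0 V"
begin

lemma cmb_closed: "cmb V f m g n \<in> C 0 V"
 unfolding cmb_def by (intro om_add om_smult omJ V fg mn)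

lemma cmb_res: "open V' ==> V' \<subseteq> V ==> rs 0 V V' (cmb V f m g n) = cmb V' (on_set V' f) (rs 0 V V' m) (on_set V' g) (rs 0 V V' n)"
 unfolding cmb_def using V fg mn by (simp add: om_res_add[OF omJ] om_res_smult[OF omJ] om_smult[OF omJ])

lemma s_cmb: "s 0 V (cmb V f m g n) = (\<lambda>y. f y * s 0 V m y + g y * s 0 V n y)"
 unfolding cmb_def using V fg mn by (simp add: s_add s_smult om_smult[OF omJ])

lemma d_cmb: "d 0 V (cmb V f m g n) = ad 1 V (sm 1 V f (d 0 V m)) (sm 1 V g (d 0 V n))"
 unfolding cmb_def using V fg mn by (simp add: hom_add[OF hom_d(3)] hom_smult[OF hom_d(3)] om_smult[OF omJ])

lemma d_cmb_cycles: "d 0 V m = z 1 V ==> d 0 V n = z 1 V ==> d 0 V (cmb V f m g n) = z 1 V"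
 using V fg by (simp add: d_cmb om_smult_zero[OF omJ] om_zero[OF omJ] om_zero_left[OF omJ])

end

text \<open>Injectivity on cohomology in degree 0, applied to the difference, which is a cycle with
  image 0.\<close>

lemma differ_by_boundary:
 assumes "open V" "m \<in> C 0 V" "n \<in> C 0 V" "d 0 V m = d 0 V n" "s 0 V m = s 0 V n" "x \<in> V"
 shows "\<exists>V' t. open V' \<and> x \<in> V' \<and> V' \<subseteq> V \<and> t \<in> C (-1) V' \<and> rs 0 V V' n = ad 0 V' (rs 0 V V' m) (d (-1) V' t)"
proof -
 have k: "sb 0 V n m \<in> C 0 V" by (rule om_sub[OF omJ assms(1,3,2)])
 have "d 0 V m \<in> C 1 V" by (rule hom_closed[OF hom_d(3) assms(1,2)])
 hence "d 0 V (sb 0 V n m) = z 1 V"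
  using hom_sub[OF omJ hom_d(3) assms(1,3,2)] assms(4) om_sub_self[OF omJ assms(1)] by simp
 moreover have "s 0 V (sb 0 V n m) = (\<lambda>_. 0)" using s_sub[OF assms(1,3,2)] assms(5) by simp
 ultimately obtain V' t where V': "open V'" "x \<in> V'" "V' \<subseteq> V" and t: "t \<in> C (-1) V'" "d (-1) V' t = rs 0 V V' (sb 0 V n m)"
  using exact_0[OF assms(1) k _ _ assms(6)] by blast
 have mn: "rs 0 V V' m \<in> C 0 V'" "rs 0 V V' n \<in> C 0 V'" by (intro om_res[OF omJ] assms V')+
 have "sb 0 V' (rs 0 V V' n) (rs 0 V V' m) = d (-1) V' t" using t(2) om_res_sub[OF omJ assms(1) V'(1,3) assms(3,2)] by simp
 hence "rs 0 V V' n = ad 0 V' (rs 0 V V' m) (d (-1) V' t)"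
  using om_sub_eq[OF omJ V'(1) mn(2,1) hom_closed[OF hom_d(2) V'(1) t(1)]] by simp
 thus ?thesis using V' t(1) by blast
qed

text \<open>The lifts x (\<open>i = 2\<close>) and y (\<open>i = 3\<close>) of the overview.\<close>

definition bcyc :: "4 => proj3 set => fn => bool" where
 "bcyc i V w \<longleftrightarrow> open V \<and> V \<subseteq> Db \<and> w \<in> C 0 V \<and> d 0 V w = z 1 V \<and> s 0 V w = ratio i b V"

lemma bcycD: "bcyc i V w ==> open V" "bcyc i V w ==> V \<subseteq> Db" "bcyc i V w ==> w \<in> C 0 V"
 "bcyc i V w ==> d 0 V w = z 1 V" "bcyc i V w ==> s 0 V w = ratio i b V"
 by (simp_all add: bcyc_def)

lemma d_res_cycle:
 assumes "open V" "open V'" "V' \<subseteq> V" "w \<in> C 0 V" "d 0 V w = z 1 V" shows "d 0 V' (rs 0 V V' w) = z 1 V'"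
 using hom_res[OF hom_d(3) assms(1-4)] assms om_res_zero[OF omJ assms(1-3)] by simp

lemma bcyc_res: "bcyc i V w ==> open V' ==> V' \<subseteq> V ==> bcyc i V' (rs 0 V V' w)"
 unfolding bcyc_def by (auto simp: om_res[OF omJ] d_res_cycle s_res ratio_restrict)

lemma ex_bcyc:
 assumes "open V" "V \<subseteq> Db" "x \<in> V" "i = 2 \<or> i = 3"
 shows "\<exists>V' w. x \<in> V' \<and> V' \<subseteq> V \<and> bcyc i V' w"
proof -
 have "\<forall>y\<in> onp V. ratio i b V y = 0" using assms(4) by (auto simp: ratio_def mem_line0)
 from surj_0[OF assms(1) ratio_regular[OF assms(2)] this assms(3)] obtain V' m where
  "open V'" "x \<in> V'" "V' \<subseteq> V" "m \<in> C 0 V'" "d 0 V' m = z 1 V'" "s 0 V' m = on_set V' (ratio i b V)" by (elim exE conjE)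
 thus ?thesis using assms(2) by (intro exI[of _ V'] exI[of _ m]) (auto simp: bcyc_def ratio_restrict)
qed

text \<open>The relation Y X = X Y between the two generators makes Y x - X y a cycle with image 0;
  \<open>e\<close> is a cochain that it bounds, the e of the overview.\<close>

definition b_datum where
 "b_datum V zX zY e \<longleftrightarrow> bcyc 2 V zX \<and> bcyc 3 V zY \<and> e \<in> C (-1) V \<and>
  d (-1) V e = sb 0 V (sm 0 V (ratio 3 b V) zX) (sm 0 V (ratio 2 b V) zY)"

lemma ex_b_datum_over:
 assumes X: "bcyc 2 V zX" and Y: "bcyc 3 V zY" and x: "x \<in> V"
 shows "\<exists>V' e. x \<in> V' \<and> V' \<subseteq> V \<and> b_datum V' (rs 0 V V' zX) (rs 0 V V' zY) e"
proof -
 note V = bcycD(1)[OF X] bcycD(2)[OF X]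
 note r = ratio_regular[OF V(2)]
 let ?w = "sb 0 V (sm 0 V (ratio 3 b V) zX) (sm 0 V (ratio 2 b V) zY)"
 have c: "sm 0 V (ratio 3 b V) zX \<in> C 0 V" "sm 0 V (ratio 2 b V) zY \<in> C 0 V"
  by (intro om_smult[OF omJ] V r bcycD[OF X] bcycD[OF Y])+
 have "d 0 V ?w = sb 1 V (z 1 V) (z 1 V)"
  by (simp add: hom_sub[OF omJ hom_d(3) V(1) c] hom_smult[OF hom_d(3) V(1) r] bcycD[OF X] bcycD[OF Y] om_smult_zero[OF omJ V(1) r])
 hence "d 0 V ?w = z 1 V" using om_sub_self[OF omJ V(1) om_zero[OF omJ V(1)]] by simp
 moreover have "s 0 V ?w = (\<lambda>_. 0)"
  by (simp add: s_sub[OF V(1) c] s_smult[OF V(1) r] bcycD[OF X] bcycD[OF Y] mult.commute)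
 ultimately obtain V' e where V': "open V'" "x \<in> V'" "V' \<subseteq> V" "e \<in> C (-1) V'" "d (-1) V' e = rs 0 V V' ?w"
  using exact_0[OF V(1) om_sub[OF omJ V(1) c] _ _ x] by blast
 have "rs 0 V V' ?w = sb 0 V' (sm 0 V' (ratio 3 b V') (rs 0 V V' zX)) (sm 0 V' (ratio 2 b V') (rs 0 V V' zY))"
  by (simp add: om_res_sub[OF omJ V(1) V'(1,3) c] om_res_smult[OF omJ V(1) V'(1,3) r] bcycD[OF X] bcycD[OF Y] ratio_restrict V'(3))
 thus ?thesis using V' bcyc_res[OF X V'(1,3)] bcyc_res[OF Y V'(1,3)]
  by (intro exI[of _ V'] exI[of _ e]) (simp add: b_datum_def)
qed

lemma ex_b_datum:
 assumes "open V" "V \<subseteq> Db" "x \<in> V"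
 shows "\<exists>V' zX zY e. x \<in> V' \<and> V' \<subseteq> V \<and> b_datum V' zX zY e"
proof -
 obtain V1 zX where 1: "x \<in> V1" "V1 \<subseteq> V" "bcyc 2 V1 zX" using ex_bcyc[OF assms, of 2] by blast
 obtain V2 zY where 2: "x \<in> V2" "V2 \<subseteq> V1" "bcyc 3 V2 zY" using ex_bcyc[OF bcycD(1,2)[OF 1(3)] 1(1), of 3] by blast
 obtain V3 e where "x \<in> V3" "V3 \<subseteq> V2" "b_datum V3 (rs 0 V2 V3 (rs 0 V1 V2 zX)) (rs 0 V2 V3 zY) e"
  using ex_b_datum_over[OF bcyc_res[OF 1(3) bcycD(1)[OF 2(3)] 2(2)] 2(3,1)] by blast
 thus ?thesis using 1(2) 2(2) by blast
qed

text \<open>The image of \<open>w\<close> vanishes on the line, hence is \<alpha> X + \<beta> Y; the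
  same combination of the lifts has the same image, and the difference is a boundary.\<close>

lemma cycle_decomposition:
 assumes X: "bcyc 2 V zX" and Y: "bcyc 3 V zY" and x: "x \<in> V" and w: "w \<in> C 0 V" "d 0 V w = z 1 V"
 shows "\<exists>V' \<alpha> \<beta> t. open V' \<and> x \<in> V' \<and> V' \<subseteq> V \<and> \<alpha> \<in> regular_on V' \<and> \<beta> \<in> regular_on V' \<and> t \<in> C (-1) V' \<and>
  rs 0 V V' w = ad 0 V' (cmb V' \<alpha> (rs 0 V V' zX) \<beta> (rs 0 V V' zY)) (d (-1) V' t)"
proof -
 note V = bcycD(1)[OF X] bcycD(2)[OF X]
 have "on_set (line0 - {pt}) (s 0 V w) = s 1 V (z 1 V)" using s_d0[OF V(1) w(1)] w(2) by simp
 also have "\<dots> = (\<lambda>_. 0)" using hom_smult[OF hom_s(2) V(1) regular_zero om_zero[OF omJ V(1)]] om_smult_zero[OF omJ V(1) regular_zero] by simp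
 finally have e: "on_set (line0 - {pt}) (s 0 V w) = (\<lambda>_. 0)" .
 have "\<forall>y\<in> onl V. s 0 V w y = 0"
 proof
  fix y assume "y \<in> onl V"
  hence "y \<in> line0 - {pt}" using V(2) pt_Db by auto
  thus "s 0 V w y = 0" using fun_cong[OF e, of y] by simp
 qed
 from ideal_line0_ratio[OF s0_reg[OF V(1) w(1)] V x this] obtain V1 \<alpha> \<beta> where V1: "open V1" "x \<in> V1" "V1 \<subseteq> V"
  and ab: "\<alpha> \<in> regular_on V1" "\<beta> \<in> regular_on V1" "\<forall>y\<in>V1. s 0 V w y = \<alpha> y * ratio 2 b V1 y + \<beta> y * ratio 3 b V1 y" by (elim exE conjE)
 note X1 = bcyc_res[OF X V1(1,3)] and Y1 = bcyc_res[OF Y V1(1,3)]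
 note q = V1(1) ab(1,2) bcycD(3)[OF X1] bcycD(3)[OF Y1]
 have w1: "rs 0 V V1 w \<in> C 0 V1" by (intro om_res[OF omJ] V V1 w)
 have s1: "s 0 V1 (cmb V1 \<alpha> (rs 0 V V1 zX) \<beta> (rs 0 V V1 zY)) = s 0 V1 (rs 0 V V1 w)"
  using s_cmb[OF q] bcycD(5)[OF X1] bcycD(5)[OF Y1] ab(3) s_res(1)[OF V(1) V1(1,3) w(1)] regular_outside[OF ab(1)] regular_outside[OF ab(2)]
  by (auto simp: osf)
 have d1: "d 0 V1 (cmb V1 \<alpha> (rs 0 V V1 zX) \<beta> (rs 0 V V1 zY)) = d 0 V1 (rs 0 V V1 w)"
  using d_cmb_cycles[OF q bcycD(4)[OF X1] bcycD(4)[OF Y1]] d_res_cycle[OF V(1) V1(1,3) w] by simp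
 from differ_by_boundary[OF V1(1) cmb_closed[OF q] w1 d1 s1 V1(2)] obtain V' t where V': "open V'" "x \<in> V'" "V' \<subseteq> V1" "t \<in> C (-1) V'"
  and e: "rs 0 V1 V' (rs 0 V V1 w) = ad 0 V' (rs 0 V1 V' (cmb V1 \<alpha> (rs 0 V V1 zX) \<beta> (rs 0 V V1 zY))) (d (-1) V' t)" by (elim exE conjE)
 have rr: "rs 0 V1 V' (rs 0 V V1 u) = rs 0 V V' u" if "u \<in> C 0 V" for u
  by (rule om_res_res[OF omJ V(1) V1(1) V'(1,3) V1(3) that])
 have "rs 0 V V' w = ad 0 V' (cmb V' (on_set V' \<alpha>) (rs 0 V V' zX) (on_set V' \<beta>) (rs 0 V V' zY)) (d (-1) V' t)"
  using e cmb_res[OF q V'(1,3)] rr[OF w(1)] rr[OF bcycD(3)[OF X]] rr[OF bcycD(3)[OF Y]] by simp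
 thus ?thesis using V' V1(3) regular_restrict[OF ab(1) V'(3)] regular_restrict[OF ab(2) V'(3)]
  by (intro exI[of _ V'] exI[of _ "on_set V' \<alpha>"] exI[of _ "on_set V' \<beta>"] exI[of _ t]) auto
qed

text \<open>The cochains near the marked point. \<open>m1\<close> lifts the generator
  \<open>zc a / zc b\<close> of the sheaf of the pair, with its simple pole. The cohomology in
  degree 1 is killed by the equations of the point, which yields \<open>mX\<close>,
  \<open>mY\<close>, \<open>mW\<close>. The image of \<open>mW\<close> is 1 because
  \<open>zc b / zc a\<close> cancels the generator; those of \<open>mX\<close> and \<open>mY\<close>
  are 0 because \<open>zc 2\<close> and \<open>zc 3\<close> vanish on the line. \<open>E\<close>
  lifts the relation between \<open>mX\<close> and \<open>mY\<close>.\<close>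

definition p_datum where
 "p_datum N m1 mX mY mW E \<longleftrightarrow> open N \<and> pt \<in> N \<and> N \<subseteq> Da \<and> m1 \<in> C 1 N \<and> mX \<in> C 0 N \<and> mY \<in> C 0 N \<and> mW \<in> C 0 N \<and> E \<in> C (-1) N \<and>
  d 1 N m1 = z 2 N \<and> d 0 N mX = sm 1 N (ratio 2 a N) m1 \<and> d 0 N mY = sm 1 N (ratio 3 a N) m1 \<and> d 0 N mW = sm 1 N (ratio b a N) m1 \<and>
  s 1 N m1 = qfun N (zc a) \<and> s 0 N mX = (\<lambda>_. 0) \<and> s 0 N mY = (\<lambda>_. 0) \<and> s 0 N mW = on_set N (\<lambda>_. 1) \<and>
  d (-1) N E = sb 0 N (sm 0 N (ratio 2 a N) mY) (sm 0 N (ratio 3 a N) mX)"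

lemma qfun_restrict: "V \<subseteq> U ==> on_set V (qfun U G) = qfun V G"
 by (auto simp: qfun_def osf)

text \<open>Surjectivity in degree 1 reaches the generator only up to a regular function
  \<open>h\<close>. The image of the cochain found is the generator times
  \<open>u = 1 - (zc b / zc a) * h\<close>, which is 1 at the marked point; near it the cochain is
  divided by \<open>u\<close>.\<close>

lemma ex_generator:
 assumes "open U" "pt \<in> U"
 shows "\<exists>N m. open N \<and> pt \<in> N \<and> N \<subseteq> Da \<and> N \<subseteq> U \<and> m \<in> C 1 N \<and> d 1 N m = z 2 N \<and> s 1 N m = qfun N (zc a)"
proof -
 let ?U = "U \<inter> Da"
 have U: "open ?U" "pt \<in> ?U" using assms open_Da pt_Da by auto
 have "qfun ?U (zc a) = qfun ?U (on_set (onl ?U) (zc a))" by (auto simp: qfun_def osf)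
 hence "qfun ?U (zc a) \<in> qsec pt ?U" unfolding qsec_iff[OF U(1)] using tw_coord by blast
 from surj_1[OF U(1) this U(2)] obtain V m h where V: "open V" "pt \<in> V" "V \<subseteq> ?U" and m: "m \<in> C 1 V" "d 1 V m = z 2 V"
  and h: "h \<in> regular_on V" "on_set V (qfun ?U (zc a)) = (\<lambda>y. s 1 V m y + on_set (line0 - {pt}) h y)" by (elim exE conjE)
 have W: "ratio b a V \<in> regular_on V" by (rule ratio_regular) (use V in auto)
 define u where "u = (\<lambda>y. on_set V (\<lambda>_. 1) y - ratio b a V y * h y)"
 have u: "u \<in> regular_on V" unfolding u_def by (intro regular_diff regular_mult regular_const W h)
 define N where "N = {y \<in> V. u y \<noteq> 0}"
 have N: "open N" "N \<subseteq> V" unfolding N_def using open_tw_nonzero[OF u[unfolded regular_on_eq_tw] V(1)] by auto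
 have pN: "pt \<in> N" using V(2) zc_pt(2)[of b] ab_distinct by (simp add: N_def u_def ratio_def)
 define v where "v = (\<lambda>y. on_set N (\<lambda>_. 1) y / on_set N u y)"
 have v: "v \<in> regular_on N" unfolding v_def
  by (rule regular_divide[OF tw_const tw_restrict[OF u[unfolded regular_on_eq_tw] N(2)]]) (simp add: N_def)
 have mN: "rs 1 V N m \<in> C 1 N" by (intro om_res[OF omJ] V N m)
 have sN: "s 1 N (rs 1 V N m) = on_set N (s 1 V m)" by (rule s_res(2)[OF V(1) N m(1)])
 have key: "v y * on_set N (s 1 V m) y = qfun N (zc a) y" for y
 proof (cases "y \<in> onp N")
  case True
  hence y: "y \<in> V" "u y \<noteq> 0" "zc b y \<noteq> 0" "zc a y \<noteq> 0" using line0_Db V(3) by (auto simp: N_def)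
  have "qfun ?U (zc a) y = s 1 V m y + h y" using fun_cong[OF h(2), of y] True y by simp
  moreover have "qfun ?U (zc a) y = zc a y / zc b y" using True y V(3) by (auto simp: qfun_def on_set_def)
  ultimately have "s 1 V m y = zc a y / zc b y - h y" by simp
  moreover have "u y = 1 - zc b y / zc a y * h y" using y(1) by (simp add: u_def ratio_def)
  moreover have "zc a y / zc b y * (1 - zc b y / zc a y * h y) = zc a y / zc b y - h y" using y(3,4) by (simp add: right_diff_distrib)
  ultimately have sy: "s 1 V m y = zc a y / zc b y * u y" by simp
  have "v y = 1 / u y" using True by (simp add: v_def)
  hence "v y * s 1 V m y = zc a y / zc b y" unfolding sy using y(2) by simp
  thus ?thesis using True by (simp add: qfun_def)
 next
  case False
  have "s 1 N (rs 1 V N m) \<in> qsec pt N" by (rule s1_qsec[OF N(1) mN])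
  hence "on_set N (s 1 V m) y = 0" using False sN by (simp add: qsec_def)
  moreover have "qfun N (zc a) y = 0" unfolding qfun_def by (rule on_set_out[OF False])
  ultimately show ?thesis by simp
 qed
 have dN: "d 1 N (rs 1 V N m) = z 2 N" using hom_res[OF hom_d(4) V(1) N m(1)] m(2) om_res_zero[OF omJ V(1) N] by simp
 have "d 1 N (sm 1 N v (rs 1 V N m)) = z 2 N"
  using hom_smult[OF hom_d(4) N(1) v mN] dN om_smult_zero[OF omJ N(1) v] by simp
 moreover have "s 1 N (sm 1 N v (rs 1 V N m)) = qfun N (zc a)"
  using s_smult(2)[OF N(1) v mN] sN key by (simp add: fun_eq_iff)
 moreover have "sm 1 N v (rs 1 V N m) \<in> C 1 N" by (rule om_smult[OF omJ N(1) v mN])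
 moreover have "N \<subseteq> Da" "N \<subseteq> U" using N(2) V(3) by auto
 ultimately show ?thesis using N(1) pN by blast
qed

text \<open>The condition on \<open>f\<close> and \<open>g\<close> says that \<open>f\<close> times
  the generator is the restriction of \<open>g\<close> to the punctured line, so
  \<open>lift_boundary\<close> applies with the image \<open>g\<close>.\<close>

lemma lift_multiple:
 assumes N: "open N" "pt \<in> N" "N \<subseteq> Da" and m: "m \<in> C 1 N" "d 1 N m = z 2 N" "s 1 N m = qfun N (zc a)"
  and fg: "f \<in> regular_on N" "g \<in> regular_on N" "\<forall>y\<in> onp N. f y * zc a y = g y * zc b y"
 shows "\<exists>V j. open V \<and> pt \<in> V \<and> V \<subseteq> N \<and> j \<in> C 0 V \<and> d 0 V j = sm 1 V (on_set V f) (rs 1 N V m) \<and> s 0 V j = on_set V g"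
proof -
 have c: "sm 1 N f m \<in> C 1 N" by (rule om_smult[OF omJ N(1) fg(1) m(1)])
 have "d 1 N (sm 1 N f m) = z 2 N" using hom_smult[OF hom_d(4) N(1) fg(1) m(1)] m(2) om_smult_zero[OF omJ N(1) fg(1)] by simp
 moreover have "s 1 N (sm 1 N f m) = on_set (line0 - {pt}) g"
 proof
  fix y show "s 1 N (sm 1 N f m) y = on_set (line0 - {pt}) g y"
  proof (cases "y \<in> onp N")
   case True
   hence "zc b y \<noteq> 0" using line0_Db by auto
   thus ?thesis using bspec[OF fg(3) True] True s_smult(2)[OF N(1) fg(1) m(1)] m(3) by (simp add: qfun_def field_simps)
  next
   case False
   have "qfun N (zc a) y = 0" unfolding qfun_def by (rule on_set_out[OF False])
   moreover have "on_set (line0 - {pt}) g y = 0" using False regular_outside[OF fg(2), of y] by (cases "y \<in> line0 - {pt}") (auto simp: on_set_out)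
   ultimately show ?thesis using s_smult(2)[OF N(1) fg(1) m(1)] m(3) by simp
  qed
 qed
 ultimately obtain V j where V: "open V" "pt \<in> V" "V \<subseteq> N" "j \<in> C 0 V" "d 0 V j = rs 1 N V (sm 1 N f m)" "s 0 V j = on_set V g"
  using lift_boundary[OF N(1) c _ fg(2) _ N(2)] by blast
 thus ?thesis using om_res_smult[OF omJ N(1) V(1,3) fg(1) m(1)] by auto
qed

lemma ex_p_datum:
 assumes "open U" "pt \<in> U"
 shows "\<exists>N m1 mX mY mW E. N \<subseteq> U \<and> p_datum N m1 mX mY mW E"
proof -
 obtain N m where N: "open N" "pt \<in> N" "N \<subseteq> Da" and NU: "N \<subseteq> U" and m: "m \<in> C 1 N" "d 1 N m = z 2 N" "s 1 N m = qfun N (zc a)"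
  using ex_generator[OF assms] by (elim exE conjE)
 note r = ratio_regular[OF N(3)]
 obtain V1 x where 1: "open V1" "pt \<in> V1" "V1 \<subseteq> N" "x \<in> C 0 V1" "d 0 V1 x = sm 1 V1 (on_set V1 (ratio 2 a N)) (rs 1 N V1 m)" "s 0 V1 x = on_set V1 (\<lambda>_. 0)"
  using lift_multiple[OF N m r regular_zero, of 2] by (auto simp: ratio_def mem_line0)
 obtain V2 y where 2: "open V2" "pt \<in> V2" "V2 \<subseteq> N" "y \<in> C 0 V2" "d 0 V2 y = sm 1 V2 (on_set V2 (ratio 3 a N)) (rs 1 N V2 m)" "s 0 V2 y = on_set V2 (\<lambda>_. 0)"
  using lift_multiple[OF N m r regular_zero, of 3] by (auto simp: ratio_def mem_line0)
 have "\<forall>u\<in> onp N. ratio b a N u * zc a u = on_set N (\<lambda>_. 1) u * zc b u"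
  using N(3) by (auto simp: ratio_def)
 from lift_multiple[OF N m r regular_const this]
 obtain V3 w where 3: "open V3" "pt \<in> V3" "V3 \<subseteq> N" "w \<in> C 0 V3" "d 0 V3 w = sm 1 V3 (on_set V3 (ratio b a N)) (rs 1 N V3 m)" "s 0 V3 w = on_set V3 (on_set N (\<lambda>_. 1))"
  by (elim exE conjE)
 define V where "V = V1 \<inter> V2 \<inter> V3"
 have V: "open V" "pt \<in> V" "V \<subseteq> V1" "V \<subseteq> V2" "V \<subseteq> V3" "V \<subseteq> N" using 1 2 3 by (auto simp: V_def)
 have VDa: "V \<subseteq> Da" using V N by blast
 note rV = ratio_regular[OF VDa]
 have tr: "d 0 V (rs 0 W V u) = sm 1 V (ratio i a V) (rs 1 N V m)"
  if "open W" "V \<subseteq> W" "W \<subseteq> N" "u \<in> C 0 W" "d 0 W u = sm 1 W (on_set W (ratio i a N)) (rs 1 N W m)" for W u i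
 proof -
  have mW: "rs 1 N W m \<in> C 1 W" by (intro om_res[OF omJ] N that m)
  have "d 0 V (rs 0 W V u) = rs 1 W V (sm 1 W (on_set W (ratio i a N)) (rs 1 N W m))"
   using hom_res[OF hom_d(3) that(1) V(1) that(2,4)] that(5) by simp
  also have "\<dots> = sm 1 V (on_set V (on_set W (ratio i a N))) (rs 1 W V (rs 1 N W m))"
   by (rule om_res_smult[OF omJ that(1) V(1) that(2) regular_restrict[OF r that(3)] mW])
  also have "rs 1 W V (rs 1 N W m) = rs 1 N V m" by (rule om_res_res[OF omJ N(1) that(1) V(1) that(2,3) m(1)])
  also have "on_set V (on_set W (ratio i a N)) = ratio i a V" using that V by (simp add: on_set_subset ratio_restrict)
  finally show ?thesis .
 qed
 let ?x = "rs 0 V1 V x" and ?y = "rs 0 V2 V y" and ?w = "rs 0 V3 V w" and ?m = "rs 1 N V m"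
 have cl: "?x \<in> C 0 V" "?y \<in> C 0 V" "?w \<in> C 0 V" "?m \<in> C 1 V" by (intro om_res[OF omJ] V 1 2 3 N m)+
 have dV: "d 0 V ?x = sm 1 V (ratio 2 a V) ?m" "d 0 V ?y = sm 1 V (ratio 3 a V) ?m" "d 0 V ?w = sm 1 V (ratio b a V) ?m"
  by (rule tr[OF 1(1) V(3) 1(3,4,5)], rule tr[OF 2(1) V(4) 2(3,4,5)], rule tr[OF 3(1) V(5) 3(3,4,5)])
 have sV: "s 0 V ?x = (\<lambda>_. 0)" "s 0 V ?y = (\<lambda>_. 0)" "s 0 V ?w = on_set V (\<lambda>_. 1)"
  using s_res(1)[OF 1(1) V(1,3) 1(4)] s_res(1)[OF 2(1) V(1,4) 2(4)] s_res(1)[OF 3(1) V(1,5) 3(4)] 1(6) 2(6) 3(6) V(5,6) 3(3)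
  by (auto simp: osf)
 have mV: "d 1 V ?m = z 2 V" "s 1 V ?m = qfun V (zc a)"
  using hom_res[OF hom_d(4) N(1) V(1,6) m(1)] m(2) om_res_zero[OF omJ N(1) V(1,6)]
   s_res(2)[OF N(1) V(1,6) m(1)] m(3) qfun_restrict[OF V(6)] by simp_all
 let ?X = "ratio 2 a V" and ?Y = "ratio 3 a V"
 have c: "sm 0 V ?X ?y \<in> C 0 V" "sm 0 V ?Y ?x \<in> C 0 V" by (intro om_smult[OF omJ] V rV cl)+
 \<comment> \<open>Both terms have the boundary \<open>?X * ?Y\<close> times the generator, so their
   difference is a cycle; its image is 0.\<close>
 let ?k = "sb 0 V (sm 0 V ?X ?y) (sm 0 V ?Y ?x)"
 have "d 0 V ?k = sb 1 V (sm 1 V (\<lambda>u. ?X u * ?Y u) ?m) (sm 1 V (\<lambda>u. ?X u * ?Y u) ?m)"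
  by (simp add: hom_sub[OF omJ hom_d(3) V(1) c] hom_smult[OF hom_d(3) V(1) rV] cl dV om_smult_smult[OF omJ V(1) rV rV cl(4)] mult.commute)
 also have "\<dots> = z 1 V" by (intro om_sub_self[OF omJ] om_smult[OF omJ] V regular_mult rV cl)
 finally have "d 0 V ?k = z 1 V" .
 moreover have "s 0 V ?k = (\<lambda>_. 0)" by (simp add: s_sub[OF V(1) c] s_smult[OF V(1) rV] cl sV)
 ultimately obtain V' E where V': "open V'" "pt \<in> V'" "V' \<subseteq> V" and E: "E \<in> C (-1) V'" "d (-1) V' E = rs 0 V V' ?k"
  using exact_0[OF V(1) om_sub[OF omJ V(1) c] _ _ V(2)] by blast
 let ?x' = "rs 0 V V' ?x" and ?y' = "rs 0 V V' ?y" and ?w' = "rs 0 V V' ?w" and ?m' = "rs 1 V V' ?m"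
 have dE: "d (-1) V' E = sb 0 V' (sm 0 V' (ratio 2 a V') ?y') (sm 0 V' (ratio 3 a V') ?x')"
  unfolding E(2) by (simp add: om_res_sub[OF omJ V(1) V'(1,3) c] om_res_smult[OF omJ V(1) V'(1,3) rV] cl ratio_restrict[OF V'(3)])
 have cl': "?x' \<in> C 0 V'" "?y' \<in> C 0 V'" "?w' \<in> C 0 V'" "?m' \<in> C 1 V'" by (intro om_res[OF omJ] V V' cl)+
 have "p_datum V' ?m' ?x' ?y' ?w' E"
  unfolding p_datum_def
 proof (intro conjI)
  show "V' \<subseteq> Da" using V'(3) VDa by blast
  show "d 1 V' ?m' = z 2 V'" using hom_res[OF hom_d(4) V(1) V'(1,3) cl(4)] mV(1) om_res_zero[OF omJ V(1) V'(1,3)] by simp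
  show "d 0 V' ?x' = sm 1 V' (ratio 2 a V') ?m'" "d 0 V' ?y' = sm 1 V' (ratio 3 a V') ?m'" "d 0 V' ?w' = sm 1 V' (ratio b a V') ?m'"
   by (simp_all add: hom_res[OF hom_d(3) V(1) V'(1,3)] cl dV om_res_smult[OF omJ V(1) V'(1,3) rV cl(4)] ratio_restrict[OF V'(3)])
  show "s 1 V' ?m' = qfun V' (zc a)" using s_res(2)[OF V(1) V'(1,3) cl(4)] mV(2) qfun_restrict[OF V'(3)] by simp
  show "s 0 V' ?x' = (\<lambda>_. 0)" "s 0 V' ?y' = (\<lambda>_. 0)" "s 0 V' ?w' = on_set V' (\<lambda>_. 1)"
   using s_res(1)[OF V(1) V'(1,3)] cl sV V'(3) by (auto simp: osf)
 qed (use V' E cl' dE in auto)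
 moreover have "V' \<subseteq> U" using V'(3) V(6) NU by blast
 ultimately show ?thesis by blast
qed

end

lemma om_sub_add_add:
 assumes F: "O_module F" and U: "open U" and m: "p \<in> car F U" "q \<in> car F U" "r \<in> car F U" "t \<in> car F U"
 shows "sub F U (p \<boxplus>[F,U] q) (r \<boxplus>[F,U] t) = sub F U p r \<boxplus>[F,U] sub F U q t"
proof -
 have s: "sub F U p r \<in> car F U" "sub F U q t \<in> car F U" by (intro om_sub F U m)+
 have "(r \<boxplus>[F,U] t) \<boxplus>[F,U] (sub F U p r \<boxplus>[F,U] sub F U q t)
   = (r \<boxplus>[F,U] sub F U p r) \<boxplus>[F,U] (t \<boxplus>[F,U] sub F U q t)"
  using m s by (simp add: om_assoc[OF F U] om_lcomm[OF F U] om_add[OF F U])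
 also have "\<dots> = p \<boxplus>[F,U] q" using om_sub_add[OF F U] m by simp
 finally show ?thesis by (subst om_sub_eq[OF F U]) (simp_all add: om_add[OF F U] m s)
qed

context resolved begin

text \<open>For \<open>m\<close> one of \<open>mX\<close>, \<open>mY\<close>, both terms have the
  boundary \<open>zc i / zc a\<close> times \<open>m1\<close>, so the difference is a cycle, with
  image \<open>zc i / zc b\<close>: the data at the marked point produce the lifts x and y over the
  part of \<open>N\<close> inside \<open>Db\<close>.\<close>

definition pz :: "4 => proj3 set => proj3 set => fn => fn => fn" where
 "pz i N V mW m = sb 0 V (sm 0 V (ratio i b V) (rs 0 N V mW)) (rs 0 N V m)"

lemma p_datumD:
 assumes "p_datum N m1 mX mY mW E"
 shows "open N" "pt \<in> N" "N \<subseteq> Da" "m1 \<in> C 1 N" "mX \<in> C 0 N" "mY \<in> C 0 N" "mW \<in> C 0 N" "E \<in> C (-1) N"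
  "d 1 N m1 = z 2 N" "d 0 N mX = sm 1 N (ratio 2 a N) m1" "d 0 N mY = sm 1 N (ratio 3 a N) m1" "d 0 N mW = sm 1 N (ratio b a N) m1"
  "s 1 N m1 = qfun N (zc a)" "s 0 N mX = (\<lambda>_. 0)" "s 0 N mY = (\<lambda>_. 0)" "s 0 N mW = on_set N (\<lambda>_. 1)"
  "d (-1) N E = sb 0 N (sm 0 N (ratio 2 a N) mY) (sm 0 N (ratio 3 a N) mX)"
 using assms by (simp_all add: p_datum_def)

context
 fixes N m1 mW V
 assumes N: "open N" "N \<subseteq> Da" and mW: "mW \<in> C 0 N" "d 0 N mW = sm 1 N (ratio b a N) m1" "s 0 N mW = on_set N (\<lambda>_. 1)"
  and m1: "m1 \<in> C 1 N"
  and V: "open V" "V \<subseteq> N" "V \<subseteq> Db"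
begin

lemma pz_closed: "m \<in> C 0 N ==> pz i N V mW m \<in> C 0 V"
 unfolding pz_def by (intro om_sub[OF omJ] om_smult[OF omJ] om_res[OF omJ] V N mW ratio_regular)

lemma d_res_multiple:
 assumes "m \<in> C 0 N" "d 0 N m = sm 1 N (ratio i a N) m1"
 shows "d 0 V (rs 0 N V m) = sm 1 V (ratio i a V) (rs 1 N V m1)"
 using hom_res[OF hom_d(3) N(1) V(1,2) assms(1)] assms(2) om_res_smult[OF omJ N(1) V(1,2) ratio_regular[OF N(2)] m1]
 by (simp add: ratio_restrict V(2))

lemma bcyc_pz:
 assumes m: "m \<in> C 0 N" "d 0 N m = sm 1 N (ratio i a N) m1" "s 0 N m = (\<lambda>_. 0)"
 shows "bcyc i V (pz i N V mW m)"
proof -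
 note rb = ratio_regular[OF V(3)] and ra = ratio_regular[OF order_trans[OF V(2) N(2)]]
 have rm: "rs 0 N V mW \<in> C 0 V" "rs 0 N V m \<in> C 0 V" "rs 1 N V m1 \<in> C 1 V" by (intro om_res[OF omJ] V N mW m m1)+
 have k: "sm 0 V (ratio i b V) (rs 0 N V mW) \<in> C 0 V" by (rule om_smult[OF omJ V(1) rb rm(1)])
 have "(\<lambda>y. ratio i b V y * ratio b a V y) = ratio i a V"
  using V(2,3) N(2) by (auto simp: ratio_def osf)
 hence "d 0 V (pz i N V mW m) = sb 1 V (sm 1 V (ratio i a V) (rs 1 N V m1)) (sm 1 V (ratio i a V) (rs 1 N V m1))"
  unfolding pz_def
  by (simp add: hom_sub[OF omJ hom_d(3) V(1) k rm(2)] hom_smult[OF hom_d(3) V(1) rb rm(1)] d_res_multiple[OF mW(1,2)] d_res_multiple[OF m(1,2)]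
   om_smult_smult[OF omJ V(1) rb ra rm(3)])
 also have "\<dots> = z 1 V" by (intro om_sub_self[OF omJ] om_smult[OF omJ] V ra rm)
 finally have "d 0 V (pz i N V mW m) = z 1 V" .
 have "s 0 V (pz i N V mW m) = (\<lambda>y. ratio i b V y * on_set V (on_set N (\<lambda>_. 1)) y - on_set V (\<lambda>_. 0) y)"
  unfolding pz_def
  by (simp add: s_sub[OF V(1) k rm(2)] s_smult(1)[OF V(1) rb rm(1)] s_res(1)[OF N(1) V(1,2)] mW(1,3) m(1,3))
 hence "s 0 V (pz i N V mW m) = ratio i b V" using V(2) by (auto simp: ratio_def osf)
 thus ?thesis unfolding bcyc_def using \<open>d 0 V (pz i N V mW m) = z 1 V\<close> V pz_closed[OF m(1)] by simp
qed

end

text \<open>In Y x - X y the terms with \<open>mW\<close> cancel and X \<open>mY\<close> - Y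
  \<open>mX\<close> remains. As X and Y are \<open>zc a / zc b\<close> times the fractions with
  denominator \<open>zc a\<close>, this is the boundary of \<open>zc a / zc b\<close> times
  \<open>E\<close>.\<close>

lemma b_datum_of_p_datum:
 assumes p: "p_datum N m1 mX mY mW E" and V: "open V" "V \<subseteq> N" "V \<subseteq> Db"
 shows "b_datum V (pz 2 N V mW mX) (pz 3 N V mW mY) (sm (-1) V (ratio a b V) (rs (-1) N V E))"
proof -
 note P = p_datumD[OF p]
 note rb = ratio_regular[OF V(3)] and ra = ratio_regular[OF order_trans[OF V(2) P(3)]]
 let ?W = "rs 0 N V mW" and ?x = "rs 0 N V mX" and ?y = "rs 0 N V mY" and ?E = "rs (-1) N V E"
 have cl: "?W \<in> C 0 V" "?x \<in> C 0 V" "?y \<in> C 0 V" "?E \<in> C (-1) V" by (intro om_res[OF omJ] V P)+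
 let ?X = "ratio 2 b V" and ?Y = "ratio 3 b V"
 have c: "sm 0 V ?X ?W \<in> C 0 V" "sm 0 V ?Y ?W \<in> C 0 V" "sm 0 V ?X ?y \<in> C 0 V" "sm 0 V ?Y ?x \<in> C 0 V"
  by (intro om_smult[OF omJ] V rb cl)+
 have ca: "sm 0 V (ratio 2 a V) ?y \<in> C 0 V" "sm 0 V (ratio 3 a V) ?x \<in> C 0 V" "sm 0 N (ratio 2 a N) mY \<in> C 0 N" "sm 0 N (ratio 3 a N) mX \<in> C 0 N"
  by (intro om_smult[OF omJ] V ra cl P ratio_regular)+
 have dE: "d (-1) V ?E = sb 0 V (sm 0 V (ratio 2 a V) ?y) (sm 0 V (ratio 3 a V) ?x)"
  using hom_res[OF hom_d(2) P(1) V(1,2) P(8)] P(17)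
  by (simp add: om_res_sub[OF omJ P(1) V(1,2) ca(3,4)] om_res_smult[OF omJ P(1) V(1,2) ratio_regular[OF P(3)]] P(5,6) ratio_restrict V(2))
 have r: "(\<lambda>y. ratio a b V y * ratio 2 a V y) = ?X" "(\<lambda>y. ratio a b V y * ratio 3 a V y) = ?Y"
  using V(2,3) P(3) by (auto simp: ratio_def osf)
 have "d (-1) V (sm (-1) V (ratio a b V) ?E) = sb 0 V (sm 0 V ?X ?y) (sm 0 V ?Y ?x)"
  by (simp add: hom_smult[OF hom_d(2) V(1) rb cl(4)] dE om_smult_sub[OF omJ V(1) rb ca(1,2)] om_smult_smult[OF omJ V(1) rb ra] cl r)
 also have "\<dots> = sb 0 V (sb 0 V (sm 0 V (\<lambda>u. ?Y u * ?X u) ?W) (sm 0 V ?Y ?x)) (sb 0 V (sm 0 V (\<lambda>u. ?Y u * ?X u) ?W) (sm 0 V ?X ?y))"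
  by (rule om_sub_sub[OF omJ V(1) _ c(4,3), symmetric]) (intro om_smult[OF omJ] V regular_mult rb cl)
 also have "\<dots> = sb 0 V (sm 0 V ?Y (pz 2 N V mW mX)) (sm 0 V ?X (pz 3 N V mW mY))"
  unfolding pz_def by (simp add: om_smult_sub[OF omJ V(1) rb] c cl om_smult_smult[OF omJ V(1) rb rb] mult.commute)
 finally have "d (-1) V (sm (-1) V (ratio a b V) ?E) = sb 0 V (sm 0 V ?Y (pz 2 N V mW mX)) (sm 0 V ?X (pz 3 N V mW mY))" .
 moreover have "sm (-1) V (ratio a b V) ?E \<in> C (-1) V" by (intro om_smult[OF omJ] V rb cl)
 ultimately show ?thesis unfolding b_datum_def
  using bcyc_pz[OF P(1,3,7,12,16,4) V P(5,10,14)] bcyc_pz[OF P(1,3,7,12,16,4) V P(6,11,15)] by simp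
qed

text \<open>With u the image of \<open>j\<close>, compatibility with the differentials gives
  \<open>c = u * zc b / zc a\<close> on the line, so the difference of the two sides lies in the
  ideal of the line. Hence \<open>j\<close> and the combination of \<open>mW\<close>,
  \<open>mX\<close>, \<open>mY\<close> with the coefficients u, \<alpha>, \<beta> have equal
  boundaries and equal images.\<close>

lemma decomposition_at_pt:
 assumes p: "p_datum N m1 mX mY mW E" and V: "open V" "pt \<in> V" "V \<subseteq> N" and j: "j \<in> C 0 V" "c \<in> regular_on V" "d 0 V j = sm 1 V c (rs 1 N V m1)"
 shows "\<exists>V' \<alpha> \<beta> t. open V' \<and> pt \<in> V' \<and> V' \<subseteq> V \<and> \<alpha> \<in> regular_on V' \<and> \<beta> \<in> regular_on V' \<and> t \<in> C (-1) V' \<and>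
  (\<forall>y\<in>V'. c y = s 0 V j y * ratio b a V y + \<alpha> y * ratio 2 a V y + \<beta> y * ratio 3 a V y) \<and>
  rs 0 V V' j = ad 0 V' (ad 0 V' (sm 0 V' (on_set V' (s 0 V j)) (rs 0 N V' mW)) (cmb V' \<alpha> (rs 0 N V' mX) \<beta> (rs 0 N V' mY))) (d (-1) V' t)"
proof -
 note P = p_datumD[OF p]
 have VDa: "V \<subseteq> Da" using V(3) P(3) by blast
 let ?u = "s 0 V j"
 have u: "?u \<in> regular_on V" by (rule s0_reg[OF V(1) j(1)])
 have m1V: "rs 1 N V m1 \<in> C 1 V" by (intro om_res[OF omJ] P V)
 define g where "g = (\<lambda>y. c y - ?u y * ratio b a V y)"
 have g: "g \<in> regular_on V" unfolding g_def by (intro regular_diff regular_mult j u ratio_regular[OF VDa])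
 have e: "on_set (line0 - {pt}) ?u = (\<lambda>y. c y * qfun V (zc a) y)"
  using s_d0[OF V(1) j(1)] j(3) s_smult(2)[OF V(1) j(2) m1V] s_res(2)[OF P(1) V(1,3) P(4)] P(13) qfun_restrict[OF V(3)] by simp
 have "g y = 0" if y: "y \<in> onl V" for y
 proof (rule regular_zero_on_line0[OF g V(1) _ y])
  fix x assume x: "x \<in> onl V" "x \<noteq> pt"
  hence nz: "zc b x \<noteq> 0" "zc a x \<noteq> 0" using line0_Db VDa by auto
  have "?u x = c x * (zc a x / zc b x)" using fun_cong[OF e, of x] x by (simp add: qfun_def)
  thus "g x = 0" using x nz by (simp add: g_def ratio_def)
 qed
 hence "\<forall>y\<in> onl V. g y = 0" by blast
 from ideal_line0_ratio[OF g V(1) VDa V(2) this] obtain V1 \<alpha> \<beta> where V1: "open V1" "pt \<in> V1" "V1 \<subseteq> V"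
  and ab: "\<alpha> \<in> regular_on V1" "\<beta> \<in> regular_on V1" "\<forall>y\<in>V1. g y = \<alpha> y * ratio 2 a V1 y + \<beta> y * ratio 3 a V1 y" by (elim exE conjE)
 have V1N: "V1 \<subseteq> N" "V1 \<subseteq> Da" using V1 V P(3) by blast+
 let ?W = "rs 0 N V1 mW" and ?x = "rs 0 N V1 mX" and ?y = "rs 0 N V1 mY" and ?m = "rs 1 N V1 m1" and ?u1 = "on_set V1 ?u"
 have cl: "?W \<in> C 0 V1" "?x \<in> C 0 V1" "?y \<in> C 0 V1" "?m \<in> C 1 V1" by (intro om_res[OF omJ] P V1 V1N)+
 have u1: "?u1 \<in> regular_on V1" by (rule regular_restrict[OF u V1(3)])
 note ra = ratio_regular[OF V1N(2)]
 note q = V1(1) ab(1,2) cl(2,3)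
 let ?k = "ad 0 V1 (sm 0 V1 ?u1 ?W) (cmb V1 \<alpha> ?x \<beta> ?y)"
 have uW: "sm 0 V1 ?u1 ?W \<in> C 0 V1" by (rule om_smult[OF omJ V1(1) u1 cl(1)])
 have k: "?k \<in> C 0 V1" by (intro om_add[OF omJ] V1 uW cmb_closed[OF q])
 have dres: "d 0 V1 (rs 0 N V1 m) = sm 1 V1 (ratio i a V1) ?m" if "m \<in> C 0 N" "d 0 N m = sm 1 N (ratio i a N) m1" for m i
  using hom_res[OF hom_d(3) P(1) V1(1) V1N(1) that(1)] that(2) om_res_smult[OF omJ P(1) V1(1) V1N(1) ratio_regular[OF P(3)] P(4)]
  by (simp add: ratio_restrict V1N(1))
 have jV1: "rs 0 V V1 j \<in> C 0 V1" by (rule om_res[OF omJ V(1) V1(1,3) j(1)])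
 have cc: "(\<lambda>y. ?u1 y * ratio b a V1 y + (\<alpha> y * ratio 2 a V1 y + \<beta> y * ratio 3 a V1 y)) = on_set V1 c"
 proof
  fix y show "?u1 y * ratio b a V1 y + (\<alpha> y * ratio 2 a V1 y + \<beta> y * ratio 3 a V1 y) = on_set V1 c y"
  proof (cases "y \<in> V1")
   case True
   hence "y \<in> V" using V1(3) by blast
   thus ?thesis using bspec[OF ab(3) True] True by (simp add: g_def ratio_def algebra_simps)
  qed (simp add: on_set_out ratio_def)
 qed
 have "d 0 V1 ?k = ad 1 V1 (sm 1 V1 (\<lambda>y. ?u1 y * ratio b a V1 y) ?m) (ad 1 V1 (sm 1 V1 (\<lambda>y. \<alpha> y * ratio 2 a V1 y) ?m) (sm 1 V1 (\<lambda>y. \<beta> y * ratio 3 a V1 y) ?m))"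
  by (simp add: hom_add[OF hom_d(3) V1(1) uW cmb_closed[OF q]] hom_smult[OF hom_d(3) V1(1) u1 cl(1)] d_cmb[OF q]
   dres[OF P(7,12)] dres[OF P(5,10)] dres[OF P(6,11)] om_smult_smult[OF omJ V1(1) u1 ra cl(4)] om_smult_smult[OF omJ V1(1) ab(1) ra cl(4)] om_smult_smult[OF omJ V1(1) ab(2) ra cl(4)])
 also have "\<dots> = sm 1 V1 (on_set V1 c) ?m"
  by (simp add: om_add_smult[OF omJ V1(1) _ _ cl(4)] regular_mult regular_add u1 ra ab cc)
 also have "\<dots> = d 0 V1 (rs 0 V V1 j)"
  using hom_res[OF hom_d(3) V(1) V1(1,3) j(1)] j(3) om_res_smult[OF omJ V(1) V1(1,3) j(2) m1V] om_res_res[OF omJ P(1) V(1) V1(1,3) V(3) P(4)] by simp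
 finally have dk: "d 0 V1 ?k = d 0 V1 (rs 0 V V1 j)" .
 have sres: "s 0 V1 ?W = on_set V1 (\<lambda>_. 1)" "s 0 V1 ?x = (\<lambda>_. 0)" "s 0 V1 ?y = (\<lambda>_. 0)"
  using s_res(1)[OF P(1) V1(1) V1N(1)] P V1N(1) by (auto simp: osf)
 have "s 0 V1 ?k = (\<lambda>y. ?u1 y * on_set V1 (\<lambda>_. 1) y)"
  by (simp add: s_add(1)[OF V1(1) uW cmb_closed[OF q]] s_smult(1)[OF V1(1) u1 cl(1)] s_cmb[OF q] sres)
 hence sk: "s 0 V1 ?k = s 0 V1 (rs 0 V V1 j)"
  unfolding s_res(1)[OF V(1) V1(1,3) j(1)] by (auto simp: osf)
 from differ_by_boundary[OF V1(1) k jV1 dk sk V1(2)] obtain V' t where V': "open V'" "pt \<in> V'" "V' \<subseteq> V1" "t \<in> C (-1) V'"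
  and eq: "rs 0 V1 V' (rs 0 V V1 j) = ad 0 V' (rs 0 V1 V' ?k) (d (-1) V' t)" by (elim exE conjE)
 have rr: "rs 0 V1 V' (rs 0 N V1 w) = rs 0 N V' w" if "w \<in> C 0 N" for w
  by (rule om_res_res[OF omJ P(1) V1(1) V'(1,3) V1N(1) that])
 have "rs 0 V V' j = ad 0 V' (ad 0 V' (sm 0 V' (on_set V' ?u) (rs 0 N V' mW)) (cmb V' (on_set V' \<alpha>) (rs 0 N V' mX) (on_set V' \<beta>) (rs 0 N V' mY))) (d (-1) V' t)"
  using eq om_res_res[OF omJ V(1) V1(1) V'(1,3) V1(3) j(1)]
  by (simp add: om_res_add[OF omJ V1(1) V'(1,3) uW cmb_closed[OF q]] om_res_smult[OF omJ V1(1) V'(1,3) u1 cl(1)] cmb_res[OF q V'(1,3)] rr P on_set_subset V'(3))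
 moreover have "\<forall>y\<in>V'. c y = ?u y * ratio b a V y + on_set V' \<alpha> y * ratio 2 a V y + on_set V' \<beta> y * ratio 3 a V y"
 proof
  fix y assume y: "y \<in> V'"
  have "y \<in> V1" "y \<in> V" using y V'(3) V1(3) by blast+
  thus "c y = ?u y * ratio b a V y + on_set V' \<alpha> y * ratio 2 a V y + on_set V' \<beta> y * ratio 3 a V y"
   using bspec[OF ab(3) \<open>y \<in> V1\<close>] y by (simp add: g_def ratio_def algebra_simps)
 qed
 ultimately show ?thesis using V' V1(3) regular_restrict[OF ab(1) V'(3)] regular_restrict[OF ab(2) V'(3)]
  by (intro exI[of _ V'] exI[of _ "on_set V' \<alpha>"] exI[of _ "on_set V' \<beta>"] exI[of _ t]) auto
qed

end

subsection \<open>The values of a roof\<close>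

context marked_line begin

lemma ex_line0_ratio: "\<exists>y\<in>line0 - {pt}. zc a y / zc b y = t"
proof -
 define v :: "complex^4" where "v = axis b 1 + t *s axis a 1"
 have v: "v $ a = t" "v $ b = 1" using ab_distinct by (simp_all add: v_def axis_def)
 have vp: "in_plane v" using ab_distinct by (simp add: in_plane_def v_def axis_def)
 have vn: "v \<noteq> 0" using v(2) by (metis zero_index zero_neq_one)
 obtain x c where x: "x \<in> line0" "c \<noteq> 0" "v = c *s rep x" using point_in_line0[OF vp vn] by (elim exE conjE)
 have "t = c * zc a x" "1 = c * zc b x" using v x(3) by (simp_all add: zc_def)
 hence nz: "zc b x \<noteq> 0" by auto
 have "t = t / (c * zc b x)" using \<open>1 = c * zc b x\<close> by simp
 also have "\<dots> = zc a x / zc b x" using \<open>t = c * zc a x\<close> x(2) by simp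
 finally have "zc a x / zc b x = t" by simp
 note nz this
 with nz show ?thesis using x(1) pt_Db by (intro bexI[of _ x]) auto
qed

lemma qsec_outside: "g \<in> qsec pt U ==> x \<notin> onp U ==> g x = 0"
 by (simp add: qsec_def)

lemma homog_coord_power: "homog_poly k (\<lambda>v. (v $ i) ^ k)"
 using homog_power[OF homog_poly.coord[of i], of k] by simp

text \<open>A section of the twist by \<open>k\<close> of the sheaf of the pairs extends over the marked point when its
 pole there has order at most \<open>k + 1\<close>.\<close>

lemma form_of_local_sections:
 assumes loc: "\<forall>y\<in>line0 - {pt}. \<exists>V G. open V \<and> y \<in> V \<and> V \<subseteq> Db \<and> G \<in> qsec pt V \<and> (\<forall>u\<in> onl V. \<Theta> u = G u)"
  and N: "open N" "pt \<in> N" "N \<subseteq> Da" and G: "G \<in> qsec pt N"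
  and eq: "\<forall>u\<in> onp N. \<Theta> u = (zc a u / zc b u) ^ k * G u"
 shows "\<exists>F. homog_poly (Suc k) F \<and> (\<forall>y\<in>line0 - {pt}. \<Theta> y = F (rep y) / zc b y ^ Suc k)"
proof -
 obtain G1 where G1: "G1 \<in> tw 1 (onl N)" "G = qfun N G1" using G qsec_iff[OF N(1)] by blast
 define H where "H y = (if y = pt then zc a pt ^ k * G1 pt else on_set line0 (\<lambda>y. \<Theta> y * zc b y ^ Suc k) y)" for y
 have "H \<in> tw (int (Suc k)) line0"
 proof (rule tw_local)
  show "H x = 0" if "x \<notin> line0" for x using that pt_line0 by (auto simp: H_def on_set_def)
  fix y assume y: "y \<in> line0"
  show "\<exists>V g. open V \<and> y \<in> V \<and> g \<in> tw (int (Suc k)) (line0 \<inter> V) \<and> (\<forall>u\<in>line0 \<inter> V. H u = g u)"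
  proof (cases "y = pt")
   case True
   have g: "(\<lambda>u. on_set (onl N) (\<lambda>u. rep u $ a ^ k) u * G1 u) \<in> tw (int k + 1) (onl N)"
    by (rule tw_mult[OF tw_form[OF homog_coord_power refl] G1(1)])
   have "H u = on_set (onl N) (\<lambda>u. rep u $ a ^ k) u * G1 u" if u: "u \<in> line0 \<inter> N" for u
   proof (cases "u = pt")
    case False
    hence "zc b u \<noteq> 0" using u line0_Db by auto
    moreover have "\<Theta> u = (zc a u / zc b u) ^ k * (G1 u / zc b u)" using eq u False by (simp add: G1(2) qfun_def)
    ultimately show ?thesis using u False by (simp add: H_def zc_def[symmetric] power_divide)
   qed (use u in \<open>simp add: H_def zc_def\<close>)
   hence h: "\<forall>u\<in>line0 \<inter> N. H u = on_set (onl N) (\<lambda>u. rep u $ a ^ k) u * G1 u" by blast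
   have e: "line0 \<inter> N = onl N" "int (Suc k) = int k + 1" by auto
   show ?thesis
   proof (rule exI, rule exI, intro conjI)
    show "open N" "y \<in> N" using N True by simp_all
    show "(\<lambda>u. on_set (onl N) (\<lambda>u. rep u $ a ^ k) u * G1 u) \<in> tw (int (Suc k)) (line0 \<inter> N)" unfolding e by (rule g)
   qed (rule h)
  next
   case False
   hence "y \<in> line0 - {pt}" using y by simp
   from bspec[OF loc this] obtain V g where V: "open V" "y \<in> V" "V \<subseteq> Db" "g \<in> qsec pt V" "\<forall>u\<in> onl V. \<Theta> u = g u" by (elim exE conjE)
   obtain g1 where g1: "g1 \<in> tw 1 (onl V)" "g = qfun V g1" using V(4) qsec_iff[OF V(1)] by blast
   have g: "(\<lambda>u. on_set (onl V) (\<lambda>u. rep u $ b ^ k) u * g1 u) \<in> tw (int k + 1) (onl V)"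
    by (rule tw_mult[OF tw_form[OF homog_coord_power refl] g1(1)])
   have "H u = on_set (onl V) (\<lambda>u. rep u $ b ^ k) u * g1 u" if u: "u \<in> line0 \<inter> V" for u
   proof -
    have "u \<noteq> pt" "zc b u \<noteq> 0" using u V(3) pt_Db by auto
    moreover have "\<Theta> u = g1 u / zc b u" using V(5) u \<open>u \<noteq> pt\<close> by (simp add: g1(2) qfun_def)
    ultimately show ?thesis using u by (simp add: H_def zc_def[symmetric])
   qed
   hence h: "\<forall>u\<in>line0 \<inter> V. H u = on_set (onl V) (\<lambda>u. rep u $ b ^ k) u * g1 u" by blast
   have e: "line0 \<inter> V = onl V" "int (Suc k) = int k + 1" by auto
   show ?thesis
   proof (rule exI, rule exI, intro conjI)
    show "open V" "y \<in> V" using V by simp_all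
    show "(\<lambda>u. on_set (onl V) (\<lambda>u. rep u $ b ^ k) u * g1 u) \<in> tw (int (Suc k)) (line0 \<inter> V)" unfolding e by (rule g)
   qed (rule h)
  qed
 qed
 from tw_line0_global[OF this] obtain F where F: "homog_poly (Suc k) F" "\<forall>x\<in>line0. H x = F (rep x)" by blast
 have "\<Theta> y = F (rep y) / zc b y ^ Suc k" if y: "y \<in> line0 - {pt}" for y
 proof -
  have "zc b y \<noteq> 0" using y line0_Db by auto
  moreover have "F (rep y) = \<Theta> y * zc b y ^ Suc k" using F(2) y by (auto simp: H_def)
  ultimately show ?thesis by simp
 qed
 thus ?thesis using F(1) by blast
qed

lemma linear_of_local_sections:
 assumes "\<forall>y\<in>line0 - {pt}. \<exists>V G. open V \<and> y \<in> V \<and> V \<subseteq> Db \<and> G \<in> qsec pt V \<and> (\<forall>u\<in> onl V. \<Theta> u = G u)"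
  and "open N" "pt \<in> N" "N \<subseteq> Da" "G \<in> qsec pt N" "\<forall>u\<in> onp N. \<Theta> u = G u"
 shows "\<exists>x0 x1. \<forall>y\<in>line0 - {pt}. \<Theta> y = x0 + x1 * (zc a y / zc b y)"
proof -
 from form_of_local_sections[OF assms(1-5), of 0] assms(6) obtain F where F: "homog_poly 1 F" "\<forall>y\<in>line0 - {pt}. \<Theta> y = F (rep y) / zc b y" by auto
 from form1_in_plane[OF F(1)] obtain x0 x1 where x: "\<forall>v. in_plane v --> F v = x0 * v $ b + x1 * v $ a" by blast
 have "\<Theta> y = x0 + x1 * (zc a y / zc b y)" if "y \<in> line0 - {pt}" for y
 proof -
  have "zc b y \<noteq> 0" "in_plane (rep y)" using that line0_Db rep_in_plane by auto
  thus ?thesis using F(2) x that by (simp add: zc_def field_simps)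
 qed
 thus ?thesis by blast
qed

lemma quadratic_of_local_sections:
 assumes "\<forall>y\<in>line0 - {pt}. \<exists>V G. open V \<and> y \<in> V \<and> V \<subseteq> Db \<and> G \<in> qsec pt V \<and> (\<forall>u\<in> onl V. \<Theta> u = G u)"
  and "open N" "pt \<in> N" "N \<subseteq> Da" "G \<in> qsec pt N" "\<forall>u\<in> onp N. \<Theta> u = zc a u / zc b u * G u"
 shows "\<exists>x0 x1 x2. \<forall>y\<in>line0 - {pt}. \<Theta> y = x0 + x1 * (zc a y / zc b y) + x2 * (zc a y / zc b y)\<^sup>2"
proof -
 from form_of_local_sections[OF assms(1-5), of 1] assms(6) obtain F where F: "homog_poly 2 F" "\<forall>y\<in>line0 - {pt}. \<Theta> y = F (rep y) / (zc b y)\<^sup>2"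
  by (auto simp: numeral_2_eq_2)
 from form2_in_plane[OF F(1)] obtain x0 x1 x2 where x: "\<forall>v. in_plane v --> F v = x0 * (v $ b)\<^sup>2 + x1 * v $ a * v $ b + x2 * (v $ a)\<^sup>2" by blast
 have "\<Theta> y = x0 + x1 * (zc a y / zc b y) + x2 * (zc a y / zc b y)\<^sup>2" if "y \<in> line0 - {pt}" for y
 proof -
  have "zc b y \<noteq> 0" "in_plane (rep y)" using that line0_Db rep_in_plane by auto
  hence "\<Theta> y = (x0 * (zc b y)\<^sup>2 + x1 * zc a y * zc b y + x2 * (zc a y)\<^sup>2) / (zc b y)\<^sup>2" using F(2) x that by (simp add: zc_def)
  also have "\<dots> = x0 + x1 * (zc a y / zc b y) + x2 * (zc a y / zc b y)\<^sup>2"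
   using \<open>zc b y \<noteq> 0\<close> by (simp add: power2_eq_square add_divide_distrib)
  finally show ?thesis .
 qed
 thus ?thesis by blast
qed

text \<open>A quadratic form in the coordinates \<open>a\<close> and \<open>b\<close>, divided by
  the square of \<open>zc b\<close>; with \<open>x2 = 0\<close> it is a linear form divided by
  \<open>zc b\<close>.\<close>

definition aff :: "complex => complex => complex => fn" where
 "aff x0 x1 x2 y = x0 + x1 * (zc a y / zc b y) + x2 * (zc a y / zc b y)\<^sup>2"

lemma aff_unique:
 assumes "\<forall>y\<in>line0 - {pt}. aff x0 x1 x2 y = aff u0 u1 u2 y"
 shows "x0 = u0 \<and> x1 = u1 \<and> x2 = u2"
proof -
 have e: "x0 + x1 * t + x2 * t\<^sup>2 = u0 + u1 * t + u2 * t\<^sup>2" for t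
 proof -
  obtain y where "y \<in> line0 - {pt}" "zc a y / zc b y = t" using ex_line0_ratio by blast
  thus ?thesis using assms by (auto simp: aff_def)
 qed
 \<comment> \<open>Every complex number is a value of \<open>zc a / zc b\<close> on the punctured
   line; the values 0, 1, -1 determine the coefficients.\<close>
 have "x0 = u0" using e[of 0] by simp
 moreover have s: "x1 + x2 = u1 + u2" using e[of 1] \<open>x0 = u0\<close> by (simp add: add.assoc)
 moreover have "x2 = u2"
 proof -
  have s': "- x1 + x2 = - u1 + u2" using e[of "-1"] \<open>x0 = u0\<close> by (simp add: add.assoc)
  have i: "(p + q) + (- p + q) = 2 * q" for p q :: complex by (simp add: algebra_simps)
  have "2 * x2 = 2 * u2" using i[of x1 x2] i[of u1 u2] unfolding s s' by (rule trans[OF sym])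
  thus ?thesis by simp
 qed
 ultimately show ?thesis by simp
qed

end

context resolved begin

text \<open>The right leg of a roof: a chain map to a sheaf placed in degree \<open>i\<close> has
  one nonzero component, and commuting with the differentials means killing boundaries. The case
  \<open>i = 0\<close> belongs to k = 0 and \<open>i = -1\<close> to k = 1.\<close>

definition tmap :: "int => fn omap => bool" where
 "tmap i \<phi> \<longleftrightarrow> O_hom (obj J i) (Qsh pt) \<phi> \<and> (\<forall>U m. open U --> m \<in> C (i - 1) U --> \<phi> U (d (i - 1) U m) = (\<lambda>_. 0))"

context
 fixes i \<phi> and U :: "proj3 set" assumes t: "tmap i \<phi>" and U: "open U"
begin

lemma tm_closed: "m \<in> C i U ==> \<phi> U m \<in> qsec pt U"
 using hom_closed[of "obj J i" "Qsh pt" \<phi> U m] t U by (simp add: tmap_def)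

lemma tm_add: "m \<in> C i U ==> n \<in> C i U ==> \<phi> U (ad i U m n) = (\<lambda>y. \<phi> U m y + \<phi> U n y)"
 using hom_add[of "obj J i" "Qsh pt" \<phi> U m n] t U by (simp add: tmap_def)

lemma tm_smult: "f \<in> regular_on U ==> m \<in> C i U ==> \<phi> U (sm i U f m) = (\<lambda>y. f y * \<phi> U m y)"
 using hom_smult[of "obj J i" "Qsh pt" \<phi> U f m] t U by (simp add: tmap_def)

lemma tm_res: "open V ==> V \<subseteq> U ==> m \<in> C i U ==> \<phi> V (rs i U V m) = on_set V (\<phi> U m)"
 using hom_res[of "obj J i" "Qsh pt" \<phi> U V m] t U by (simp add: tmap_def)

lemma tm_d: "i - 1 = j ==> m \<in> C j U ==> \<phi> U (d j U m) = (\<lambda>_. 0)"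
 using t U by (auto simp: tmap_def)

lemma tm_outside: "m \<in> C i U ==> y \<notin> onp U ==> \<phi> U m y = 0"
 using tm_closed qsec_outside by blast

lemma tm_sub: "m \<in> C i U ==> n \<in> C i U ==> \<phi> U (sb i U m n) = (\<lambda>y. \<phi> U m y - \<phi> U n y)"
proof -
 assume m: "m \<in> C i U" "n \<in> C i U"
 have "\<phi> U (sb i U m n) = (\<lambda>y. \<phi> U m y + on_set U (\<lambda>_. -1) y * \<phi> U n y)"
  using m by (simp add: sub_def tm_add tm_smult om_smult[OF omJ U] regular_const)
 thus ?thesis using tm_outside[OF m(2)] by (auto simp: osf)
qed

end

lemma tm_point: "tmap i \<phi> ==> open U ==> open V ==> V \<subseteq> U ==> m \<in> C i U ==> y \<in> V ==> \<phi> V (rs i U V m) y = \<phi> U m y"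
 by (simp add: tm_res)

text \<open>The part of \<open>p_datum\<close> about \<open>m1\<close> and \<open>mW\<close> that
  survives maps of roofs: a homotopy changes the image of \<open>m\<close> by a multiple of
  \<open>zc b / zc a\<close>, which vanishes at the marked point, so the image is normalised at that
  point only.\<close>

definition p_cycle where
 "p_cycle V \<mu> m \<longleftrightarrow> open V \<and> pt \<in> V \<and> V \<subseteq> Da \<and> \<mu> \<in> C 1 V \<and> d 1 V \<mu> = z 2 V \<and> m \<in> C 0 V \<and>
  d 0 V m = sm 1 V (ratio b a V) \<mu> \<and> s 0 V m pt = 1"

text \<open>Quantified over all local data instead of a chosen one: the data of a roof over
  \<open>J\<close> map to data of \<open>J\<close>, so the relation passes from \<open>J\<close> to
  that roof.\<close>

definition val1 :: "fn omap => complex^3 => bool" where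
 "val1 \<phi> x \<longleftrightarrow> (\<forall>V zX zY e. b_datum V zX zY e --> (\<forall>y\<in> onl V. \<phi> V e y = aff (x$1) (x$2) (x$3) y))"

text \<open>Sections have the value \<open>0\<close> at \<open>pt\<close> by convention, so the residue is read off from a regular extension \<open>k\<close>.\<close>

definition val0 :: "fn omap => complex^5 => bool" where
 "val0 \<phi> x \<longleftrightarrow> (\<forall>V w. bcyc 2 V w --> (\<forall>y\<in> onl V. \<phi> V w y = aff (x$1) (x$2) 0 y)) \<and>
  (\<forall>V w. bcyc 3 V w --> (\<forall>y\<in> onl V. \<phi> V w y = aff (x$3) (x$4) 0 y)) \<and>
  (\<forall>V \<mu> m. p_cycle V \<mu> m --> (\<exists>k\<in>regular_on (onl V). k pt = x$5 \<and> (\<forall>y\<in> onp V. k y = ratio b a V y * \<phi> V m y)))"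

lemma b_datumD:
 assumes "b_datum V zX zY e"
 shows "bcyc 2 V zX" "bcyc 3 V zY" "e \<in> C (-1) V" "d (-1) V e = sb 0 V (sm 0 V (ratio 3 b V) zX) (sm 0 V (ratio 2 b V) zY)"
  "open V" "V \<subseteq> Db" "zX \<in> C 0 V" "zY \<in> C 0 V"
 using assms by (auto simp: b_datum_def bcyc_def)

lemma b_datum_res:
 assumes D: "b_datum V zX zY e" and V': "open V'" "V' \<subseteq> V"
 shows "b_datum V' (rs 0 V V' zX) (rs 0 V V' zY) (rs (-1) V V' e)"
proof -
 note D' = b_datumD[OF D]
 note r = ratio_regular[OF D'(6)]
 have c: "sm 0 V (ratio 3 b V) zX \<in> C 0 V" "sm 0 V (ratio 2 b V) zY \<in> C 0 V" by (intro om_smult[OF omJ] D' r)+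
 have "d (-1) V' (rs (-1) V V' e) = rs 0 V V' (sb 0 V (sm 0 V (ratio 3 b V) zX) (sm 0 V (ratio 2 b V) zY))"
  using hom_res[OF hom_d(2) D'(5) V' D'(3)] D'(4) by simp
 also have "\<dots> = sb 0 V' (sm 0 V' (ratio 3 b V') (rs 0 V V' zX)) (sm 0 V' (ratio 2 b V') (rs 0 V V' zY))"
  by (simp add: om_res_sub[OF omJ D'(5) V' c] om_res_smult[OF omJ D'(5) V' r] D' ratio_restrict V')
 finally show ?thesis unfolding b_datum_def
  using bcyc_res[OF D'(1) V'] bcyc_res[OF D'(2) V'] om_res[OF omJ D'(5) V' D'(3)] by simp
qed

text \<open>Two lifts of one generator differ locally by a boundary, which \<phi> kills.\<close>

lemma bcyc_value_unique:
 assumes t: "tmap 0 \<phi>" and w: "bcyc i V w" "bcyc i V' w'" and y: "y \<in> V" "y \<in> V'"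
 shows "\<phi> V w y = \<phi> V' w' y"
proof -
 let ?U = "V \<inter> V'"
 note W = bcycD[OF w(1)] and W' = bcycD[OF w(2)]
 have U: "open ?U" using W W' by auto
 note r = bcyc_res[OF w(1) U Int_lower1] bcyc_res[OF w(2) U Int_lower2]
 note R = bcycD[OF r(1)] and R' = bcycD[OF r(2)]
 obtain T \<tau> where T: "open T" "y \<in> T" "T \<subseteq> ?U" "\<tau> \<in> C (-1) T" "rs 0 ?U T (rs 0 V' ?U w') = ad 0 T (rs 0 ?U T (rs 0 V ?U w)) (d (-1) T \<tau>)"
  using differ_by_boundary[OF U R(3) R'(3), of y] R R' y by auto
 have c: "rs 0 ?U T (rs 0 V ?U w) \<in> C 0 T" "d (-1) T \<tau> \<in> C 0 T" by (intro om_res[OF omJ] U T R hom_closed[OF hom_d(2)])+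
 have "\<phi> T (rs 0 ?U T (rs 0 V' ?U w')) y = \<phi> T (rs 0 ?U T (rs 0 V ?U w)) y"
  unfolding T(5) by (simp add: tm_add[OF t T(1) c] tm_d[OF t T(1) _ T(4)])
 thus ?thesis
  using tm_point[OF t U T(1,3) R(3) T(2)] tm_point[OF t U T(1,3) R'(3) T(2)]
   tm_point[OF t W(1) U Int_lower1 W(3), of y] tm_point[OF t W'(1) U Int_lower2 W'(3), of y] y by simp
qed

text \<open>By exactness in degree -1 the difference of \<open>p\<close> and \<open>q\<close> is
  locally a boundary from degree -2, which \<phi> kills.\<close>

lemma boundary_value:
 assumes t: "tmap (-1) \<phi>" and S: "open S" "y \<in> S" and p: "p \<in> C (-1) S" "q \<in> C (-1) S" "d (-1) S p = d (-1) S q"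
 shows "\<phi> S p y = \<phi> S q y"
proof -
 have k: "sb (-1) S p q \<in> C (-1) S" by (rule om_sub[OF omJ S(1) p(1,2)])
 have "d (-1) S (sb (-1) S p q) = z 0 S"
  using hom_sub[OF omJ hom_d(2) S(1) p(1,2)] p(3) om_sub_self[OF omJ S(1) hom_closed[OF hom_d(2) S(1) p(2)]] by simp
 from exact_m1[OF S(1) k this S(2)] obtain T \<tau> where T: "open T" "y \<in> T" "T \<subseteq> S" "\<tau> \<in> C (-2) T" "d (-2) T \<tau> = rs (-1) S T (sb (-1) S p q)" by (elim exE conjE)
 have "\<phi> S (sb (-1) S p q) y = \<phi> T (d (-2) T \<tau>) y" unfolding T(5) by (rule tm_point[OF t S(1) T(1,3) k T(2), symmetric])
 also have "\<dots> = 0" using tm_d[OF t T(1) _ T(4)] by simp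
 finally show ?thesis using tm_sub[OF t S(1) p(1,2)] by simp
qed

text \<open>Keeps the cochain \<tau> by which two lifts differ: for a right leg in degree -1 its
  value on \<tau> measures the change of lift.\<close>

definition link where
 "link V w V' w' T \<tau> \<longleftrightarrow> open T \<and> T \<subseteq> V \<and> T \<subseteq> V' \<and> \<tau> \<in> C (-1) T \<and> rs 0 V' T w' = ad 0 T (rs 0 V T w) (d (-1) T \<tau>)"

lemma linkD: "link V w V' w' T \<tau> ==> open T" "link V w V' w' T \<tau> ==> T \<subseteq> V" "link V w V' w' T \<tau> ==> T \<subseteq> V'"
 "link V w V' w' T \<tau> ==> \<tau> \<in> C (-1) T" "link V w V' w' T \<tau> ==> rs 0 V' T w' = ad 0 T (rs 0 V T w) (d (-1) T \<tau>)"
 by (simp_all add: link_def)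

lemma ex_link:
 assumes w: "bcyc i V w" "bcyc i V' w'" and y: "y \<in> V" "y \<in> V'"
 shows "\<exists>T \<tau>. y \<in> T \<and> link V w V' w' T \<tau>"
proof -
 let ?U = "V \<inter> V'"
 note W = bcycD[OF w(1)] and W' = bcycD[OF w(2)]
 have U: "open ?U" using W W' by auto
 note R = bcycD[OF bcyc_res[OF w(1) U Int_lower1]] and R' = bcycD[OF bcyc_res[OF w(2) U Int_lower2]]
 obtain T \<tau> where T: "open T" "y \<in> T" "T \<subseteq> ?U" "\<tau> \<in> C (-1) T" "rs 0 ?U T (rs 0 V' ?U w') = ad 0 T (rs 0 ?U T (rs 0 V ?U w)) (d (-1) T \<tau>)"
  using differ_by_boundary[OF U R(3) R'(3), of y] R R' y by auto
 hence "link V w V' w' T \<tau>"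
  using om_res_res[OF omJ W(1) U T(1) T(3) Int_lower1 W(3)] om_res_res[OF omJ W'(1) U T(1) T(3) Int_lower2 W'(3)] by (simp add: link_def)
 thus ?thesis using T(2) by blast
qed

lemma link_res:
 assumes l: "link V w V' w' T \<tau>" and w: "open V" "w \<in> C 0 V" "open V'" "w' \<in> C 0 V'" and S: "open S" "S \<subseteq> T"
 shows "link V w V' w' S (rs (-1) T S \<tau>)"
proof -
 note L = linkD[OF l]
 have "rs 0 V' S w' = rs 0 T S (rs 0 V' T w')" by (rule om_res_res[OF omJ w(3) L(1) S L(3) w(4), symmetric])
 also have "\<dots> = ad 0 S (rs 0 T S (rs 0 V T w)) (rs 0 T S (d (-1) T \<tau>))" unfolding L(5)
  by (rule om_res_add[OF omJ L(1) S]) (intro om_res[OF omJ] w L hom_closed[OF hom_d(2)])+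
 also have "rs 0 T S (rs 0 V T w) = rs 0 V S w" by (rule om_res_res[OF omJ w(1) L(1) S L(2) w(2)])
 also have "rs 0 T S (d (-1) T \<tau>) = d (-1) S (rs (-1) T S \<tau>)" by (rule hom_res[OF hom_d(2) L(1) S L(4), symmetric])
 finally show ?thesis unfolding link_def using S L(2,3) om_res[OF omJ L(1) S L(4)] by blast
qed

text \<open>If the lifts change by the boundaries of p and q, then \<open>e\<close> changes by Y p -
  X q up to a cocycle, on which \<phi> is 0. The value on Y p - X q vanishes on the line because X
  and Y do.\<close>

lemma b_datum_value_unique:
 assumes t: "tmap (-1) \<phi>" and w: "b_datum V zX zY e" "b_datum V' zX' zY' e'" and y: "y \<in> V" "y \<in> V'" "y \<in> line0"
 shows "\<phi> V e y = \<phi> V' e' y"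
proof -
 note W = b_datumD[OF w(1)] and W' = b_datumD[OF w(2)]
 obtain A p where A: "y \<in> A" "link V zX V' zX' A p" using ex_link[OF W(1) W'(1) y(1,2)] by (elim exE conjE)
 obtain B q where B: "y \<in> B" "link V zY V' zY' B q" using ex_link[OF W(2) W'(2) y(1,2)] by (elim exE conjE)
 let ?T = "A \<inter> B"
 have T: "open ?T" "y \<in> ?T" "?T \<subseteq> V" "?T \<subseteq> V'" using linkD[OF A(2)] linkD[OF B(2)] A(1) B(1) by auto
 note S = b_datumD[OF b_datum_res[OF w(1) T(1,3)]] and S' = b_datumD[OF b_datum_res[OF w(2) T(1,4)]]
 note PA = linkD[OF link_res[OF A(2) W(5,7) W'(5,7) T(1) Int_lower1]] and PB = linkD[OF link_res[OF B(2) W(5,8) W'(5,8) T(1) Int_lower2]]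
 let ?x = "rs 0 V ?T zX" and ?y = "rs 0 V ?T zY" and ?E = "rs (-1) V ?T e" and ?E' = "rs (-1) V' ?T e'"
 let ?p = "rs (-1) A ?T p" and ?q = "rs (-1) B ?T q"
 note pq = PA(4) PB(4)
 have dpq: "d (-1) ?T ?p \<in> C 0 ?T" "d (-1) ?T ?q \<in> C 0 ?T" by (intro hom_closed[OF hom_d(2)] T pq)+
 let ?rx = "ratio 2 b ?T" and ?ry = "ratio 3 b ?T"
 note r = ratio_regular[OF S(6)]
 let ?k = "sb (-1) ?T (sm (-1) ?T ?ry ?p) (sm (-1) ?T ?rx ?q)"
 have c: "sm (-1) ?T ?ry ?p \<in> C (-1) ?T" "sm (-1) ?T ?rx ?q \<in> C (-1) ?T" by (intro om_smult[OF omJ] T r pq)+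
 have k: "?k \<in> C (-1) ?T" by (rule om_sub[OF omJ T(1) c])
 let ?e2 = "ad (-1) ?T ?E ?k"
 have e2: "?e2 \<in> C (-1) ?T" by (rule om_add[OF omJ T(1) S(3) k])
 have c0: "sm 0 ?T ?ry ?x \<in> C 0 ?T" "sm 0 ?T ?rx ?y \<in> C 0 ?T" "sm 0 ?T ?ry (d (-1) ?T ?p) \<in> C 0 ?T" "sm 0 ?T ?rx (d (-1) ?T ?q) \<in> C 0 ?T"
  by (intro om_smult[OF omJ] T r S dpq)+
 have "d (-1) ?T ?E' = sb 0 ?T (ad 0 ?T (sm 0 ?T ?ry ?x) (sm 0 ?T ?ry (d (-1) ?T ?p))) (ad 0 ?T (sm 0 ?T ?rx ?y) (sm 0 ?T ?rx (d (-1) ?T ?q)))"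
  unfolding S'(4) PA(5) PB(5) by (simp add: om_smult_add[OF omJ T(1) r S(7) dpq(1)] om_smult_add[OF omJ T(1) r S(8) dpq(2)])
 also have "\<dots> = ad 0 ?T (sb 0 ?T (sm 0 ?T ?ry ?x) (sm 0 ?T ?rx ?y)) (sb 0 ?T (sm 0 ?T ?ry (d (-1) ?T ?p)) (sm 0 ?T ?rx (d (-1) ?T ?q)))"
  by (rule om_sub_add_add[OF omJ T(1) c0(1,3,2,4)])
 also have "\<dots> = d (-1) ?T ?e2"
  by (simp add: hom_add[OF hom_d(2) T(1) S(3) k] S(4) hom_sub[OF omJ hom_d(2) T(1) c] hom_smult[OF hom_d(2) T(1) r] pq)
 finally have "\<phi> ?T ?E' y = \<phi> ?T ?e2 y" by (rule boundary_value[OF t T(1,2) S'(3) e2])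
 also have "\<dots> = \<phi> ?T ?E y + (?ry y * \<phi> ?T ?p y - ?rx y * \<phi> ?T ?q y)"
  by (simp add: tm_add[OF t T(1) S(3) k] tm_sub[OF t T(1) c] tm_smult[OF t T(1) r] pq)
 also have "\<dots> = \<phi> ?T ?E y" using y(3) T(2) by (simp add: ratio_def mem_line0)
 finally show ?thesis using tm_point[OF t W(5) T(1,3) W(3) T(2)] tm_point[OF t W'(5) T(1,4) W'(3) T(2)] by simp
qed

end

context marked_line begin

lemma qsec_residue:
 assumes "g \<in> qsec pt V" "open V" "V \<subseteq> Da"
 shows "\<exists>k\<in>regular_on (onl V). \<forall>y\<in> onp V. k y = ratio b a V y * g y"
proof -
 have "ratio b a (onl V) \<in> regular_on (onl V)" by (rule ratio_regular) (use assms(3) in auto)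
 moreover have "ratio b a (onl V) pt = 0" using zc_pt(2)[of b] ab_distinct by (simp add: ratio_def on_set_def)
 ultimately obtain k where "k \<in> regular_on (onl V)" "\<forall>y\<in> onp V. k y = ratio b a (onl V) y * g y"
  using assms(1,2) unfolding qsec_def by blast
 thus ?thesis by (intro bexI[of _ k]) (auto simp: ratio_def)
qed

lemma regular_line0_zero:
 assumes "g \<in> regular_on (onl V)" "open V" "pt \<in> V" "\<And>y. y \<in> onp V ==> g y = 0"
 shows "g pt = 0"
proof -
 have "g = (\<lambda>_. 0)"
 proof (rule tw_zero_on_open[of _ 0 V "{2,3}" Db])
  show "g \<in> tw 0 (V \<inter> lin_sub {2, 3})" using assms(1) by (simp add: line0_eq regular_on_eq_tw)
  show "Db \<inter> lin_sub {2, 3} \<noteq> {}" using ex_line0_ratio[of 0] line0_Db unfolding line0_eq[symmetric] by blast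
  fix x assume "x \<in> Db \<inter> lin_sub {2, 3}" "x \<in> V"
  thus "g x = 0" using assms(4) pt_Db by (auto simp: line0_eq[symmetric])
 qed (use assms(2) open_Db in auto)
 thus ?thesis by simp
qed

end

context resolved begin

lemma p_cycle_of_p_datum: "p_datum N m1 mX mY mW E ==> p_cycle N m1 mW"
 by (simp add: p_cycle_def p_datum_def)

lemma p_datum_res:
 assumes p: "p_datum N m1 mX mY mW E" and V: "open V" "pt \<in> V" "V \<subseteq> N"
 shows "p_datum V (rs 1 N V m1) (rs 0 N V mX) (rs 0 N V mY) (rs 0 N V mW) (rs (-1) N V E)"
proof -
 note P = p_datumD[OF p]
 note r = ratio_regular[OF P(3)]
 have c: "sm 0 N (ratio 2 a N) mY \<in> C 0 N" "sm 0 N (ratio 3 a N) mX \<in> C 0 N" by (intro om_smult[OF omJ] P r)+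
 have dr: "d 0 V (rs 0 N V m) = sm 1 V (ratio i a V) (rs 1 N V m1)" if "m \<in> C 0 N" "d 0 N m = sm 1 N (ratio i a N) m1" for m i
  using hom_res[OF hom_d(3) P(1) V(1,3) that(1)] that(2) om_res_smult[OF omJ P(1) V(1,3) r P(4)] by (simp add: ratio_restrict V(3))
 have "V \<subseteq> Da" using V(3) P(3) by blast
 moreover have "d 1 V (rs 1 N V m1) = z 2 V" using hom_res[OF hom_d(4) P(1) V(1,3) P(4)] P(9) om_res_zero[OF omJ P(1) V(1,3)] by simp
 moreover have "s 1 V (rs 1 N V m1) = qfun V (zc a)" using s_res(2)[OF P(1) V(1,3) P(4)] P(13) qfun_restrict[OF V(3)] by simp
 moreover have "s 0 V (rs 0 N V mX) = (\<lambda>_. 0)" "s 0 V (rs 0 N V mY) = (\<lambda>_. 0)" "s 0 V (rs 0 N V mW) = on_set V (\<lambda>_. 1)"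
  using s_res(1)[OF P(1) V(1,3)] P(5-7,14-16) V(3) by (simp_all add: on_set_subset) (simp_all add: on_set_def)
 moreover have "d (-1) V (rs (-1) N V E) = sb 0 V (sm 0 V (ratio 2 a V) (rs 0 N V mY)) (sm 0 V (ratio 3 a V) (rs 0 N V mX))"
  using hom_res[OF hom_d(2) P(1) V(1,3) P(8)] P(17)
  by (simp add: om_res_sub[OF omJ P(1) V(1,3) c] om_res_smult[OF omJ P(1) V(1,3) r] P(5,6) ratio_restrict V(3))
 ultimately show ?thesis unfolding p_datum_def
  using V dr[OF P(5,10)] dr[OF P(6,11)] dr[OF P(7,12)] om_res[OF omJ P(1) V(1,3)] P(4-8) by simp
qed

lemma p_cycle_res:
 assumes c: "p_cycle V \<mu> m" and W: "open W" "pt \<in> W" "W \<subseteq> V"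
 shows "p_cycle W (rs 1 V W \<mu>) (rs 0 V W m)"
proof -
 have Q: "open V" "pt \<in> V" "V \<subseteq> Da" "\<mu> \<in> C 1 V" "d 1 V \<mu> = z 2 V" "m \<in> C 0 V" "d 0 V m = sm 1 V (ratio b a V) \<mu>" "s 0 V m pt = 1"
  using c by (simp_all add: p_cycle_def)
 have "W \<subseteq> Da" using W(3) Q(3) by blast
 moreover have "d 0 W (rs 0 V W m) = sm 1 W (ratio b a W) (rs 1 V W \<mu>)"
  using hom_res[OF hom_d(3) Q(1) W(1,3) Q(6)] Q(7) om_res_smult[OF omJ Q(1) W(1,3) ratio_regular[OF Q(3)] Q(4)] by (simp add: ratio_restrict[OF W(3)])
 ultimately show ?thesis unfolding p_cycle_def
  using W om_res[OF omJ Q(1) W(1,3)] Q(4,5,6,8) hom_res[OF hom_d(4) Q(1) W(1,3) Q(4)] om_res_zero[OF omJ Q(1) W(1,3)] s_res(1)[OF Q(1) W(1,3) Q(6)] by simp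
qed

text \<open>With u the image of \<open>M\<close>, the cochain \<open>\<mu> - u * m1\<close> has
  image 0, hence is locally the boundary of some \<tau>. Then \<open>M\<close> and
  \<open>u * w + (zc b / zc a) * \<tau>\<close> have equal boundaries and images, so \<phi> takes
  the same value on both. After multiplication by \<open>zc b / zc a\<close> the term with \<tau>
  vanishes at the marked point, where u is 1.\<close>

lemma p_cycle_value_unique_same:
 assumes t: "tmap 0 \<phi>" and p: "p_datum U m1 mX mY w E" and c: "p_cycle U \<mu> M"
  and k0: "k0 \<in> regular_on (onl U)" "\<forall>y\<in> onp U. k0 y = ratio b a U y * \<phi> U w y"
  and k: "k \<in> regular_on (onl U)" "\<forall>y\<in> onp U. k y = ratio b a U y * \<phi> U M y"
 shows "k pt = k0 pt"
proof -
 note P = p_datumD[OF p]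
 have Q: "\<mu> \<in> C 1 U" "d 1 U \<mu> = z 2 U" "M \<in> C 0 U" "d 0 U M = sm 1 U (ratio b a U) \<mu>" "s 0 U M pt = 1"
  using c by (simp_all add: p_cycle_def)
 have r: "ratio b a U \<in> regular_on U" by (rule ratio_regular[OF P(3)])
 let ?u = "s 0 U M"
 have u: "?u \<in> regular_on U" by (rule s0_reg[OF P(1) Q(3)])
 have um: "sm 1 U ?u m1 \<in> C 1 U" by (rule om_smult[OF omJ P(1) u P(4)])
 let ?\<nu> = "sb 1 U \<mu> (sm 1 U ?u m1)"
 have nu: "?\<nu> \<in> C 1 U" by (rule om_sub[OF omJ P(1) Q(1) um])
 have "d 1 U ?\<nu> = z 2 U"
  by (simp add: hom_sub[OF omJ hom_d(4) P(1) Q(1) um] hom_smult[OF hom_d(4) P(1) u P(4)] Q(2) P(9) om_smult_zero[OF omJ P(1) u] om_sub_self[OF omJ P(1) om_zero[OF omJ P(1)]])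
 moreover have "s 1 U ?\<nu> = on_set (line0 - {pt}) (\<lambda>_. 0)"
 proof
  fix y
  show "s 1 U ?\<nu> y = on_set (line0 - {pt}) (\<lambda>_. 0) y"
  proof (cases "y \<in> onp U")
   case False
   thus ?thesis using qsec_outside[OF s1_qsec[OF P(1) nu] False] by (simp add: on_set_def)
  next
   case True
   hence nz: "zc b y \<noteq> 0" "zc a y \<noteq> 0" using line0_Db P(3) by auto
   have e: "(\<lambda>x. ratio b a U x * s 1 U \<mu> x) = on_set (line0 - {pt}) ?u"
    using s_d0[OF P(1) Q(3)] Q(4) s_smult(2)[OF P(1) r Q(1)] by simp
   have uy: "?u y = (zc b y / zc a y) * s 1 U \<mu> y" using fun_cong[OF e, of y] True by (simp add: ratio_def)
   have m1y: "s 1 U m1 y = zc a y / zc b y" using P(13) True by (simp add: qfun_def)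
   have "s 1 U ?\<nu> y = s 1 U \<mu> y + on_set U (\<lambda>_. - 1) y * (?u y * s 1 U m1 y)"
    unfolding sub_def using P Q um u by (simp add: s_add s_smult om_smult[OF omJ] regular_const)
   also have "\<dots> = 0" unfolding m1y uy using nz True by simp
   finally show ?thesis by (simp add: on_set_def)
  qed
 qed
 ultimately obtain A \<tau> where A: "open A" "pt \<in> A" "A \<subseteq> U" "\<tau> \<in> C 0 A" "d 0 A \<tau> = rs 1 U A ?\<nu>" "s 0 A \<tau> = on_set A (\<lambda>_. 0)"
  using lift_boundary[OF P(1) nu _ regular_zero _ P(2)] by blast
 have ADa: "A \<subseteq> Da" using A(3) P(3) by blast
 note rA = ratio_regular[OF ADa]
 let ?M = "rs 0 U A M" and ?w = "rs 0 U A w" and ?u' = "on_set A ?u"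
 have cl: "?M \<in> C 0 A" "?w \<in> C 0 A" "rs 1 U A \<mu> \<in> C 1 A" "rs 1 U A m1 \<in> C 1 A" by (intro om_res[OF omJ] P Q A)+
 have u': "?u' \<in> regular_on A" by (rule regular_restrict[OF u A(3)])
 have c1: "sm 0 A ?u' ?w \<in> C 0 A" "sm 0 A (ratio b a A) \<tau> \<in> C 0 A" by (intro om_smult[OF omJ] A u' rA cl)+
 let ?k = "ad 0 A (sm 0 A ?u' ?w) (sm 0 A (ratio b a A) \<tau>)"
 have kc: "?k \<in> C 0 A" by (rule om_add[OF omJ A(1) c1])
 have x1: "sm 1 A (ratio b a A) (rs 1 U A \<mu>) \<in> C 1 A" "sm 1 A (\<lambda>y. ?u' y * ratio b a A y) (rs 1 U A m1) \<in> C 1 A"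
  by (intro om_smult[OF omJ] A regular_mult u' rA cl)+
 have d1: "d 0 A (sm 0 A ?u' ?w) = sm 1 A (\<lambda>y. ?u' y * ratio b a A y) (rs 1 U A m1)"
  using hom_res[OF hom_d(3) P(1) A(1,3) P(7)] P(12) om_res_smult[OF omJ P(1) A(1,3) r P(4)]
  by (simp add: hom_smult[OF hom_d(3) A(1) u' cl(2)] ratio_restrict[OF A(3)] om_smult_smult[OF omJ A(1) u' rA cl(4)])
 have d2: "d 0 A (sm 0 A (ratio b a A) \<tau>) = sb 1 A (sm 1 A (ratio b a A) (rs 1 U A \<mu>)) (sm 1 A (\<lambda>y. ?u' y * ratio b a A y) (rs 1 U A m1))"
  by (simp add: hom_smult[OF hom_d(3) A(1) rA A(4)] A(5) om_res_sub[OF omJ P(1) A(1,3) Q(1) um] om_res_smult[OF omJ P(1) A(1,3) u P(4)]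
    om_smult_sub[OF omJ A(1) rA] cl om_smult[OF omJ A(1) u'] om_smult_smult[OF omJ A(1) rA u' cl(4)] mult.commute)
 have dk: "d 0 A ?k = d 0 A ?M"
  using hom_res[OF hom_d(3) P(1) A(1,3) Q(3)] Q(4) om_res_smult[OF omJ P(1) A(1,3) r Q(1)] om_sub_add[OF omJ A(1) x1]
  by (simp add: hom_add[OF hom_d(3) A(1) c1] d1 d2 ratio_restrict[OF A(3)])
 have "s 0 A ?k = (\<lambda>y. ?u' y * on_set A (on_set U (\<lambda>_. 1)) y + ratio b a A y * on_set A (\<lambda>_. 0) y)"
  by (simp add: s_add(1)[OF A(1) c1] s_smult(1)[OF A(1) u' cl(2)] s_smult(1)[OF A(1) rA A(4)] A(6) s_res(1)[OF P(1) A(1,3) P(7)] P(16))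
 hence sk: "s 0 A ?k = s 0 A ?M" unfolding s_res(1)[OF P(1) A(1,3) Q(3)] using A(3) by (auto simp: osf)
 from differ_by_boundary[OF A(1) kc cl(1) dk sk A(2)] obtain B e where B: "open B" "pt \<in> B" "B \<subseteq> A" "e \<in> C (-1) B"
  "rs 0 A B ?M = ad 0 B (rs 0 A B ?k) (d (-1) B e)" by (elim exE conjE)
 obtain k1 where k1: "k1 \<in> regular_on (onl A)" "\<forall>y\<in> onp A. k1 y = ratio b a A y * \<phi> A \<tau> y"
  using qsec_residue[OF tm_closed[OF t A(1,4)] A(1) ADa] by blast
 have kB: "rs 0 A B ?k \<in> C 0 B" "d (-1) B e \<in> C 0 B" by (intro om_res[OF omJ] A B kc hom_closed[OF hom_d(2)])+
 have BU: "B \<subseteq> U" "B \<subseteq> Da" using B(3) A(3) ADa by auto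
 have phi: "\<phi> U M y = ?u y * \<phi> U w y + ratio b a A y * \<phi> A \<tau> y" if y: "y \<in> B" for y
 proof -
  have yA: "y \<in> A" using y B(3) by auto
  have "\<phi> U M y = \<phi> A ?M y" by (rule tm_point[OF t P(1) A(1,3) Q(3) yA, symmetric])
  also have "\<dots> = \<phi> B (rs 0 A B ?M) y" by (rule tm_point[OF t A(1) B(1,3) cl(1) y, symmetric])
  also have "\<dots> = \<phi> B (rs 0 A B ?k) y" unfolding B(5) by (simp add: tm_add[OF t B(1) kB] tm_d[OF t B(1) _ B(4)])
  also have "\<dots> = \<phi> A ?k y" by (rule tm_point[OF t A(1) B(1,3) kc y])
  also have "\<dots> = ?u y * \<phi> A ?w y + ratio b a A y * \<phi> A \<tau> y"
   using yA by (simp add: tm_add[OF t A(1) c1] tm_smult[OF t A(1) u' cl(2)] tm_smult[OF t A(1) rA A(4)])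
  also have "\<phi> A ?w y = \<phi> U w y" by (rule tm_point[OF t P(1) A(1,3) P(7) yA])
  finally show ?thesis .
 qed
 let ?BL = "onl B"
 define g where "g = (\<lambda>y. on_set ?BL k y - (on_set ?BL ?u y * on_set ?BL k0 y + on_set ?BL (ratio b a B) y * on_set ?BL k1 y))"
 have "g pt = 0"
 proof (rule regular_line0_zero[OF _ B(1,2)])
  have rs: "on_set ?BL f \<in> regular_on ?BL" if "f \<in> regular_on W" "?BL \<subseteq> W" for f W by (rule regular_restrict[OF that])
  have sub: "?BL \<subseteq> onl U" "?BL \<subseteq> onl A" "?BL \<subseteq> U" "?BL \<subseteq> B" using BU(1) B(3) by auto
  show "g \<in> regular_on ?BL" unfolding g_def
   by (intro regular_diff regular_add regular_mult rs[OF k(1) sub(1)] rs[OF k0(1) sub(1)] rs[OF k1(1) sub(2)] rs[OF u sub(3)] rs[OF ratio_regular[OF BU(2)] sub(4)])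
  fix y assume y: "y \<in> ?BL - {pt}"
  hence yy: "y \<in> onp U" "y \<in> onp A" "y \<in> B" using BU B(3) by auto
  define r where "r = zc b y / zc a y"
  have "k y = r * \<phi> U M y" "k0 y = r * \<phi> U w y" "k1 y = r * \<phi> A \<tau> y" "ratio b a B y = r" "ratio b a A y = r"
   using bspec[OF k(2) yy(1)] bspec[OF k0(2) yy(1)] bspec[OF k1(2) yy(2)] yy by (simp_all add: ratio_in r_def)
  thus "g y = 0" using phi[OF yy(3)] y by (simp add: g_def algebra_simps)
 qed
 moreover have "ratio b a B pt = 0" using zc_pt(2)[of b] ab_distinct by (simp add: ratio_def on_set_def)
 moreover have "?u pt = 1" by (rule Q(5))
 ultimately show ?thesis using B(2) pt_line0 by (simp add: g_def)
qed

lemma p_cycle_value_unique: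
 assumes t: "tmap 0 \<phi>" and p: "p_datum N m1 mX mY mW E" and c: "p_cycle V \<mu> m"
  and k0: "k0 \<in> regular_on (onl N)" "\<forall>y\<in> onp N. k0 y = ratio b a N y * \<phi> N mW y"
  and k: "k \<in> regular_on (onl V)" "\<forall>y\<in> onp V. k y = ratio b a V y * \<phi> V m y"
 shows "k pt = k0 pt"
proof -
 note P = p_datumD[OF p]
 have Q: "open V" "pt \<in> V" "m \<in> C 0 V" using c by (simp_all add: p_cycle_def)
 let ?U = "V \<inter> N"
 have U: "open ?U" "pt \<in> ?U" using P Q by auto
 have r: "on_set (onl ?U) f \<in> regular_on (onl ?U) \<and> (\<forall>y\<in> onp ?U. on_set (onl ?U) f y = ratio b a ?U y * \<phi> ?U (rs 0 W ?U w) y)"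
  if "f \<in> regular_on (onl W)" "\<forall>y\<in> onp W. f y = ratio b a W y * \<phi> W w y" "open W" "?U \<subseteq> W" "w \<in> C 0 W" for f W w
  using regular_restrict[OF that(1), of "onl ?U"] that(2,4) tm_point[OF t that(3) U(1) that(4,5)] by (auto simp: ratio_def)
 note e0 = r[OF k0 P(1) Int_lower2 P(7)] and e = r[OF k Q(1) Int_lower1 Q(3)]
 have "on_set (onl ?U) k pt = on_set (onl ?U) k0 pt"
  by (rule p_cycle_value_unique_same[OF t p_datum_res[OF p U Int_lower2] p_cycle_res[OF c U Int_lower1] e0[THEN conjunct1] e0[THEN conjunct2] e[THEN conjunct1] e[THEN conjunct2]])
 thus ?thesis using U(2) pt_line0 by simp
qed

text \<open>The values on all lifts glue to one section over the punctured line. Near the marked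
  point the lift \<open>pz\<close> has minus the value of \<open>mX\<close> or \<open>mY\<close>,
  because \<open>zc i\<close> vanishes on the line; its pole is therefore at most simple, and a
  linear form results.\<close>

lemma ex_bcyc_value:
 assumes t: "tmap 0 \<phi>" and i: "i = 2 \<or> i = 3"
 shows "\<exists>x0 x1. \<forall>V w. bcyc i V w --> (\<forall>y\<in> onl V. \<phi> V w y = aff x0 x1 0 y)"
proof -
 define \<Theta> where "\<Theta> y = (SOME c. \<exists>V w. bcyc i V w \<and> y \<in> V \<and> c = \<phi> V w y)" for y
 have Th: "\<Theta> y = \<phi> V w y" if "bcyc i V w" "y \<in> V" for V w y
 proof -
  have "\<exists>c. \<exists>V w. bcyc i V w \<and> y \<in> V \<and> c = \<phi> V w y" using that by blast
  from someI_ex[OF this] obtain V' w' where "bcyc i V' w'" "y \<in> V'" "\<Theta> y = \<phi> V' w' y" unfolding \<Theta>_def[symmetric] by (elim exE conjE)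
  thus ?thesis using bcyc_value_unique[OF t that(1) _ that(2)] by metis
 qed
 obtain N m1 mX mY mW E where p: "p_datum N m1 mX mY mW E" using ex_p_datum[OF open_UNIV UNIV_I] by blast
 note P = p_datumD[OF p]
 let ?m = "if i = 2 then mX else mY"
 have m: "?m \<in> C 0 N" "d 0 N ?m = sm 1 N (ratio i a N) m1" "s 0 N ?m = (\<lambda>_. 0)" using i P by auto
 let ?V = "N \<inter> Db"
 have V: "open ?V" "?V \<subseteq> N" "?V \<subseteq> Db" using P(1) open_Db by auto
 have q: "bcyc i ?V (pz i N ?V mW ?m)" by (rule bcyc_pz[OF P(1,3,7,12,16,4) V m])
 have neg: "sm 0 N (on_set N (\<lambda>_. - 1)) ?m \<in> C 0 N" by (intro om_smult[OF omJ] P regular_const m)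
 have "\<exists>x0 x1. \<forall>y\<in>line0 - {pt}. \<Theta> y = x0 + x1 * (zc a y / zc b y)"
 proof (rule linear_of_local_sections[OF _ P(1,2,3) tm_closed[OF t P(1) neg]])
  show "\<forall>y\<in>line0 - {pt}. \<exists>V G. open V \<and> y \<in> V \<and> V \<subseteq> Db \<and> G \<in> qsec pt V \<and> (\<forall>u\<in> onl V. \<Theta> u = G u)"
  proof
   fix y assume "y \<in> line0 - {pt}"
   hence "y \<in> Db" using line0_Db by blast
   then obtain V w where w: "y \<in> V" "bcyc i V w" using ex_bcyc[OF open_Db subset_refl _ i] by blast
   note W = bcycD[OF w(2)]
   show "\<exists>V G. open V \<and> y \<in> V \<and> V \<subseteq> Db \<and> G \<in> qsec pt V \<and> (\<forall>u\<in> onl V. \<Theta> u = G u)"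
    by (rule exI[of _ V], rule exI[of _ "\<phi> V w"]) (use W w Th[OF w(2)] tm_closed[OF t W(1,3)] in simp)
  qed
  show "\<forall>u\<in> onp N. \<Theta> u = \<phi> N (sm 0 N (on_set N (\<lambda>_. - 1)) ?m) u"
  proof
   fix u assume u: "u \<in> onp N"
   hence uV: "u \<in> ?V" using line0_Db by auto
   have r: "ratio i b ?V \<in> regular_on ?V" by (rule ratio_regular[OF V(3)])
   have c: "rs 0 N ?V mW \<in> C 0 ?V" "rs 0 N ?V ?m \<in> C 0 ?V" by (intro om_res[OF omJ] P V m)+
   have "\<Theta> u = ratio i b ?V u * \<phi> ?V (rs 0 N ?V mW) u - \<phi> ?V (rs 0 N ?V ?m) u"
    unfolding Th[OF q uV] pz_def by (simp only: tm_sub[OF t V(1) om_smult[OF omJ V(1) r c(1)] c(2)] tm_smult[OF t V(1) r c(1)])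
   also have "ratio i b ?V u = 0" using u i by (auto simp: ratio_def on_set_def mem_line0)
   also have "\<phi> ?V (rs 0 N ?V ?m) u = \<phi> N ?m u" by (rule tm_point[OF t P(1) V(1,2) m(1) uV])
   finally show "\<Theta> u = \<phi> N (sm 0 N (on_set N (\<lambda>_. - 1)) ?m) u"
    using tm_smult[OF t P(1) regular_const m(1), of "-1"] u by simp
  qed
 qed
 then obtain x0 x1 where x: "\<forall>y\<in>line0 - {pt}. \<Theta> y = x0 + x1 * (zc a y / zc b y)" by blast
 have "\<phi> V w y = aff x0 x1 0 y" if "bcyc i V w" "y \<in> onl V" for V w y
 proof -
  have "y \<in> line0 - {pt}" using that bcycD(2)[OF that(1)] pt_Db by auto
  thus ?thesis using x Th[OF that(1), of y] that(2) by (simp add: aff_def)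
 qed
 thus ?thesis by blast
qed

text \<open>As in \<open>ex_bcyc_value\<close>, but near the marked point the value is
  \<open>zc a / zc b\<close> times the value on \<open>E\<close>: the pole may have order two, and a
  quadratic form results.\<close>

lemma ex_val1:
 assumes t: "tmap (-1) \<phi>"
 shows "\<exists>x. val1 \<phi> x"
proof -
 define \<Theta> where "\<Theta> y = (SOME c. \<exists>V zX zY e. b_datum V zX zY e \<and> y \<in> V \<and> c = \<phi> V e y)" for y
 have Th: "\<Theta> y = \<phi> V e y" if "b_datum V zX zY e" "y \<in> V" "y \<in> line0" for V zX zY e y
 proof -
  have "\<exists>c. \<exists>V zX zY e. b_datum V zX zY e \<and> y \<in> V \<and> c = \<phi> V e y" using that by blast
  from someI_ex[OF this] obtain V' zX' zY' e' where "b_datum V' zX' zY' e'" "y \<in> V'" "\<Theta> y = \<phi> V' e' y" unfolding \<Theta>_def[symmetric] by (elim exE conjE)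
  thus ?thesis using b_datum_value_unique[OF t that(1) _ that(2) _ that(3)] by metis
 qed
 obtain N m1 mX mY mW E where p: "p_datum N m1 mX mY mW E" using ex_p_datum[OF open_UNIV UNIV_I] by blast
 note P = p_datumD[OF p]
 let ?V = "N \<inter> Db"
 have V: "open ?V" "?V \<subseteq> N" "?V \<subseteq> Db" using P(1) open_Db by auto
 note q = b_datum_of_p_datum[OF p V]
 have "\<exists>x0 x1 x2. \<forall>y\<in>line0 - {pt}. \<Theta> y = x0 + x1 * (zc a y / zc b y) + x2 * (zc a y / zc b y)\<^sup>2"
 proof (rule quadratic_of_local_sections[OF _ P(1,2,3) tm_closed[OF t P(1,8)]])
  show "\<forall>y\<in>line0 - {pt}. \<exists>V G. open V \<and> y \<in> V \<and> V \<subseteq> Db \<and> G \<in> qsec pt V \<and> (\<forall>u\<in> onl V. \<Theta> u = G u)"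
  proof
   fix y assume "y \<in> line0 - {pt}"
   hence "y \<in> Db" using line0_Db by blast
   from ex_b_datum[OF open_Db subset_refl this] obtain V zX zY e where w: "y \<in> V" "b_datum V zX zY e" by (elim exE conjE)
   note W = b_datumD[OF w(2)]
   show "\<exists>V G. open V \<and> y \<in> V \<and> V \<subseteq> Db \<and> G \<in> qsec pt V \<and> (\<forall>u\<in> onl V. \<Theta> u = G u)"
    by (rule exI[of _ V], rule exI[of _ "\<phi> V e"]) (use W w Th[OF w(2)] tm_closed[OF t W(5,3)] in simp)
  qed
  show "\<forall>u\<in> onp N. \<Theta> u = zc a u / zc b u * \<phi> N E u"
  proof
   fix u assume u: "u \<in> onp N"
   hence uV: "u \<in> ?V" "u \<in> line0" using line0_Db by auto
   have c: "rs (-1) N ?V E \<in> C (-1) ?V" by (intro om_res[OF omJ] P V)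
   show "\<Theta> u = zc a u / zc b u * \<phi> N E u"
    unfolding Th[OF q uV] tm_smult[OF t V(1) ratio_regular[OF V(3)] c] using uV tm_point[OF t P(1) V(1,2) P(8) uV(1)]
    by (simp add: ratio_def)
  qed
 qed
 then obtain x0 x1 x2 where x: "\<forall>y\<in>line0 - {pt}. \<Theta> y = x0 + x1 * (zc a y / zc b y) + x2 * (zc a y / zc b y)\<^sup>2" by blast
 define v :: "complex^3" where "v = (\<chi> i. if i = 1 then x0 else if i = 2 then x1 else x2)"
 have v: "v $ 1 = x0" "v $ 2 = x1" "v $ 3 = x2" by (simp_all add: v_def)
 have "\<phi> V e y = aff x0 x1 x2 y" if "b_datum V zX zY e" "y \<in> onl V" for V zX zY e y
 proof -
  have "y \<in> line0 - {pt}" using that b_datumD(6)[OF that(1)] pt_Db by auto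
  thus ?thesis using x Th[OF that(1), of y] that(2) by (simp add: aff_def)
 qed
 hence "val1 \<phi> v" unfolding val1_def v by blast
 thus ?thesis by blast
qed

lemma ex_val0:
 assumes t: "tmap 0 \<phi>"
 shows "\<exists>x. val0 \<phi> x"
proof -
 obtain x0 x1 where x: "\<forall>V w. bcyc 2 V w --> (\<forall>y\<in> onl V. \<phi> V w y = aff x0 x1 0 y)" using ex_bcyc_value[OF t, of 2] by blast
 obtain x2 x3 where y: "\<forall>V w. bcyc 3 V w --> (\<forall>y\<in> onl V. \<phi> V w y = aff x2 x3 0 y)" using ex_bcyc_value[OF t, of 3] by blast
 obtain N m1 mX mY mW E where p: "p_datum N m1 mX mY mW E" using ex_p_datum[OF open_UNIV UNIV_I] by blast
 note P = p_datumD[OF p]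
 obtain k0 where k0: "k0 \<in> regular_on (onl N)" "\<forall>y\<in> onp N. k0 y = ratio b a N y * \<phi> N mW y"
  using qsec_residue[OF tm_closed[OF t P(1,7)] P(1,3)] by blast
 define v :: "complex^5" where "v = (\<chi> i. if i = 1 then x0 else if i = 2 then x1 else if i = 3 then x2 else if i = 4 then x3 else k0 pt)"
 have v: "v $ 1 = x0" "v $ 2 = x1" "v $ 3 = x2" "v $ 4 = x3" "v $ 5 = k0 pt" by (simp_all add: v_def)
 have "\<exists>k\<in>regular_on (onl V). k pt = k0 pt \<and> (\<forall>y\<in> onp V. k y = ratio b a V y * \<phi> V m y)" if c: "p_cycle V \<mu> m" for V \<mu> m
 proof -
  have "m \<in> C 0 V" "open V" "V \<subseteq> Da" using c by (simp_all add: p_cycle_def)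
  then obtain k where k: "k \<in> regular_on (onl V)" "\<forall>y\<in> onp V. k y = ratio b a V y * \<phi> V m y"
   using qsec_residue[OF tm_closed[OF t]] by blast
  thus ?thesis using p_cycle_value_unique[OF t p c k0 k] by blast
 qed
 hence "val0 \<phi> v" unfolding val0_def v using x y by blast
 thus ?thesis by blast
qed

lemma bcyc_at: "y \<in> line0 - {pt} ==> i = 2 \<or> i = 3 ==> \<exists>V w. y \<in> V \<and> bcyc i V w"
 using ex_bcyc[OF open_Db subset_refl, of y i] line0_Db by blast

text \<open>In the type \<open>3\<close> the numeral \<open>3\<close> denotes 0, so these are all
  the indices.\<close>

lemma exhaust3: "(i::3) = 1 \<or> i = 2 \<or> i = 3"
proof (induct i)
 case (of_int z)
 hence "z = 0 \<or> z = 1 \<or> z = 2" by auto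
 thus ?case by auto
qed

lemma val1_unique: "val1 \<phi> x ==> val1 \<phi> u ==> x = u"
proof -
 assume v: "val1 \<phi> x" "val1 \<phi> u"
 have "\<forall>y\<in>line0 - {pt}. aff (x$1) (x$2) (x$3) y = aff (u$1) (u$2) (u$3) y"
 proof
  fix y assume y: "y \<in> line0 - {pt}"
  hence "y \<in> Db" using line0_Db by blast
  from ex_b_datum[OF open_Db subset_refl this] obtain V zX zY e where w: "y \<in> V" "b_datum V zX zY e" by (elim exE conjE)
  thus "aff (x$1) (x$2) (x$3) y = aff (u$1) (u$2) (u$3) y" using v y unfolding val1_def by (metis DiffD1 IntI)
 qed
 hence "x $ 1 = u $ 1 \<and> x $ 2 = u $ 2 \<and> x $ 3 = u $ 3" by (rule aff_unique)
 thus "x = u" unfolding vec_eq_iff using exhaust3 by metis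
qed

lemma exhaust5: "(i::5) = 1 \<or> i = 2 \<or> i = 3 \<or> i = 4 \<or> i = 5"
proof (induct i)
 case (of_int z)
 hence "z = 0 \<or> z = 1 \<or> z = 2 \<or> z = 3 \<or> z = 4" by auto
 thus ?case by auto
qed

lemma val0_unique: "val0 \<phi> x ==> val0 \<phi> u ==> x = u"
proof -
 assume v: "val0 \<phi> x" "val0 \<phi> u"
 have "\<forall>y\<in>line0 - {pt}. aff (x$1) (x$2) 0 y = aff (u$1) (u$2) 0 y"
 proof
  fix y assume y: "y \<in> line0 - {pt}"
  obtain V w where "y \<in> V" "bcyc 2 V w" using bcyc_at[OF y, of 2] by blast
  thus "aff (x$1) (x$2) 0 y = aff (u$1) (u$2) 0 y" using v y unfolding val0_def by (metis DiffD1 IntI)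
 qed
 from aff_unique[OF this] have 1: "x $ 1 = u $ 1 \<and> x $ 2 = u $ 2" by simp
 have "\<forall>y\<in>line0 - {pt}. aff (x$3) (x$4) 0 y = aff (u$3) (u$4) 0 y"
 proof
  fix y assume y: "y \<in> line0 - {pt}"
  obtain V w where "y \<in> V" "bcyc 3 V w" using bcyc_at[OF y, of 3] by blast
  thus "aff (x$3) (x$4) 0 y = aff (u$3) (u$4) 0 y" using v y unfolding val0_def by (metis DiffD1 IntI)
 qed
 from aff_unique[OF this] have 2: "x $ 3 = u $ 3 \<and> x $ 4 = u $ 4" by simp
 obtain N m1 mX mY mW E where p: "p_datum N m1 mX mY mW E" using ex_p_datum[OF open_UNIV UNIV_I] by blast
 note P = p_datumD[OF p]
 obtain k where k: "k\<in>regular_on (onl N)" "k pt = x$5" "\<forall>y\<in> onp N. k y = ratio b a N y * \<phi> N mW y"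
  using v(1) p_cycle_of_p_datum[OF p] unfolding val0_def by blast
 obtain l where l: "l\<in>regular_on (onl N)" "l pt = u$5" "\<forall>y\<in> onp N. l y = ratio b a N y * \<phi> N mW y"
  using v(2) p_cycle_of_p_datum[OF p] unfolding val0_def by blast
 have "(\<lambda>y. k y - l y) pt = 0"
  by (rule regular_line0_zero[OF regular_diff[OF k(1) l(1)] P(1,2)]) (use k(3) l(3) in simp)
 hence "x $ 5 = u $ 5" using k l by simp
 thus "x = u" unfolding vec_eq_iff using 1 2 exhaust5 by metis
qed

lemma val1_add: "val1 \<phi> x ==> val1 \<psi> u ==> val1 (\<lambda>U m y. \<phi> U m y + \<psi> U m y) (x + u)"
 unfolding val1_def by (simp add: aff_def algebra_simps)

lemma val1_scale: "val1 \<phi> x ==> (\<And>U m y. y \<in> U ==> \<psi> U m y = c * \<phi> U m y) ==> val1 \<psi> (c *s x)"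
 unfolding val1_def by (simp add: aff_def algebra_simps)

lemma val0_add:
 assumes "val0 \<phi> x" "val0 \<psi> u" shows "val0 (\<lambda>U m y. \<phi> U m y + \<psi> U m y) (x + u)"
 unfolding val0_def
proof (intro conjI allI impI)
 fix V \<mu> m assume c: "p_cycle V \<mu> m"
 obtain k where k: "k\<in>regular_on (onl V)" "k pt = x$5" "\<forall>y\<in> onp V. k y = ratio b a V y * \<phi> V m y"
  using assms(1) c unfolding val0_def by blast
 obtain l where l: "l\<in>regular_on (onl V)" "l pt = u$5" "\<forall>y\<in> onp V. l y = ratio b a V y * \<psi> V m y"
  using assms(2) c unfolding val0_def by blast
 show "\<exists>k\<in>regular_on (onl V). k pt = (x + u) $ 5 \<and> (\<forall>y\<in> onp V. k y = ratio b a V y * (\<phi> V m y + \<psi> V m y))"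
  by (rule bexI[OF _ regular_add[OF k(1) l(1)]]) (use k l in \<open>simp add: algebra_simps\<close>)
qed (use assms in \<open>simp_all add: val0_def aff_def algebra_simps\<close>)

lemma val0_scale:
 assumes "val0 \<phi> x" "\<And>U m y. y \<in> U ==> \<psi> U m y = c * \<phi> U m y" shows "val0 \<psi> (c *s x)"
 unfolding val0_def
proof (intro conjI allI impI)
 fix V \<mu> m assume p: "p_cycle V \<mu> m"
 obtain k where k: "k\<in>regular_on (onl V)" "k pt = x$5" "\<forall>y\<in> onp V. k y = ratio b a V y * \<phi> V m y"
  using assms(1) p unfolding val0_def by blast
 have ck: "(\<lambda>y. c * k y) \<in> regular_on (onl V)" using k(1) unfolding regular_on_eq_tw by (rule tw_cmult)
 show "\<exists>k\<in>regular_on (onl V). k pt = (c *s x) $ 5 \<and> (\<forall>y\<in> onp V. k y = ratio b a V y * \<psi> V m y)"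
  by (rule bexI[OF _ ck]) (use k assms(2) in \<open>simp add: algebra_simps\<close>)
qed (use assms in \<open>simp_all add: val0_def aff_def algebra_simps\<close>)

end

section \<open>A criterion for quasi-isomorphisms to the complex of the pair\<close>

lemma O_hom_zero: "O_module F ==> O_module G ==> O_hom F G (\<lambda>U m. zs G U)"
 by (rule O_homI) (simp_all add: om_zero om_zero_left om_smult_zero om_res_zero)

lemma O_module_zero: "O_module (function_sheaf (\<lambda>_. {\<lambda>_. 0}))"
 using O_module_zero_sheaf by (simp add: zero_sheaf_def)

lemma O_hom_to_zero: "O_hom F (function_sheaf (\<lambda>_. {\<lambda>_. 0})) (\<lambda>U m. \<lambda>_. 0)"
 by (rule O_homI) (simp_all add: on_set_def)

lemma int_cases_3:
 fixes i :: int
 obtains "i > 1" | "i = 1" | "i = 0" | "i = -1" | "i < -1"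
 by linarith

context marked_line begin

lemma O_module_qsec: "O_module (Qsh pt)"
proof (rule O_module_function_sheaf)
 fix U :: "proj3 set" assume U: "open U"
 show "(\<lambda>_. 0) \<in> qsec pt U" unfolding qsec_iff[OF U] by (intro bexI[of _ "\<lambda>_. 0"] tw_zero) (simp add: qfun_def on_set_def)
 show "(\<lambda>x. f x + g x) \<in> qsec pt U" if "f \<in> qsec pt U" "g \<in> qsec pt U" for f g
 proof -
  from iffD1[OF qsec_iff[OF U] that(1)] obtain F where F: "F \<in> tw 1 (onl U)" "f = qfun U F" by (elim bexE)
  from iffD1[OF qsec_iff[OF U] that(2)] obtain G where G: "G \<in> tw 1 (onl U)" "g = qfun U G" by (elim bexE)
  show ?thesis unfolding qsec_iff[OF U]
   by (rule bexI[OF _ tw_add[OF F(1) G(1)]]) (simp add: F(2) G(2) qfun_def on_set_def add_divide_distrib fun_eq_iff)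
 qed
 show "(\<lambda>x. f x * g x) \<in> qsec pt U" if "f \<in> regular_on U" "g \<in> qsec pt U" for f g
 proof -
  from iffD1[OF qsec_iff[OF U] that(2)] obtain G where G: "G \<in> tw 1 (onl U)" "g = qfun U G" by (elim bexE)
  have f: "on_set (onl U) f \<in> tw 0 (onl U)" using that(1) unfolding regular_on_eq_tw by (rule tw_restrict) auto
  have "(\<lambda>x. on_set (onl U) f x * G x) \<in> tw 1 (onl U)" using tw_mult[OF f G(1)] by simp
  thus ?thesis unfolding qsec_iff[OF U]
   by (rule bexI[rotated]) (simp add: G(2) qfun_def osf)
 qed
 show "f x = 0" if "f \<in> qsec pt U" "x \<notin> U" for f x using qsec_outside[OF that(1), of x] that(2) by blast
 show restr: "on_set V f \<in> qsec pt V" if V: "open V" "V \<subseteq> U" "f \<in> qsec pt U" for V f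
 proof -
  from iffD1[OF qsec_iff[OF U] V(3)] obtain F where F: "F \<in> tw 1 (onl U)" "f = qfun U F" by (elim bexE)
  have "on_set V f = qfun V (on_set (onl V) F)" using V(2) by (auto simp: F(2) qfun_def osf)
  moreover have "on_set (onl V) F \<in> tw 1 (onl V)" by (rule tw_restrict[OF F(1)]) (use V(2) in auto)
  ultimately show ?thesis unfolding qsec_iff[OF V(1)] by blast
 qed
 fix f :: "fn"
 assume out: "\<And>x. x \<notin> U ==> f x = 0" and loc: "\<And>x. x \<in> U ==> \<exists>V. open V \<and> x \<in> V \<and> V \<subseteq> U \<and> on_set V f \<in> qsec pt V"
 have van: "f x = 0" if "x \<notin> line0 - {pt}" for x
 proof (cases "x \<in> U")
  case True
  from loc[OF this] obtain V where V: "open V" "x \<in> V" "V \<subseteq> U" "on_set V f \<in> qsec pt V" by (elim exE conjE)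
  have "x \<notin> onp V" using that by blast
  from qsec_outside[OF V(4) this] show ?thesis using V(2) by simp
 qed (rule out)
 \<comment> \<open>The value at the marked point of the numerator of \<open>f\<close>, read off from
   one local description; \<open>f\<close> itself is 0 there by convention.\<close>
 obtain c where c: "pt \<in> U ==> \<exists>V F. open V \<and> pt \<in> V \<and> V \<subseteq> U \<and> F \<in> tw 1 (onl V) \<and> on_set V f = qfun V F \<and> F pt = c" and c0: "pt \<notin> U ==> c = 0"
 proof (cases "pt \<in> U")
  case True
  from loc[OF this] obtain V where V: "open V" "pt \<in> V" "V \<subseteq> U" "on_set V f \<in> qsec pt V" by (elim exE conjE)
  from iffD1[OF qsec_iff[OF V(1)] V(4)] obtain F where "F \<in> tw 1 (onl V)" "on_set V f = qfun V F" by (elim bexE)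
  hence "\<exists>V' F'. open V' \<and> pt \<in> V' \<and> V' \<subseteq> U \<and> F' \<in> tw 1 (onl V') \<and> on_set V' f = qfun V' F' \<and> F' pt = F pt"
   using V(1-3) by (intro exI[of _ V] exI[of _ F] conjI) simp_all
  with True show ?thesis by (intro that[of "F pt"]) simp_all
 qed (use that[of 0] in simp)
 define G where "G x = (if x = pt then c else f x * zc b x)" for x
 have Gq: "G u = F u" if "F \<in> tw 1 (onl V)" "on_set V f = qfun V F" "u \<in> onl V" "u \<noteq> pt" for V F u
  using fun_cong[OF that(2), of u] that(3,4) line0_Db[of u] by (simp add: G_def qfun_def)
 have "G \<in> tw 1 (onl U)"
 proof (rule tw_local)
  show "G x = 0" if "x \<notin> onl U" for x
  proof (cases "x = pt")
   case True thus ?thesis using that pt_line0 c0 by (auto simp: G_def)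
  next
   case False thus ?thesis using that out[of x] van[of x] by (auto simp: G_def)
  qed
  fix x assume x: "x \<in> onl U"
  have "\<exists>V F. open V \<and> x \<in> V \<and> V \<subseteq> U \<and> F \<in> tw 1 (onl V) \<and> on_set V f = qfun V F \<and> (\<forall>u\<in> onl V. G u = F u)"
  proof (cases "x = pt")
   case True
   then obtain V' F where V': "open V'" "pt \<in> V'" "V' \<subseteq> U" "F \<in> tw 1 (onl V')" "on_set V' f = qfun V' F" "F pt = c"
    using c x by blast
   hence "G pt = F pt" by (simp add: G_def)
   hence "\<forall>u\<in> onl V'. G u = F u" using Gq[OF V'(4,5)] by metis
   thus ?thesis unfolding True by (intro exI[of _ V'] exI[of _ F] conjI V'(1-5))
  next
   case False
   have "x \<in> U" using x by simp
   from loc[OF this] obtain V where V: "open V" "x \<in> V" "V \<subseteq> U" "on_set V f \<in> qsec pt V" by (elim exE conjE)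
   let ?V = "V \<inter> Db"
   have o: "open ?V" "x \<in> ?V" "?V \<subseteq> V" using V open_Db line0_Db[of x] x False by auto
   from iffD1[OF qsec_iff[OF V(1)] V(4)] obtain F0 where F0: "F0 \<in> tw 1 (onl V)" "on_set V f = qfun V F0" by (elim bexE)
   let ?F = "on_set (onl ?V) F0"
   have F: "?F \<in> tw 1 (onl ?V)" by (rule tw_restrict[OF F0(1)]) auto
   have e: "on_set ?V f = qfun ?V ?F"
   proof
    fix u show "on_set ?V f u = qfun ?V ?F u"
     using fun_cong[OF F0(2), of u] van[of u] by (auto simp: qfun_def on_set_def)
   qed
   have "\<forall>u\<in> onl ?V. G u = ?F u" using Gq[OF F e] pt_Db by blast
   thus ?thesis using o V(3) F e by (intro exI[of _ ?V] exI[of _ ?F]) auto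
  qed
  then obtain V F where V: "open V" "x \<in> V" "V \<subseteq> U" "F \<in> tw 1 (onl V)" "\<forall>u\<in> onl V. G u = F u" by (elim exE conjE)
  have e: "onl U \<inter> V = onl V" using V(3) by blast
  show "\<exists>V g. open V \<and> x \<in> V \<and> g \<in> tw 1 (onl U \<inter> V) \<and> (\<forall>y\<in> onl U \<inter> V. G y = g y)"
   by (rule exI[of _ V], rule exI[of _ F], unfold e, intro conjI V)
 qed
 moreover have "f = qfun U G"
 proof
  fix u show "f u = qfun U G u"
   using van[of u] out[of u] line0_Db[of u] by (auto simp: qfun_def on_set_def G_def)
 qed
 ultimately show "f \<in> qsec pt U" unfolding qsec_iff[OF U] by blast
qed

text \<open>The complex of the pair is concentrated in degrees 0 and 1, and its boundaries in degree
  1 are the restrictions of regular functions to the punctured line; the hypotheses list what this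
  leaves to check, degree by degree.\<close>

lemma quasi_isoI:
 assumes bc: "bounded_complex K" and ch: "chain_map K (Ip a) s"
  and high: "\<And>i U m. i > 1 ==> open U ==> m \<in> car (obj K i) U ==> m = zs (obj K i) U"
  and inj1: "\<And>U x c g. open U ==> x \<in> U ==> c \<in> car (obj K 1) U ==> diff K 1 U c = zs (obj K 2) U ==>
   g \<in> regular_on U ==> s 1 U c = on_set (line0 - {pt}) g ==>
   \<exists>V j. open V \<and> x \<in> V \<and> V \<subseteq> U \<and> j \<in> car (obj K 0) V \<and> diff K 0 V j = res (obj K 1) U V c"
  and surj1: "\<And>U x n. open U ==> x \<in> U ==> n \<in> qsec pt U ==>
   \<exists>V m h. open V \<and> x \<in> V \<and> V \<subseteq> U \<and> m \<in> car (obj K 1) V \<and> h \<in> regular_on V \<and>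
    (\<forall>y\<in>V. n y = s 1 V m y + on_set (line0 - {pt}) h y)"
  and inj0: "\<And>U x e. open U ==> x \<in> U ==> e \<in> car (obj K 0) U ==> diff K 0 U e = zs (obj K 1) U ==> s 0 U e = (\<lambda>_. 0) ==>
   \<exists>V t. open V \<and> x \<in> V \<and> V \<subseteq> U \<and> t \<in> car (obj K (-1)) V \<and> diff K (-1) V t = res (obj K 0) U V e"
  and surj0: "\<And>U x g. open U ==> x \<in> U ==> g \<in> regular_on U ==> (\<forall>y\<in> onp U. g y = 0) ==>
   \<exists>V m. open V \<and> x \<in> V \<and> V \<subseteq> U \<and> m \<in> car (obj K 0) V \<and> diff K 0 V m = zs (obj K 1) V \<and> s 0 V m = on_set V g"
  and inj: "\<And>i U x e. i < 0 ==> open U ==> x \<in> U ==> e \<in> car (obj K i) U ==> diff K i U e = zs (obj K (i + 1)) U ==>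
   \<exists>V t. open V \<and> x \<in> V \<and> V \<subseteq> U \<and> t \<in> car (obj K (i - 1)) V \<and> diff K (i - 1) V t = res (obj K i) U V e"
 shows "quasi_iso K (Ip a) s"
 unfolding quasi_iso_def
proof (intro conjI allI impI ballI)
 note om = bounded_complex_module[OF bc]
 have hs: "O_hom (obj K i) (obj (Ip a) i) (s i)" for i using ch by (simp add: chain_map_def)
 fix i U and x :: proj3 assume U: "open U" and x: "x \<in> U"
 {
  fix m assume m: "m \<in> cycles K i U" and b: "s i U m \<in> boundaries (Ip a) i U"
  have mc: "m \<in> car (obj K i) U" "diff K i U m = zs (obj K (i + 1)) U" using m by (simp_all add: cycles_def)
  consider "i > 1" | "i = 1" | "i = 0" | "i < 0" by linarith
  hence "\<exists>V t. open V \<and> x \<in> V \<and> V \<subseteq> U \<and> t \<in> car (obj K (i - 1)) V \<and> diff K (i - 1) V t = res (obj K i) U V m"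
  proof cases
   case 1
   have h: "O_hom (obj K (i - 1)) (obj K i) (diff K (i - 1))" by (rule bounded_complex_hom[OF bc]) simp
   have "m = zs (obj K i) U" by (rule high[OF 1 U mc(1)])
   hence "diff K (i - 1) U (zs (obj K (i - 1)) U) = res (obj K i) U U m"
    using hom_zero[OF om om h U] om_res_zero[OF om U U subset_refl] by simp
   thus ?thesis using U x om_zero[OF om U] by blast
  next
   case 2
   obtain g where "g \<in> regular_on U" "s 1 U m = on_set (line0 - {pt}) g" using b 2 by (auto simp: boundaries_def I_obj I_diff)
   thus ?thesis using inj1[OF U x _ _ , of m g] mc 2 by simp
  next
   case 3
   have "s 0 U m = (\<lambda>_. 0)" using b 3 by (auto simp: boundaries_def I_obj I_diff)
   thus ?thesis using inj0[OF U x, of m] mc 3 by simp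
  next
   case 4
   show ?thesis by (rule inj[OF 4 U x mc])
  qed
  then obtain V t where V: "open V" "x \<in> V" "V \<subseteq> U" "t \<in> car (obj K (i - 1)) V" "diff K (i - 1) V t = res (obj K i) U V m" by (elim exE conjE)
  have "res (obj K i) U V m \<in> boundaries K i V" unfolding boundaries_def V(5)[symmetric] by (rule imageI[OF V(4)])
  thus "\<exists>V. open V \<and> x \<in> V \<and> V \<subseteq> U \<and> res (obj K i) U V m \<in> boundaries K i V" using V(1-3) by blast
 }
 fix n assume n: "n \<in> cycles (Ip a) i U"
 let ?G = "\<lambda>V. \<exists>m\<in>cycles K i V. \<exists>b\<in>boundaries (Ip a) i V.
    res (obj (Ip a) i) U V n = s i V m \<boxplus>[obj (Ip a) i,V] b"
 consider "i = 1" | "i = 0" | "i \<noteq> 0" "i \<noteq> 1" by linarith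
 thus "\<exists>V. open V \<and> x \<in> V \<and> V \<subseteq> U \<and> ?G V"
 proof cases
  case 1
  have nq: "n \<in> qsec pt U" using n 1 by (simp add: cycles_def I_obj)
  from surj1[OF U x nq] obtain V m h where V: "open V" "x \<in> V" "V \<subseteq> U"
   and m: "m \<in> car (obj K 1) V" "h \<in> regular_on V" "\<forall>y\<in>V. n y = s 1 V m y + on_set (line0 - {pt}) h y" by (elim exE conjE)
  have h1: "O_hom (obj K 1) (obj K 2) (diff K 1)" by (rule bounded_complex_hom[OF bc]) simp
  have "diff K 1 V m = zs (obj K 2) V" by (rule high[OF _ V(1) hom_closed[OF h1 V(1) m(1)]]) simp
  hence mcy: "m \<in> cycles K 1 V" using m(1) by (simp add: cycles_def)
  have hb: "on_set (line0 - {pt}) h \<in> boundaries (Ip a) 1 V" using m(2) by (auto simp: boundaries_def I_obj I_diff)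
  have "s 1 V m \<in> qsec pt V" using hom_closed[OF hs[of 1] V(1) m(1)] by (simp add: I_obj)
  hence "on_set V n = (\<lambda>y. s 1 V m y + on_set (line0 - {pt}) h y)"
   using m(3) qsec_outside[of "s 1 V m" V] regular_outside[OF m(2)] by (auto simp: osf)
  hence "?G V" unfolding 1 using mcy hb by (intro bexI[of _ m] bexI[of _ "on_set (line0 - {pt}) h"]) (simp_all add: I_obj)
  thus ?thesis using V by blast
 next
  case 2
  have nr: "n \<in> regular_on U" and "on_set (line0 - {pt}) n = (\<lambda>_. 0)" using n 2 by (simp_all add: cycles_def I_obj I_diff)
  hence "\<forall>y\<in> onp U. n y = 0" by (metis DiffE DiffI IntD2 on_set_in)
  from surj0[OF U x nr this] obtain V m where V: "open V" "x \<in> V" "V \<subseteq> U"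
   and m: "m \<in> car (obj K 0) V" "diff K 0 V m = zs (obj K 1) V" "s 0 V m = on_set V n" by (elim exE conjE)
  have "?G V" unfolding 2 using m
   by (intro bexI[of _ m] bexI[of _ "\<lambda>_. 0"]) (auto simp: I_obj I_diff boundaries_def cycles_def)
  thus ?thesis using V by blast
 next
  case 3
  have h: "O_hom (obj K i) (obj K (i + 1)) (diff K i)" by (rule bounded_complex_hom[OF bc]) simp
  have "n = (\<lambda>_. 0)" using n 3 by (simp add: cycles_def I_obj)
  moreover have "s i U (zs (obj K i) U) = (\<lambda>_. 0)" using hom_closed[OF hs[of i] U om_zero[OF om U]] 3 by (simp add: I_obj)
  moreover have "zs (obj K i) U \<in> cycles K i U" using hom_zero[OF om om h U] om_zero[OF om U] by (simp add: cycles_def)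
  moreover have "(\<lambda>_. 0) \<in> boundaries (Ip a) i U"
  \<comment> \<open>In degree 2 the boundaries come from the sheaf of the pair, in the other degrees
    considered from a zero sheaf.\<close>
  proof (cases "i = 2")
   case True thus ?thesis by (auto simp: boundaries_def I_obj I_diff intro!: image_eqI[of _ _ "\<lambda>_. 0"]) (use om_zero[OF O_module_qsec U] in simp)
  next
   case False thus ?thesis using 3 by (simp add: boundaries_def I_obj I_diff)
  qed
  ultimately have "?G U" by (intro bexI[of _ "zs (obj K i) U"] bexI[of _ "\<lambda>_. 0"]) (simp_all add: I_obj(3)[OF 3] on_set_def)
  thus ?thesis using U x by blast
 qed
qed (rule ch)

end

lemma chain_map_hom: "chain_map K L \<phi> ==> O_hom (obj K i) (obj L i) (\<phi> i)"
 by (simp add: chain_map_def)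

lemma chain_map_commute: "chain_map K L \<phi> ==> i + 1 = j ==> open U ==> m \<in> car (obj K i) U ==>
  \<phi> j U (diff K i U m) = diff L i U (\<phi> i U m)"
 by (auto simp: chain_map_def)

lemma chain_map_comp:
 assumes "chain_map K L \<phi>" "chain_map L M \<psi>" shows "chain_map K M (cmap_comp \<psi> \<phi>)"
 unfolding chain_map_def
proof (intro conjI allI impI ballI)
 show "O_hom (obj K i) (obj M i) (cmap_comp \<psi> \<phi> i)" for i
  unfolding cmap_comp_def by (rule O_hom_comp[OF chain_map_hom[OF assms(1)] chain_map_hom[OF assms(2)]])
 show "cmap_comp \<psi> \<phi> (i + 1) U (diff K i U m) = diff M i U (cmap_comp \<psi> \<phi> i U m)"
  if "open U" "m \<in> car (obj K i) U" for i U m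
  unfolding cmap_comp_def chain_map_commute[OF assms(1) refl that]
  by (rule chain_map_commute[OF assms(2) refl that(1) hom_closed[OF chain_map_hom[OF assms(1)] that]])
qed

lemma sub_function_sheaf [simp]: "sub (function_sheaf S) U f g = (\<lambda>y. f y + on_set U (\<lambda>_. - 1) y * g y)"
 by (simp add: sub_def)

text \<open>The legs are compared up to homotopy because \<open>roof_rel\<close> provides no more
  for the second of two related roofs.\<close>

locale roof_map = J: resolved a b J s + M: resolved a b M sM
 for a b :: 4 and J s M sM +
 fixes u
 assumes chain_u: "chain_map M J u" and hom_su: "homotopic M (Ip a) sM (cmap_comp s u)"
begin

lemma u_closed: "open U ==> m \<in> M.C i U ==> u i U m \<in> J.C i U"
 by (rule hom_closed[OF chain_map_hom[OF chain_u]])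

lemma u_d: "open U ==> m \<in> M.C (-1) U ==> u 0 U (M.d (-1) U m) = J.d (-1) U (u (-1) U m)"
 "open U ==> m \<in> M.C 0 U ==> u 1 U (M.d 0 U m) = J.d 0 U (u 0 U m)"
 "open U ==> m \<in> M.C 1 U ==> u 2 U (M.d 1 U m) = J.d 1 U (u 1 U m)"
 using chain_map_commute[OF chain_u] by simp_all

lemma u_zero: "open U ==> u i U (M.z i U) = J.z i U"
 by (rule hom_zero[OF M.omJ J.omJ chain_map_hom[OF chain_u]])

text \<open>The complex of the pair is zero in degree -1, so a homotopy contributes in degree 0 only
  through the boundary of \<open>m\<close>.\<close>

lemma s_u:
 "\<exists>h. O_hom (obj M 1) (function_sheaf regular_on) h \<and>
  (\<forall>U m. open U --> m \<in> M.C 0 U --> sM 0 U m = (\<lambda>y. s 0 U (u 0 U m) y + h U (M.d 0 U m) y))"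
proof -
 from hom_su obtain h where h: "\<forall>i. O_hom (obj M i) (obj (Ip a) (i - 1)) (h i)"
  "\<forall>i U. open U --> (\<forall>m\<in>M.C i U. sM i U m = cmap_comp s u i U m \<boxplus>[obj (Ip a) i,U]
    (diff (Ip a) (i - 1) U (h i U m) \<boxplus>[obj (Ip a) i,U] h (i + 1) U (M.d i U m)))"
  unfolding homotopic_def by (elim exE conjE)
 show ?thesis
 proof (rule exI[of _ "h 1"], intro conjI allI impI)
  show "O_hom (obj M 1) (function_sheaf regular_on) (h 1)" using h(1)[rule_format, of 1] by (simp add: J.I_obj)
  show "sM 0 U m = (\<lambda>y. s 0 U (u 0 U m) y + h 1 U (M.d 0 U m) y)" if "open U" "m \<in> M.C 0 U" for U m
   using h(2)[rule_format, OF that] by (simp add: J.I_obj J.I_diff cmap_comp_def)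
 qed
qed

lemma bcyc_push: "M.bcyc i V w ==> J.bcyc i V (u 0 V w)"
proof -
 assume w: "M.bcyc i V w"
 note W = M.bcycD[OF w]
 from s_u obtain h where h: "O_hom (obj M 1) (function_sheaf regular_on) h"
  and h2: "\<forall>U m. open U --> m \<in> M.C 0 U --> sM 0 U m = (\<lambda>y. s 0 U (u 0 U m) y + h U (M.d 0 U m) y)" by (elim exE conjE)
 have "h V (M.z 1 V) = (\<lambda>_. 0)" using hom_smult[OF h W(1) regular_zero om_zero[OF M.omJ W(1)]] om_smult_zero[OF M.omJ W(1) regular_zero] by simp
 hence "s 0 V (u 0 V w) = J.ratio i b V" using h2[rule_format, OF W(1,3)] W(4,5) by simp
 thus ?thesis unfolding J.bcyc_def using W u_closed[OF W(1,3)] u_d(2)[OF W(1,3)] u_zero[OF W(1), of 1] by simp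
qed

lemma u_smult: "open U ==> f \<in> regular_on U ==> m \<in> M.C i U ==> u i U (M.sm i U f m) = J.sm i U f (u i U m)"
 by (rule hom_smult[OF chain_map_hom[OF chain_u]])

lemma b_datum_push: "M.b_datum V zX zY e ==> J.b_datum V (u 0 V zX) (u 0 V zY) (u (-1) V e)"
proof -
 assume D: "M.b_datum V zX zY e"
 note D' = M.b_datumD[OF D]
 note r = J.ratio_regular[OF D'(6)]
 have c: "M.sm 0 V (J.ratio 3 b V) zX \<in> M.C 0 V" "M.sm 0 V (J.ratio 2 b V) zY \<in> M.C 0 V" by (intro om_smult[OF M.omJ] D' r)+
 have "J.d (-1) V (u (-1) V e) = u 0 V (M.sb 0 V (M.sm 0 V (J.ratio 3 b V) zX) (M.sm 0 V (J.ratio 2 b V) zY))"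
  using u_d(1)[OF D'(5,3)] D'(4) by simp
 also have "\<dots> = J.sb 0 V (J.sm 0 V (J.ratio 3 b V) (u 0 V zX)) (J.sm 0 V (J.ratio 2 b V) (u 0 V zY))"
  by (simp add: hom_sub[OF M.omJ chain_map_hom[OF chain_u] D'(5) c] u_smult[OF D'(5) r] D')
 finally show ?thesis unfolding J.b_datum_def using bcyc_push D'(1,2) u_closed[OF D'(5,3)] by simp
qed

lemma p_cycle_push: "M.p_cycle V \<mu> m ==> J.p_cycle V (u 1 V \<mu>) (u 0 V m)"
proof -
 assume "M.p_cycle V \<mu> m"
 hence Q: "open V" "J.pt \<in> V" "V \<subseteq> J.Da" "\<mu> \<in> M.C 1 V" "M.d 1 V \<mu> = M.z 2 V" "m \<in> M.C 0 V" "M.d 0 V m = M.sm 1 V (J.ratio b a V) \<mu>" "sM 0 V m J.pt = 1"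
  by (simp_all add: M.p_cycle_def)
 note r = J.ratio_regular[OF Q(3)]
 from s_u obtain h where h: "O_hom (obj M 1) (function_sheaf regular_on) h"
  and h2: "\<forall>U m. open U --> m \<in> M.C 0 U --> sM 0 U m = (\<lambda>y. s 0 U (u 0 U m) y + h U (M.d 0 U m) y)" by (elim exE conjE)
 have "h V (M.d 0 V m) = (\<lambda>y. J.ratio b a V y * h V \<mu> y)" using hom_smult[OF h Q(1) r Q(4)] Q(7) by simp
 moreover have "J.ratio b a V J.pt = 0" using J.zc_pt(2)[of b] J.ab_distinct by (simp add: J.ratio_def on_set_def)
 ultimately have "s 0 V (u 0 V m) J.pt = 1" using h2[rule_format, OF Q(1,6)] Q(8) by simp
 thus ?thesis unfolding J.p_cycle_def
  using Q u_closed[OF Q(1,4)] u_closed[OF Q(1,6)] u_d(2)[OF Q(1,6)] u_d(3)[OF Q(1,4)] u_zero[OF Q(1), of 2] u_smult[OF Q(1) r Q(4)] by simp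
qed

text \<open>A homotopy changes the value on \<open>e\<close> by its value on Y x - X y, which
  vanishes on the line.\<close>

lemma val1_push:
 assumes v: "J.val1 \<phi> x" and h: "O_hom (obj M 0) (Qsh J.pt) h"
  and eq: "\<And>V e. open V ==> e \<in> M.C (-1) V ==> \<psi> V e = (\<lambda>y. \<phi> V (u (-1) V e) y + h V (M.d (-1) V e) y)"
 shows "M.val1 \<psi> x"
 unfolding M.val1_def
proof (intro allI impI ballI)
 fix V zX zY e y assume D: "M.b_datum V zX zY e" and y: "y \<in> onl V"
 note D' = M.b_datumD[OF D]
 note r = J.ratio_regular[OF D'(6)]
 have c: "M.sm 0 V (J.ratio 3 b V) zX \<in> M.C 0 V" "M.sm 0 V (J.ratio 2 b V) zY \<in> M.C 0 V" by (intro om_smult[OF M.omJ] D' r)+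
 have "h V (M.d (-1) V e) y = J.ratio 3 b V y * h V zX y + on_set V (\<lambda>_. - 1) y * (J.ratio 2 b V y * h V zY y)"
  unfolding D'(4) by (simp add: hom_sub[OF M.omJ h D'(5) c] hom_smult[OF h D'(5) r] D')
 also have "\<dots> = 0" using y by (simp add: J.ratio_def mem_line0)
 finally show "\<psi> V e y = J.aff (x $ 1) (x $ 2) (x $ 3) y"
  using eq[OF D'(5,3)] v b_datum_push[OF D] y unfolding J.val1_def by simp
qed

text \<open>On cycles the homotopy contributes nothing. On \<open>m\<close> it contributes
  \<open>zc b / zc a\<close> times \<open>h V \<mu>\<close>, which has at most a simple pole; a
  further factor \<open>zc b / zc a\<close> makes the contribution 0 at the marked point.\<close>

lemma val0_push:
 assumes v: "J.val0 \<phi> x" and h: "O_hom (obj M 1) (Qsh J.pt) h"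
  and eq: "\<And>V m. open V ==> m \<in> M.C 0 V ==> \<psi> V m = (\<lambda>y. \<phi> V (u 0 V m) y + h V (M.d 0 V m) y)"
 shows "M.val0 \<psi> x"
proof -
 have bc: "\<psi> V w y = \<phi> V (u 0 V w) y" if w: "M.bcyc i V w" for i V w y
 proof -
  note W = M.bcycD[OF w]
  have "h V (M.z 1 V) = (\<lambda>_. 0)" using hom_smult[OF h(1) W(1) regular_zero om_zero[OF M.omJ W(1)]] om_smult_zero[OF M.omJ W(1) regular_zero] by simp
  thus ?thesis using eq[OF W(1,3)] W(4) by simp
 qed
 have 1: "\<forall>V w. M.bcyc 2 V w --> (\<forall>y\<in> onl V. \<psi> V w y = J.aff (x$1) (x$2) 0 y)"
 proof (intro allI impI ballI)
  fix V w y assume w: "M.bcyc 2 V w" "y \<in> onl V"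
  show "\<psi> V w y = J.aff (x$1) (x$2) 0 y"
   unfolding bc[OF w(1)] by (rule v[unfolded J.val0_def, THEN conjunct1, rule_format, OF bcyc_push[OF w(1)] w(2)])
 qed
 have 2: "\<forall>V w. M.bcyc 3 V w --> (\<forall>y\<in> onl V. \<psi> V w y = J.aff (x$3) (x$4) 0 y)"
 proof (intro allI impI ballI)
  fix V w y assume w: "M.bcyc 3 V w" "y \<in> onl V"
  show "\<psi> V w y = J.aff (x$3) (x$4) 0 y"
   unfolding bc[OF w(1)] by (rule v[unfolded J.val0_def, THEN conjunct2, THEN conjunct1, rule_format, OF bcyc_push[OF w(1)] w(2)])
 qed
 have 3: "\<exists>k\<in>regular_on (onl V). k J.pt = x$5 \<and> (\<forall>y\<in> onl V - {J.pt}. k y = J.ratio b a V y * \<psi> V m y)" if c: "M.p_cycle V \<mu> m" for V \<mu> m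
 proof -
  have Q: "open V" "J.pt \<in> V" "V \<subseteq> J.Da" "\<mu> \<in> M.C 1 V" "m \<in> M.C 0 V" "M.d 0 V m = M.sm 1 V (J.ratio b a V) \<mu>"
   using c by (simp_all add: M.p_cycle_def)
  note r = J.ratio_regular[OF Q(3)]
  obtain k where k: "k\<in>regular_on (onl V)" "k J.pt = x$5" "\<forall>y\<in> onl V - {J.pt}. k y = J.ratio b a V y * \<phi> V (u 0 V m) y"
   using v p_cycle_push[OF c] unfolding J.val0_def by blast
  have hm: "h V \<mu> \<in> qsec J.pt V" using hom_closed[OF h Q(1,4)] by simp
  from J.qsec_residue[OF hm Q(1,3)] obtain l where l: "l\<in>regular_on (onl V)" "\<forall>y\<in> onl V - {J.pt}. l y = J.ratio b a V y * h V \<mu> y" by (elim bexE)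
  have rL: "J.ratio b a (onl V) \<in> regular_on (onl V)" by (rule J.ratio_regular) (use Q(3) in auto)
  show ?thesis
  proof (rule bexI[OF _ regular_add[OF k(1) regular_mult[OF rL l(1)]]], intro conjI ballI)
   have "J.ratio b a (onl V) J.pt = 0" using J.zc_pt(2)[of b] J.ab_distinct by (simp add: J.ratio_def on_set_def)
   thus "k J.pt + J.ratio b a (onl V) J.pt * l J.pt = x $ 5" using k(2) by simp
   fix y assume y: "y \<in> onl V - {J.pt}"
   have e: "h V (M.d 0 V m) = (\<lambda>y. J.ratio b a V y * h V \<mu> y)" using hom_smult[OF h Q(1) r Q(4)] Q(6) by simp
   have "J.ratio b a (onl V) y = J.ratio b a V y" using y by (simp add: J.ratio_in)
   thus "k y + J.ratio b a (onl V) y * l y = J.ratio b a V y * \<psi> V m y"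
    using bspec[OF k(3) y] bspec[OF l(2) y] by (simp add: eq[OF Q(1,5)] e distrib_left)
  qed
 qed
 show ?thesis unfolding M.val0_def using 1 2 3 by blast
qed

end

subsection \<open>A common roof\<close>

context marked_line begin

lemma qsec_generator_at_pt:
 assumes "n \<in> qsec pt U" "open U" "pt \<in> U" "open N" "pt \<in> N" "N \<subseteq> Da"
 shows "\<exists>V c. open V \<and> pt \<in> V \<and> V \<subseteq> U \<and> V \<subseteq> N \<and> c \<in> regular_on V \<and> (\<forall>y\<in>V. n y = c y * qfun V (zc a) y)"
proof -
 from iffD1[OF qsec_iff[OF assms(2)] assms(1)] obtain G where G: "G \<in> tw 1 (onl U)" "n = qfun U G" by (elim bexE)
 let ?W = "U \<inter> N"
 have W: "open ?W" "pt \<in> ?W" using assms by auto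
 let ?g = "\<lambda>y. on_set (onl ?W) G y / on_set (onl ?W) (zc a) y"
 have "?g \<in> tw 0 (onl ?W)"
  by (rule tw_divide[OF tw_restrict[OF G(1)] tw_coord]) (use assms(6) in auto)
 from tw_extend_from_line0[OF this W pt_line0] obtain V c where V: "open V" "pt \<in> V" "V \<subseteq> ?W" "c \<in> tw 0 V"
  and c: "\<forall>y\<in> onl V. c y = ?g y" by (elim exE conjE)
 have "n y = c y * qfun V (zc a) y" if y: "y \<in> V" for y
 proof (cases "y \<in> line0 - {pt}")
  case True
  hence "y \<in> U" "y \<in> N" "zc a y \<noteq> 0" using y V(3) assms(6) by auto
  thus ?thesis using bspec[OF c, of y] y True by (simp add: G(2) qfun_def)
 next
  case False
  hence "qfun U G y = 0" "qfun V (zc a) y = 0" unfolding qfun_def by (auto intro!: on_set_out)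
  thus ?thesis by (simp add: G(2))
 qed
 thus ?thesis using V by (intro exI[of _ V] exI[of _ c]) (simp add: regular_on_eq_tw)
qed

lemma qsec_regular_off_pt:
 assumes "n \<in> qsec pt U" "open U" "x \<in> U" "x \<noteq> pt"
 shows "\<exists>V h. open V \<and> x \<in> V \<and> V \<subseteq> U \<and> h \<in> regular_on V \<and> (\<forall>y\<in>V. n y = on_set (line0 - {pt}) h y)"
proof (cases "x \<in> line0")
 case True
 from iffD1[OF qsec_iff[OF assms(2)] assms(1)] obtain G where G: "G \<in> tw 1 (onl U)" "n = qfun U G" by (elim bexE)
 let ?W = "U \<inter> Db"
 have W: "open ?W" "x \<in> ?W" using assms True line0_Db open_Db by auto
 let ?g = "\<lambda>y. on_set (onl ?W) G y / on_set (onl ?W) (zc b) y"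
 have "?g \<in> tw 0 (onl ?W)"
  by (rule tw_divide[OF tw_restrict[OF G(1)] tw_coord]) auto
 from tw_extend_from_line0[OF this W True] obtain V h where V: "open V" "x \<in> V" "V \<subseteq> ?W" "h \<in> tw 0 V"
  and h: "\<forall>y\<in> onl V. h y = ?g y" by (elim exE conjE)
 have "n y = on_set (line0 - {pt}) h y" if y: "y \<in> V" for y
 proof (cases "y \<in> line0 - {pt}")
  case True
  hence "y \<in> U" "y \<in> Db" using y V(3) by auto
  thus ?thesis using bspec[OF h, of y] y True by (simp add: G(2) qfun_def)
 next
  case False
  hence "qfun U G y = 0" unfolding qfun_def by (auto intro!: on_set_out)
  thus ?thesis unfolding on_set_out[OF False] by (simp add: G(2))
 qed
 thus ?thesis using V by (intro exI[of _ V] exI[of _ h]) (simp add: regular_on_eq_tw)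
next
 case False
 have "n y = 0" if "y \<in> U - line0" for y using qsec_outside[OF assms(1), of y] that by blast
 moreover have "open (U - line0)" unfolding Diff_eq by (rule open_Int[OF assms(2) open_compl_line0])
 ultimately show ?thesis using False assms(3) regular_zero
  by (intro exI[of _ "U - line0"] exI[of _ "\<lambda>_. 0"]) (auto simp: on_set_def)
qed

lemma homotopic_of_eq:
 assumes K: "\<And>i. O_module (obj K i)"
  and h: "\<And>i. O_hom (obj K i) (obj (Ip a) i) (g i)"
  and eq: "\<And>U m. open U ==> m \<in> car (obj K 0) U ==> f 0 U m = g 0 U m"
  "\<And>U m. open U ==> m \<in> car (obj K 1) U ==> f 1 U m = g 1 U m"
  and h': "\<And>i. O_hom (obj K i) (obj (Ip a) i) (f i)"
 shows "homotopic K (Ip a) f g"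
proof -
 have omI: "O_module (obj (Ip a) i)" for i
  using O_module_qsec O_module_zero O_module_struct_sheaf by (cases "i = 0"; cases "i = 1") (simp_all add: I_obj struct_sheaf_def)
 have hz: "O_hom (obj K i) (obj (Ip a) (i - 1)) (\<lambda>U m. \<lambda>_. 0)" for i
 proof -
  have "zs (obj (Ip a) (i - 1)) U = (\<lambda>_. 0)" for U
   by (cases "i - 1 = 0"; cases "i - 1 = 1") (simp_all add: I_obj)
  thus ?thesis using O_hom_zero[OF K omI, of i "i - 1"] by simp
 qed
 show ?thesis unfolding homotopic_def
 proof (rule exI[of _ "\<lambda>i U m. \<lambda>_. 0"], intro conjI allI impI ballI)
  fix i U m assume U: "open (U::proj3 set)" and m: "m \<in> car (obj K i) U"
  have z: "diff (Ip a) (i - 1) U (\<lambda>_. 0) = (\<lambda>_. 0)" by (cases "i = 1") (auto simp: I_diff on_set_def)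
  consider "i = 0" | "i = 1" | "i \<noteq> 0" "i \<noteq> 1" by blast
  thus "f i U m = g i U m \<boxplus>[obj (Ip a) i,U]
   (diff (Ip a) (i - 1) U (\<lambda>_. 0) \<boxplus>[obj (Ip a) i,U] (\<lambda>_. 0))"
  proof cases
   case 1 thus ?thesis using eq(1)[OF U] m unfolding z by (simp add: I_obj)
  next
   case 2 thus ?thesis using eq(2)[OF U] m unfolding z by (simp add: I_obj)
  next
   case 3
   have "f i U m = (\<lambda>_. 0)" "g i U m = (\<lambda>_. 0)" using hom_closed[OF h U m] hom_closed[OF h' U m] 3 by (simp_all add: I_obj)
   thus ?thesis unfolding z by (simp add: I_obj(3)[OF 3])
  qed
 qed (rule hz)
qed

end

context resolved begin

lemma lift_res:
 assumes U: "open U" "e \<in> C i U" and V: "open V" "V \<subseteq> U" "t \<in> C j V" "d j V t = rs i U V e" and j: "j + 1 = i" and W: "open W" "W \<subseteq> V"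
 shows "rs j V W t \<in> C j W" "d j W (rs j V W t) = rs i U W e"
 using om_res[OF omJ V(1) W V(3)] hom_res[OF bounded_complex_hom[OF bc j] V(1) W V(3)] V(4) om_res_res[OF omJ U(1) V(1) W V(2) U(2)] by simp_all

end

locale roof_gen = resolved + fixes N m1 mX mY mW E assumes pd: "p_datum N m1 mX mY mW E"
begin

lemmas P = p_datumD[OF pd]

abbreviation g where "g \<equiv> gen_hom (obj J 1) N m1"

lemma hom_g: "O_hom (function_sheaf (ext_zero N)) (obj J 1) g"
 by (rule O_hom_gen_hom[OF omJ P(1,4)])

lemma g_zero: "open U ==> g U (\<lambda>_. 0) = z 1 U"
 using hom_zero[OF O_module_ext_zero omJ hom_g] by simp

lemma gen_at_N: "f \<in> regular_on N ==> g N f = sm 1 N f m1"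
 using om_res_id[OF omJ P(1,4)] by (simp add: gen_hom_def)

lemma
 assumes U: "open U" and c: "c \<in> ext_zero N U"
 shows d_gen: "d 1 U (g U c) = z 2 U" and s_gen: "s 1 U (g U c) = (\<lambda>y. c y * qfun U (zc a) y)"
proof -
 have "d 1 U (g U c) = z 2 U \<and> s 1 U (g U c) = (\<lambda>y. c y * qfun U (zc a) y)"
 proof (cases "U \<subseteq> N")
  case True
  hence cr: "c \<in> regular_on U" using c by (simp add: ext_zero_def)
  have m: "rs 1 N U m1 \<in> C 1 U" by (rule om_res[OF omJ P(1) U True P(4)])
  have "d 1 U (rs 1 N U m1) = z 2 U" using hom_res[OF hom_d(4) P(1) U True P(4)] P(9) om_res_zero[OF omJ P(1) U True] by simp
  thus ?thesis using True m qfun_restrict[OF True]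
   by (simp add: gen_hom_def hom_smult[OF hom_d(4) U cr] om_smult_zero[OF omJ U cr] s_smult(2)[OF U cr] s_res(2)[OF P(1) U True P(4)] P(13))
 next
  case False
  hence "c = (\<lambda>_. 0)" using c by (simp add: ext_zero_def)
  thus ?thesis using False hom_zero[OF omJ omJ hom_d(4) U] hom_zero[OF omJ O_module_qsec hom_s(2) U] by (simp add: gen_hom_def)
 qed
 thus "d 1 U (g U c) = z 2 U" "s 1 U (g U c) = (\<lambda>y. c y * qfun U (zc a) y)" by simp_all
qed

end

locale two_roofs = J: roof_gen a b J s N m1 mX mY mW E + K: roof_gen a b K s' N n1 nX nY nW F
 for a b :: 4 and J s K s' N m1 mX mY mW E n1 nX nY nW F
begin

lemmas P = J.P and Q = K.P and hom_g = J.hom_g K.hom_g and g_zero = J.g_zero K.g_zero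

abbreviation EN :: fsheaf where "EN \<equiv> function_sheaf (ext_zero N)"
abbreviation g1 where "g1 \<equiv> J.g"
abbreviation g2 where "g2 \<equiv> K.g"

text \<open>In degree \<open>1\<close> the common roof \<open>M\<close> is free on one generator over the neighbourhood \<open>N\<close> of the marked point; in
 degree \<open>0\<close> it consists of triples \<open>(j, k, c)\<close> such that the images of \<open>j\<close> and \<open>k\<close> agree and their boundaries
 are \<open>c\<close> times the generators.\<close>

definition MP :: "proj3 set => fn => bool" where
 "MP U k \<longleftrightarrow> pr (pr (J.d 0 U (p1 (p1 k))) (K.d 0 U (p2 (p1 k)))) (s 0 U (p1 (p1 k))) =
  pr (pr (g1 U (p2 k)) (g2 U (p2 k))) (s' 0 U (p2 (p1 k)))"

text \<open>\<open>MP\<close> itself is a single equation between coded maps, the form to which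
  \<open>O_module_equalizer\<close> applies.\<close>

lemma MP_iff: "MP U k \<longleftrightarrow> J.d 0 U (p1 (p1 k)) = g1 U (p2 k) \<and> K.d 0 U (p2 (p1 k)) = g2 U (p2 k) \<and> s 0 U (p1 (p1 k)) = s' 0 U (p2 (p1 k))"
 by (simp add: MP_def)

text \<open>In negative degrees the plain direct sum is enough: the cycles of degree 0 are pairs of
  cycles with equal image, and dividing by the boundaries of \<open>J\<close> and of
  \<open>K\<close> separately leaves the ideal of the line once, not twice.\<close>

definition M :: "fn ocomplex" where
 "M = \<lparr>obj = (\<lambda>i. if i = 1 then EN else if i = 0 then subsheaf (dirsum (dirsum (obj J 0) (obj K 0)) EN) MP
   else if i < 0 then dirsum (obj J i) (obj K i) else function_sheaf (\<lambda>_. {\<lambda>_. 0})),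
  diff = (\<lambda>i. if i = 0 then (\<lambda>U. p2) else if i = -1 then (\<lambda>U k. pr (pr (J.d (-1) U (p1 k)) (K.d (-1) U (p2 k))) (\<lambda>_. 0))
   else if i < 0 then (\<lambda>U k. pr (J.d i U (p1 k)) (K.d i U (p2 k))) else (\<lambda>U m. \<lambda>_. 0))\<rparr>"

lemma M_obj: "obj M 1 = EN" "obj M 0 = subsheaf (dirsum (dirsum (obj J 0) (obj K 0)) EN) MP"
 "i < 0 ==> obj M i = dirsum (obj J i) (obj K i)" "i > 1 ==> obj M i = function_sheaf (\<lambda>_. {\<lambda>_. 0})"
 by (simp_all add: M_def)

lemma M_diff: "diff M 0 = (\<lambda>U. p2)" "diff M (-1) = (\<lambda>U k. pr (pr (J.d (-1) U (p1 k)) (K.d (-1) U (p2 k))) (\<lambda>_. 0))"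
 "i < -1 ==> diff M i = (\<lambda>U k. pr (J.d i U (p1 k)) (K.d i U (p2 k)))" "i > 0 ==> diff M i = (\<lambda>U m. \<lambda>_. 0)"
 by (simp_all add: M_def)

lemma M_carrier_0: "k \<in> car (obj M 0) U \<longleftrightarrow>
  p1 (p1 k) \<in> J.C 0 U \<and> p2 (p1 k) \<in> K.C 0 U \<and> p2 k \<in> ext_zero N U \<and> MP U k"
 by (auto simp: M_obj)

lemma O_module_M: "O_module (obj M i)"
proof -
 have D: "O_module (dirsum (dirsum (obj J 0) (obj K 0)) EN)" by (intro O_module_dirsum J.omJ K.omJ O_module_ext_zero)
 have "O_module (subsheaf (dirsum (dirsum (obj J 0) (obj K 0)) EN) MP)"
  unfolding MP_def[abs_def]
 proof (rule O_module_equalizer[OF D])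
  show "O_module (dirsum (dirsum (obj J 1) (obj K 1)) (function_sheaf regular_on))"
   using O_module_struct_sheaf unfolding struct_sheaf_def by (intro O_module_dirsum J.omJ K.omJ)
  have p11: "O_hom (dirsum (dirsum (obj J 0) (obj K 0)) EN) (obj J 0) (\<lambda>U k. p1 (p1 k))"
   by (rule O_hom_comp[OF O_hom_p1 O_hom_p1])
  have p12: "O_hom (dirsum (dirsum (obj J 0) (obj K 0)) EN) (obj K 0) (\<lambda>U k. p2 (p1 k))"
   by (rule O_hom_comp[OF O_hom_p1 O_hom_p2])
  have p2: "O_hom (dirsum (dirsum (obj J 0) (obj K 0)) EN) EN (\<lambda>U k. p2 k)" by (rule O_hom_p2)
  show "O_hom (dirsum (dirsum (obj J 0) (obj K 0)) EN) (dirsum (dirsum (obj J 1) (obj K 1)) (function_sheaf regular_on))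
   (\<lambda>U k. pr (pr (J.d 0 U (p1 (p1 k))) (K.d 0 U (p2 (p1 k)))) (s 0 U (p1 (p1 k))))"
   by (intro O_hom_pr O_hom_comp[OF p11 J.hom_d(3)] O_hom_comp[OF p12 K.hom_d(3)] O_hom_comp[OF p11 J.hom_s(1)])
  show "O_hom (dirsum (dirsum (obj J 0) (obj K 0)) EN) (dirsum (dirsum (obj J 1) (obj K 1)) (function_sheaf regular_on))
   (\<lambda>U k. pr (pr (g1 U (p2 k)) (g2 U (p2 k))) (s' 0 U (p2 (p1 k))))"
   by (intro O_hom_pr O_hom_comp[OF p2 hom_g(1)] O_hom_comp[OF p2 hom_g(2)] O_hom_comp[OF p12 K.hom_s(1)])
 qed
 thus ?thesis
  by (cases i rule: int_cases_3) (simp_all add: M_obj O_module_ext_zero O_module_zero O_module_dirsum J.omJ K.omJ)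
qed

lemma bounded_M: "bounded_complex M"
 unfolding bounded_complex_def
proof (intro conjI allI impI ballI)
 fix i
 show "O_module (obj M i)" by (rule O_module_M)
 show "O_hom (obj M i) (obj M (i + 1)) (diff M i)"
 proof (cases i rule: int_cases_3)
  case 3
  thus ?thesis by (simp add: M_obj M_diff O_hom_from_subsheaf[OF O_hom_p2])
 next
  case 4
  have h1: "O_hom (dirsum (obj J (-1)) (obj K (-1))) (obj J 0) (\<lambda>U k. J.d (-1) U (p1 k))" by (rule O_hom_comp[OF O_hom_p1 J.hom_d(2)])
  have h2: "O_hom (dirsum (obj J (-1)) (obj K (-1))) (obj K 0) (\<lambda>U k. K.d (-1) U (p2 k))" by (rule O_hom_comp[OF O_hom_p2 K.hom_d(2)])
  have h3: "O_hom (dirsum (obj J (-1)) (obj K (-1))) EN (\<lambda>U k. \<lambda>_. 0)"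
   using O_hom_zero[OF O_module_dirsum[OF J.omJ K.omJ] O_module_ext_zero, of "-1" "-1" N] by simp
  have "O_hom (dirsum (obj J (-1)) (obj K (-1))) (subsheaf (dirsum (dirsum (obj J 0) (obj K 0)) EN) MP)
    (\<lambda>U k. pr (pr (J.d (-1) U (p1 k)) (K.d (-1) U (p2 k))) (\<lambda>_. 0))"
  proof (rule O_hom_to_subsheaf[OF O_hom_pr[OF O_hom_pr[OF h1 h2] h3]])
   fix U m assume U: "open U" and m: "m \<in> car (dirsum (obj J (-1)) (obj K (-1))) U"
   hence m': "p1 m \<in> J.C (-1) U" "p2 m \<in> K.C (-1) U" by simp_all
   show "MP U (pr (pr (J.d (-1) U (p1 m)) (K.d (-1) U (p2 m))) (\<lambda>_. 0))"
    unfolding MP_iff using g_zero[OF U] by (simp add: J.dd(2)[OF U m'(1)] K.dd(2)[OF U m'(2)] J.s_dm1[OF U m'(1)] K.s_dm1[OF U m'(2)])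
  qed
  thus ?thesis using 4 by (simp add: M_obj M_diff)
 next
  case 5
  have "O_hom (obj J i) (obj J (i + 1)) (diff J i)" "O_hom (obj K i) (obj K (i + 1)) (diff K i)"
   by (rule bounded_complex_hom[OF J.bc refl], rule bounded_complex_hom[OF K.bc refl])
  hence "O_hom (dirsum (obj J i) (obj K i)) (dirsum (obj J (i + 1)) (obj K (i + 1))) (\<lambda>U k. pr (J.d i U (p1 k)) (K.d i U (p2 k)))"
   by (intro O_hom_pr O_hom_comp[OF O_hom_p1] O_hom_comp[OF O_hom_p2])
  thus ?thesis using 5 by (simp add: M_obj M_diff)
 qed (simp_all add: M_obj M_diff O_hom_to_zero)
next
 fix i U m assume U: "open (U::proj3 set)" and m: "m \<in> car (obj M i) U"
 show "diff M (i + 1) U (diff M i U m) = zs (obj M (i + 2)) U"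
 proof (cases i rule: int_cases_3)
  case 4
  thus ?thesis by (simp add: M_obj M_diff)
 next
  case 5
  have m': "p1 m \<in> J.C i U" "p2 m \<in> K.C i U" using m 5 by (simp_all add: M_obj)
  have dd: "J.d (i + 1) U (J.d i U (p1 m)) = J.z (i + 2) U" "K.d (i + 1) U (K.d i U (p2 m)) = K.z (i + 2) U"
   using bounded_complex_dd[OF J.bc refl U m'(1)] bounded_complex_dd[OF K.bc refl U m'(2)] .
  show ?thesis
  proof (cases "i = -2")
   case True thus ?thesis using dd by (simp add: M_obj M_diff)
  next
   case False thus ?thesis using dd 5 by (simp add: M_obj M_diff)
  qed
 qed (simp_all add: M_obj M_diff)
next
 obtain A B where A: "\<forall>i. \<bar>i\<bar> > A --> (\<forall>U. open U --> J.C i U = {J.z i U})" and B: "\<forall>i. \<bar>i\<bar> > B --> (\<forall>U. open U --> K.C i U = {K.z i U})"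
  using J.bc K.bc unfolding bounded_complex_def by (elim conjE exE)
 show "\<exists>n. \<forall>i. \<bar>i\<bar> > n --> (\<forall>U. open U --> car (obj M i) U = {zs (obj M i) U})"
 proof (rule exI[of _ "max 1 (max A B)"], intro allI impI)
  fix i :: int and U :: "proj3 set" assume i: "\<bar>i\<bar> > max 1 (max A B)" and U: "open U"
  then consider "i > 1" | "i < -1" by linarith
  thus "car (obj M i) U = {zs (obj M i) U}"
  proof cases
   case 2
   have "J.C i U = {J.z i U}" "K.C i U = {K.z i U}" using A B i U by auto
   moreover have "{k. p1 k = x \<and> p2 k = y} = {pr x y}" for x y
    using pr_p1_p2 by (intro Set.set_eqI iffI) auto
   ultimately show ?thesis using 2 by (simp add: M_obj)
  qed (simp add: M_obj)
 qed
qed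

text \<open>Serves for both projections of the common roof, with \<pi> equal to \<open>p1\<close> or
  \<open>p2\<close> and \<open>h\<close> the map given by the generator.\<close>

definition leg where
 "leg X \<pi> h i = (if i = 1 then h else if i = 0 then (\<lambda>U k. \<pi> (p1 k)) else if i < 0 then (\<lambda>U. \<pi>) else (\<lambda>U m. zs (obj X i) U))"

lemma leg: "leg X \<pi> h 1 = h" "leg X \<pi> h 0 = (\<lambda>U k. \<pi> (p1 k))" "i < 0 ==> leg X \<pi> h i = (\<lambda>U. \<pi>)" "i > 1 ==> leg X \<pi> h i = (\<lambda>U m. zs (obj X i) U)"
 by (simp_all add: leg_def)

lemma chain_leg:
 assumes bc: "bounded_complex X" and \<pi>: "\<And>i. O_hom (dirsum (obj J i) (obj K i)) (obj X i) (\<lambda>U. \<pi>)" and h: "O_hom EN (obj X 1) h"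
  and dh: "\<And>U c. open U ==> c \<in> ext_zero N U ==> diff X 1 U (h U c) = zs (obj X 2) U"
  and d0: "\<And>U k. MP U k ==> diff X 0 U (\<pi> (p1 k)) = h U (p2 k)"
  and d\<pi>: "\<And>i U k. \<pi> (pr (J.d i U (p1 k)) (K.d i U (p2 k))) = diff X i U (\<pi> k)"
 shows "chain_map M X (leg X \<pi> h)"
 unfolding chain_map_def
proof (intro conjI allI impI ballI)
 note om = bounded_complex_module[OF bc]
 show "O_hom (obj M i) (obj X i) (leg X \<pi> h i)" for i
 proof (cases i rule: int_cases_3)
  case 3
  have "O_hom (dirsum (dirsum (obj J 0) (obj K 0)) EN) (obj X 0) (\<lambda>U k. \<pi> (p1 k))" by (rule O_hom_comp[OF O_hom_p1 \<pi>])
  thus ?thesis using 3 by (simp add: M_obj leg O_hom_from_subsheaf)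
 qed (simp_all add: M_obj leg h \<pi> O_hom_zero O_module_zero om)
 fix i U m assume U: "open (U::proj3 set)" and m: "m \<in> car (obj M i) U"
 show "leg X \<pi> h (i + 1) U (diff M i U m) = diff X i U (leg X \<pi> h i U m)"
 proof (cases i rule: int_cases_3)
  case 1 thus ?thesis using hom_zero[OF om om bounded_complex_hom[OF bc refl, of i] U] by (simp add: leg)
 next
  case 2 thus ?thesis using dh[OF U, of m] m by (simp add: leg M_obj)
 next
  case 3 thus ?thesis using m d0[of U m] by (simp add: leg M_diff M_carrier_0)
 qed (simp_all add: leg M_diff d\<pi>)
qed

abbreviation uJ where "uJ \<equiv> leg J p1 g1"
abbreviation uK where "uK \<equiv> leg K p2 g2"

lemma chain_uJ: "chain_map M J uJ"
 by (rule chain_leg[OF J.bc O_hom_p1 hom_g(1) J.d_gen]) (simp_all add: MP_iff)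

lemma chain_uK: "chain_map M K uK"
 by (rule chain_leg[OF K.bc O_hom_p2 hom_g(2) K.d_gen]) (simp_all add: MP_iff)

abbreviation sM where "sM \<equiv> cmap_comp s uJ"

lemma sM_eq: "sM 0 U k = s 0 U (p1 (p1 k))" "open U ==> c \<in> ext_zero N U ==> sM 1 U c = (\<lambda>y. c y * J.qfun U (zc a) y)"
 by (simp_all add: cmap_comp_def leg J.s_gen)

lemma chain_sM: "chain_map M (Ip a) sM"
 by (rule chain_map_comp[OF chain_uJ J.chain_s])

lemma ext_zero_restrict: "c \<in> ext_zero N U ==> open U ==> open V ==> V \<subseteq> U ==> on_set V c \<in> ext_zero N V"
 using om_res[OF O_module_ext_zero, of U V c N] by simp

lemma M_member: "j \<in> J.C 0 V ==> k \<in> K.C 0 V ==> c \<in> ext_zero N V ==> J.d 0 V j = g1 V c ==> K.d 0 V k = g2 V c ==> s 0 V j = s' 0 V k ==>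
  pr (pr j k) c \<in> car (obj M 0) V"
 by (simp add: M_carrier_0 MP_iff)

text \<open>Injectivity in degree 1 needs preimages in \<open>J\<close> and \<open>K\<close> with a
  common image, which \<open>lift_boundary\<close> supplies. Surjectivity in degree 1 comes from the
  generator at the marked point; elsewhere every local section of the sheaf is the restriction of a
  regular function.\<close>

lemma quasi_iso_M: "quasi_iso M (Ip a) sM"
proof (rule J.quasi_isoI[OF bounded_M chain_sM])
 show "m = zs (obj M i) U" if "i > 1" "open U" "m \<in> car (obj M i) U" for i U m
  using that by (simp add: M_obj)
next
 fix U x c g assume U: "open U" "x \<in> U" and c: "c \<in> car (obj M 1) U" and g: "g \<in> regular_on U" and sc: "sM 1 U c = on_set (line0 - {J.pt}) g"
 have c: "c \<in> ext_zero N U" using c by (simp add: M_obj)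
 have gc: "g1 U c \<in> J.C 1 U" "g2 U c \<in> K.C 1 U" using hom_closed[OF hom_g(1) U(1), of c] hom_closed[OF hom_g(2) U(1), of c] c by simp_all
 have sg: "s 1 U (g1 U c) = on_set (line0 - {J.pt}) g" "s' 1 U (g2 U c) = on_set (line0 - {J.pt}) g"
  using sc sM_eq(2)[OF U(1) c] J.s_gen[OF U(1) c] K.s_gen[OF U(1) c] by simp_all
 from J.lift_boundary[OF U(1) gc(1) J.d_gen[OF U(1) c] g sg(1) U(2)] obtain A j where A: "open A" "x \<in> A" "A \<subseteq> U" "j \<in> J.C 0 A"
  "J.d 0 A j = J.rs 1 U A (g1 U c)" "s 0 A j = on_set A g" by (elim exE conjE)
 from K.lift_boundary[OF U(1) gc(2) K.d_gen[OF U(1) c] g sg(2) U(2)] obtain B k where B: "open B" "x \<in> B" "B \<subseteq> U" "k \<in> K.C 0 B"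
  "K.d 0 B k = K.rs 1 U B (g2 U c)" "s' 0 B k = on_set B g" by (elim exE conjE)
 let ?V = "A \<inter> B"
 have V: "open ?V" "x \<in> ?V" "?V \<subseteq> U" using A B by auto
 let ?m = "pr (pr (J.rs 0 A ?V j) (K.rs 0 B ?V k)) (on_set ?V c)"
 have "?m \<in> car (obj M 0) ?V"
 proof (rule M_member)
  note lj = J.lift_res[OF U(1) gc(1) A(1,3,4,5) _ V(1) Int_lower1] and lk = K.lift_res[OF U(1) gc(2) B(1,3,4,5) _ V(1) Int_lower2]
  show "J.rs 0 A ?V j \<in> J.C 0 ?V" "K.rs 0 B ?V k \<in> K.C 0 ?V" using lj(1) lk(1) by simp_all
  show "on_set ?V c \<in> ext_zero N ?V" by (rule ext_zero_restrict[OF c U(1) V(1,3)])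
  show "J.d 0 ?V (J.rs 0 A ?V j) = g1 ?V (on_set ?V c)"
   using lj(2) hom_res[OF hom_g(1) U(1) V(1,3), of c] c by simp
  show "K.d 0 ?V (K.rs 0 B ?V k) = g2 ?V (on_set ?V c)"
   using lk(2) hom_res[OF hom_g(2) U(1) V(1,3), of c] c by simp
  show "s 0 ?V (J.rs 0 A ?V j) = s' 0 ?V (K.rs 0 B ?V k)"
   using J.s_res(1)[OF A(1) V(1) Int_lower1 A(4)] K.s_res(1)[OF B(1) V(1) Int_lower2 B(4)] A(6) B(6) by (simp add: on_set_subset)
 qed
 thus "\<exists>V j. open V \<and> x \<in> V \<and> V \<subseteq> U \<and> j \<in> car (obj M 0) V \<and> diff M 0 V j = res (obj M 1) U V c"
  using V by (intro exI[of _ ?V] exI[of _ ?m]) (simp add: M_diff M_obj(1))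
next
 fix U x n assume U: "open U" "x \<in> U" and n: "n \<in> qsec J.pt U"
 show "\<exists>V m h. open V \<and> x \<in> V \<and> V \<subseteq> U \<and> m \<in> car (obj M 1) V \<and> h \<in> regular_on V \<and>
    (\<forall>y\<in>V. n y = sM 1 V m y + on_set (line0 - {J.pt}) h y)"
 proof (cases "x = J.pt")
  case True
  from J.qsec_generator_at_pt[OF n U(1) _ P(1,2,3)] U(2) True obtain V c where V: "open V" "J.pt \<in> V" "V \<subseteq> U" "V \<subseteq> N" "c \<in> regular_on V"
   "\<forall>y\<in>V. n y = c y * J.qfun V (zc a) y" by auto
  have c: "c \<in> ext_zero N V" using V by (simp add: ext_zero_def)
  show ?thesis using V c sM_eq(2)[OF V(1) c] True regular_zero
   by (intro exI[of _ V] exI[of _ c] exI[of _ "\<lambda>_. 0"]) (simp add: M_obj on_set_def)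
 next
  case False
  from J.qsec_regular_off_pt[OF n U False] obtain V h where V: "open V" "x \<in> V" "V \<subseteq> U" "h \<in> regular_on V"
   "\<forall>y\<in>V. n y = on_set (line0 - {J.pt}) h y" by (elim exE conjE)
  have c: "(\<lambda>_. 0) \<in> ext_zero N V" by (simp add: ext_zero_def regular_zero)
  show ?thesis using V c sM_eq(2)[OF V(1) c]
   by (intro exI[of _ V] exI[of _ "\<lambda>_. 0"] exI[of _ h]) (simp add: M_obj)
 qed
next
 fix U x e assume U: "open U" "x \<in> U" and e: "e \<in> car (obj M 0) U" and de: "diff M 0 U e = zs (obj M 1) U" and se: "sM 0 U e = (\<lambda>_. 0)"
 have e': "p1 (p1 e) \<in> J.C 0 U" "p2 (p1 e) \<in> K.C 0 U" "J.d 0 U (p1 (p1 e)) = g1 U (p2 e)" "K.d 0 U (p2 (p1 e)) = g2 U (p2 e)" "s 0 U (p1 (p1 e)) = s' 0 U (p2 (p1 e))"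
  using e by (simp_all add: M_carrier_0 MP_iff)
 have p2e: "p2 e = (\<lambda>_. 0)" using de by (simp add: M_diff M_obj(1))
 have cyc: "J.d 0 U (p1 (p1 e)) = J.z 1 U" "K.d 0 U (p2 (p1 e)) = K.z 1 U" using e'(3,4) g_zero[OF U(1)] p2e by simp_all
 have s0: "s 0 U (p1 (p1 e)) = (\<lambda>_. 0)" "s' 0 U (p2 (p1 e)) = (\<lambda>_. 0)" using se e'(5) by (simp_all add: sM_eq)
 from J.exact_0[OF U(1) e'(1) cyc(1) s0(1) U(2)] obtain A t where A: "open A" "x \<in> A" "A \<subseteq> U" "t \<in> J.C (-1) A" "J.d (-1) A t = J.rs 0 U A (p1 (p1 e))" by (elim exE conjE)
 from K.exact_0[OF U(1) e'(2) cyc(2) s0(2) U(2)] obtain B r where B: "open B" "x \<in> B" "B \<subseteq> U" "r \<in> K.C (-1) B" "K.d (-1) B r = K.rs 0 U B (p2 (p1 e))" by (elim exE conjE)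
 let ?V = "A \<inter> B"
 have V: "open ?V" "x \<in> ?V" "?V \<subseteq> U" using A B by auto
 let ?m = "pr (J.rs (-1) A ?V t) (K.rs (-1) B ?V r)"
 note lj = J.lift_res[OF U(1) e'(1) A(1,3,4,5) _ V(1) Int_lower1] and lk = K.lift_res[OF U(1) e'(2) B(1,3,4,5) _ V(1) Int_lower2]
 have m: "J.rs (-1) A ?V t \<in> J.C (-1) ?V" "K.rs (-1) B ?V r \<in> K.C (-1) ?V" using lj(1) lk(1) by simp_all
 have "J.d (-1) ?V (J.rs (-1) A ?V t) = J.rs 0 U ?V (p1 (p1 e))" "K.d (-1) ?V (K.rs (-1) B ?V r) = K.rs 0 U ?V (p2 (p1 e))" using lj(2) lk(2) by simp_all
 hence "diff M (-1) ?V ?m = res (obj M 0) U ?V e" using p2e by (simp add: M_diff M_obj(2) on_set_def)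
 moreover have "?m \<in> car (obj M (-1)) ?V" using m by (simp add: M_obj)
 ultimately show "\<exists>V t. open V \<and> x \<in> V \<and> V \<subseteq> U \<and> t \<in> car (obj M (-1)) V \<and> diff M (-1) V t = res (obj M 0) U V e"
  using V by (intro exI[of _ ?V] exI[of _ ?m]) simp
next
 fix U x g assume U: "open U" "x \<in> U" and g: "g \<in> regular_on U" "\<forall>y\<in> onl U - {J.pt}. g y = 0"
 from J.surj_0[OF U(1) g U(2)] obtain A j where A: "open A" "x \<in> A" "A \<subseteq> U" "j \<in> J.C 0 A" "J.d 0 A j = J.z 1 A" "s 0 A j = on_set A g" by (elim exE conjE)
 from K.surj_0[OF U(1) g U(2)] obtain B k where B: "open B" "x \<in> B" "B \<subseteq> U" "k \<in> K.C 0 B" "K.d 0 B k = K.z 1 B" "s' 0 B k = on_set B g" by (elim exE conjE)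
 let ?V = "A \<inter> B"
 have V: "open ?V" "x \<in> ?V" "?V \<subseteq> U" using A B by auto
 let ?m = "pr (pr (J.rs 0 A ?V j) (K.rs 0 B ?V k)) (\<lambda>_. 0)"
 have "?m \<in> car (obj M 0) ?V"
 proof (rule M_member)
  show "J.rs 0 A ?V j \<in> J.C 0 ?V" "K.rs 0 B ?V k \<in> K.C 0 ?V" by (intro om_res[OF J.omJ] om_res[OF K.omJ] A B V Int_lower1 Int_lower2)+
  show "(\<lambda>_. 0) \<in> ext_zero N ?V" by (simp add: ext_zero_def regular_zero)
  show "J.d 0 ?V (J.rs 0 A ?V j) = g1 ?V (\<lambda>_. 0)" using J.d_res_cycle[OF A(1) V(1) Int_lower1 A(4,5)] g_zero(1)[OF V(1)] by simp
  show "K.d 0 ?V (K.rs 0 B ?V k) = g2 ?V (\<lambda>_. 0)" using K.d_res_cycle[OF B(1) V(1) Int_lower2 B(4,5)] g_zero(2)[OF V(1)] by simp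
  show "s 0 ?V (J.rs 0 A ?V j) = s' 0 ?V (K.rs 0 B ?V k)"
   using J.s_res(1)[OF A(1) V(1) Int_lower1 A(4)] K.s_res(1)[OF B(1) V(1) Int_lower2 B(4)] A(6) B(6) by (simp add: on_set_subset)
 qed
 moreover have "sM 0 ?V ?m = on_set ?V g" using J.s_res(1)[OF A(1) V(1) Int_lower1 A(4)] A(6) by (simp add: sM_eq on_set_subset)
 ultimately show "\<exists>V m. open V \<and> x \<in> V \<and> V \<subseteq> U \<and> m \<in> car (obj M 0) V \<and> diff M 0 V m = zs (obj M 1) V \<and> sM 0 V m = on_set V g"
  using V by (intro exI[of _ ?V] exI[of _ ?m]) (simp add: M_diff M_obj(1))
next
 fix i U x e assume i: "(i::int) < 0" and U: "open U" "x \<in> U" and e: "e \<in> car (obj M i) U" and de: "diff M i U e = zs (obj M (i + 1)) U"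
 have e': "p1 e \<in> J.C i U" "p2 e \<in> K.C i U" using e i by (simp_all add: M_obj)
 have cyc: "J.d i U (p1 e) = J.z (i + 1) U" "K.d i U (p2 e) = K.z (i + 1) U"
  using de i by (cases "i = -1"; simp add: M_obj M_diff)+
 from J.exact_neg[OF i U(1) e'(1) cyc(1) U(2)] obtain A t where A: "open A" "x \<in> A" "A \<subseteq> U" "t \<in> J.C (i - 1) A" "J.d (i - 1) A t = J.rs i U A (p1 e)" by (elim exE conjE)
 from K.exact_neg[OF i U(1) e'(2) cyc(2) U(2)] obtain B r where B: "open B" "x \<in> B" "B \<subseteq> U" "r \<in> K.C (i - 1) B" "K.d (i - 1) B r = K.rs i U B (p2 e)" by (elim exE conjE)
 let ?V = "A \<inter> B"
 have V: "open ?V" "x \<in> ?V" "?V \<subseteq> U" using A B by auto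
 let ?m = "pr (J.rs (i - 1) A ?V t) (K.rs (i - 1) B ?V r)"
 note lj = J.lift_res[OF U(1) e'(1) A(1,3,4,5) _ V(1) Int_lower1] and lk = K.lift_res[OF U(1) e'(2) B(1,3,4,5) _ V(1) Int_lower2]
 have m: "J.rs (i - 1) A ?V t \<in> J.C (i - 1) ?V" "K.rs (i - 1) B ?V r \<in> K.C (i - 1) ?V" using lj(1) lk(1) by simp_all
 have "J.d (i - 1) ?V (J.rs (i - 1) A ?V t) = J.rs i U ?V (p1 e)" "K.d (i - 1) ?V (K.rs (i - 1) B ?V r) = K.rs i U ?V (p2 e)" using lj(2) lk(2) by simp_all
 hence "diff M (i - 1) ?V ?m = res (obj M i) U ?V e" using i by (simp add: M_diff M_obj)
 moreover have "?m \<in> car (obj M (i - 1)) ?V" using m i by (simp add: M_obj)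
 ultimately show "\<exists>V t. open V \<and> x \<in> V \<and> V \<subseteq> U \<and> t \<in> car (obj M (i - 1)) V \<and> diff M (i - 1) V t = res (obj M i) U V e"
  using V by (intro exI[of _ ?V] exI[of _ ?m]) simp
qed

lemma resolved_M: "resolved a b M sM"
 using J.marked_line_axioms bounded_M quasi_iso_M by (simp add: resolved_def resolved_axioms_def)

lemma homotopic_legs: "homotopic M (Ip a) sM sM" "homotopic M (Ip a) sM (cmap_comp s' uK)"
proof -
 have cK: "chain_map M (Ip a) (cmap_comp s' uK)" by (rule chain_map_comp[OF chain_uK K.chain_s])
 note h = chain_map_hom[OF chain_sM] and k = chain_map_hom[OF cK]
 show "homotopic M (Ip a) sM sM" by (rule J.homotopic_of_eq[OF O_module_M h _ _ h]) (rule refl)+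
 show "homotopic M (Ip a) sM (cmap_comp s' uK)"
 proof (rule J.homotopic_of_eq[OF O_module_M k _ _ h])
  show "sM 0 U m = cmap_comp s' uK 0 U m" if "m \<in> car (obj M 0) U" for U m
   using that by (simp add: M_carrier_0 MP_iff cmap_comp_def leg)
  show "sM 1 U m = cmap_comp s' uK 1 U m" if "open U" "m \<in> car (obj M 1) U" for U m
   using that by (simp add: M_obj cmap_comp_def leg J.s_gen K.s_gen)
 qed
qed

end

context two_roofs begin

interpretation MM: resolved a b M sM
 by (rule resolved_M)

text \<open>The generator of the common roof is the function 1 on \<open>N\<close>; its cochains are
  those of the two roofs side by side, in degree 0 with the coefficient of their boundaries as third
  component.\<close>

lemma p_datum_M:
 "MM.p_datum N (on_set N (\<lambda>_. 1)) (pr (pr mX nX) (J.ratio 2 a N)) (pr (pr mY nY) (J.ratio 3 a N)) (pr (pr mW nW) (J.ratio b a N)) (pr E F)"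
proof -
 note r = J.ratio_regular[OF P(3)]
 have ez: "f \<in> ext_zero N N \<longleftrightarrow> f \<in> regular_on N" for f by (simp add: ext_zero_def)
 have mem: "pr (pr mX nX) (J.ratio 2 a N) \<in> MM.C 0 N" "pr (pr mY nY) (J.ratio 3 a N) \<in> MM.C 0 N" "pr (pr mW nW) (J.ratio b a N) \<in> MM.C 0 N"
  by (rule M_member; simp add: P Q ez r J.gen_at_N K.gen_at_N)+
 have one: "on_set N (\<lambda>_. 1) \<in> ext_zero N N" by (simp add: ez regular_const)
 have mult: "(\<lambda>y. J.ratio i a N y * on_set N (\<lambda>_. 1) y) = J.ratio i a N" for i by (auto simp: J.ratio_def osf)
 have s1: "sM 1 N (on_set N (\<lambda>_. 1)) = J.qfun N (zc a)"
  unfolding sM_eq(2)[OF P(1) one] by (auto simp: J.qfun_def osf)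
 have z0: "(\<lambda>y. J.ratio 2 a N y * J.ratio 3 a N y + on_set N (\<lambda>_. - 1) y * (J.ratio 3 a N y * J.ratio 2 a N y)) = (\<lambda>_. 0)"
  by (auto simp: J.ratio_def osf)
 have dE: "MM.d (-1) N (pr E F) = MM.sb 0 N (MM.sm 0 N (J.ratio 2 a N) (pr (pr mY nY) (J.ratio 3 a N))) (MM.sm 0 N (J.ratio 3 a N) (pr (pr mX nX) (J.ratio 2 a N)))"
  using P(17) Q(17) by (simp add: M_diff M_obj(2) sub_def z0)
 show ?thesis
  unfolding MM.p_datum_def using P(1-3) mem one s1 dE P(8) Q(8) P(14-16) Q(14-16)
  by (simp add: M_diff M_obj(1,3) M_obj(4)[of 2] mult sM_eq(1))
qed

end

subsection \<open>Null-homotopies\<close>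

context marked_line begin

lemma qsec_local:
 assumes U: "open U" and out: "\<And>x. x \<notin> U ==> f x = 0"
  and loc: "\<And>x. x \<in> U ==> \<exists>V. open V \<and> x \<in> V \<and> V \<subseteq> U \<and> on_set V f \<in> qsec pt V"
 shows "f \<in> qsec pt U"
proof -
 define C where "C = {V. open V \<and> V \<subseteq> U \<and> on_set V f \<in> qsec pt V}"
 have CU: "\<Union>C = U" using loc by (auto simp: C_def)
 have "\<exists>!n. n \<in> car (Qsh pt) (\<Union>C) \<and> (\<forall>V\<in>C. res (Qsh pt) (\<Union>C) V n = on_set V f)"
  by (rule om_glue[OF O_module_qsec]) (auto simp: C_def osf)
 then obtain n where n: "n \<in> qsec pt U" "\<forall>V\<in>C. on_set V n = on_set V f" unfolding CU by auto
 have "n = f"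
 proof
  fix x show "n x = f x"
  proof (cases "x \<in> U")
   case True
   then obtain V where V: "V \<in> C" "x \<in> V" using CU by blast
   have "on_set V n x = on_set V f x" using bspec[OF n(2) V(1)] by simp
   thus ?thesis using V(2) by simp
  next
   case False thus ?thesis using out[OF False] qsec_outside[OF n(1), of x] by auto
  qed
 qed
 thus ?thesis using n(1) by simp
qed

lemma qsec_add: "open U ==> f \<in> qsec pt U ==> g \<in> qsec pt U ==> (\<lambda>y. f y + g y) \<in> qsec pt U"
 using om_add[OF O_module_qsec, of U f g] by simp

lemma qsec_mult: "open U ==> f \<in> regular_on U ==> g \<in> qsec pt U ==> (\<lambda>y. f y * g y) \<in> qsec pt U"
 using om_smult[OF O_module_qsec, of U f g] by simp

lemma qsec_restrict: "open U ==> open V ==> V \<subseteq> U ==> f \<in> qsec pt U ==> on_set V f \<in> qsec pt V"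
 using om_res[OF O_module_qsec, of U V f] by simp

lemma tw_sum: "finite A ==> (\<And>q. q \<in> A ==> f q \<in> tw n B) ==> (\<lambda>y. \<Sum>q\<in>A. f q y) \<in> tw n B"
 by (induction A rule: finite_induct) (simp_all add: tw_zero tw_add)

text \<open>The first cohomology of the sheaf of the pairs on the line vanishes, in the form of a solution of the
 Cousin problem for finitely many points.\<close>

lemma cousin_problem:
 assumes fin: "finite Z" "Z = line0 - U" and U: "open U" "onl U \<noteq> {}"
  and A: "\<And>q. q \<in> Z ==> open (A q) \<and> q \<in> A q \<and> A q \<inter> line0 \<subseteq> insert q U"
  and \<theta>: "\<And>q. q \<in> Z ==> \<theta> q \<in> qsec pt (A q \<inter> U)"
 shows "\<exists>\<xi>0 \<xi>. \<xi>0 \<in> qsec pt U \<and> (\<forall>q\<in>Z. \<xi> q \<in> qsec pt (A q) \<and> (\<forall>y\<in>A q \<inter> U. \<xi> q y = \<xi>0 y + \<theta> q y))"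
proof -
 have AU: "open (A q \<inter> U)" if "q \<in> Z" for q using A[OF that] U by auto
 have "\<exists>G. G \<in> tw 1 (A q \<inter> U \<inter> line0) \<and> \<theta> q = qfun (A q \<inter> U) G" if "q \<in> Z" for q
  using iffD1[OF qsec_iff[OF AU[OF that]] \<theta>[OF that]] by (elim bexE) (rule exI, rule conjI)
 then obtain G where G: "\<And>q. q \<in> Z ==> G q \<in> tw 1 (A q \<inter> U \<inter> line0)" "\<And>q. q \<in> Z ==> \<theta> q = qfun (A q \<inter> U) (G q)" by metis
 have ZL: "q \<in> line0" "q \<notin> U" if "q \<in> Z" for q using that fin(2) by auto
 have "\<exists>\<psi> N g. \<psi> \<in> tw 1 (line0 - {q}) \<and> open N \<and> q \<in> N \<and> g \<in> tw 1 (onl N) \<and>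
  (\<forall>y\<in>N \<inter> (A q \<inter> U) \<inter> line0 - {q}. G q y - \<psi> y = g y)" if q: "q \<in> Z" for q
 proof -
  have "A q \<inter> U \<inter> line0 \<noteq> {}" using open_meet_line0[of "A q" U] A[OF q] U ZL(1)[OF q] by blast
  thus ?thesis using principal_part[of "G q" 1 "A q \<inter> U" q] G(1)[OF q] AU[OF q] ZL(1)[OF q] by simp
 qed
 then obtain \<psi> N g where psi: "\<And>q. q \<in> Z ==> \<psi> q \<in> tw 1 (line0 - {q})" and N: "\<And>q. q \<in> Z ==> open (N q)" "\<And>q. q \<in> Z ==> q \<in> N q"
  and g: "\<And>q. q \<in> Z ==> g q \<in> tw 1 (N q \<inter> line0)"
  and eq: "\<And>q y. q \<in> Z ==> y \<in> N q \<inter> (A q \<inter> U) \<inter> line0 - {q} ==> G q y - \<psi> q y = g q y" by metis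
 \<comment> \<open>The sum of all pole parts. It is regular on \<open>U\<close>, and
   \<open>G q - S\<close> is regular at \<open>q\<close>: the pole part of \<open>G q\<close>
   cancels, and the other summands have their poles elsewhere.\<close>
 define S where "S y = (\<Sum>q\<in>Z. \<psi> q y)" for y
 have SU: "on_set (onl V) S \<in> tw 1 (onl V)" if "V \<subseteq> U" for V
 proof -
  have "(\<lambda>y. \<Sum>q\<in>Z. on_set (onl V) (\<psi> q) y) \<in> tw 1 (onl V)"
   by (rule tw_sum[OF fin(1)], rule tw_restrict[OF psi]) (use that ZL in auto)
  moreover have "(\<lambda>y. \<Sum>q\<in>Z. on_set (onl V) (\<psi> q) y) = on_set (onl V) S"
   by (auto simp: S_def osf)
  ultimately show ?thesis by simp
 qed
 define \<xi>0 where "\<xi>0 = qfun U (\<lambda>y. - on_set (onl U) S y)"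
 define H where "H q y = (if y = q then g q q - (\<Sum>p\<in>Z-{q}. \<psi> p q) else on_set (A q \<inter> line0) (\<lambda>y. G q y - S y) y)" for q y
 have xi0: "\<xi>0 \<in> qsec pt U" unfolding \<xi>0_def qsec_iff[OF U(1)] using tw_uminus[OF SU[OF subset_refl]] by blast
 have "H q \<in> tw 1 (A q \<inter> line0)" if q: "q \<in> Z" for q
 proof (rule tw_local)
  note Aq = A[OF q]
  show "H q x = 0" if "x \<notin> A q \<inter> line0" for x using that Aq ZL(1)[OF q] by (auto simp: H_def on_set_def)
  fix x assume x: "x \<in> A q \<inter> line0"
  show "\<exists>V F. open V \<and> x \<in> V \<and> F \<in> tw 1 (A q \<inter> line0 \<inter> V) \<and> (\<forall>y\<in>A q \<inter> line0 \<inter> V. H q y = F y)"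
  proof (cases "x = q")
   case False
   let ?B = "A q \<inter> line0 \<inter> U"
   have e: "?B = A q \<inter> U \<inter> line0" by blast
   have "on_set ?B S \<in> tw 1 ?B" using SU[of "A q \<inter> U"] unfolding e by simp
   hence F: "(\<lambda>y. G q y - on_set ?B S y) \<in> tw 1 ?B" using tw_diff[OF G(1)[OF q]] unfolding e by blast
   have "x \<in> U" using x False Aq by auto
   moreover have "\<forall>y\<in>?B. H q y = G q y - on_set ?B S y" using ZL(2)[OF q] by (auto simp: H_def)
   ultimately show ?thesis using U(1) F by (intro exI[of _ U] exI[of _ "\<lambda>y. G q y - on_set ?B S y"]) simp
  next
   case True
   let ?B = "A q \<inter> line0 \<inter> N q"
   have "(\<lambda>y. \<Sum>p\<in>Z-{q}. on_set ?B (\<psi> p) y) \<in> tw 1 ?B"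
   proof (rule tw_sum)
    fix p assume p: "p \<in> Z - {q}"
    thus "on_set ?B (\<psi> p) \<in> tw 1 ?B" by (intro tw_restrict[OF psi]) (use Aq ZL(2) p in auto)
   qed (use fin in simp)
   moreover have "on_set ?B (g q) \<in> tw 1 ?B" by (rule tw_restrict[OF g[OF q]]) auto
   ultimately have F: "(\<lambda>y. on_set ?B (g q) y - (\<Sum>p\<in>Z-{q}. on_set ?B (\<psi> p) y)) \<in> tw 1 ?B" by (intro tw_diff)
   have "H q y = on_set ?B (g q) y - (\<Sum>p\<in>Z-{q}. on_set ?B (\<psi> p) y)" if y: "y \<in> ?B" for y
   proof (cases "y = q")
    case True
    hence "q \<in> ?B" using y by simp
    thus ?thesis using True by (simp add: H_def)
   next
    case False
    hence "y \<in> N q \<inter> (A q \<inter> U) \<inter> line0 - {q}" using y Aq by auto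
    moreover have "S y = \<psi> q y + (\<Sum>p\<in>Z-{q}. \<psi> p y)" unfolding S_def by (rule sum.remove[OF fin(1) q])
    ultimately show ?thesis using eq[OF q] y False by (auto simp: H_def)
   qed
   thus ?thesis using N(1,2)[OF q] True F
    by (intro exI[of _ "N q"] exI[of _ "\<lambda>y. on_set ?B (g q) y - (\<Sum>p\<in>Z-{q}. on_set ?B (\<psi> p) y)"]) simp
  qed
 qed
 hence xi: "qfun (A q) (H q) \<in> qsec pt (A q)" if "q \<in> Z" for q using qsec_iff[of "A q"] A[OF that] that by blast
 have "qfun (A q) (H q) y = \<xi>0 y + \<theta> q y" if q: "q \<in> Z" and y: "y \<in> A q \<inter> U" for q y
 proof (cases "y \<in> line0 - {pt}")
  case True
  have "y \<noteq> q" using y ZL(2)[OF q] by blast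
  thus ?thesis using True y by (simp add: G(2)[OF q] \<xi>0_def qfun_def H_def diff_divide_distrib)
 next
  case False
  hence n: "y \<notin> A q \<inter> line0 - {pt}" "y \<notin> onp U" "y \<notin> A q \<inter> U \<inter> line0 - {pt}" by auto
  show ?thesis unfolding G(2)[OF q] \<xi>0_def qfun_def on_set_out[OF n(1)] on_set_out[OF n(2)] on_set_out[OF n(3)] by simp
 qed
 thus ?thesis using xi0 xi by (intro exI[of _ \<xi>0] exI[of _ "\<lambda>q. qfun (A q) (H q)"]) simp
qed

end

locale free_roof = resolved +
 fixes N mX mY mW E
 assumes obj1: "obj J 1 = function_sheaf (ext_zero N)" and pd: "p_datum N (on_set N (\<lambda>_. 1)) mX mY mW E"
begin

lemmas P = p_datumD[OF pd]

text \<open>Over \<open>Db\<close> a cycle is locally a combination of lifts of X and Y up to a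
  boundary, and \<phi> is 0 on all of these. At the marked point values are 0 by convention.\<close>

lemma cycle_value_zero:
 assumes t: "tmap 0 \<phi>" and v: "val0 \<phi> 0" and V: "open V" and w: "w \<in> C 0 V" "d 0 V w = z 1 V"
 shows "\<phi> V w = (\<lambda>_. 0)"
proof
 fix y show "\<phi> V w y = 0"
 proof (cases "y \<in> onp V")
  case False thus ?thesis by (rule tm_outside[OF t V w(1)])
 next
  case True
  let ?V = "V \<inter> Db"
  have oV: "open ?V" "y \<in> ?V" using V open_Db True line0_Db by auto
  from ex_b_datum[OF oV(1) _ oV(2)] obtain A zX zY e where A: "y \<in> A" "A \<subseteq> ?V" "b_datum A zX zY e" by blast
  note D = b_datumD[OF A(3)]
  have AV: "A \<subseteq> V" using A(2) by blast
  have wA: "rs 0 V A w \<in> C 0 A" "d 0 A (rs 0 V A w) = z 1 A" by (intro om_res[OF omJ] V D AV w, rule d_res_cycle[OF V D(5) AV w])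
  from cycle_decomposition[OF D(1,2) A(1) wA] obtain T \<alpha> \<beta> t' where T: "open T" "y \<in> T" "T \<subseteq> A" "\<alpha> \<in> regular_on T" "\<beta> \<in> regular_on T" "t' \<in> C (-1) T"
   and eq: "rs 0 A T (rs 0 V A w) = ad 0 T (cmb T \<alpha> (rs 0 A T zX) \<beta> (rs 0 A T zY)) (d (-1) T t')" by (elim exE conjE)
  have X: "bcyc 2 T (rs 0 A T zX)" "bcyc 3 T (rs 0 A T zY)" by (intro bcyc_res D T)+
  note XD = bcycD(3)[OF X(1)] bcycD(3)[OF X(2)]
  have yL: "y \<in> onl T" using True T(2) by simp
  have "\<phi> T (rs 0 A T zX) y = 0" "\<phi> T (rs 0 A T zY) y = 0"
   using v[unfolded val0_def, THEN conjunct1, rule_format, OF X(1) yL] v[unfolded val0_def, THEN conjunct2, THEN conjunct1, rule_format, OF X(2) yL]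
   by (simp_all add: aff_def)
  moreover have "\<phi> T (rs 0 A T (rs 0 V A w)) y = \<alpha> y * \<phi> T (rs 0 A T zX) y + \<beta> y * \<phi> T (rs 0 A T zY) y"
   unfolding eq using cmb_closed[OF T(1,4,5) XD] hom_closed[OF hom_d(2) T(1,6)]
   by (simp add: tm_add[OF t T(1)] tm_d[OF t T(1) _ T(6)]) (simp add: cmb_def tm_add[OF t T(1)] tm_smult[OF t T(1)] om_smult[OF omJ T(1)] T(4,5) XD)
  moreover have "\<phi> T (rs 0 A T (rs 0 V A w)) y = \<phi> V w y"
   using tm_point[OF t D(5) T(1,3) wA(1) T(2)] tm_point[OF t V D(5) AV w(1) A(1)] by simp
  ultimately show ?thesis by simp
 qed
qed

text \<open>A map out of \<open>ext_zero N\<close> is given by a section \<open>Y\<close> over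
  \<open>N\<close>, and \<open>mW\<close> forces \<open>zc b / zc a\<close> times \<open>Y\<close>
  to be the value on \<open>mW\<close>; this is solvable in the sheaf because the residue is 0. For
  a cochain \<open>m\<close> over a subset of \<open>N\<close> with boundary \<open>c\<close>, the
  cochain \<open>(zc b / zc a) * m - c * mW\<close> is a cycle, so its value is 0, and
  \<open>zc b\<close> cancels off the marked point.\<close>

lemma null_homotopic_0:
 assumes t: "tmap 0 \<phi>" and v: "val0 \<phi> 0"
 shows "\<exists>h. O_hom (obj J 1) (Qsh pt) h \<and> (\<forall>U m. open U --> m \<in> C 0 U --> \<phi> U m = h U (d 0 U m))"
proof -
 obtain k where k: "k \<in> regular_on (onl N)" "k pt = 0" "\<forall>y\<in> onp N. k y = ratio b a N y * \<phi> N mW y"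
  using v[unfolded val0_def, THEN conjunct2, THEN conjunct2, rule_format, OF p_cycle_of_p_datum[OF pd]] by auto
 have "qfun N (zc a) = qfun N (on_set (onl N) (zc a))" by (auto simp: qfun_def osf)
 hence "qfun N (zc a) \<in> qsec pt N" unfolding qsec_iff[OF P(1)] using tw_coord by blast
 \<comment> \<open>\<open>k\<close> vanishes at the marked point, so it is a test function for the
   generator \<open>zc a / zc b\<close>; the product extends regularly, and off the marked point it
   is the value on \<open>mW\<close>.\<close>
 then obtain l where l: "l \<in> regular_on (onl N)" "\<forall>y\<in> onp N. l y = k y * qfun N (zc a) y"
  using k(1,2) P(1) unfolding qsec_def by blast
 define Y where "Y = qfun N (\<lambda>y. l y * on_set (onl N) (zc a) y)"
 have "(\<lambda>y. l y * on_set (onl N) (zc a) y) \<in> tw 1 (onl N)" using tw_mult[OF l(1)[unfolded regular_on_eq_tw] tw_coord] by simp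
 hence Yq: "Y \<in> qsec pt N" unfolding Y_def qsec_iff[OF P(1)] by blast
 have WY: "ratio b a N y * Y y = \<phi> N mW y" if y: "y \<in> onp N" for y
 proof -
  have nz: "zc a y \<noteq> 0" "zc b y \<noteq> 0" using y P(3) line0_Db by auto
  have "l y = (zc b y / zc a y * \<phi> N mW y) * (zc a y / zc b y)" using bspec[OF l(2) y] bspec[OF k(3) y] y by (simp add: ratio_def qfun_def)
  hence ly: "l y = \<phi> N mW y" using nz by simp
  show ?thesis using y nz by (simp add: Y_def qfun_def ratio_def ly)
 qed
 let ?h = "gen_hom (Qsh pt) N Y"
 have h: "O_hom (obj J 1) (Qsh pt) ?h" unfolding obj1 by (rule O_hom_gen_hom[OF O_module_qsec P(1)]) (simp add: Yq)
 have "\<phi> U m = ?h U (d 0 U m)" if U: "open U" and m: "m \<in> C 0 U" for U m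
 proof -
  let ?c = "d 0 U m"
  have c: "?c \<in> ext_zero N U" using hom_closed[OF hom_d(3) U m] by (simp add: obj1)
  show ?thesis
  proof (cases "U \<subseteq> N")
   case False
   hence "d 0 U m = z 1 U" using c by (simp add: ext_zero_def obj1)
   thus ?thesis using cycle_value_zero[OF t v U m] False by (simp add: gen_hom_def)
  next
   case True
   hence cr: "?c \<in> regular_on U" using c by (simp add: ext_zero_def)
   have UDa: "U \<subseteq> Da" using True P(3) by blast
   note r = ratio_regular[OF UDa]
   let ?w = "rs 0 N U mW"
   have w: "?w \<in> C 0 U" by (intro om_res[OF omJ] P U True)
   have cl: "sm 0 U (ratio b a U) m \<in> C 0 U" "sm 0 U ?c ?w \<in> C 0 U" by (intro om_smult[OF omJ] U r m cr w)+
   have dw: "d 0 U ?w = ratio b a U"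
    using hom_res[OF hom_d(3) P(1) U True P(7)] P(12) True by (auto simp: obj1 on_set_subset ratio_def osf)
   have "d 0 U (sb 0 U (sm 0 U (ratio b a U) m) (sm 0 U ?c ?w)) = z 1 U"
    by (simp add: hom_sub[OF omJ hom_d(3) U cl] hom_smult[OF hom_d(3) U] r m cr w dw) (auto simp: obj1 osf regular_outside[OF cr])
   from cycle_value_zero[OF t v U om_sub[OF omJ U cl] this]
   have e: "(\<lambda>y. ratio b a U y * \<phi> U m y - ?c y * \<phi> U ?w y) = (\<lambda>_. 0)"
    by (simp add: tm_sub[OF t U cl] tm_smult[OF t U] r m cr w)
   show ?thesis
   proof
    fix y show "\<phi> U m y = ?h U ?c y"
    proof (cases "y \<in> onp U")
     case y: True
     hence nz: "zc a y \<noteq> 0" "zc b y \<noteq> 0" "y \<in> N" using UDa line0_Db True by auto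
     have "\<phi> U ?w y = \<phi> N mW y" by (rule tm_point[OF t P(1) U True P(7)]) (use y in simp)
     hence "ratio b a U y * \<phi> U m y = ?c y * (ratio b a N y * Y y)" using fun_cong[OF e, of y] WY[of y] y nz(3) by simp
     hence "zc b y / zc a y * \<phi> U m y = zc b y / zc a y * (?c y * Y y)" using y nz(3) by (simp add: ratio_def)
     hence "\<phi> U m y = ?c y * Y y" using nz by simp
     thus ?thesis using True y by (simp add: gen_hom_def)
    next
     case y: False
     have "Y y = 0 \<or> y \<notin> U" using qsec_outside[OF Yq, of y] y by blast
     hence "?h U ?c y = 0" using True by (auto simp: gen_hom_def on_set_def)
     thus ?thesis using tm_outside[OF t U m y] by simp
    qed
   qed
  qed
 qed
 thus ?thesis using h by blast
qed

end

context marked_line begin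

lemma qsec_localI:
 assumes U: "open U" and out: "\<And>x. x \<notin> onp U ==> f x = 0"
  and loc: "\<And>x. x \<in> onl U ==> \<exists>T g. open T \<and> x \<in> T \<and> T \<subseteq> U \<and> g \<in> qsec pt T \<and> (\<forall>u\<in> onp T. f u = g u)"
 shows "f \<in> qsec pt U"
proof (rule qsec_local[OF U])
 show "f x = 0" if "x \<notin> U" for x using out that by blast
 fix x assume x: "x \<in> U"
 show "\<exists>V. open V \<and> x \<in> V \<and> V \<subseteq> U \<and> on_set V f \<in> qsec pt V"
 proof (cases "x \<in> line0")
  case True
  hence "x \<in> onl U" using x by simp
  from loc[OF this] obtain T g where T: "open T" "x \<in> T" "T \<subseteq> U" "g \<in> qsec pt T" "\<forall>u\<in> onp T. f u = g u" by (elim exE conjE)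
  have "on_set T f = g"
  proof
   fix u show "on_set T f u = g u"
   proof (cases "u \<in> onp T")
    case True thus ?thesis using T(5) by simp
   next
    case False
    have "on_set T f u = 0" using False out[of u] by (cases "u \<in> T") (auto simp: on_set_out)
    thus ?thesis using qsec_outside[OF T(4) False] by simp
   qed
  qed
  thus ?thesis using T(1-4) by (intro exI[of _ T]) simp
 next
  case False
  let ?T = "U \<inter> - line0"
  have o: "open ?T" by (rule open_Int[OF U open_compl_line0])
  have "on_set ?T f = (\<lambda>_. 0)" using out by (auto simp: osf)
  thus ?thesis using om_zero[OF O_module_qsec o] o x False by (intro exI[of _ ?T]) auto
 qed
qed

end

lemma om_add_cancel:
 assumes "O_module F" "open U" "m \<in> car F U" "n \<in> car F U" "k \<in> car F U"
  "m \<boxplus>[F,U] n = m \<boxplus>[F,U] k"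
 shows "n = k"
proof -
 have "sub F U (m \<boxplus>[F,U] n) m = n" "sub F U (m \<boxplus>[F,U] n) m = k"
  using om_sub_eq[OF assms(1,2) om_add[OF assms(1,2,3,4)] assms(3,4)] om_sub_eq[OF assms(1,2) om_add[OF assms(1,2,3,4)] assms(3,5)] assms(6) by simp_all
 thus ?thesis by simp
qed

context free_roof begin

lemma C1_eq: "C 1 U = ext_zero N U" "z 1 U = (\<lambda>_. 0)" "sm 1 U f g = (\<lambda>x. f x * g x)" "ad 1 U f g = (\<lambda>x. f x + g x)" "rs 1 U V = on_set V"
 unfolding obj1 by simp_all

text \<open>The multiples of \<open>mW\<close>; they are defined on open subsets of \<open>N\<close> only.\<close>

definition wl where
 "wl T \<kappa> \<longleftrightarrow> \<kappa> = z 0 T \<or> (T \<subseteq> N \<and> (\<exists>\<delta>\<in>regular_on T. \<kappa> = sm 0 T \<delta> (rs 0 N T mW)))"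

lemma mW_res: "open T ==> T \<subseteq> N ==> rs 0 N T mW \<in> C 0 T"
 by (intro om_res[OF omJ] P)

lemma wl_closed: "wl T \<kappa> ==> open T ==> \<kappa> \<in> C 0 T"
 unfolding wl_def using om_zero[OF omJ] om_smult[OF omJ] mW_res by auto

lemma wl_smult: "wl T \<kappa> ==> open T ==> g \<in> regular_on T ==> wl T (sm 0 T g \<kappa>)"
 unfolding wl_def by (auto simp: om_smult_zero[OF omJ] om_smult_smult[OF omJ] mW_res intro!: regular_mult)

lemma wl_add:
 assumes "wl T \<kappa>" "wl T \<kappa>'" "open T" shows "wl T (ad 0 T \<kappa> \<kappa>')"
proof (cases "\<kappa> = z 0 T \<or> \<kappa>' = z 0 T")
 case True
 thus ?thesis using assms om_zero_left[OF omJ assms(3)] om_zero_right[OF omJ assms(3)] wl_closed by metis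
next
 case False
 then obtain \<delta> \<delta>' where d: "T \<subseteq> N" "\<delta> \<in> regular_on T" "\<delta>' \<in> regular_on T" "\<kappa> = sm 0 T \<delta> (rs 0 N T mW)" "\<kappa>' = sm 0 T \<delta>' (rs 0 N T mW)"
  using assms(1,2) unfolding wl_def by blast
 hence "ad 0 T \<kappa> \<kappa>' = sm 0 T (\<lambda>x. \<delta> x + \<delta>' x) (rs 0 N T mW)" using om_add_smult[OF omJ assms(3)] mW_res[OF assms(3)] by simp
 thus ?thesis unfolding wl_def using d(1) regular_add[OF d(2,3)] by blast
qed

lemma wl_res:
 assumes "wl T \<kappa>" "open T" "open S" "S \<subseteq> T" shows "wl S (rs 0 T S \<kappa>)"
proof (cases "\<kappa> = z 0 T")
 case True thus ?thesis using om_res_zero[OF omJ assms(2-4)] by (simp add: wl_def)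
next
 case False
 then obtain \<delta> where d: "T \<subseteq> N" "\<delta> \<in> regular_on T" "\<kappa> = sm 0 T \<delta> (rs 0 N T mW)" using assms(1) unfolding wl_def by blast
 have "rs 0 T S \<kappa> = sm 0 S (on_set S \<delta>) (rs 0 N S mW)" unfolding d(3)
  using om_res_smult[OF omJ assms(2-4) d(2) mW_res[OF assms(2) d(1)]] om_res_res[OF omJ P(1) assms(2-4) d(1) P(7)] by simp
 thus ?thesis unfolding wl_def using d(1) assms(4) regular_restrict[OF d(2) assms(4)] by blast
qed

lemma d_mW: "open T ==> T \<subseteq> N ==> \<delta> \<in> regular_on T ==> d 0 T (sm 0 T \<delta> (rs 0 N T mW)) = (\<lambda>y. \<delta> y * ratio b a T y)"
 using hom_smult[OF hom_d(3) _ _ mW_res] hom_res[OF hom_d(3) P(1) _ _ P(7)]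
 by (simp add: C1_eq P(12)) (auto simp: fun_eq_iff on_set_def ratio_def)

text \<open>Over \<open>Db\<close> the boundary of a multiple of \<open>mW\<close> determines the
  coefficient, since \<open>zc b / zc a\<close> is nonzero there.\<close>

lemma wl_cycle:
 assumes "wl T \<kappa>" "open T" "T \<subseteq> Db" "d 0 T \<kappa> = z 1 T" shows "\<kappa> = z 0 T"
proof (rule ccontr)
 assume "\<kappa> \<noteq> z 0 T"
 then obtain \<delta> where d: "T \<subseteq> N" "\<delta> \<in> regular_on T" "\<kappa> = sm 0 T \<delta> (rs 0 N T mW)" using assms(1) unfolding wl_def by blast
 have "\<delta> y = 0" for y
 proof (cases "y \<in> T")
  case True
  hence "zc a y \<noteq> 0" "zc b y \<noteq> 0" using d(1) P(3) assms(3) by auto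
  thus ?thesis using fun_cong[OF assms(4)[unfolded d(3) d_mW[OF assms(2) d(1,2)] C1_eq], of y] True by (simp add: ratio_def)
 qed (rule regular_outside[OF d(2)])
 hence "\<delta> = (\<lambda>_. 0)" by blast
 thus False using d(3) om_zero_smult[OF omJ assms(2) mW_res[OF assms(2) d(1)]] \<open>\<kappa> \<noteq> z 0 T\<close> by simp
qed

section \<open>Torsors of values of a null-homotopy for k = 1\<close>

context
 fixes \<phi> assumes t: "tmap (-1) \<phi>" and v: "val1 \<phi> 0"
begin

lemma syzygy_value_zero: "b_datum V zX zY e ==> y \<in> onl V ==> \<phi> V e y = 0"
 using v[unfolded val1_def, rule_format, of V zX zY e y] by (simp add: aff_def)

lemma link_value_unique:
 assumes l: "link V w V' w' T \<tau>" "link V w V' w' T' \<tau>'" and w: "open V" "w \<in> C 0 V" "open V'" "w' \<in> C 0 V'" and y: "y \<in> T" "y \<in> T'"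
 shows "\<phi> T \<tau> y = \<phi> T' \<tau>' y"
proof -
 let ?S = "T \<inter> T'"
 note L = linkD[OF l(1)] and L' = linkD[OF l(2)]
 have S: "open ?S" "y \<in> ?S" using L L' y by auto
 note A = linkD[OF link_res[OF l(1) w S(1) Int_lower1]] and B = linkD[OF link_res[OF l(2) w S(1) Int_lower2]]
 have "d (-1) ?S (rs (-1) T ?S \<tau>) = d (-1) ?S (rs (-1) T' ?S \<tau>')"
  by (rule om_add_cancel[OF omJ S(1) om_res[OF omJ w(1) S(1) A(2) w(2)] hom_closed[OF hom_d(2) S(1) A(4)] hom_closed[OF hom_d(2) S(1) B(4)]])
   (use A(5) B(5) in simp)
 from boundary_value[OF t S A(4) B(4) this] show ?thesis
  using tm_point[OF t L(1) S(1) Int_lower1 L(4) S(2)] tm_point[OF t L'(1) S(1) Int_lower2 L'(4) S(2)] by simp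
qed

text \<open>The amount by which the values of a null-homotopy must change from the lift
  \<open>w\<close> to the lift \<open>w'\<close>.\<close>

definition del where
 "del V w V' w' y = (THE c. \<exists>T \<tau>. y \<in> T \<and> link V w V' w' T \<tau> \<and> c = \<phi> T \<tau> y)"

lemma del_eq:
 assumes "bcyc i V w" "bcyc i V' w'" "link V w V' w' T \<tau>" "y \<in> T"
 shows "del V w V' w' y = \<phi> T \<tau> y"
 unfolding del_def
proof (rule the_equality)
 show "\<exists>T' \<tau>'. y \<in> T' \<and> link V w V' w' T' \<tau>' \<and> \<phi> T \<tau> y = \<phi> T' \<tau>' y" using assms(3,4) by blast
 fix c assume "\<exists>T \<tau>. y \<in> T \<and> link V w V' w' T \<tau> \<and> c = \<phi> T \<tau> y"
 then obtain T' \<tau>' where "y \<in> T'" "link V w V' w' T' \<tau>'" "c = \<phi> T' \<tau>' y" by (elim exE conjE)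
 thus "c = \<phi> T \<tau> y"
  using link_value_unique[OF _ assms(3) bcycD(1,3)[OF assms(1)] bcycD(1,3)[OF assms(2)] _ assms(4)] by simp
qed

lemma del_cocycle:
 assumes w: "bcyc i V w" "bcyc i V' w'" "bcyc i V'' w''" and y: "y \<in> V" "y \<in> V'" "y \<in> V''"
 shows "del V w V'' w'' y = del V w V' w' y + del V' w' V'' w'' y"
proof -
 note W = bcycD(1,3)[OF w(1)] bcycD(1,3)[OF w(2)] bcycD(1,3)[OF w(3)]
 obtain T \<tau> where T: "y \<in> T" "link V w V' w' T \<tau>" using ex_link[OF w(1,2) y(1,2)] by blast
 obtain S \<sigma> where S: "y \<in> S" "link V' w' V'' w'' S \<sigma>" using ex_link[OF w(2,3) y(2,3)] by blast
 note LT = linkD[OF T(2)] and LS = linkD[OF S(2)]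
 let ?R = "T \<inter> S"
 have R: "open ?R" "y \<in> ?R" using LT LS T S by auto
 let ?p = "rs (-1) T ?R \<tau>" and ?q = "rs (-1) S ?R \<sigma>"
 note A = linkD[OF link_res[OF T(2) W(1-4) R(1) Int_lower1]] and B = linkD[OF link_res[OF S(2) W(3-6) R(1) Int_lower2]]
 have pq: "ad (-1) ?R ?p ?q \<in> C (-1) ?R" by (rule om_add[OF omJ R(1) A(4) B(4)])
 have cl: "rs 0 V ?R w \<in> C 0 ?R" "d (-1) ?R ?p \<in> C 0 ?R" "d (-1) ?R ?q \<in> C 0 ?R"
  by (rule om_res[OF omJ W(1) R(1) A(2) W(2)], rule hom_closed[OF hom_d(2) R(1) A(4)], rule hom_closed[OF hom_d(2) R(1) B(4)])
 have "rs 0 V'' ?R w'' = ad 0 ?R (rs 0 V ?R w) (d (-1) ?R (ad (-1) ?R ?p ?q))"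
  using A(5) B(5) om_assoc[OF omJ R(1) cl] hom_add[OF hom_d(2) R(1) A(4) B(4)] by simp
 hence l: "link V w V'' w'' ?R (ad (-1) ?R ?p ?q)" unfolding link_def using R(1) A(2) B(3) pq by blast
 have "del V w V'' w'' y = \<phi> ?R ?p y + \<phi> ?R ?q y"
  using del_eq[OF w(1,3) l R(2)] tm_add[OF t R(1) A(4) B(4)] by simp
 thus ?thesis
  using del_eq[OF w(1,2) T(2,1)] del_eq[OF w(2,3) S(2,1)] tm_point[OF t LT(1) R(1) Int_lower1 LT(4) R(2)] tm_point[OF t LS(1) R(1) Int_lower2 LS(4) R(2)] by simp
qed

text \<open>The values that a null-homotopy takes on the lifts of a generator of the ideal: a section of a torsor
 under the sheaf of the pair.\<close>

definition torsor_section where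
 "torsor_section i \<Xi> \<longleftrightarrow> (\<forall>V w. bcyc i V w --> \<Xi> V w \<in> qsec pt V) \<and>
  (\<forall>V w V' w' T \<tau>. bcyc i V w --> bcyc i V' w' --> link V w V' w' T \<tau> --> (\<forall>y\<in>T. \<Xi> V' w' y = \<Xi> V w y + \<phi> T \<tau> y))"

text \<open>A lift \<open>z0\<close> over \<open>U\<close> misses finitely many points of the line,
  and near each of them another lift is chosen. The differences \<theta> form a Cousin problem; its
  solution gives compatible values on the chosen lifts, and on any other lift the value follows by
  adding \<open>del\<close>. At the marked point the chosen lift comes from \<open>zp\<close>, which
  lives on the punctured neighbourhood only; its value is nevertheless a section across the
  point.\<close>

lemma ex_torsor_section:
 assumes i: "i = 2 \<or> i = 3" and zp: "bcyc i (N \<inter> Db) zp"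
 shows "\<exists>\<Xi>. torsor_section i \<Xi> \<and> \<Xi> (N \<inter> Db) zp \<in> qsec pt N"
proof -
 obtain y0 where y0: "y0 \<in> line0 - {pt}" using ex_line0_ratio[of 0] by blast
 obtain U z0 where z0: "y0 \<in> U" "bcyc i U z0" using bcyc_at[OF y0 i] by blast
 note U = bcycD[OF z0(2)]
 define Z where "Z = line0 - U"
 have finZ: "finite Z" unfolding Z_def by (rule finite_line0_diff[OF U(1)]) (use z0(1) y0 in blast)
 have ZL: "q \<in> line0" "q \<notin> U" if "q \<in> Z" for q using that by (auto simp: Z_def)
 \<comment> \<open>Removes the other exceptional points from a neighbourhood of
   \<open>q\<close>.\<close>
 define R where "R q = (\<Inter>q'\<in>Z-{q}. {x. lf q' (rep x) \<noteq> 0})" for q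
 have oR: "open (R q)" for q unfolding R_def using finZ by (intro open_INT ballI open_form_nonzero[OF homog_lf]) auto
 have R: "x \<in> R q \<longleftrightarrow> (\<forall>q'\<in>Z-{q}. x \<noteq> q')" if "x \<in> line0" for x q
  using lf_zero_iff[OF _ that] ZL(1) by (auto simp: R_def)
 have "\<exists>A zq. open A \<and> q \<in> A \<and> A \<inter> line0 \<subseteq> insert q U \<and> bcyc i (A \<inter> Db) zq \<and> (q = pt --> A \<subseteq> N \<and> zq = rs 0 (N \<inter> Db) (A \<inter> Db) zp)"
  if q: "q \<in> Z" for q
 proof -
  have "\<exists>B zq. open B \<and> q \<in> B \<and> bcyc i (B \<inter> Db) zq \<and> (q = pt --> B \<subseteq> N \<and> zq = rs 0 (N \<inter> Db) (B \<inter> Db) zp)"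
  proof (cases "q = pt")
   case True
   have "rs 0 (N \<inter> Db) (N \<inter> Db) zp = zp" using om_res_id[OF omJ bcycD(1,3)[OF zp]] by simp
   thus ?thesis using P(1,2) zp True by (intro exI[of _ N] exI[of _ zp]) simp
  next
   case False
   then obtain B w where B: "q \<in> B" "bcyc i B w" using bcyc_at[of q i] ZL(1)[OF q] i by blast
   have "B \<inter> Db = B" using bcycD(2)[OF B(2)] by blast
   thus ?thesis using B bcycD(1)[OF B(2)] False by (intro exI[of _ B] exI[of _ w]) simp
  qed
  then obtain B zq where B: "open B" "q \<in> B" "bcyc i (B \<inter> Db) zq" "q = pt --> B \<subseteq> N \<and> zq = rs 0 (N \<inter> Db) (B \<inter> Db) zp" by (elim exE conjE)
  let ?A = "B \<inter> R q"
  have oA: "open ?A" "open (?A \<inter> Db)" using B(1) oR open_Db by auto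
  have "onl ?A \<subseteq> insert q U"
  proof
   fix x assume x: "x \<in> onl ?A"
   hence "\<forall>q'\<in>Z-{q}. x \<noteq> q'" using R[of x q] by blast
   thus "x \<in> insert q U" using x by (auto simp: Z_def)
  qed
  moreover have "q \<in> R q" using R[OF ZL(1)[OF q], of q] by blast
  moreover have "bcyc i (?A \<inter> Db) (rs 0 (B \<inter> Db) (?A \<inter> Db) zq)" by (rule bcyc_res[OF B(3) oA(2)]) blast
  moreover have "q = pt --> ?A \<subseteq> N \<and> rs 0 (B \<inter> Db) (?A \<inter> Db) zq = rs 0 (N \<inter> Db) (?A \<inter> Db) zp"
  proof
   assume "q = pt"
   hence b: "B \<subseteq> N" "zq = rs 0 (N \<inter> Db) (B \<inter> Db) zp" using B(4) by blast+
   have "rs 0 (B \<inter> Db) (?A \<inter> Db) zq = rs 0 (N \<inter> Db) (?A \<inter> Db) zp" unfolding b(2)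
    by (rule om_res_res[OF omJ bcycD(1)[OF zp] bcycD(1)[OF B(3)] oA(2) _ _ bcycD(3)[OF zp]]) (use b(1) in auto)
   thus "?A \<subseteq> N \<and> rs 0 (B \<inter> Db) (?A \<inter> Db) zq = rs 0 (N \<inter> Db) (?A \<inter> Db) zp" using b(1) by blast
  qed
  ultimately show ?thesis using oA(1) B(2) by (intro exI[of _ ?A] exI[of _ "rs 0 (B \<inter> Db) (?A \<inter> Db) zq"]) blast
 qed
 then obtain A zq where A: "\<And>q. q \<in> Z ==> open (A q) \<and> q \<in> A q \<and> A q \<inter> line0 \<subseteq> insert q U"
  and zq: "\<And>q. q \<in> Z ==> bcyc i (A q \<inter> Db) (zq q)"
  and Ap: "pt \<in> Z ==> A pt \<subseteq> N \<and> zq pt = rs 0 (N \<inter> Db) (A pt \<inter> Db) zp" by metis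
 define \<theta> where "\<theta> q = on_set (A q \<inter> U \<inter> line0) (del U z0 (A q \<inter> Db) (zq q))" for q
 have \<theta>: "\<theta> q \<in> qsec pt (A q \<inter> U)" if q: "q \<in> Z" for q
 proof (rule qsec_localI)
  show "open (A q \<inter> U)" using A[OF q] U(1) by auto
  show "\<theta> q x = 0" if "x \<notin> A q \<inter> U \<inter> line0 - {pt}" for x
   unfolding \<theta>_def by (rule on_set_out) (use that U(2) pt_Db in auto)
  fix x assume x: "x \<in> A q \<inter> U \<inter> line0"
  hence "x \<in> U" "x \<in> A q \<inter> Db" using U(2) by auto
  from ex_link[OF z0(2) zq[OF q] this] obtain T \<tau> where T: "x \<in> T" "link U z0 (A q \<inter> Db) (zq q) T \<tau>" by (elim exE conjE)
  note L = linkD[OF T(2)]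
  have "\<forall>u\<in> onp T. \<theta> q u = \<phi> T \<tau> u"
  proof
   fix u assume u: "u \<in> onp T"
   hence "u \<in> A q \<inter> U \<inter> line0" "u \<in> T" using L(2,3) by auto
   thus "\<theta> q u = \<phi> T \<tau> u" using del_eq[OF z0(2) zq[OF q] T(2)] by (simp add: \<theta>_def)
  qed
  thus "\<exists>T g. open T \<and> x \<in> T \<and> T \<subseteq> A q \<inter> U \<and> g \<in> qsec pt T \<and> (\<forall>u\<in> onp T. \<theta> q u = g u)"
   using T(1) L tm_closed[OF t L(1,4)] by (intro exI[of _ T] exI[of _ "\<phi> T \<tau>"]) auto
 qed
 have Une: "onl U \<noteq> {}" using z0(1) y0 by blast
 obtain \<xi>0 \<xi> where xi0: "\<xi>0 \<in> qsec pt U" and xi: "\<And>q. q \<in> Z ==> \<xi> q \<in> qsec pt (A q)"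
  and xieq: "\<And>q y. q \<in> Z ==> y \<in> A q \<inter> U ==> \<xi> q y = \<xi>0 y + \<theta> q y"
  using cousin_problem[OF finZ Z_def U(1) Une A \<theta>] by metis
 \<comment> \<open>The value on a reference lift plus the difference from it; at an exceptional
   point \<open>y\<close> the reference lift is the one chosen for \<open>y\<close>.\<close>
 define \<Xi> where "\<Xi> V w y = (if y \<in> onl V then (if y \<in> U then \<xi>0 y + del U z0 V w y else \<xi> y y + del (A y \<inter> Db) (zq y) V w y) else 0)" for V w y
 have c: "\<Xi> V' w' y = \<Xi> V w y + \<phi> T \<tau> y" if w: "bcyc i V w" "bcyc i V' w'" and l: "link V w V' w' T \<tau>" and y: "y \<in> T" for V w V' w' T \<tau> y
 proof -
  note L = linkD[OF l]
  have yV: "y \<in> V" "y \<in> V'" using L y by auto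
  have dl: "del V w V' w' y = \<phi> T \<tau> y" by (rule del_eq[OF w l y])
  show ?thesis
  proof (cases "y \<in> line0")
   case False
   thus ?thesis using tm_outside[OF t L(1,4), of y] by (simp add: \<Xi>_def)
  next
   case yL: True
   show ?thesis
   proof (cases "y \<in> U")
    case True
    thus ?thesis using yV yL del_cocycle[OF z0(2) w True yV] dl by (simp add: \<Xi>_def)
   next
    case False
    hence q: "y \<in> Z" using yL by (simp add: Z_def)
    hence "y \<in> A y \<inter> Db" using A[OF q] yV bcycD(2)[OF w(1)] by auto
    thus ?thesis using yV yL False del_cocycle[OF zq[OF q] w _ yV] dl by (simp add: \<Xi>_def)
   qed
  qed
 qed
 \<comment> \<open>Near \<open>q\<close> the reference lift of \<open>q\<close> serves at every
   point, not only at \<open>q\<close>: the Cousin solution makes the two expressions agree.\<close>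
 have XiA: "\<Xi> V w u = \<xi> q u + del (A q \<inter> Db) (zq q) V w u" if w: "bcyc i V w" and q: "q \<in> Z" and u: "u \<in> V" "u \<in> A q" "u \<in> line0" for V w q u
 proof (cases "u = q")
  case True thus ?thesis using u ZL[OF q] by (simp add: \<Xi>_def)
 next
  case False
  hence uU: "u \<in> U" using A[OF q] u by blast
  have uB: "u \<in> A q \<inter> Db" using u bcycD(2)[OF w] by auto
  have "\<xi> q u = \<xi>0 u + del U z0 (A q \<inter> Db) (zq q) u" using xieq[OF q, of u] uU u by (simp add: \<theta>_def)
  thus ?thesis using del_cocycle[OF z0(2) zq[OF q] w uU uB u(1)] u uU by (simp add: \<Xi>_def)
 qed
 have reg: "\<Xi> V w \<in> qsec pt V" if w: "bcyc i V w" for V w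
 proof (rule qsec_localI[OF bcycD(1)[OF w]])
  note W = bcycD[OF w]
  show "\<Xi> V w x = 0" if "x \<notin> onp V" for x
  proof -
   have "x \<notin> onl V" using that W(2) pt_Db by auto
   thus ?thesis unfolding \<Xi>_def by (rule if_not_P)
  qed
  fix x assume x: "x \<in> onl V"
  hence xD: "x \<in> Db" using W(2) by auto
  show "\<exists>T g. open T \<and> x \<in> T \<and> T \<subseteq> V \<and> g \<in> qsec pt T \<and> (\<forall>u\<in> onp T. \<Xi> V w u = g u)"
  proof (cases "x \<in> U")
   case True
   obtain T \<tau> where T: "x \<in> T" "link U z0 V w T \<tau>" using ex_link[OF z0(2) w True] x by blast
   note L = linkD[OF T(2)]
   have "(\<lambda>u. on_set T \<xi>0 u + \<phi> T \<tau> u) \<in> qsec pt T"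
    by (intro qsec_add qsec_restrict[OF U(1) L(1,2) xi0] tm_closed[OF t L(1,4)] L)
   moreover have "\<forall>u\<in> onp T. \<Xi> V w u = on_set T \<xi>0 u + \<phi> T \<tau> u"
   proof
    fix u assume "u \<in> onp T"
    hence u: "u \<in> T" "u \<in> onl V" "u \<in> U" using L(2,3) by auto
    thus "\<Xi> V w u = on_set T \<xi>0 u + \<phi> T \<tau> u" using del_eq[OF z0(2) w T(2) u(1)] by (simp add: \<Xi>_def)
   qed
   ultimately show ?thesis using L(1,3) T(1) by (intro exI[of _ T] exI[of _ "\<lambda>u. on_set T \<xi>0 u + \<phi> T \<tau> u"]) simp
  next
   case False
   hence q: "x \<in> Z" using x by (simp add: Z_def)
   have "x \<in> A x \<inter> Db" using A[OF q] xD by blast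
   then obtain T \<tau> where T: "x \<in> T" "link (A x \<inter> Db) (zq x) V w T \<tau>" using ex_link[OF zq[OF q] w] x by blast
   note L = linkD[OF T(2)]
   have TA: "T \<subseteq> A x" using L(2) by blast
   have oA: "open (A x)" using A[OF q] by blast
   have "(\<lambda>u. on_set T (\<xi> x) u + \<phi> T \<tau> u) \<in> qsec pt T"
    by (intro qsec_add qsec_restrict[OF oA L(1) TA xi[OF q]] tm_closed[OF t L(1,4)] L)
   moreover have "\<forall>u\<in> onp T. \<Xi> V w u = on_set T (\<xi> x) u + \<phi> T \<tau> u"
   proof
    fix u assume "u \<in> onp T"
    hence u: "u \<in> T" "u \<in> V" "u \<in> A x" "u \<in> line0" using L(3) TA by auto
    thus "\<Xi> V w u = on_set T (\<xi> x) u + \<phi> T \<tau> u" using del_eq[OF zq[OF q] w T(2) u(1)] XiA[OF w q u(2-4)] by simp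
   qed
   ultimately show ?thesis using L(1,3) T(1) by (intro exI[of _ T] exI[of _ "\<lambda>u. on_set T (\<xi> x) u + \<phi> T \<tau> u"]) simp
  qed
 qed
 have "\<Xi> (N \<inter> Db) zp \<in> qsec pt N"
 proof (rule qsec_localI[OF P(1)])
  show "\<Xi> (N \<inter> Db) zp x = 0" if "x \<notin> onp N" for x
   using that qsec_outside[OF reg[OF zp], of x] by blast
  fix x assume x: "x \<in> onl N"
  show "\<exists>T g. open T \<and> x \<in> T \<and> T \<subseteq> N \<and> g \<in> qsec pt T \<and> (\<forall>u\<in> onp T. \<Xi> (N \<inter> Db) zp u = g u)"
  proof (cases "x = pt")
   case False
   hence "x \<in> Db" using x line0_Db by blast
   thus ?thesis using reg[OF zp] bcycD(1)[OF zp] x by (intro exI[of _ "N \<inter> Db"] exI[of _ "\<Xi> (N \<inter> Db) zp"]) auto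
  next
   case True
   have q: "pt \<in> Z" using pt_line0 U(2) pt_Db by (auto simp: Z_def)
   note Aq = A[OF q] and Aq' = Ap[OF q]
   \<comment> \<open>The reference lift of the marked point is a restriction of \<open>zp\<close>,
     so the difference is 0 and \<open>\<xi> pt\<close> remains.\<close>
   have "\<Xi> (N \<inter> Db) zp u = \<xi> pt u" if u: "u \<in> A pt \<inter> line0 - {pt}" for u
   proof -
    have uB: "u \<in> A pt \<inter> Db" "u \<in> N \<inter> Db" using u line0_Db Aq' by auto
    note z2 = bcycD(1,3)[OF zq[OF q]]
    let ?B = "A pt \<inter> Db"
    have BN: "?B \<subseteq> N \<inter> Db" using Aq' by blast
    have r: "rs 0 ?B ?B (zq pt) = zq pt" by (rule om_res_id[OF omJ z2])
    have "d (-1) ?B (z (-1) ?B) = z 0 ?B" by (rule hom_zero[OF omJ omJ hom_d(2) z2(1)])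
    hence l: "link ?B (zq pt) (N \<inter> Db) zp ?B (z (-1) ?B)"
     unfolding link_def using z2(1) BN om_zero[OF omJ z2(1)] r om_zero_right[OF omJ z2] Aq' by simp
    have "\<phi> ?B (z (-1) ?B) = (\<lambda>_. 0)" using tm_smult[OF t z2(1) regular_zero om_zero[OF omJ z2(1)]] om_smult_zero[OF omJ z2(1) regular_zero] by simp
    hence "del ?B (zq pt) (N \<inter> Db) zp u = 0" using del_eq[OF zq[OF q] zp l uB(1)] by simp
    thus ?thesis using XiA[OF zp q uB(2)] u by simp
   qed
   thus ?thesis unfolding True using Aq Aq' xi[OF q] by (intro exI[of _ "A pt"] exI[of _ "\<xi> pt"]) simp
  qed
 qed
 moreover have "torsor_section i \<Xi>" unfolding torsor_section_def using reg c by blast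
 ultimately show ?thesis by blast
qed

section \<open>The null-homotopy for k = 1\<close>

context
 fixes \<Xi> assumes tor: "\<forall>i. i = 2 \<or> i = 3 --> torsor_section i (\<Xi> i)"
begin

lemma tor_qsec: "i = 2 \<or> i = 3 ==> bcyc i V w ==> \<Xi> i V w \<in> qsec pt V"
 using tor[rule_format, of i] unfolding torsor_section_def by blast

lemma tor_link: "i = 2 \<or> i = 3 ==> bcyc i V w ==> bcyc i V' w' ==> link V w V' w' T \<tau> ==> y \<in> T ==> \<Xi> i V' w' y = \<Xi> i V w y + \<phi> T \<tau> y"
 using tor[rule_format, of i] unfolding torsor_section_def by blast

lemma tor_res:
 assumes i: "i = 2 \<or> i = 3" and w: "bcyc i V w" and S: "open S" "S \<subseteq> V"
 shows "\<Xi> i S (rs 0 V S w) = on_set S (\<Xi> i V w)"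
proof
 fix y
 note R = bcyc_res[OF w S]
 note k = bcycD(3)[OF R]
 show "\<Xi> i S (rs 0 V S w) y = on_set S (\<Xi> i V w) y"
 proof (cases "y \<in> S")
  case True
  have "d (-1) S (z (-1) S) = z 0 S" by (rule hom_zero[OF omJ omJ hom_d(2) S(1)])
  hence l: "link V w S (rs 0 V S w) S (z (-1) S)" unfolding link_def
   using S om_zero[OF omJ S(1)] om_res_id[OF omJ S(1) k] om_zero_right[OF omJ S(1) k] by simp
  have "\<phi> S (z (-1) S) = (\<lambda>_. 0)"
   using tm_smult[OF t S(1) regular_zero om_zero[OF omJ S(1)]] om_smult_zero[OF omJ S(1) regular_zero] by simp
  thus ?thesis using tor_link[OF i w R l True] True by simp
 next
  case False
  thus ?thesis using qsec_outside[OF tor_qsec[OF i R], of y] by (simp add: on_set_out)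
 qed
qed

text \<open>A local form of the cochain \<open>k\<close> of degree 0, with the value
  \<open>f\<close> that the homotopy receives on it: \<Xi> on the lifts, \<phi> on boundaries, and 0
  on multiples of \<open>mW\<close>.\<close>

definition rep_at where
 "rep_at T k f \<kappa> zX zY \<alpha> \<beta> \<tau> \<longleftrightarrow> wl T \<kappa> \<and> bcyc 2 T zX \<and> bcyc 3 T zY \<and> \<alpha> \<in> regular_on T \<and> \<beta> \<in> regular_on T \<and>
  \<tau> \<in> C (-1) T \<and> k = ad 0 T \<kappa> (ad 0 T (cmb T \<alpha> zX \<beta> zY) (d (-1) T \<tau>)) \<and>
  f = (\<lambda>u. \<alpha> u * \<Xi> 2 T zX u + \<beta> u * \<Xi> 3 T zY u + \<phi> T \<tau> u)"

definition cy where "cy T k f \<longleftrightarrow> (\<exists>\<kappa> zX zY \<alpha> \<beta> \<tau>. rep_at T k f \<kappa> zX zY \<alpha> \<beta> \<tau>)"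

lemma cyI: "rep_at T k f \<kappa> zX zY \<alpha> \<beta> \<tau> ==> cy T k f"
 unfolding cy_def by (intro exI)

lemma rep_atD:
 assumes "rep_at T k f \<kappa> zX zY \<alpha> \<beta> \<tau>"
 shows "open T" "T \<subseteq> Db" "wl T \<kappa>" "bcyc 2 T zX" "bcyc 3 T zY" "\<alpha> \<in> regular_on T" "\<beta> \<in> regular_on T"
  "\<tau> \<in> C (-1) T" "k = ad 0 T \<kappa> (ad 0 T (cmb T \<alpha> zX \<beta> zY) (d (-1) T \<tau>))"
  "f = (\<lambda>u. \<alpha> u * \<Xi> 2 T zX u + \<beta> u * \<Xi> 3 T zY u + \<phi> T \<tau> u)"
  "\<kappa> \<in> C 0 T" "zX \<in> C 0 T" "zY \<in> C 0 T" "cmb T \<alpha> zX \<beta> zY \<in> C 0 T" "d (-1) T \<tau> \<in> C 0 T"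
proof -
 show *: "wl T \<kappa>" "bcyc 2 T zX" "bcyc 3 T zY" "\<alpha> \<in> regular_on T" "\<beta> \<in> regular_on T"
  "\<tau> \<in> C (-1) T" "k = ad 0 T \<kappa> (ad 0 T (cmb T \<alpha> zX \<beta> zY) (d (-1) T \<tau>))"
  "f = (\<lambda>u. \<alpha> u * \<Xi> 2 T zX u + \<beta> u * \<Xi> 3 T zY u + \<phi> T \<tau> u)" using assms by (simp_all add: rep_at_def)
 show **: "open T" "T \<subseteq> Db" "zX \<in> C 0 T" "zY \<in> C 0 T" using bcycD[OF *(2)] bcycD[OF *(3)] by simp_all
 show "\<kappa> \<in> C 0 T" "cmb T \<alpha> zX \<beta> zY \<in> C 0 T" "d (-1) T \<tau> \<in> C 0 T"
  using wl_closed[OF *(1) **(1)] cmb_closed[OF **(1) *(4,5) **(3,4)] hom_closed[OF hom_d(2) **(1) *(6)] by simp_all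
qed

lemma rep_at_res:
 assumes r: "rep_at T k f \<kappa> zX zY \<alpha> \<beta> \<tau>" and S: "open S" "S \<subseteq> T"
 shows "rep_at S (rs 0 T S k) (on_set S f) (rs 0 T S \<kappa>) (rs 0 T S zX) (rs 0 T S zY) (on_set S \<alpha>) (on_set S \<beta>) (rs (-1) T S \<tau>)"
proof -
 note R = rep_atD[OF r]
 have "rs 0 T S k = ad 0 S (rs 0 T S \<kappa>) (ad 0 S (cmb S (on_set S \<alpha>) (rs 0 T S zX) (on_set S \<beta>) (rs 0 T S zY)) (d (-1) S (rs (-1) T S \<tau>)))"
  unfolding R(9) using om_res_add[OF omJ R(1) S R(11)] om_res_add[OF omJ R(1) S R(14,15)] om_add[OF omJ R(1) R(14,15)]
   cmb_res[OF R(1,6,7,12,13) S] hom_res[OF hom_d(2) R(1) S R(8)] by simp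
 moreover have "on_set S f = (\<lambda>u. on_set S \<alpha> u * \<Xi> 2 S (rs 0 T S zX) u + on_set S \<beta> u * \<Xi> 3 S (rs 0 T S zY) u + \<phi> S (rs (-1) T S \<tau>) u)"
  unfolding R(10) tor_res[OF disjI1[OF refl] R(4) S] tor_res[OF disjI2[OF refl] R(5) S] tm_res[OF t R(1) S R(8)] by (auto simp: osf)
 ultimately show ?thesis unfolding rep_at_def
  using wl_res[OF R(3,1) S] bcyc_res[OF R(4) S] bcyc_res[OF R(5) S] regular_restrict[OF R(6) S(2)] regular_restrict[OF R(7) S(2)] om_res[OF omJ R(1) S R(8)] by blast
qed

lemma cy_res: "cy T k f ==> open S ==> S \<subseteq> T ==> cy S (rs 0 T S k) (on_set S f)"
 unfolding cy_def by (elim exE) (intro exI, rule rep_at_res)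

lemma cyD:
 assumes "cy T k f" shows "open T" "T \<subseteq> Db" "f \<in> qsec pt T" "k \<in> C 0 T"
proof -
 from assms obtain \<kappa> zX zY \<alpha> \<beta> \<tau> where r: "rep_at T k f \<kappa> zX zY \<alpha> \<beta> \<tau>" unfolding cy_def by (elim exE)
 note R = rep_atD[OF r]
 show "open T" "T \<subseteq> Db" by (rule R)+
 show "f \<in> qsec pt T" unfolding R(10) by (intro qsec_add qsec_mult tor_qsec tm_closed[OF t] R) simp_all
 show "k \<in> C 0 T" unfolding R(9) by (intro om_add[OF omJ] R)
qed

lemma cy_smult:
 assumes "cy T k f" "g \<in> regular_on T" shows "cy T (sm 0 T g k) (\<lambda>u. g u * f u)"
proof -
 from assms obtain \<kappa> zX zY \<alpha> \<beta> \<tau> where r: "rep_at T k f \<kappa> zX zY \<alpha> \<beta> \<tau>" unfolding cy_def by (elim exE)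
 note R = rep_atD[OF r] and g = assms(2)
 have "rep_at T (sm 0 T g k) (\<lambda>u. g u * f u) (sm 0 T g \<kappa>) zX zY (\<lambda>u. g u * \<alpha> u) (\<lambda>u. g u * \<beta> u) (sm (-1) T g \<tau>)"
  unfolding rep_at_def
 proof (intro conjI)
  have "sm 0 T g (cmb T \<alpha> zX \<beta> zY) = cmb T (\<lambda>u. g u * \<alpha> u) zX (\<lambda>u. g u * \<beta> u) zY"
   unfolding cmb_def using R g by (simp add: om_smult_add[OF omJ] om_smult_smult[OF omJ] om_smult[OF omJ])
  thus "sm 0 T g k = ad 0 T (sm 0 T g \<kappa>) (ad 0 T (cmb T (\<lambda>u. g u * \<alpha> u) zX (\<lambda>u. g u * \<beta> u) zY) (d (-1) T (sm (-1) T g \<tau>)))"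
   unfolding R(9) using hom_smult[OF hom_d(2) R(1) g R(8)] om_smult_add[OF omJ R(1) g] R om_add[OF omJ R(1) R(14,15)] by simp
  show "(\<lambda>u. g u * f u) = (\<lambda>u. g u * \<alpha> u * \<Xi> 2 T zX u + g u * \<beta> u * \<Xi> 3 T zY u + \<phi> T (sm (-1) T g \<tau>) u)"
   unfolding R(10) tm_smult[OF t R(1) g R(8)] by (simp add: algebra_simps)
 qed (use R g in \<open>auto intro: wl_smult regular_mult om_smult[OF omJ]\<close>)
 thus ?thesis by (rule cyI)
qed

text \<open>The lifts of the second form are exchanged for those of the first; the comparing
  cochains are absorbed into \<tau>, and \<Xi> changes exactly by their values under \<phi>.\<close>

lemma cy_add:
 assumes "cy T k f" "cy T k' f'" "y \<in> T"
 shows "\<exists>S. open S \<and> y \<in> S \<and> S \<subseteq> T \<and> cy S (rs 0 T S (ad 0 T k k')) (on_set S (\<lambda>u. f u + f' u))"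
proof -
 from assms(1) obtain \<kappa> zX zY \<alpha> \<beta> \<tau> where r: "rep_at T k f \<kappa> zX zY \<alpha> \<beta> \<tau>" unfolding cy_def by (elim exE)
 from assms(2) obtain \<kappa>' zX' zY' \<alpha>' \<beta>' \<tau>' where r': "rep_at T k' f' \<kappa>' zX' zY' \<alpha>' \<beta>' \<tau>'" unfolding cy_def by (elim exE)
 note R0 = rep_atD[OF r] and R0' = rep_atD[OF r']
 obtain A p where A: "y \<in> A" "link T zX T zX' A p" using ex_link[OF R0(4) R0'(4) assms(3,3)] by (elim exE conjE)
 obtain B q where B: "y \<in> B" "link T zY T zY' B q" using ex_link[OF R0(5) R0'(5) assms(3,3)] by (elim exE conjE)
 let ?S = "A \<inter> B"
 note LA = linkD[OF A(2)] and LB = linkD[OF B(2)]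
 have S: "open ?S" "?S \<subseteq> T" "y \<in> ?S" using A(1) B(1) LA(1,2) LB(1) by auto
 let ?p = "rs (-1) A ?S p" and ?q = "rs (-1) B ?S q"
 note lA = link_res[OF A(2) R0(1,12) R0'(1,12) S(1) Int_lower1] and lB = link_res[OF B(2) R0(1,13) R0'(1,13) S(1) Int_lower2]
 note PA = linkD[OF lA] and PB = linkD[OF lB]
 note r1 = rep_at_res[OF r S(1,2)] and r1' = rep_at_res[OF r' S(1,2)]
 note R = rep_atD[OF r1] and R' = rep_atD[OF r1']
 let ?a = "on_set ?S \<alpha>" and ?a' = "on_set ?S \<alpha>'" and ?b = "on_set ?S \<beta>" and ?b' = "on_set ?S \<beta>'"
 let ?X = "rs 0 T ?S zX" and ?Y = "rs 0 T ?S zY" and ?X' = "rs 0 T ?S zX'" and ?Y' = "rs 0 T ?S zY'" and ?k = "rs 0 T ?S \<kappa>" and ?k' = "rs 0 T ?S \<kappa>'"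
 let ?t = "rs (-1) T ?S \<tau>" and ?t' = "rs (-1) T ?S \<tau>'"
 let ?n = "ad (-1) ?S (ad (-1) ?S ?t ?t') (ad (-1) ?S (sm (-1) ?S ?a' ?p) (sm (-1) ?S ?b' ?q))"
 have n: "?n \<in> C (-1) ?S" by (intro om_add[OF omJ] om_smult[OF omJ] S R R' PA PB)
 have pq: "sm (-1) ?S ?a' ?p \<in> C (-1) ?S" "sm (-1) ?S ?b' ?q \<in> C (-1) ?S" "ad (-1) ?S ?t ?t' \<in> C (-1) ?S"
  "ad (-1) ?S (sm (-1) ?S ?a' ?p) (sm (-1) ?S ?b' ?q) \<in> C (-1) ?S" by (intro om_add[OF omJ] om_smult[OF omJ] S R R' PA PB)+
 have dp: "d (-1) ?S ?p \<in> C 0 ?S" "d (-1) ?S ?q \<in> C 0 ?S" by (intro hom_closed[OF hom_d(2)] S PA PB)+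
 note smc = om_smult[OF omJ S(1)]
 have dn: "d (-1) ?S ?n = ad 0 ?S (ad 0 ?S (d (-1) ?S ?t) (d (-1) ?S ?t')) (ad 0 ?S (sm 0 ?S ?a' (d (-1) ?S ?p)) (sm 0 ?S ?b' (d (-1) ?S ?q)))"
  by (simp add: hom_add[OF hom_d(2) S(1)] pq R(8) R'(8) hom_smult[OF hom_d(2) S(1)] R'(6,7) PA(4) PB(4))
 have "rs 0 T ?S (ad 0 T k k') = ad 0 ?S (ad 0 ?S ?k (ad 0 ?S (cmb ?S ?a ?X ?b ?Y) (d (-1) ?S ?t)))
   (ad 0 ?S ?k' (ad 0 ?S (cmb ?S ?a' ?X' ?b' ?Y') (d (-1) ?S ?t')))"
  using om_res_add[OF omJ R0(1) S(1,2) cyD(4)[OF assms(1)] cyD(4)[OF assms(2)]] R(9) R'(9) by simp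
 also have "cmb ?S ?a' ?X' ?b' ?Y' = ad 0 ?S (ad 0 ?S (sm 0 ?S ?a' ?X) (sm 0 ?S ?a' (d (-1) ?S ?p))) (ad 0 ?S (sm 0 ?S ?b' ?Y) (sm 0 ?S ?b' (d (-1) ?S ?q)))"
  unfolding cmb_def PA(5) PB(5) using om_smult_add[OF omJ S(1)] R R' dp by simp
 finally have "rs 0 T ?S (ad 0 T k k') = ad 0 ?S (ad 0 ?S ?k ?k') (ad 0 ?S (cmb ?S (\<lambda>u. ?a u + ?a' u) ?X (\<lambda>u. ?b u + ?b' u) ?Y) (d (-1) ?S ?n))"
  unfolding dn unfolding cmb_def
  by (simp add: om_add_smult[OF omJ S(1), symmetric] om_assoc[OF omJ S(1)] om_lcomm[OF omJ S(1)] om_comm[OF omJ S(1)] om_add[OF omJ S(1)] smc R R' dp)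
 moreover have "on_set ?S (\<lambda>u. f u + f' u) = (\<lambda>u. (?a u + ?a' u) * \<Xi> 2 ?S ?X u + (?b u + ?b' u) * \<Xi> 3 ?S ?Y u + \<phi> ?S ?n u)"
 proof
  fix u
  show "on_set ?S (\<lambda>u. f u + f' u) u = (?a u + ?a' u) * \<Xi> 2 ?S ?X u + (?b u + ?b' u) * \<Xi> 3 ?S ?Y u + \<phi> ?S ?n u"
  proof (cases "u \<in> ?S")
   case True
   have 1: "\<Xi> 2 ?S ?X' u = \<Xi> 2 ?S ?X u + \<phi> ?S ?p u" "\<Xi> 3 ?S ?Y' u = \<Xi> 3 ?S ?Y u + \<phi> ?S ?q u"
    using tor_link[OF _ R0(4) R0'(4) lA True] tor_link[OF _ R0(5) R0'(5) lB True]
     tor_res[OF _ R0(4) S(1,2)] tor_res[OF _ R0'(4) S(1,2)] tor_res[OF _ R0(5) S(1,2)] tor_res[OF _ R0'(5) S(1,2)] True by simp_all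
   have 2: "\<phi> ?S ?n u = \<phi> ?S ?t u + \<phi> ?S ?t' u + (?a' u * \<phi> ?S ?p u + ?b' u * \<phi> ?S ?q u)"
    by (simp add: tm_add[OF t S(1)] tm_smult[OF t S(1)] pq R(8) R'(6-8) PA(4) PB(4))
   show ?thesis using fun_cong[OF R(10), of u] fun_cong[OF R'(10), of u] True unfolding 2 1 by (simp add: algebra_simps)
  next
   case False
   have "\<phi> ?S ?n u = 0" by (rule tm_outside[OF t S(1) n]) (use False in blast)
   moreover have "?a u = 0" "?a' u = 0" "?b u = 0" "?b' u = 0" "on_set ?S (\<lambda>u. f u + f' u) u = 0" by (rule on_set_out[OF False])+
   ultimately show ?thesis by simp
  qed
 qed
 ultimately have "rep_at ?S (rs 0 T ?S (ad 0 T k k')) (on_set ?S (\<lambda>u. f u + f' u)) (ad 0 ?S ?k ?k') ?X ?Y (\<lambda>u. ?a u + ?a' u) (\<lambda>u. ?b u + ?b' u) ?n"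
  unfolding rep_at_def using wl_add[OF R(3) R'(3) S(1)] R(4,5) regular_add[OF R(6) R'(6)] regular_add[OF R(7) R'(7)] n by blast
 from cyI[OF this] show ?thesis using S by (intro exI[of _ ?S] conjI)
qed

text \<open>Here the vanishing of \<open>val1\<close> enters. The part \<kappa> is a cycle, hence 0.
  The image gives \<alpha> X + \<beta> Y = 0, so \<alpha> = - \<gamma> Y and \<beta> = \<gamma> X.
  Then \<tau> and \<gamma> e have the same boundary, so \<phi> agrees on them, and its value on
  \<gamma> e is 0 on the line. The coefficients \<alpha> and \<beta> vanish there as well.\<close>

lemma cy_zero:
 assumes "cy T (z 0 T) f" "y \<in> T" shows "f y = 0"
proof (cases "y \<in> line0")
 case False
 thus ?thesis using qsec_outside[OF cyD(3)[OF assms(1)], of y] by blast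
next
 case yL: True
 from assms(1) obtain \<kappa> zX zY \<alpha> \<beta> \<tau> where r: "rep_at T (z 0 T) f \<kappa> zX zY \<alpha> \<beta> \<tau>" unfolding cy_def by (elim exE)
 note R = rep_atD[OF r]
 note x = bcycD[OF R(4)] and yy = bcycD[OF R(5)]
 have o: "open T" by (rule R)
 have dc: "d 0 T (ad 0 T (cmb T \<alpha> zX \<beta> zY) (d (-1) T \<tau>)) = z 1 T"
  using hom_add[OF hom_d(3) o R(14,15)] d_cmb_cycles[OF o R(6,7,12,13) x(4) yy(4)] dd(2)[OF o R(8)] om_zero_left[OF omJ o om_zero[OF omJ o]] by simp
 have "d 0 T \<kappa> = z 1 T"
 proof -
  have "z 1 T = d 0 T (z 0 T)" by (rule hom_zero[OF omJ omJ hom_d(3) o, symmetric])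
  also have "\<dots> = ad 1 T (d 0 T \<kappa>) (z 1 T)"
   by (subst R(9)) (simp add: hom_add[OF hom_d(3) o R(11) om_add[OF omJ o R(14,15)]] dc)
  also have "\<dots> = d 0 T \<kappa>" by (rule om_zero_right[OF omJ o hom_closed[OF hom_d(3) o R(11)]])
  finally show ?thesis by simp
 qed
 hence k0: "\<kappa> = z 0 T" by (rule wl_cycle[OF R(3,1,2)])
 have eq: "ad 0 T (cmb T \<alpha> zX \<beta> zY) (d (-1) T \<tau>) = z 0 T"
  using R(9) om_zero_left[OF omJ o om_add[OF omJ o R(14,15)]] k0 by simp
 have "s 0 T (z 0 T) = (\<lambda>_. 0)" using hom_zero[OF omJ _ hom_s(1) o] O_module_struct_sheaf by (simp add: struct_sheaf_def)
 hence sx: "\<alpha> u * ratio 2 b T u + \<beta> u * ratio 3 b T u = 0" for u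
  using fun_cong[OF s_add(1)[OF o R(14,15)], of u] by (simp add: eq s_cmb[OF o R(6,7,12,13)] s_dm1[OF o R(8)] x(5) yy(5))
 have "\<forall>u\<in>T. \<alpha> u * ratio 2 b T u + \<beta> u * ratio 3 b T u = 0" using sx by (rule ballI)
 from syzygy_ratio[OF R(6,7,1,2) assms(2) this] obtain T1 \<gamma> where T1: "open T1" "y \<in> T1" "T1 \<subseteq> T" "\<gamma> \<in> regular_on T1"
  "\<forall>u\<in>T1. \<alpha> u = - (\<gamma> u * ratio 3 b T1 u) \<and> \<beta> u = \<gamma> u * ratio 2 b T1 u" by (elim exE conjE)
 from ex_b_datum_over[OF R(4,5) assms(2)] obtain T2 e where T2: "y \<in> T2" "T2 \<subseteq> T" "b_datum T2 (rs 0 T T2 zX) (rs 0 T T2 zY) e" by (elim exE conjE)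
 note D2 = b_datumD[OF T2(3)]
 let ?S = "T1 \<inter> T2"
 have S: "open ?S" "?S \<subseteq> T" "?S \<subseteq> T2" "y \<in> ?S" using T1 T2 D2(5) by auto
 let ?X = "rs 0 T ?S zX" and ?Y = "rs 0 T ?S zY" and ?e = "rs (-1) T2 ?S e" and ?t = "rs (-1) T ?S \<tau>" and ?g = "on_set ?S \<gamma>"
 have B: "b_datum ?S ?X ?Y ?e"
  using b_datum_res[OF T2(3) S(1,3)] om_res_res[OF omJ R(1) D2(5) S(1,3) T2(2) R(12)] om_res_res[OF omJ R(1) D2(5) S(1,3) T2(2) R(13)] by simp
 note Q = rep_atD[OF rep_at_res[OF r S(1,2)]] and Bd = b_datumD[OF B]
 have g: "?g \<in> regular_on ?S" by (rule regular_restrict[OF T1(4)]) blast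
 have ab: "on_set ?S \<alpha> = (\<lambda>u. on_set ?S (\<lambda>_. - 1) u * (?g u * ratio 3 b ?S u))" "on_set ?S \<beta> = (\<lambda>u. ?g u * ratio 2 b ?S u)"
  using T1(5) by (auto simp: osf ratio_def)
 note rr = ratio_regular[OF Q(2)]
 let ?R = "sm 0 ?S (\<lambda>u. ?g u * ratio 3 b ?S u) ?X" and ?Q = "sm 0 ?S (\<lambda>u. ?g u * ratio 2 b ?S u) ?Y"
 have RQ: "?R \<in> C 0 ?S" "?Q \<in> C 0 ?S" "sm 0 ?S (on_set ?S \<alpha>) ?X \<in> C 0 ?S" by (intro om_smult[OF omJ] S regular_mult g rr Q)+
 have de: "d (-1) ?S (sm (-1) ?S ?g ?e) = sb 0 ?S ?R ?Q"
  by (simp add: hom_smult[OF hom_d(2) S(1) g Bd(3)] Bd(4) om_smult_sub[OF omJ S(1) g] om_smult[OF omJ S(1)] rr Q om_smult_smult[OF omJ S(1) g])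
 have "ad 0 ?S (cmb ?S (on_set ?S \<alpha>) ?X (on_set ?S \<beta>) ?Y) (d (-1) ?S (sm (-1) ?S ?g ?e)) = ad 0 ?S (sm 0 ?S (on_set ?S \<alpha>) ?X) ?R"
  unfolding de unfolding cmb_def using om_assoc[OF omJ S(1)] RQ om_sub_add[OF omJ S(1)] om_sub[OF omJ S(1)] by (simp add: ab(2))
 also have "\<dots> = sm 0 ?S (\<lambda>u. on_set ?S \<alpha> u + ?g u * ratio 3 b ?S u) ?X"
  by (rule om_add_smult[OF omJ S(1) Q(6) _ Q(12)]) (intro regular_mult g rr)
 also have "(\<lambda>u. on_set ?S \<alpha> u + ?g u * ratio 3 b ?S u) = (\<lambda>_. 0)" unfolding ab(1) by (auto simp: osf)
 also have "sm 0 ?S (\<lambda>_. 0) ?X = z 0 ?S" by (rule om_zero_smult[OF omJ S(1) Q(12)])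
 finally have 1: "ad 0 ?S (cmb ?S (on_set ?S \<alpha>) ?X (on_set ?S \<beta>) ?Y) (d (-1) ?S (sm (-1) ?S ?g ?e)) = z 0 ?S" .
 have ge: "sm (-1) ?S ?g ?e \<in> C (-1) ?S" by (rule om_smult[OF omJ S(1) g Bd(3)])
 have "ad 0 ?S (cmb ?S (on_set ?S \<alpha>) ?X (on_set ?S \<beta>) ?Y) (d (-1) ?S ?t) = rs 0 T ?S (z 0 T)"
  unfolding eq[symmetric] using om_res_add[OF omJ R(1) S(1,2) R(14,15)] cmb_res[OF R(1,6,7,12,13) S(1,2)] hom_res[OF hom_d(2) R(1) S(1,2) R(8)] by simp
 also have "\<dots> = z 0 ?S" by (rule om_res_zero[OF omJ R(1) S(1,2)])
 finally have "d (-1) ?S ?t = d (-1) ?S (sm (-1) ?S ?g ?e)"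
  using om_add_cancel[OF omJ S(1) Q(14,15) hom_closed[OF hom_d(2) S(1) ge]] 1 by simp
 hence "\<phi> ?S ?t y = \<phi> ?S (sm (-1) ?S ?g ?e) y" by (rule boundary_value[OF t S(1,4) Q(8) ge])
 also have "\<dots> = 0" using tm_smult[OF t S(1) g Bd(3)] syzygy_value_zero[OF B] S(4) yL by simp
 finally have "\<phi> T \<tau> y = 0" using tm_point[OF t R(1) S(1,2) R(8) S(4)] by simp
 moreover have "\<alpha> y = 0" "\<beta> y = 0" using bspec[OF T1(5,2)] T1(2) yL by (simp_all add: ratio_def mem_line0)
 ultimately show "f y = 0" by (simp add: R(10))
qed

lemma cy_unique:
 assumes "cy T k f" "cy T k f'" "y \<in> T" shows "f y = f' y"
proof -
 note A = cyD[OF assms(1)]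
 let ?m = "on_set T (\<lambda>_. - 1)"
 from cy_add[OF assms(1) cy_smult[OF assms(2) regular_const] assms(3), of "- 1"] obtain S where S: "open S" "y \<in> S" "S \<subseteq> T"
  "cy S (rs 0 T S (ad 0 T k (sm 0 T ?m k))) (on_set S (\<lambda>u. f u + ?m u * f' u))" by (elim exE conjE)
 have "cy S (z 0 S) (on_set S (\<lambda>u. f u + ?m u * f' u))"
  using S(4) om_neg_cancel[OF omJ A(1,4)] om_res_zero[OF omJ A(1) S(1,3)] by simp
 from cy_zero[OF this S(2)] show ?thesis using S(2) assms(3) by simp
qed

lemma ex_refs:
 assumes "open V" "V \<subseteq> Db" "y \<in> V" shows "\<exists>S zX zY. y \<in> S \<and> S \<subseteq> V \<and> bcyc 2 S zX \<and> bcyc 3 S zY"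
 using ex_b_datum[OF assms] unfolding b_datum_def by (elim exE conjE) (intro exI conjI)

lemma cy_boundary:
 assumes U: "open U" "\<tau> \<in> C (-1) U" "y \<in> U" "y \<in> Db"
 shows "\<exists>S. y \<in> S \<and> S \<subseteq> U \<and> cy S (rs 0 U S (d (-1) U \<tau>)) (on_set S (\<phi> U \<tau>))"
proof -
 have "open (U \<inter> Db)" "U \<inter> Db \<subseteq> Db" "y \<in> U \<inter> Db" using open_Int[OF U(1) open_Db] U by auto
 from ex_refs[OF this] obtain S zX zY where S: "y \<in> S" "S \<subseteq> U \<inter> Db" "bcyc 2 S zX" "bcyc 3 S zY" by (elim exE conjE)
 note X = bcycD[OF S(3)] and Y = bcycD[OF S(4)]
 have SU: "S \<subseteq> U" using S(2) by blast
 note z0 = om_zero[OF omJ X(1)] and tau = om_res[OF omJ U(1) X(1) SU U(2)]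
 have k: "d (-1) S (rs (-1) U S \<tau>) \<in> C 0 S" by (rule hom_closed[OF hom_d(2) X(1) tau])
 have "rs 0 U S (d (-1) U \<tau>) = ad 0 S (z 0 S) (ad 0 S (cmb S (\<lambda>_. 0) zX (\<lambda>_. 0) zY) (d (-1) S (rs (-1) U S \<tau>)))"
  unfolding cmb_def using hom_res[OF hom_d(2) U(1) X(1) SU U(2)] k
  by (simp add: om_zero_smult[OF omJ X(1)] X Y om_zero_left[OF omJ X(1)] z0)
 hence "rep_at S (rs 0 U S (d (-1) U \<tau>)) (on_set S (\<phi> U \<tau>)) (z 0 S) zX zY (\<lambda>_. 0) (\<lambda>_. 0) (rs (-1) U S \<tau>)"
  unfolding rep_at_def wl_def using S regular_zero tau tm_res[OF t U(1) X(1) SU U(2)] by simp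
 from cyI[OF this] show ?thesis using S(1) SU by (intro exI[of _ S] conjI)
qed

lemma cy_ex:
 assumes U: "open U" "m \<in> C 0 U" "y \<in> U" "y \<in> Db"
 shows "\<exists>T f. y \<in> T \<and> T \<subseteq> U \<and> cy T (rs 0 U T m) f"
proof -
 let ?A = "U \<inter> Db" and ?c = "d 0 U m"
 have A: "open ?A" "?A \<subseteq> Db" "?A \<subseteq> U" "y \<in> ?A" using open_Int[OF U(1) open_Db] U by auto
 have c: "?c \<in> ext_zero N U" using hom_closed[OF hom_d(3) U(1,2)] by (simp add: C1_eq)
 note mA = om_res[OF omJ U(1) A(1,3) U(2)]
 have "\<exists>\<kappa>. wl ?A \<kappa> \<and> d 0 ?A \<kappa> = on_set ?A ?c"
 proof (cases "U \<subseteq> N")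
  case True
  hence NA: "?A \<subseteq> N" "?A \<subseteq> Da" using P(3) by blast+
  have cr: "on_set ?A ?c \<in> regular_on ?A" by (rule regular_restrict) (use c ext_zero_regular A in blast)+
  \<comment> \<open>Over \<open>Db\<close> the multiple of \<open>mW\<close> by
    \<open>zc a / zc b\<close> times the boundary of \<open>m\<close> has the same boundary as
    \<open>m\<close>; subtracting it leaves a cycle.\<close>
  have r: "(\<lambda>u. on_set ?A ?c u * ratio a b ?A u) \<in> regular_on ?A" by (intro regular_mult cr ratio_regular A)
  have "(\<lambda>u. on_set ?A ?c u * ratio a b ?A u * ratio b a ?A u) = on_set ?A ?c"
   using NA(2) by (auto simp: on_set_def ratio_def fun_eq_iff)
  thus ?thesis using d_mW[OF A(1) NA(1) r] NA(1) r unfolding wl_def by (intro exI[of _ "sm 0 ?A (\<lambda>u. on_set ?A ?c u * ratio a b ?A u) (rs 0 N ?A mW)"]) auto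
 next
  case False
  hence "?c = (\<lambda>_. 0)" using c by (simp add: ext_zero_def)
  thus ?thesis using hom_zero[OF omJ omJ hom_d(3) A(1)] by (intro exI[of _ "z 0 ?A"]) (simp add: wl_def C1_eq on_set_def)
 qed
 then obtain \<kappa> where k: "wl ?A \<kappa>" "d 0 ?A \<kappa> = on_set ?A ?c" by (elim exE conjE)
 note kc = wl_closed[OF k(1) A(1)]
 let ?m = "sb 0 ?A (rs 0 U ?A m) \<kappa>"
 have m: "?m \<in> C 0 ?A" by (rule om_sub[OF omJ A(1) mA kc])
 have "d 0 ?A (rs 0 U ?A m) = on_set ?A ?c" using hom_res[OF hom_d(3) U(1) A(1,3) U(2)] by (simp add: C1_eq)
 hence dm: "d 0 ?A ?m = z 1 ?A"
  using hom_sub[OF omJ hom_d(3) A(1) mA kc] om_sub_self[OF omJ A(1) hom_closed[OF hom_d(3) A(1) kc]] k(2) by simp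
 from ex_refs[OF A(1,2,4)] obtain S zX zY where S: "y \<in> S" "S \<subseteq> ?A" "bcyc 2 S zX" "bcyc 3 S zY" by (elim exE conjE)
 note X = bcycD[OF S(3)]
 note mS = om_res[OF omJ A(1) X(1) S(2) m]
 from cycle_decomposition[OF S(3,4,1) mS d_res_cycle[OF A(1) X(1) S(2) m dm]]
 obtain T \<alpha> \<beta> \<tau> where T: "open T" "y \<in> T" "T \<subseteq> S" "\<alpha> \<in> regular_on T" "\<beta> \<in> regular_on T" "\<tau> \<in> C (-1) T"
  "rs 0 S T (rs 0 ?A S ?m) = ad 0 T (cmb T \<alpha> (rs 0 S T zX) \<beta> (rs 0 S T zY)) (d (-1) T \<tau>)" by (elim exE conjE)
 have TA: "T \<subseteq> ?A" "T \<subseteq> U" using T(3) S(2) by auto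
 have "rs 0 U T m = rs 0 ?A T (ad 0 ?A \<kappa> ?m)"
  using om_sub_add[OF omJ A(1) mA kc] om_res_res[OF omJ U(1) A(1) T(1) TA(1) A(3) U(2)] by simp
 also have "\<dots> = ad 0 T (rs 0 ?A T \<kappa>) (rs 0 ?A T ?m)" by (rule om_res_add[OF omJ A(1) T(1) TA(1) kc m])
 also have "rs 0 ?A T ?m = rs 0 S T (rs 0 ?A S ?m)" by (rule om_res_res[OF omJ A(1) X(1) T(1,3) S(2) m, symmetric])
 finally have "rep_at T (rs 0 U T m) (\<lambda>u. \<alpha> u * \<Xi> 2 T (rs 0 S T zX) u + \<beta> u * \<Xi> 3 T (rs 0 S T zY) u + \<phi> T \<tau> u)
  (rs 0 ?A T \<kappa>) (rs 0 S T zX) (rs 0 S T zY) \<alpha> \<beta> \<tau>"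
  unfolding rep_at_def T(7) using wl_res[OF k(1) A(1) T(1) TA(1)] bcyc_res[OF S(3) T(1,3)] bcyc_res[OF S(4) T(1,3)] T(4-6) by blast
 from cyI[OF this] show ?thesis using T(2) TA(2) by (intro exI conjI)
qed

context
 assumes xp: "\<Xi> 2 (N \<inter> Db) (pz 2 N (N \<inter> Db) mW mX) \<in> qsec pt N" "\<Xi> 3 (N \<inter> Db) (pz 3 N (N \<inter> Db) mW mY) \<in> qsec pt N"
begin

lemma pz_res:
 assumes m: "m \<in> C 0 N" and T: "open T" "T \<subseteq> N \<inter> Db" shows "rs 0 (N \<inter> Db) T (pz i N (N \<inter> Db) mW m) = pz i N T mW m"
proof -
 let ?B = "N \<inter> Db"
 have B: "open ?B" "?B \<subseteq> N" "?B \<subseteq> Db" using open_Int[OF P(1) open_Db] by auto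
 have w: "rs 0 N ?B mW \<in> C 0 ?B" "rs 0 N ?B m \<in> C 0 ?B" "rs 0 ?B T (rs 0 N ?B mW) = rs 0 N T mW" "rs 0 ?B T (rs 0 N ?B m) = rs 0 N T m"
  by (intro om_res[OF omJ] om_res_res[OF omJ] P B T m)+
 show ?thesis unfolding pz_def using w
  by (simp add: om_res_sub[OF omJ B(1) T] om_smult[OF omJ B(1) ratio_regular[OF B(3)]] om_res_smult[OF omJ B(1) T ratio_regular[OF B(3)]] ratio_restrict[OF T(2)])
qed

text \<open>Near the marked point a cochain is a combination of \<open>mW\<close>,
  \<open>mX\<close>, \<open>mY\<close>. Over \<open>Db\<close> one has \<open>mX\<close> = X
  \<open>mW\<close> - x and \<open>mY\<close> = Y \<open>mW\<close> - y for the lifts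
  \<open>pz\<close>, which turns this into a local form with the coefficients
  \<open>- \<alpha>\<close> and \<open>- \<beta>\<close>. Its value is a section across the marked
  point because \<Xi> is one on these two lifts.\<close>

lemma cy_at_pt:
 assumes U: "open U" "pt \<in> U" "m \<in> C 0 U"
 shows "\<exists>V g. open V \<and> pt \<in> V \<and> V \<subseteq> U \<and> g \<in> qsec pt V \<and> cy (V \<inter> Db) (rs 0 U (V \<inter> Db) m) (on_set (V \<inter> Db) g)"
proof -
 let ?V = "U \<inter> N"
 have V: "open ?V" "pt \<in> ?V" "?V \<subseteq> N" "?V \<subseteq> U" using open_Int[OF U(1) P(1)] U(2) P(2) by auto
 let ?j = "rs 0 U ?V m"
 note j = om_res[OF omJ U(1) V(1,4) U(3)]
 have c: "d 0 ?V ?j \<in> regular_on ?V" using hom_closed[OF hom_d(3) V(1) j] V(3) by (simp add: C1_eq ext_zero_def)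
 have "d 0 ?V ?j = sm 1 ?V (d 0 ?V ?j) (rs 1 N ?V (on_set N (\<lambda>_. 1)))"
  using regular_outside[OF c] V(3) by (auto simp: C1_eq fun_eq_iff on_set_def)
 from decomposition_at_pt[OF pd V(1-3) j c this] obtain W \<alpha> \<beta> \<tau> where W: "open W" "pt \<in> W" "W \<subseteq> ?V" and ab: "\<alpha> \<in> regular_on W" "\<beta> \<in> regular_on W"
  and tau: "\<tau> \<in> C (-1) W" and eq: "rs 0 ?V W ?j = ad 0 W (ad 0 W (sm 0 W (on_set W (s 0 ?V ?j)) (rs 0 N W mW)) (cmb W \<alpha> (rs 0 N W mX) \<beta> (rs 0 N W mY))) (d (-1) W \<tau>)"
  by (elim exE conjE)
 let ?T = "W \<inter> Db" and ?B = "N \<inter> Db" and ?u = "on_set W (s 0 ?V ?j)"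
 have T: "open ?T" "?T \<subseteq> W" "?T \<subseteq> Db" "?T \<subseteq> N" "?T \<subseteq> ?B" "W \<subseteq> N" "W \<subseteq> U" using open_Int[OF W(1) open_Db] W by auto
 have u: "?u \<in> regular_on W" by (rule regular_restrict[OF s0_reg[OF V(1) j] W(3)])
 let ?x = "\<Xi> 2 ?B (pz 2 N ?B mW mX)" and ?y = "\<Xi> 3 ?B (pz 3 N ?B mW mY)"
 define g where "g = (\<lambda>v. - \<alpha> v * on_set W ?x v + - \<beta> v * on_set W ?y v + \<phi> W \<tau> v)"
 have g: "g \<in> qsec pt W" unfolding g_def
  by (intro qsec_add qsec_mult regular_uminus ab qsec_restrict[OF P(1) W(1) T(6)] xp tm_closed[OF t W(1) tau] W)
 have B: "open ?B" "?B \<subseteq> N" "?B \<subseteq> Db" using open_Int[OF P(1) open_Db] by auto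
 note bz = bcyc_pz[OF P(1,3,7,12,16,4)]
 note z2 = bz[OF B P(5,10,14)] and z3 = bz[OF B P(6,11,15)]
 let ?zX = "pz 2 N ?T mW mX" and ?zY = "pz 3 N ?T mW mY"
 note zX = bz[OF T(1,4,3) P(5,10,14)] and zY = bz[OF T(1,4,3) P(6,11,15)]
 let ?X = "ratio 2 b ?T" and ?Y = "ratio 3 b ?T" and ?W = "rs 0 N ?T mW" and ?x' = "rs 0 N ?T mX" and ?y' = "rs 0 N ?T mY"
 let ?a = "on_set ?T \<alpha>" and ?b = "on_set ?T \<beta>" and ?v = "on_set ?T ?u" and ?t = "d (-1) ?T (rs (-1) W ?T \<tau>)"
 have reg: "?a \<in> regular_on ?T" "?b \<in> regular_on ?T" "?v \<in> regular_on ?T" "?X \<in> regular_on ?T" "?Y \<in> regular_on ?T"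
  using regular_restrict[OF ab(1) T(2)] regular_restrict[OF ab(2) T(2)] regular_restrict[OF u T(2)] ratio_regular[OF T(3)] by simp_all
 have cl: "?W \<in> C 0 ?T" "?x' \<in> C 0 ?T" "?y' \<in> C 0 ?T" "?t \<in> C 0 ?T" by (intro om_res[OF omJ] hom_closed[OF hom_d(2)] P T W tau)+
 have zc: "?zX \<in> C 0 ?T" "?zY \<in> C 0 ?T" using bcycD(3)[OF zX] bcycD(3)[OF zY] by auto
 \<comment> \<open>The coefficient of \<open>mW\<close> after the substitution: the old one plus
   \<alpha> X + \<beta> Y.\<close>
 define \<delta> where "\<delta> = (\<lambda>v. ?v v + (?a v * ?X v + ?b v * ?Y v))"
 have \<delta>: "\<delta> \<in> regular_on ?T" unfolding \<delta>_def by (intro regular_add regular_mult reg)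
 have na: "(\<lambda>v. - ?a v) \<in> regular_on ?T" "(\<lambda>v. - ?b v) \<in> regular_on ?T" by (intro regular_uminus reg)+
 note sc = om_smult[OF omJ T(1)]
 have split: "sm 0 ?T (\<lambda>v. f v * r v) ?W = ad 0 ?T (sm 0 ?T f m) (sm 0 ?T f (sb 0 ?T (sm 0 ?T r ?W) m))"
  if "f \<in> regular_on ?T" "r \<in> regular_on ?T" "m \<in> C 0 ?T" for f r m
  using om_smult_add[OF omJ T(1) that(1,3) om_sub[OF omJ T(1) sc[OF that(2) cl(1)] that(3)]] om_sub_add[OF omJ T(1) sc[OF that(2) cl(1)] that(3)]
   om_smult_smult[OF omJ T(1) that(1,2) cl(1)] by simp
 have dW: "sm 0 ?T \<delta> ?W = ad 0 ?T (sm 0 ?T ?v ?W) (ad 0 ?T (ad 0 ?T (sm 0 ?T ?a ?x') (sm 0 ?T ?a ?zX)) (ad 0 ?T (sm 0 ?T ?b ?y') (sm 0 ?T ?b ?zY)))"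
  unfolding \<delta>_def pz_def split[OF reg(1,4) cl(2), symmetric] split[OF reg(2,5) cl(3), symmetric]
  by (simp add: om_add_smult[OF omJ T(1) _ _ cl(1)] regular_add regular_mult reg)
 have nz: "ad 0 ?T (sm 0 ?T f m) (sm 0 ?T (\<lambda>v. - f v) m) = z 0 ?T" if "f \<in> regular_on ?T" "m \<in> C 0 ?T" for f m
  using om_add_smult[OF omJ T(1) that(1) regular_uminus[OF that(1)] that(2)] om_zero_smult[OF omJ T(1) that(2)] by simp
 have "rs 0 U ?T m = rs 0 W ?T (rs 0 ?V W ?j)"
  using om_res_res[OF omJ U(1) V(1) W(1,3) V(4) U(3)] om_res_res[OF omJ U(1) W(1) T(1,2,7) U(3)] by simp
 also have "\<dots> = ad 0 ?T (ad 0 ?T (sm 0 ?T ?v ?W) (ad 0 ?T (sm 0 ?T ?a ?x') (sm 0 ?T ?b ?y'))) ?t"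
 proof -
  have w: "rs 0 N W mW \<in> C 0 W" "rs 0 N W mX \<in> C 0 W" "rs 0 N W mY \<in> C 0 W" by (intro om_res[OF omJ] P W T)+
  note sW = om_smult[OF omJ W(1) u w(1)] and cW = cmb_closed[OF W(1) ab w(2,3)] and tW = hom_closed[OF hom_d(2) W(1) tau]
  show ?thesis unfolding eq
   by (simp add: om_res_add[OF omJ W(1) T(1,2)] om_add[OF omJ W(1)] sW cW tW om_res_smult[OF omJ W(1) T(1,2) u w(1)] cmb_res[OF W(1) ab w(2,3) T(1,2)]
     om_res_res[OF omJ P(1) W(1) T(1,2,6)] P hom_res[OF hom_d(2) W(1) T(1,2) tau, symmetric]) (simp add: cmb_def)
 qed
 also have "\<dots> = ad 0 ?T (sm 0 ?T \<delta> ?W) (ad 0 ?T (cmb ?T (\<lambda>v. - ?a v) ?zX (\<lambda>v. - ?b v) ?zY) ?t)" (is "?l = ?r")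
 proof -
  let ?z1 = "sm 0 ?T ?a ?zX" and ?n1 = "sm 0 ?T (\<lambda>v. - ?a v) ?zX" and ?z2 = "sm 0 ?T ?b ?zY" and ?n2 = "sm 0 ?T (\<lambda>v. - ?b v) ?zY"
  have m: "?z1 \<in> C 0 ?T" "?n1 \<in> C 0 ?T" "?z2 \<in> C 0 ?T" "?n2 \<in> C 0 ?T" "sm 0 ?T ?v ?W \<in> C 0 ?T" "sm 0 ?T ?a ?x' \<in> C 0 ?T" "sm 0 ?T ?b ?y' \<in> C 0 ?T" "?l \<in> C 0 ?T"
   by (intro om_add[OF omJ] sc T reg na zc cl)+
  have "?r = ad 0 ?T (ad 0 ?T ?z1 ?n1) (ad 0 ?T (ad 0 ?T ?z2 ?n2) ?l)"
   unfolding dW cmb_def using m(1-7) cl(4) by (simp add: om_assoc[OF omJ T(1)] om_lcomm[OF omJ T(1)] om_comm[OF omJ T(1)] om_add[OF omJ T(1)])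
  thus ?thesis using nz[OF reg(1) zc(1)] nz[OF reg(2) zc(2)] om_zero_left[OF omJ T(1)] m(8) by simp
 qed
 finally have e: "rs 0 U ?T m = ad 0 ?T (sm 0 ?T \<delta> ?W) (ad 0 ?T (cmb ?T (\<lambda>v. - ?a v) ?zX (\<lambda>v. - ?b v) ?zY) ?t)" .
 have X: "\<Xi> 2 ?T ?zX = on_set ?T ?x" "\<Xi> 3 ?T ?zY = on_set ?T ?y"
  using tor_res[OF disjI1[OF refl] z2 T(1,5)] tor_res[OF disjI2[OF refl] z3 T(1,5)] pz_res[OF P(5) T(1,5)] pz_res[OF P(6) T(1,5)] by simp_all
 have "on_set ?T g = (\<lambda>v. - ?a v * \<Xi> 2 ?T ?zX v + - ?b v * \<Xi> 3 ?T ?zY v + \<phi> ?T (rs (-1) W ?T \<tau>) v)"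
  unfolding X tm_res[OF t W(1) T(1,2) tau] g_def by (auto simp: osf)
 hence "rep_at ?T (rs 0 U ?T m) (on_set ?T g) (sm 0 ?T \<delta> ?W) ?zX ?zY (\<lambda>v. - ?a v) (\<lambda>v. - ?b v) (rs (-1) W ?T \<tau>)"
  unfolding rep_at_def wl_def using e zX zY na om_res[OF omJ W(1) T(1,2) tau] \<delta> T(4) by blast
 from cyI[OF this] show ?thesis using W(1,2) T(7) g by (intro exI[of _ W] exI[of _ g] conjI)
qed

text \<open>The null-homotopy: by \<open>cy_ex\<close> and \<open>cy_unique\<close>, the common
  value of all local forms of \<open>m\<close>.\<close>

definition hh :: "proj3 set => fn => fn" where
 "hh U m = on_set (onp U) (\<lambda>y. THE c. \<exists>T f. y \<in> T \<and> T \<subseteq> U \<and> cy T (rs 0 U T m) f \<and> c = f y)"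

lemma hh_eq:
 assumes U: "open U" "m \<in> C 0 U" and c: "cy T (rs 0 U T m) f" "T \<subseteq> U" "y \<in> T" "y \<in> line0"
 shows "hh U m y = f y"
proof -
 note A = cyD[OF c(1)]
 have "y \<in> onp U" using c A(2) pt_Db by blast
 hence "hh U m y = (THE c. \<exists>T f. y \<in> T \<and> T \<subseteq> U \<and> cy T (rs 0 U T m) f \<and> c = f y)" by (simp add: hh_def)
 also have "\<dots> = f y"
 proof (rule the_equality)
  show "\<exists>T' f'. y \<in> T' \<and> T' \<subseteq> U \<and> cy T' (rs 0 U T' m) f' \<and> f y = f' y" using c by (intro exI conjI) simp_all
  fix c' assume "\<exists>T' f'. y \<in> T' \<and> T' \<subseteq> U \<and> cy T' (rs 0 U T' m) f' \<and> c' = f' y"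
  then obtain T' f' where T': "y \<in> T'" "T' \<subseteq> U" "cy T' (rs 0 U T' m) f'" "c' = f' y" by (elim exE conjE)
  note B = cyD[OF T'(3)]
  let ?S = "T \<inter> T'"
  have S: "open ?S" "y \<in> ?S" using A(1) B(1) c(3) T'(1) by auto
  have "cy ?S (rs 0 U ?S m) (on_set ?S f)" "cy ?S (rs 0 U ?S m) (on_set ?S f')"
   using cy_res[OF c(1) S(1) Int_lower1] cy_res[OF T'(3) S(1) Int_lower2]
    om_res_res[OF omJ U(1) A(1) S(1) Int_lower1 c(2) U(2)] om_res_res[OF omJ U(1) B(1) S(1) Int_lower2 T'(2) U(2)] by simp_all
  from cy_unique[OF this S(2)] show "c' = f y" using S(2) T'(4) by simp
 qed
 finally show ?thesis .
qed

lemma hh_outside: "y \<notin> onp U ==> hh U m y = 0"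
 unfolding hh_def by (rule on_set_out)

lemma hh_qsec:
 assumes U: "open U" "m \<in> C 0 U" shows "hh U m \<in> qsec pt U"
proof (rule qsec_localI[OF U(1) hh_outside])
 fix x assume x: "x \<in> onl U"
 show "\<exists>T g. open T \<and> x \<in> T \<and> T \<subseteq> U \<and> g \<in> qsec pt T \<and> (\<forall>u\<in> onp T. hh U m u = g u)"
 proof (cases "x = pt")
  case False
  then obtain T f where T: "x \<in> T" "T \<subseteq> U" "cy T (rs 0 U T m) f" using cy_ex[OF U, of x] line0_Db x by blast
  have "\<forall>u\<in> onp T. hh U m u = f u" using hh_eq[OF U T(3,2)] by blast
  thus ?thesis using T(1,2) cyD[OF T(3)] by (intro exI[of _ T] exI[of _ f] conjI)
 next
  case True
  hence "pt \<in> U" using x by blast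
  from cy_at_pt[OF U(1) this U(2)] obtain V g where V: "open V" "pt \<in> V" "V \<subseteq> U" "g \<in> qsec pt V" "cy (V \<inter> Db) (rs 0 U (V \<inter> Db) m) (on_set (V \<inter> Db) g)" by (elim exE conjE)
  have "hh U m u = g u" if u: "u \<in> onp V" for u
  proof -
   have "u \<in> V \<inter> Db" using u line0_Db by blast
   thus ?thesis using hh_eq[OF U V(5), of u] u V(3) by auto
  qed
  thus ?thesis unfolding True using V by (intro exI[of _ V] exI[of _ g] conjI ballI)
 qed
qed

lemma hh_pointwise:
 assumes "\<And>y. y \<in> U ==> y \<in> line0 ==> y \<in> Db ==> hh U m y = g y" "\<And>y. y \<notin> onp U ==> g y = 0"
 shows "hh U m = g"
proof
 fix y show "hh U m y = g y"
  using assms hh_outside[of y U m] line0_Db[of y] by (cases "y \<in> onp U") auto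
qed

lemma O_hom_hh: "O_hom (obj J 0) (Qsh pt) hh"
proof (rule O_homI)
 fix U :: "proj3 set" assume U: "open U"
 show "hh U m \<in> car (Qsh pt) U" if "m \<in> C 0 U" for m using hh_qsec[OF U that] by simp
 fix m assume m: "m \<in> C 0 U"
 show "hh U (ad 0 U m n) = hh U m \<boxplus>[Qsh pt,U] hh U n" if n: "n \<in> C 0 U" for n
 proof (rule hh_pointwise)
  fix y assume y: "y \<in> U" "y \<in> line0" "y \<in> Db"
  obtain T f where T: "y \<in> T" "T \<subseteq> U" "cy T (rs 0 U T m) f" using cy_ex[OF U m y(1,3)] by (elim exE conjE)
  obtain T' f' where T': "y \<in> T'" "T' \<subseteq> U" "cy T' (rs 0 U T' n) f'" using cy_ex[OF U n y(1,3)] by (elim exE conjE)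
  note A = cyD[OF T(3)] and B = cyD[OF T'(3)]
  let ?S = "T \<inter> T'"
  have S: "open ?S" "y \<in> ?S" "?S \<subseteq> U" using A(1) B(1) T T' by auto
  have "cy ?S (rs 0 U ?S m) (on_set ?S f)" "cy ?S (rs 0 U ?S n) (on_set ?S f')"
   using cy_res[OF T(3) S(1) Int_lower1] cy_res[OF T'(3) S(1) Int_lower2]
    om_res_res[OF omJ U A(1) S(1) Int_lower1 T(2) m] om_res_res[OF omJ U B(1) S(1) Int_lower2 T'(2) n] by simp_all
  from cy_add[OF this S(2)] obtain R where R: "open R" "y \<in> R" "R \<subseteq> ?S"
   "cy R (rs 0 ?S R (ad 0 ?S (rs 0 U ?S m) (rs 0 U ?S n))) (on_set R (\<lambda>u. on_set ?S f u + on_set ?S f' u))" by (elim exE conjE)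
  note mn = om_add[OF omJ U m n]
  have "cy R (rs 0 U R (ad 0 U m n)) (on_set R (\<lambda>u. on_set ?S f u + on_set ?S f' u))"
   using R(4) om_res_add[OF omJ U S(1,3) m n] om_res_res[OF omJ U S(1) R(1,3) S(3) mn] by simp
  from hh_eq[OF U mn this _ R(2) y(2)] R S(2,3)
  have "hh U (ad 0 U m n) y = f y + f' y" by auto
  thus "hh U (ad 0 U m n) y = (hh U m \<boxplus>[Qsh pt,U] hh U n) y"
   using hh_eq[OF U m T(3,2,1) y(2)] hh_eq[OF U n T'(3,2,1) y(2)] by simp
 qed (simp add: hh_outside)
 show "hh U (sm 0 U f m) = f \<cdot>[Qsh pt,U] hh U m" if f: "f \<in> regular_on U" for f
 proof (rule hh_pointwise)
  fix y assume y: "y \<in> U" "y \<in> line0" "y \<in> Db"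
  obtain T g where T: "y \<in> T" "T \<subseteq> U" "cy T (rs 0 U T m) g" using cy_ex[OF U m y(1,3)] by (elim exE conjE)
  note A = cyD[OF T(3)]
  have "cy T (rs 0 U T (sm 0 U f m)) (\<lambda>u. on_set T f u * g u)"
   using cy_smult[OF T(3) regular_restrict[OF f T(2)]] om_res_smult[OF omJ U A(1) T(2) f m] by simp
  from hh_eq[OF U om_smult[OF omJ U f m] this T(2,1) y(2)] show "hh U (sm 0 U f m) y = (f \<cdot>[Qsh pt,U] hh U m) y"
   using hh_eq[OF U m T(3,2,1) y(2)] T(1) by simp
 qed (simp add: hh_outside)
next
 fix U V :: "proj3 set" and m assume UV: "open U" "open V" "V \<subseteq> U" and m: "m \<in> C 0 U"
 note mV = om_res[OF omJ UV m]
 show "hh V (rs 0 U V m) = res (Qsh pt) U V (hh U m)"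
 proof (rule hh_pointwise)
  fix y assume y: "y \<in> V" "y \<in> line0" "y \<in> Db"
  obtain T f where T: "y \<in> T" "T \<subseteq> V" "cy T (rs 0 V T (rs 0 U V m)) f" using cy_ex[OF UV(2) mV y(1,3)] by (elim exE conjE)
  have TU: "T \<subseteq> U" using T(2) UV(3) by blast
  have "cy T (rs 0 U T m) f" using T(3) om_res_res[OF omJ UV(1,2) cyD(1)[OF T(3)] T(2) UV(3) m] by simp
  from hh_eq[OF UV(1) m this TU T(1) y(2)] show "hh V (rs 0 U V m) y = res (Qsh pt) U V (hh U m) y"
   using hh_eq[OF UV(2) mV T(3,2,1) y(2)] y(1) by simp
 qed (use UV(3) in \<open>auto simp: on_set_def intro: hh_outside\<close>)
qed

lemma hh_boundary:
 assumes U: "open U" "\<tau> \<in> C (-1) U" shows "\<phi> U \<tau> = hh U (d (-1) U \<tau>)"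
proof (rule hh_pointwise[symmetric])
 fix y assume y: "y \<in> U" "y \<in> line0" "y \<in> Db"
 from cy_boundary[OF U y(1,3)] obtain S where S: "y \<in> S" "S \<subseteq> U" "cy S (rs 0 U S (d (-1) U \<tau>)) (on_set S (\<phi> U \<tau>))" by (elim exE conjE)
 from hh_eq[OF U(1) hom_closed[OF hom_d(2) U] S(3,2,1) y(2)] show "hh U (d (-1) U \<tau>) y = \<phi> U \<tau> y" using S(1) by simp
qed (rule tm_outside[OF t U])

end

end

end

lemma null_homotopic_1:
 assumes t: "tmap (-1) \<phi>" and v: "val1 \<phi> 0"
 shows "\<exists>h. O_hom (obj J 0) (Qsh pt) h \<and> (\<forall>U e. open U --> e \<in> C (-1) U --> \<phi> U e = h U (d (-1) U e))"
proof -
 have B: "open (N \<inter> Db)" "N \<inter> Db \<subseteq> N" "N \<inter> Db \<subseteq> Db" using open_Int[OF P(1) open_Db] by auto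
 note bz = bcyc_pz[OF P(1,3,7,12,16,4) B]
 obtain \<Xi>2 where x2: "torsor_section \<phi> 2 \<Xi>2" "\<Xi>2 (N \<inter> Db) (pz 2 N (N \<inter> Db) mW mX) \<in> qsec pt N"
  using ex_torsor_section[OF t v disjI1[OF refl] bz[OF P(5,10,14)]] by (elim exE conjE)
 obtain \<Xi>3 where x3: "torsor_section \<phi> 3 \<Xi>3" "\<Xi>3 (N \<inter> Db) (pz 3 N (N \<inter> Db) mW mY) \<in> qsec pt N"
  using ex_torsor_section[OF t v disjI2[OF refl] bz[OF P(6,11,15)]] by (elim exE conjE)
 define \<Xi> where "\<Xi> i = (if i = 2 then \<Xi>2 else \<Xi>3)" for i :: 4
 have \<Xi>: "\<forall>i. i = 2 \<or> i = 3 --> torsor_section \<phi> i (\<Xi> i)" using x2(1) x3(1) by (auto simp: \<Xi>_def)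
 have xp: "\<Xi> 2 (N \<inter> Db) (pz 2 N (N \<inter> Db) mW mX) \<in> qsec pt N" "\<Xi> 3 (N \<inter> Db) (pz 3 N (N \<inter> Db) mW mY) \<in> qsec pt N"
  using x2(2) x3(2) by (simp_all add: \<Xi>_def)
 show ?thesis using O_hom_hh[OF t v \<Xi> xp] hh_boundary[OF t v \<Xi> xp] by (intro exI[of _ "hh \<phi> \<Xi>"] conjI allI impI)
qed

end

subsection \<open>A locally free resolution\<close>

lemma O_hom_form:
 assumes P: "homog_poly d P" and k: "int d + n = k"
 shows "O_hom (function_sheaf (tw n)) (function_sheaf (tw k)) (\<lambda>U f y. P (rep y) * f y)"
proof (rule O_homI)
 fix U :: "proj3 set" and f assume f: "f \<in> car (function_sheaf (tw n)) U"
 have "(\<lambda>y. on_set U (\<lambda>y. P (rep y)) y * f y) \<in> tw k U" using tw_mult[OF tw_form[OF P refl]] f k by auto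
 moreover have "(\<lambda>y. on_set U (\<lambda>y. P (rep y)) y * f y) = (\<lambda>y. P (rep y) * f y)" using tw_outside f by (fastforce simp: on_set_def)
 ultimately show "(\<lambda>y. P (rep y) * f y) \<in> car (function_sheaf (tw k)) U" by simp
qed (auto simp: algebra_simps osf)

lemma O_hom_coord: "n + 1 = k ==> O_hom (function_sheaf (tw n)) (function_sheaf (tw k)) (\<lambda>U f y. zc i y * f y)"
 using O_hom_form[OF homog_poly.coord, of n k i] by (simp add: zc_def add.commute)

lemma O_hom_tw_add:
 assumes "O_hom F (function_sheaf (tw n)) \<phi>" "O_hom F (function_sheaf (tw n)) \<psi>"
 shows "O_hom F (function_sheaf (tw n)) (\<lambda>U m y. \<phi> U m y + \<psi> U m y)"
 by (rule O_homI) (use assms[THEN hom_closed] in \<open>auto simp: tw_add assms[THEN hom_add] assms[THEN hom_smult] assms[THEN hom_res] algebra_simps osf\<close>)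

context marked_line begin

lemma O_hom_qleg: "O_hom (function_sheaf (tw 1)) (Qsh pt) (\<lambda>U f. on_set (line0 - {pt}) (\<lambda>y. f y / zc b y))"
proof (rule O_homI)
 fix U :: "proj3 set" and f assume U: "open U" and f: "f \<in> car (function_sheaf (tw 1)) U"
 have "on_set (onl U) f \<in> tw 1 (onl U)" using tw_restrict[of f 1 U] f by simp
 moreover have "on_set (line0 - {pt}) (\<lambda>y. f y / zc b y) = qfun U (on_set (onl U) f)"
  using tw_outside f by (fastforce simp: qfun_def on_set_def)
 ultimately show "on_set (line0 - {pt}) (\<lambda>y. f y / zc b y) \<in> car (Qsh pt) U"
  using qsec_iff[OF U] by auto
qed (auto simp: algebra_simps osf add_divide_distrib)

text \<open>The monad \<open>O(-1) \<rightarrow> O\<^sup>3 \<rightarrow> O(1)\<close> with maps \<open>(-z\<^sub>3, z\<^sub>2, 0)\<close> and \<open>(z\<^sub>2, z\<^sub>3, z\<^sub>b)\<close>, a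
 locally free resolution of the pair.\<close>

definition R :: "fn ocomplex" where
 "R = \<lparr>obj = (\<lambda>i. if i = -1 then function_sheaf (tw (-1)) else if i = 0 then dirsum (dirsum (function_sheaf (tw 0)) (function_sheaf (tw 0))) (function_sheaf (tw 0))
   else if i = 1 then function_sheaf (tw 1) else function_sheaf (\<lambda>_. {\<lambda>_. 0})),
  diff = (\<lambda>i U m. if i = -1 then pr (pr (\<lambda>y. - zc 3 y * m y) (\<lambda>y. zc 2 y * m y)) (\<lambda>y. 0 * m y)
   else if i = 0 then (\<lambda>y. (zc 2 y * p1 (p1 m) y + zc 3 y * p2 (p1 m) y) + zc b y * p2 m y) else (\<lambda>_. 0))\<rparr>"

text \<open>On the line the differential of degree 0 is \<open>zc b\<close> times the third
  component. Hence the third projection and the division by \<open>zc b\<close> commute with the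
  differentials.\<close>

definition q :: "fn cmap" where
 "q = (\<lambda>i U m. if i = 0 then p2 m else if i = 1 then on_set (line0 - {pt}) (\<lambda>y. m y / zc b y) else (\<lambda>_. 0))"

lemma R_simps [simp]: "obj R (-1) = function_sheaf (tw (-1))" "obj R 0 = dirsum (dirsum (function_sheaf (tw 0)) (function_sheaf (tw 0))) (function_sheaf (tw 0))"
 "obj R 1 = function_sheaf (tw 1)" "i > 1 ==> obj R i = function_sheaf (\<lambda>_. {\<lambda>_. 0})" "i < -1 ==> obj R i = function_sheaf (\<lambda>_. {\<lambda>_. 0})"
 "diff R (-1) U m = pr (pr (\<lambda>y. - zc 3 y * m y) (\<lambda>y. zc 2 y * m y)) (\<lambda>y. 0 * m y)"
 "diff R 0 U m = (\<lambda>y. (zc 2 y * p1 (p1 m) y + zc 3 y * p2 (p1 m) y) + zc b y * p2 m y)"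
 "i > 0 ==> diff R i U m = (\<lambda>_. 0)" "i < -1 ==> diff R i U m = (\<lambda>_. 0)"
 by (auto simp: R_def)

lemma q_simps [simp]: "q 0 U m = p2 m" "q 1 U m = on_set (line0 - {pt}) (\<lambda>y. m y / zc b y)" "i > 1 ==> q i U m = (\<lambda>_. 0)" "i < 0 ==> q i U m = (\<lambda>_. 0)"
 by (simp_all add: q_def)

lemma regular_eq: "regular_on = tw 0"
 by (rule ext) (rule regular_on_eq_tw)

lemma O_hom_R0: "O_hom (obj R 0) (function_sheaf (tw 0)) (\<lambda>U m. p1 (p1 m))" "O_hom (obj R 0) (function_sheaf (tw 0)) (\<lambda>U m. p2 (p1 m))" "O_hom (obj R 0) (function_sheaf (tw 0)) (\<lambda>U m. p2 m)"
 unfolding R_simps by (rule O_hom_comp[OF O_hom_p1 O_hom_p1], rule O_hom_comp[OF O_hom_p1 O_hom_p2], rule O_hom_p2)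

lemma O_module_R: "O_module (obj R i)"
 by (cases i rule: int_cases_3) (simp_all add: O_module_tw O_module_dirsum O_module_zero)

lemma bounded_R: "bounded_complex R"
 unfolding bounded_complex_def
proof (intro conjI allI impI ballI)
 fix i
 show "O_module (obj R i)" by (rule O_module_R)
 show "O_hom (obj R i) (obj R (i + 1)) (diff R i)"
 proof (cases i rule: int_cases_3)
  case 3
  have "O_hom (obj R 0) (function_sheaf (tw 1)) (\<lambda>U m y. (zc 2 y * p1 (p1 m) y + zc 3 y * p2 (p1 m) y) + zc b y * p2 m y)"
   by (intro O_hom_tw_add O_hom_comp[OF O_hom_R0(1) O_hom_coord] O_hom_comp[OF O_hom_R0(2) O_hom_coord] O_hom_comp[OF O_hom_R0(3) O_hom_coord]) simp_all
  thus ?thesis using 3 by (simp add: R_def)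
 next
  case 4
  have "O_hom (function_sheaf (tw (-1))) (function_sheaf (tw 0)) (\<lambda>U f y. P (rep y) * f y)" if "homog_poly 1 P" for P
   using O_hom_form[OF that, of "-1" 0] by simp
  \<comment> \<open>The third component is the zero form, taken in degree 1 like the other two; this
    is why the differential contains \<open>0 * m y\<close>.\<close>
  from this[OF homog_cmult[OF homog_poly.coord, of "-1" 3]] this[OF homog_poly.coord, of 2] this[OF homog_zero]
  have "O_hom (function_sheaf (tw (-1))) (obj R 0) (\<lambda>U m. pr (pr (\<lambda>y. - zc 3 y * m y) (\<lambda>y. zc 2 y * m y)) (\<lambda>y. 0 * m y))"
   unfolding R_simps by (intro O_hom_pr) (simp_all add: zc_def)
  thus ?thesis using 4 by (simp add: R_def)
 next
  case 5
  have "O_hom (obj R i) (obj R (i + 1)) (\<lambda>U m. \<lambda>_. 0)"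
   using O_hom_zero[OF O_module_R[of i] O_module_R[of "i + 1"]] 5 by (cases "i = -2") simp_all
  thus ?thesis using 5 by (simp add: R_def)
 qed (simp_all add: R_def O_hom_to_zero)
next
 fix i U m assume U: "open (U::proj3 set)" and m: "m \<in> car (obj R i) U"
 show "diff R (i + 1) U (diff R i U m) = zs (obj R (i + 2)) U"
 proof (cases i rule: int_cases_3)
  case 5
  thus ?thesis by (cases "i = -2"; cases "i = -3") (simp_all)
 qed simp_all
next
 show "\<exists>N. \<forall>i. \<bar>i\<bar> > N --> (\<forall>U. open U --> car (obj R i) U = {zs (obj R i) U})"
 proof (rule exI[of _ 1], intro allI impI)
  fix i :: int and U :: "proj3 set" assume "\<bar>i\<bar> > 1"
  hence "i > 1 \<or> i < -1" by linarith
  thus "car (obj R i) U = {zs (obj R i) U}" by auto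
 qed
qed

lemma chain_q: "chain_map R (Ip a) q"
 unfolding chain_map_def
proof (intro conjI allI impI ballI)
 fix i
 show "O_hom (obj R i) (obj (Ip a) i) (q i)"
 proof (cases i rule: int_cases_3)
  case 2 thus ?thesis using O_hom_qleg by (simp add: I_obj q_def)
 next
  case 3 thus ?thesis using O_hom_R0(3) by (simp add: I_obj q_def regular_eq)
 qed (simp_all add: I_obj q_def O_hom_to_zero)
 fix U m assume U: "open (U::proj3 set)" and m: "m \<in> car (obj R i) U"
 show "q (i + 1) U (diff R i U m) = diff (Ip a) i U (q i U m)"
 proof (cases i rule: int_cases_3)
  case 3 thus ?thesis using line0_Db by (auto simp: I_diff osf mem_line0)
 next
  case 5
  thus ?thesis by (cases "i = -2") (simp_all add: I_diff)
 qed (simp_all add: I_diff)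
qed

lemma tw_zero_at_pt:
 assumes g: "g \<in> tw n U" "open U" and z: "\<And>y. y \<in> onp U ==> g y = 0" and y: "y \<in> onl U" and n: "n = 0 \<or> n = 1"
 shows "g y = 0"
proof (cases "y = pt")
 case True
 let ?V = "U \<inter> Da"
 have V: "open ?V" "pt \<in> ?V" using open_Int[OF g(2) open_Da] y pt_Da True by auto
 have d: "on_set ?V (zc a) \<in> tw 1 ?V" "\<And>y. y \<in> ?V ==> on_set ?V (zc a) y \<noteq> 0" using tw_coord by auto
 have gV: "on_set ?V g \<in> tw n ?V" by (rule tw_restrict[OF g(1)]) blast
 have "(\<lambda>y. on_set ?V g y / (if n = 0 then 1 else on_set ?V (zc a) y)) \<in> regular_on ?V"
 proof (cases "n = 0")
  case False
  thus ?thesis using tw_divide[OF gV d, of 0] n by (simp add: regular_eq)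
 qed (use gV in \<open>simp add: regular_eq\<close>)
 from regular_zero_on_line0[OF this V(1), of pt] show ?thesis using z V(2) pt_line0 d(2) True by (auto split: if_splits)
qed (use z y in blast)

text \<open>Each condition is a fact about the ideal of the line: in degree 1,
  \<open>c - g * zc b\<close> vanishes on the line and is a combination of \<open>zc 2\<close> and
  \<open>zc 3\<close>; in degree 0, a cycle with third component 0 is a syzygy of these two.\<close>

lemma quasi_iso_q: "quasi_iso R (Ip a) q"
proof (rule quasi_isoI[OF bounded_R chain_q])
 fix U :: "proj3 set" and x assume U: "open U" "x \<in> U"
 {
  fix c g assume c: "c \<in> car (obj R 1) U" and g: "g \<in> regular_on U" and e: "q 1 U c = on_set (line0 - {pt}) g"
  let ?f = "\<lambda>y. c y - g y * on_set U (zc b) y"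
  have f: "?f \<in> tw 1 U" using tw_diff[of c 1 U] tw_mult[of g 0 U _ 1, OF _ tw_coord] c g by (simp add: regular_eq)
  have "?f y = 0" if y: "y \<in> onl U" for y
  proof (rule tw_zero_at_pt[OF f U(1) _ y])
   show "?f u = 0" if "u \<in> onp U" for u
    using fun_cong[OF e, of u] that line0_Db[of u] by (simp add: field_simps)
  qed simp
  from tw_ideal_line0[OF f U this] obtain V \<alpha> \<beta> where V: "open V" "x \<in> V" "V \<subseteq> U" "\<alpha> \<in> tw 0 V" "\<beta> \<in> tw 0 V" "\<forall>y\<in>V. ?f y = \<alpha> y * zc 2 y + \<beta> y * zc 3 y" by auto
  have "(\<lambda>y. (zc 2 y * \<alpha> y + zc 3 y * \<beta> y) + zc b y * on_set V g y) = on_set V c"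
  proof
   fix y show "(zc 2 y * \<alpha> y + zc 3 y * \<beta> y) + zc b y * on_set V g y = on_set V c y"
    using bspec[OF V(6), of y] V(3) tw_outside[OF V(4), of y] tw_outside[OF V(5), of y]
    by (cases "y \<in> V") (auto simp: on_set_out algebra_simps)
  qed
  thus "\<exists>V j. open V \<and> x \<in> V \<and> V \<subseteq> U \<and> j \<in> car (obj R 0) V \<and> diff R 0 V j = res (obj R 1) U V c"
   using V(1-5) tw_restrict[of g 0 U V] g by (intro exI[of _ V] exI[of _ "pr (pr \<alpha> \<beta>) (on_set V g)"]) (simp add: regular_eq)
 }
 {
  fix n assume n: "n \<in> qsec pt U"
  show "\<exists>V m h. open V \<and> x \<in> V \<and> V \<subseteq> U \<and> m \<in> car (obj R 1) V \<and> h \<in> regular_on V \<and> (\<forall>y\<in>V. n y = q 1 V m y + on_set (line0 - {pt}) h y)"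
  proof (cases "x \<in> line0")
   case True
   from iffD1[OF qsec_iff[OF U(1)] n] obtain G where G: "G \<in> tw 1 (onl U)" "n = qfun U G" by (elim bexE)
   from tw_extend_from_line0[OF G(1) U True] obtain V F where V: "open V" "x \<in> V" "V \<subseteq> U" "F \<in> tw 1 V" "\<forall>y\<in> onl V. F y = G y" by (elim exE conjE)
   thus ?thesis unfolding G(2)
    by (intro exI[of _ V] exI[of _ F] exI[of _ "\<lambda>_. 0"]) (auto simp: regular_zero qfun_def on_set_def)
  next
   case False
   have "open (U \<inter> - line0)" "x \<in> U \<inter> - line0" using open_Int[OF U(1) open_compl_line0] U(2) False by auto
   thus ?thesis using qsec_outside[OF n]
    by (intro exI[of _ "U \<inter> - line0"] exI[of _ "\<lambda>_. 0"]) (auto simp: regular_zero tw_zero on_set_def)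
  qed
 }
 {
  fix e assume e: "e \<in> car (obj R 0) U" "diff R 0 U e = zs (obj R 1) U" "q 0 U e = (\<lambda>_. 0)"
  have r: "p1 (p1 e) \<in> tw 0 U" "p2 (p1 e) \<in> tw 0 U" using e(1) by simp_all
  have "p1 (p1 e) y * zc 2 y + p2 (p1 e) y * zc 3 y = 0" for y
   using fun_cong[OF e(2)[unfolded R_simps function_sheaf_simps], of y] e(3) by (simp add: mult.commute)
  from tw_syzygy[OF r U this] obtain V \<gamma> where V: "open V" "x \<in> V" "V \<subseteq> U" "\<gamma> \<in> tw (-1) V"
   "\<forall>y\<in>V. p1 (p1 e) y = - (\<gamma> y * zc 3 y) \<and> p2 (p1 e) y = \<gamma> y * zc 2 y" by auto
  have "(\<lambda>y. - zc 3 y * \<gamma> y) = on_set V (p1 (p1 e))" "(\<lambda>y. zc 2 y * \<gamma> y) = on_set V (p2 (p1 e))"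
   using V(5) tw_outside[OF V(4)] by (auto simp: osf)
  thus "\<exists>V t. open V \<and> x \<in> V \<and> V \<subseteq> U \<and> t \<in> car (obj R (-1)) V \<and> diff R (-1) V t = res (obj R 0) U V e"
   using V e(3) by (intro exI[of _ V] exI[of _ \<gamma>]) (simp add: on_set_def)
 }
 {
  fix g assume g: "g \<in> regular_on U" and z: "\<forall>y\<in> onp U. g y = 0"
  have g': "g \<in> tw 0 U" using g by (simp add: regular_eq)
  have "g y = 0" if "y \<in> onl U" for y by (rule tw_zero_at_pt[OF g' U(1) _ that]) (use z in auto)
  from tw_ideal_line0[OF g' U this] obtain V \<alpha> \<beta> where V: "open V" "x \<in> V" "V \<subseteq> U" "\<alpha> \<in> tw (-1) V" "\<beta> \<in> tw (-1) V" "\<forall>y\<in>V. g y = \<alpha> y * zc 2 y + \<beta> y * zc 3 y" by auto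
  have h: "(\<lambda>y. - (zc b y * f y)) \<in> tw 0 V" if "f \<in> tw (-1) V" for f
   using tw_uminus[OF hom_closed[OF O_hom_coord[of "-1" 0] V(1), unfolded function_sheaf_simps, OF _ that]] by simp
  \<comment> \<open>A cycle with the third component \<open>g\<close>: as \<open>g\<close> is the
    combination of \<open>zc 2\<close> and \<open>zc 3\<close> with coefficients \<alpha> and
    \<beta>, the first two components cancel \<open>zc b * g\<close>.\<close>
  let ?m = "pr (pr (\<lambda>y. - (zc b y * \<alpha> y)) (\<lambda>y. - (zc b y * \<beta> y))) (on_set V g)"
  have "diff R 0 V ?m = (\<lambda>_. 0)" unfolding R_simps
  proof
   fix y show "zc 2 y * p1 (p1 ?m) y + zc 3 y * p2 (p1 ?m) y + zc b y * p2 ?m y = 0"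
    using bspec[OF V(6), of y] tw_outside[OF V(4), of y] tw_outside[OF V(5), of y]
    by (cases "y \<in> V") (auto simp: on_set_out algebra_simps)
  qed
  thus "\<exists>V m. open V \<and> x \<in> V \<and> V \<subseteq> U \<and> m \<in> car (obj R 0) V \<and> diff R 0 V m = zs (obj R 1) V \<and> q 0 V m = on_set V g"
   using V(1-3) h[OF V(4)] h[OF V(5)] tw_restrict[OF g' V(3)] by (intro exI[of _ V] exI[of _ ?m]) (simp del: R_simps(7))
 }
 fix i :: int and e assume i: "i < 0" and e: "e \<in> car (obj R i) U" "diff R i U e = zs (obj R (i + 1)) U"
 have e0: "e = (\<lambda>_. 0)"
 proof (cases "i = -1")
  case True
  have "(\<lambda>y. - zc 3 y * e y) = (\<lambda>_. 0)" using e(2) True by simp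
  from fun_cong[OF this] have "zc 3 y * e y = 0" for y by simp
  moreover have "{y. zc 3 y \<noteq> 0} \<noteq> {}" using zc_coord_point(1) by blast
  ultimately show ?thesis using tw_zero_on_open[of e "-1" U "{}" "{y. zc 3 y \<noteq> 0}"] e(1) True U(1) open_coord_nonzero by (auto simp: lin_sub_empty)
 qed (use i e(1) in simp)
 show "\<exists>V t. open V \<and> x \<in> V \<and> V \<subseteq> U \<and> t \<in> car (obj R (i - 1)) V \<and> diff R (i - 1) V t = res (obj R i) U V e"
  using U i unfolding e0 by (intro exI[of _ U] exI[of _ "\<lambda>_. 0"]) (cases "i = -1"; simp add: on_set_def)
qed simp_all


lemma resolved_R: "resolved a b R q"
 using marked_line_axioms bounded_R quasi_iso_q by (intro resolved.intro resolved_axioms.intro)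

interpretation RR: resolved a b R q by (rule resolved_R)

text \<open>The lifts x and y in the resolution are (-1, 0, X) and (0, -1, Y), whence the signs of
  the first two coefficients. In the third only \<open>zc a\<close> occurs, because a multiple of
  \<open>zc b\<close> there is null-homotopic.\<close>

definition f0 :: "complex^5 => fn omap" where
 "f0 x U m = on_set (line0 - {pt}) (\<lambda>y. (- (x$1 * zc b y + x$2 * zc a y) * p1 (p1 m) y + - (x$3 * zc b y + x$4 * zc a y) * p2 (p1 m) y + x$5 * zc a y * p2 m y) / zc b y)"

definition f1 :: "complex^3 => fn omap" where
 "f1 x U m = on_set (line0 - {pt}) (\<lambda>y. (x$1 * zc b y * zc b y + x$2 * zc a y * zc b y + x$3 * zc a y * zc a y) * m y / zc b y)"

lemma tmap_f0: "RR.tmap 0 (f0 x)"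
proof -
 have c: "homog_poly 1 (\<lambda>v. c * v $ i)" for c i by (rule homog_cmult[OF homog_poly.coord])
 have 1: "O_hom (function_sheaf (tw 0)) (function_sheaf (tw 1)) (\<lambda>U f y. - (c * zc b y + e * zc a y) * f y)" for c e
  using O_hom_form[OF homog_cmult[OF homog_poly.add[OF c[of c b] c[of e a]], of "-1"], of 0 1] by (simp add: zc_def)
 have 2: "O_hom (function_sheaf (tw 0)) (function_sheaf (tw 1)) (\<lambda>U f y. c * zc a y * f y)" for c
  using O_hom_form[OF c[of c a], of 0 1] by (simp add: zc_def)
 have "O_hom (obj R 0) (Qsh pt) (f0 x)"
  unfolding f0_def[abs_def]
  by (rule O_hom_comp[OF _ O_hom_qleg]) (intro O_hom_tw_add O_hom_comp[OF O_hom_R0(1) 1] O_hom_comp[OF O_hom_R0(2) 1] O_hom_comp[OF O_hom_R0(3) 2])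
 thus ?thesis unfolding RR.tmap_def by (auto simp: f0_def osf mem_line0)
qed

lemma tmap_f1: "RR.tmap (-1) (f1 x)"
proof -
 have m: "homog_poly (1 + 1) (\<lambda>v. c * v $ i * v $ j)" for c i j by (rule homog_poly.mult[OF homog_cmult[OF homog_poly.coord] homog_poly.coord])
 have "O_hom (obj R (-1)) (Qsh pt) (f1 x)"
  unfolding f1_def[abs_def] R_simps
  by (rule O_hom_comp[OF _ O_hom_qleg])
   (use O_hom_form[OF homog_poly.add[OF homog_poly.add[OF m[of "x$1" b b] m[of "x$2" a b]] m[of "x$3" a a]], of "-1" 1] in \<open>simp add: zc_def\<close>)
 thus ?thesis unfolding RR.tmap_def by (auto simp: f1_def osf)
qed

lemma tw0_const: "on_set V (\<lambda>_. c) \<in> tw 0 V" and tw0_ratio: "V \<subseteq> Db ==> ratio i b V \<in> tw 0 V"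
 using regular_const[of V c] ratio_regular[of V b i] by (simp_all add: regular_eq)

lemma bcyc_R:
 "RR.bcyc 2 Db (pr (pr (on_set Db (\<lambda>_. - 1)) (\<lambda>_. 0)) (ratio 2 b Db))" "RR.bcyc 3 Db (pr (pr (\<lambda>_. 0) (on_set Db (\<lambda>_. - 1))) (ratio 3 b Db))"
 unfolding RR.bcyc_def by (simp_all add: open_Db tw0_const tw0_ratio tw_zero) (auto simp: on_set_def ratio_def fun_eq_iff)

text \<open>The boundary of the generator \<open>1 / zc b\<close> of O(-1) is (-Y, X, 0), which is Y
  x - X y for the lifts of \<open>bcyc_R\<close>.\<close>

lemma b_datum_R: "RR.b_datum Db (pr (pr (on_set Db (\<lambda>_. - 1)) (\<lambda>_. 0)) (ratio 2 b Db)) (pr (pr (\<lambda>_. 0) (on_set Db (\<lambda>_. - 1))) (ratio 3 b Db)) (on_set Db (\<lambda>y. 1 / zc b y))"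
proof -
 have "on_set Db (\<lambda>y. 1 / on_set Db (zc b) y) \<in> tw (-1) Db" by (rule tw_inverse[OF tw_coord]) simp
 moreover have "on_set Db (\<lambda>y. 1 / on_set Db (zc b) y) = on_set Db (\<lambda>y. 1 / zc b y)" by (auto simp: osf)
 ultimately show ?thesis unfolding RR.b_datum_def using bcyc_R
  by (simp add: sub_def) (auto simp: on_set_def ratio_def fun_eq_iff)
qed

lemma p_cycle_R: "RR.p_cycle Da (on_set Da (zc a)) (pr (pr (\<lambda>_. 0) (\<lambda>_. 0)) (on_set Da (\<lambda>_. 1)))"
 unfolding RR.p_cycle_def using pt_Da by (simp add: open_Da tw0_const tw_zero tw_coord) (auto simp: on_set_def ratio_def fun_eq_iff)

text \<open>Some values \<open>u\<close> exist by \<open>ex_val0\<close>, so comparing them with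
  \<open>x\<close> on one explicit datum of each kind is enough.\<close>

lemma val0_f0: "RR.val0 (f0 x) x"
proof -
 obtain u where u: "RR.val0 (f0 x) u" using RR.ex_val0[OF tmap_f0[of x]] by (elim exE)
 have "aff (u$1) (u$2) 0 y = aff (x$1) (x$2) 0 y \<and> aff (u$3) (u$4) 0 y = aff (x$3) (x$4) 0 y" if y: "y \<in> line0 - {pt}" for y
 proof -
  have "y \<in> Db" using y line0_Db by blast
  hence "f0 x Db (pr (pr (on_set Db (\<lambda>_. - 1)) (\<lambda>_. 0)) (ratio 2 b Db)) y = aff (x$1) (x$2) 0 y"
   "f0 x Db (pr (pr (\<lambda>_. 0) (on_set Db (\<lambda>_. - 1))) (ratio 3 b Db)) y = aff (x$3) (x$4) 0 y"
   using y by (simp_all add: f0_def aff_def mem_line0 ratio_def field_simps)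
  thus ?thesis using u bcyc_R y \<open>y \<in> Db\<close> unfolding RR.val0_def by (metis DiffD1 IntI)
 qed
 hence "\<forall>y\<in>line0 - {pt}. aff (u$1) (u$2) 0 y = aff (x$1) (x$2) 0 y" "\<forall>y\<in>line0 - {pt}. aff (u$3) (u$4) 0 y = aff (x$3) (x$4) 0 y" by blast+
 note 1 = this[THEN aff_unique]
 obtain k where k: "k \<in> regular_on (onl Da)" "k pt = u$5" "\<forall>y\<in> onp Da. k y = ratio b a Da y * f0 x Da (pr (pr (\<lambda>_. 0) (\<lambda>_. 0)) (on_set Da (\<lambda>_. 1))) y"
  using u p_cycle_R unfolding RR.val0_def by blast
 have "(\<lambda>y. k y - on_set (onl Da) (\<lambda>_. x$5) y) \<in> regular_on (onl Da)" by (intro regular_diff k regular_const)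
 from regular_line0_zero[OF this open_Da pt_Da] have "k pt = x$5"
  using k(3) line0_Db pt_line0 pt_Da by (auto simp: f0_def ratio_def)
 hence "u = x" using 1 k(2) RR.exhaust5 by (auto simp: vec_eq_iff) metis
 thus ?thesis using u by simp
qed

lemma val1_f1: "RR.val1 (f1 x) x"
proof -
 obtain u where u: "RR.val1 (f1 x) u" using RR.ex_val1[OF tmap_f1[of x]] by (elim exE)
 have "aff (u$1) (u$2) (u$3) y = aff (x$1) (x$2) (x$3) y" if y: "y \<in> line0 - {pt}" for y
 proof -
  have "y \<in> Db" using y line0_Db by blast
  hence "f1 x Db (on_set Db (\<lambda>y. 1 / zc b y)) y = aff (x$1) (x$2) (x$3) y"
   using y by (simp add: f1_def aff_def power2_eq_square add_divide_distrib)
  thus ?thesis using u b_datum_R y \<open>y \<in> Db\<close> unfolding RR.val1_def by (metis DiffD1 IntI)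
 qed
 hence "u$1 = x$1 \<and> u$2 = x$2 \<and> u$3 = x$3" by (intro aff_unique ballI)
 hence "u = x" using RR.exhaust3 by (auto simp: vec_eq_iff) metis
 thus ?thesis using u by simp
qed

end

subsection \<open>Spaces of morphisms\<close>

text \<open>The invariant \<open>V\<close> separates the classes, and every vector is its value on
  some roof with the fixed left leg \<open>(P, q)\<close>. Hence the classes are the fibres of
  \<open>V\<close>, and sums do not depend on the common left leg on which they are formed.\<close>

lemma iso_to_CnI:
 fixes V :: "'a roof => complex^'n => bool" and F :: "complex^'n => 'a cmap"
 assumes val: "\<And>r. r \<in> roofs K L ==> \<exists>!x. V r x"
  and rel: "\<And>r r' x. r \<in> roofs K L ==> r' \<in> roofs K L ==> V r x ==> (r, r') \<in> roof_rel K L \<longleftrightarrow> V r' x"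
  and add: "\<And>J s f g x u. (J, s, f) \<in> roofs K L ==> (J, s, g) \<in> roofs K L ==> V (J, s, f) x ==> V (J, s, g) u ==>
   (J, s, cmap_add L f g) \<in> roofs K L \<and> V (J, s, cmap_add L f g) (x + u)"
  and scale: "\<And>J s f x c. (J, s, f) \<in> roofs K L ==> V (J, s, f) x ==>
   (J, s, cmap_scale L c f) \<in> roofs K L \<and> V (J, s, cmap_scale L c f) (c *s x)"
  and F: "\<And>x. (P, q, F x) \<in> roofs K L \<and> V (P, q, F x) x"
 shows "iso_to_Cn (derived_hom K L) TYPE('n)"
proof -
 define cl where "cl x = {r \<in> roofs K L. V r x}" for x
 have in_cl: "r \<in> cl x \<longleftrightarrow> r \<in> roofs K L \<and> V r x" for r x by (simp add: cl_def)
 have img: "roof_rel K L `` {r} = cl x" if "r \<in> roofs K L" "V r x" for r x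
 proof (rule Set.set_eqI)
  fix r'
  have "(r, r') \<in> roof_rel K L ==> r' \<in> roofs K L" by (auto simp: roof_rel_def)
  thus "r' \<in> roof_rel K L `` {r} \<longleftrightarrow> r' \<in> cl x" using rel[OF that(1) _ that(2), of r'] by (auto simp: in_cl)
 qed
 have Fc: "(P, q, F x) \<in> cl x" for x using F by (simp add: in_cl)
 have car: "carrier (derived_hom K L) = range cl"
 proof -
  have "roofs K L // roof_rel K L = range cl"
  proof (intro equalityI subsetI)
   fix X assume "X \<in> roofs K L // roof_rel K L"
   then obtain r where r: "r \<in> roofs K L" "X = roof_rel K L `` {r}" by (rule quotientE)
   from val[OF r(1)] obtain x where "V r x" by blast
   thus "X \<in> range cl" using img r by blast
  next
   fix X assume "X \<in> range cl"
   then obtain x where "X = roof_rel K L `` {(P, q, F x)}" using img F by blast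
   thus "X \<in> roofs K L // roof_rel K L" using F by (auto intro: quotientI)
  qed
  thus ?thesis by (simp add: derived_hom_def)
 qed
 have plus: "cl x \<oplus>\<^bsub>derived_hom K L\<^esub> cl y = cl (x + y)" for x y
 proof -
  have "(THE Z. \<exists>J s f g. (J, s, f) \<in> cl x \<and> (J, s, g) \<in> cl y \<and> Z = roof_rel K L `` {(J, s, cmap_add L f g)}) = cl (x + y)"
  proof (rule the_equality)
   have "cl (x + y) = roof_rel K L `` {(P, q, cmap_add L (F x) (F y))}"
    using add[of P q "F x" "F y" x y] F img[of "(P, q, cmap_add L (F x) (F y))" "x + y"] by simp
   thus "\<exists>J s f g. (J, s, f) \<in> cl x \<and> (J, s, g) \<in> cl y \<and> cl (x + y) = roof_rel K L `` {(J, s, cmap_add L f g)}"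
    using Fc by (intro exI[of _ P] exI[of _ q] exI[of _ "F x"] exI[of _ "F y"] conjI)
   fix Z assume "\<exists>J s f g. (J, s, f) \<in> cl x \<and> (J, s, g) \<in> cl y \<and> Z = roof_rel K L `` {(J, s, cmap_add L f g)}"
   then obtain J s f g where Z: "(J, s, f) \<in> cl x" "(J, s, g) \<in> cl y" "Z = roof_rel K L `` {(J, s, cmap_add L f g)}" by (elim exE conjE)
   show "Z = cl (x + y)" unfolding Z(3) using add[of J s f g x y] Z(1,2) img[of "(J, s, cmap_add L f g)" "x + y"] by (simp add: in_cl)
  qed
  thus ?thesis by (simp add: derived_hom_def)
 qed
 have smul: "c \<odot>\<^bsub>derived_hom K L\<^esub> cl x = cl (c *s x)" for c x
 proof -
  have "(THE Z. \<exists>J s f. (J, s, f) \<in> cl x \<and> Z = roof_rel K L `` {(J, s, cmap_scale L c f)}) = cl (c *s x)"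
  proof (rule the_equality)
   have "cl (c *s x) = roof_rel K L `` {(P, q, cmap_scale L c (F x))}"
    using scale[of P q "F x" x c] F img[of "(P, q, cmap_scale L c (F x))" "c *s x"] by simp
   thus "\<exists>J s f. (J, s, f) \<in> cl x \<and> cl (c *s x) = roof_rel K L `` {(J, s, cmap_scale L c f)}"
    using Fc by (intro exI[of _ P] exI[of _ q] exI[of _ "F x"] conjI)
   fix Z assume "\<exists>J s f. (J, s, f) \<in> cl x \<and> Z = roof_rel K L `` {(J, s, cmap_scale L c f)}"
   then obtain J s f where Z: "(J, s, f) \<in> cl x" "Z = roof_rel K L `` {(J, s, cmap_scale L c f)}" by (elim exE conjE)
   show "Z = cl (c *s x)" unfolding Z(2) using scale[of J s f x c] Z(1) img[of "(J, s, cmap_scale L c f)" "c *s x"] by (simp add: in_cl)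
  qed
  thus ?thesis by (simp add: derived_hom_def)
 qed
 have "inj cl"
 proof (rule injI)
  fix x y assume "cl x = cl y"
  hence v: "V (P, q, F x) x" "V (P, q, F x) y" using Fc[of x] F[of x] in_cl[of "(P, q, F x)" y] by simp_all
  obtain w where "\<forall>z. V (P, q, F x) z --> z = w" by (rule ex1E[OF val[OF conjunct1[OF F[of x]]]]) (rule that)
  from this[rule_format, OF v(1)] this[rule_format, OF v(2)] show "x = y" by simp
 qed
 hence "bij_betw cl UNIV (carrier (derived_hom K L))" unfolding car bij_betw_def by simp
 thus ?thesis unfolding iso_to_Cn_def using plus smul by (intro exI[of _ cl]) simp
qed

text \<open>What the two computations share, with \<open>n\<close> = -k the degree of the right leg:
  \<open>val0\<close> at \<open>n = 0\<close> and \<open>val1\<close> at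
  \<open>n = -1\<close>.\<close>

locale ext_value = marked_line +
 fixes n :: int and val :: "fn ocomplex => fn cmap => fn omap => complex^'n => bool"
  and F :: "complex^'n => fn omap"
 assumes ex: "resolved a b J s ==> resolved.tmap a J n \<phi> ==> \<exists>x. val J s \<phi> x"
  and unique: "resolved a b J s ==> val J s \<phi> x ==> val J s \<phi> u ==> x = u"
  and val_add: "resolved a b J s ==> val J s \<phi> x ==> val J s \<psi> u ==> val J s (\<lambda>U m y. \<phi> U m y + \<psi> U m y) (x + u)"
  and val_scale: "resolved a b J s ==> val J s \<phi> x ==> (\<And>U m y. y \<in> U ==> \<psi> U m y = c * \<phi> U m y) ==> val J s \<psi> (c *s x)"
  and push: "roof_map a b J s M sM v ==> val J s \<phi> x ==> O_hom (obj M (n + 1)) (Qsh pt) h ==>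
   (\<And>V m. open V ==> m \<in> car (obj M n) V ==> \<psi> V m = (\<lambda>y. \<phi> V (v n V m) y + h V (diff M n V m) y)) ==> val M sM \<psi> x"
  and null: "free_roof a b J s N mX mY mW E ==> resolved.tmap a J n \<phi> ==> val J s \<phi> 0 ==>
   \<exists>h. O_hom (obj J (n + 1)) (Qsh pt) h \<and> (\<forall>U m. open U --> m \<in> car (obj J n) U --> \<phi> U m = h U (diff J n U m))"
  and F: "resolved.tmap a R n (F x)" "val R q (F x) x"
begin

abbreviation I :: "fn ocomplex" where "I \<equiv> Ip a"

definition L :: "fn ocomplex" where "L = shift (- n) (sheaf_complex (fst (rho a)))"

lemma L_obj [simp]: "obj L n = Qsh pt" "i \<noteq> n ==> obj L i = function_sheaf (\<lambda>_. {\<lambda>_. 0})"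
 by (simp_all add: L_def shift_def sheaf_complex_def rho_fst zero_sheaf_def)

lemma O_module_L: "O_module (obj L i)"
 by (cases "i = n") (simp_all add: O_module_qsec O_module_zero)

lemma L_ops [simp]: "zs (obj L i) U = (\<lambda>_. 0)" "f \<boxplus>[obj L i,U] g = (\<lambda>x. f x + g x)" "f \<cdot>[obj L i,U] g = (\<lambda>x. f x * g x)"
 "res (obj L i) U V = on_set V"
 by (cases "i = n"; simp)+

text \<open>An odd shift puts a sign before the differential, and minus zero is 0 by the group laws
  of the sections.\<close>

lemma L_diff: assumes U: "open U" shows "diff L i U m = (\<lambda>_. 0)"
proof (cases "even n")
 case False
 define G where "G = obj (sheaf_complex (fst (rho a))) (i + - n + 1)"
 have z: "zs G U = (\<lambda>_. 0)" by (simp add: G_def sheaf_complex_def rho_fst zero_sheaf_def)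
 have G: "O_module G" using O_module_qsec O_module_zero by (simp add: G_def sheaf_complex_def rho_fst zero_sheaf_def)
 note ag = om_abelian_group[OF G U] and z0 = om_zero[OF G U]
 have "\<ominus>\<^bsub>sec G U\<^esub> (zs G U) = zs G U"
  by (rule abelian_group.minus_equality[OF ag]) (simp_all add: z0 om_zero_left[OF G U])
 thus ?thesis using False z by (simp add: L_def shift_def G_def) (simp add: sheaf_complex_def)
qed (simp add: L_def shift_def sheaf_complex_def)

lemma L_hom_zero: "i \<noteq> n ==> O_hom G (obj L i) \<phi> ==> open U ==> m \<in> car G U ==> \<phi> U m = (\<lambda>_. 0)"
 using hom_closed[of G "obj L i" \<phi> U m] by simp

lemma L_hom_outside: "O_hom G (obj L i) \<phi> ==> open U ==> m \<in> car G U ==> y \<notin> U ==> \<phi> U m y = 0"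
 using hom_closed[of G "obj L i" \<phi> U m] qsec_outside[of "\<phi> U m" U y] by (cases "i = n") auto

lemma L_homD: "chain_map J L f ==> O_hom (obj J n) (Qsh pt) (f n)"
 using chain_map_hom[of J L f n] by simp

lemma chain_map_tmap:
 assumes r: "resolved a b J s" and f: "chain_map J L f" shows "resolved.tmap a J n (f n)"
 unfolding resolved.tmap_def[OF r]
 using L_homD[OF f] chain_map_commute[OF f, of "n - 1" n] L_diff by simp

lemma tmap_chain_map:
 assumes r: "resolved a b J s" and f: "\<And>i. O_hom (obj J i) (obj L i) (f i)" and t: "resolved.tmap a J n (f n)"
 shows "chain_map J L f"
 unfolding chain_map_def
proof (intro conjI allI impI ballI)
 fix i U m assume U: "open (U::proj3 set)" and m: "m \<in> car (obj J i) U"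
 have d: "diff J i U m \<in> car (obj J (i + 1)) U"
  by (rule hom_closed[OF bounded_complex_hom[OF resolved.bc[OF r] refl] U m])
 have "f (i + 1) U (diff J i U m) = (\<lambda>_. 0)"
 proof (cases "i + 1 = n")
  case True
  thus ?thesis using resolved.tm_d[OF r t U, of i m] m by simp
 qed (rule L_hom_zero[OF _ f U d])
 thus "f (i + 1) U (diff J i U m) = diff L i U (f i U m)" using L_diff[OF U] by simp
qed (rule f)

lemma homotopicI:
 assumes r: "resolved a b M sM" and f: "chain_map M L f" and g: "chain_map M L g"
  and h: "O_hom (obj M (n + 1)) (Qsh pt) h"
  and eq: "\<And>U m. open U ==> m \<in> car (obj M n) U ==> f n U m = (\<lambda>y. g n U m y + h U (diff M n U m) y)"
 shows "homotopic M L f g"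
 unfolding homotopic_def
proof (rule exI[of _ "\<lambda>i. if i = n + 1 then h else (\<lambda>U m. \<lambda>_. 0)"], intro conjI allI impI ballI)
 fix i
 show "O_hom (obj M i) (obj L (i - 1)) (if i = n + 1 then h else (\<lambda>U m. \<lambda>_. 0))"
  using h O_hom_to_zero by (cases "i = n + 1") auto
 fix U m assume U: "open (U::proj3 set)" and m: "m \<in> car (obj M i) U"
 show "f i U m = g i U m \<boxplus>[obj L i,U] (diff L (i - 1) U ((if i = n + 1 then h else (\<lambda>U m. \<lambda>_. 0)) U m) \<boxplus>[obj L i,U]
   (if i + 1 = n + 1 then h else (\<lambda>U m. \<lambda>_. 0)) U (diff M i U m))"
 proof (cases "i = n")
  case True
  thus ?thesis using eq[OF U] m L_diff[OF U] by simp
 next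
  case False
  thus ?thesis using L_hom_zero[OF False chain_map_hom[OF f] U m] L_hom_zero[OF False chain_map_hom[OF g] U m] L_diff[OF U] by simp
 qed
qed

lemma chain_map_add:
 assumes r: "resolved a b J s" and f: "chain_map J L f" and g: "chain_map J L g" shows "chain_map J L (cmap_add L f g)"
proof (rule tmap_chain_map[OF r])
 note h = chain_map_hom[OF f] chain_map_hom[OF g]
 show *: "O_hom (obj J i) (obj L i) (cmap_add L f g i)" for i
 proof (rule O_homI)
  fix U m assume U: "open (U::proj3 set)" "m \<in> car (obj J i) U"
  show "cmap_add L f g i U m \<in> car (obj L i) U"
   unfolding cmap_add_def by (rule om_add[OF O_module_L U(1) hom_closed[OF h(1) U] hom_closed[OF h(2) U]])
 qed (auto simp: cmap_add_def h[THEN hom_add] h[THEN hom_smult] h[THEN hom_res] algebra_simps osf)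
 show "resolved.tmap a J n (cmap_add L f g n)"
  unfolding resolved.tmap_def[OF r]
 proof (intro conjI allI impI)
  fix U m assume U: "open (U::proj3 set)" "m \<in> car (obj J (n - 1)) U"
  have "f n U (diff J (n - 1) U m) = (\<lambda>_. 0)" "g n U (diff J (n - 1) U m) = (\<lambda>_. 0)"
   using resolved.tm_d[OF r chain_map_tmap[OF r f] U(1) refl U(2)] resolved.tm_d[OF r chain_map_tmap[OF r g] U(1) refl U(2)] by simp_all
  thus "cmap_add L f g n U (diff J (n - 1) U m) = (\<lambda>_. 0)" by (simp add: cmap_add_def)
 qed (use *[of n] in simp)
qed

lemma chain_map_scale:
 assumes r: "resolved a b J s" and f: "chain_map J L f" shows "chain_map J L (cmap_scale L c f)"
proof (rule tmap_chain_map[OF r])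
 note h = chain_map_hom[OF f]
 show *: "O_hom (obj J i) (obj L i) (cmap_scale L c f i)" for i
 proof (rule O_homI)
  fix U m assume U: "open (U::proj3 set)" "m \<in> car (obj J i) U"
  show "cmap_scale L c f i U m \<in> car (obj L i) U"
   unfolding cmap_scale_def by (rule om_smult[OF O_module_L U(1) regular_const hom_closed[OF h U]])
  show "cmap_scale L c f i U (m \<boxplus>[obj J i,U] m') = cmap_scale L c f i U m \<boxplus>[obj L i,U] cmap_scale L c f i U m'"
   if "m' \<in> car (obj J i) U" for m'
   unfolding cmap_scale_def L_ops hom_add[OF h U that] by (simp add: distrib_left)
  show "cmap_scale L c f i U (g \<cdot>[obj J i,U] m) = g \<cdot>[obj L i,U] cmap_scale L c f i U m" if "g \<in> regular_on U" for g
   unfolding cmap_scale_def L_ops hom_smult[OF h U(1) that U(2)] by (simp add: mult.left_commute)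
  show "cmap_scale L c f i V (res (obj J i) U V m) = res (obj L i) U V (cmap_scale L c f i U m)" if V: "open V" "V \<subseteq> U" for V
   unfolding cmap_scale_def L_ops hom_res[OF h U(1) V U(2)] using subsetD[OF V(2)] by (simp add: osf)
 qed
 show "resolved.tmap a J n (cmap_scale L c f n)"
  unfolding resolved.tmap_def[OF r]
 proof (intro conjI allI impI)
  fix U m assume U: "open (U::proj3 set)" "m \<in> car (obj J (n - 1)) U"
  have "f n U (diff J (n - 1) U m) = (\<lambda>_. 0)"
   by (rule resolved.tm_d[OF r chain_map_tmap[OF r f] U(1) refl U(2)])
  thus "cmap_scale L c f n U (diff J (n - 1) U m) = (\<lambda>_. 0)" unfolding cmap_scale_def L_ops by simp
 qed (use *[of n] in simp)
qed

lemma roofsD: "(J, s, f) \<in> roofs I L ==> resolved a b J s" "(J, s, f) \<in> roofs I L ==> chain_map J L f"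
 using marked_line_axioms by (auto simp: roofs_def intro!: resolved.intro resolved_axioms.intro)

lemma roofsI: "resolved a b J s ==> chain_map J L f ==> (J, s, f) \<in> roofs I L"
 using resolved.bc[of a b J s] resolved.qi[of a b J s] by (simp add: roofs_def)

text \<open>Both values are carried to the roof \<open>M\<close> that dominates the two, the second
  one across the homotopy of the right legs, and values on \<open>M\<close> are unique.\<close>

lemma related_imp_same_value:
 assumes "((J, s, f), (J', s', f')) \<in> roof_rel I L" "val J s (f n) x" "val J' s' (f' n) x'"
 shows "x = x'"
proof -
 from assms(1) obtain M u u' where r: "(J, s, f) \<in> roofs I L" "(J', s', f') \<in> roofs I L" and M: "bounded_complex M" "chain_map M J u" "chain_map M J' u'" "quasi_iso M I (cmap_comp s u)"
  "homotopic M I (cmap_comp s u) (cmap_comp s' u')" "homotopic M L (cmap_comp f u) (cmap_comp f' u')"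
  unfolding roof_rel_def by blast
 note r1 = roofsD[OF r(1)] and r2 = roofsD[OF r(2)]
 let ?s = "cmap_comp s u"
 have rM: "resolved a b M ?s" using marked_line_axioms M(1,4) by (intro resolved.intro resolved_axioms.intro)
 note hs = chain_map_hom[OF resolved.chain_s[OF rM]]
 have refl: "homotopic M I ?s ?s" by (rule homotopic_of_eq[OF bounded_complex_module[OF M(1)] hs refl refl hs])
 have rm: "roof_map a b J s M ?s u" "roof_map a b J' s' M ?s u'"
  using r1(1) r2(1) rM M(2,3,5) refl by (auto intro!: roof_map.intro roof_map_axioms.intro)
 have z: "O_hom (obj M (n + 1)) (Qsh pt) (\<lambda>U m. \<lambda>_. 0)"
  using O_hom_zero[OF bounded_complex_module[OF M(1)] O_module_qsec] by simp
 have v: "val M ?s (cmap_comp f u n) x" by (rule push[OF rm(1) assms(2) z]) (simp add: cmap_comp_def)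
 from M(6) obtain h where h: "\<forall>i. O_hom (obj M i) (obj L (i - 1)) (h i)"
  "\<forall>i U. open U --> (\<forall>m\<in>car (obj M i) U. cmap_comp f u i U m = cmap_comp f' u' i U m \<boxplus>[obj L i,U]
    (diff L (i - 1) U (h i U m) \<boxplus>[obj L i,U] h (i + 1) U (diff M i U m)))" unfolding homotopic_def by (elim exE conjE)
 have "O_hom (obj M (n + 1)) (Qsh pt) (h (n + 1))" using h(1)[rule_format, of "n + 1"] by simp
 hence "val M ?s (cmap_comp f u n) x'"
  by (rule push[OF rm(2) assms(3)]) (use h(2)[rule_format, of _ _ n] L_diff in \<open>simp add: cmap_comp_def\<close>)
 from unique[OF rM v this] show ?thesis .
qed

text \<open>On the common roof the difference of the two right legs has the value 0, hence is
  null-homotopic.\<close>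

lemma same_value_imp_related:
 assumes r: "(J, s, f) \<in> roofs I L" "(J', s', f') \<in> roofs I L" and v: "val J s (f n) x" "val J' s' (f' n) x"
 shows "((J, s, f), (J', s', f')) \<in> roof_rel I L"
proof -
 note r1 = roofsD[OF r(1)] and r2 = roofsD[OF r(2)]
 interpret A: resolved a b J s by (rule r1)
 interpret B: resolved a b J' s' by (rule r2)
 obtain N0 m1 mX mY mW E where 1: "A.p_datum N0 m1 mX mY mW E" using A.ex_p_datum[OF open_UNIV UNIV_I] by (elim exE conjE)
 note P1 = A.p_datumD[OF 1]
 \<comment> \<open>The second datum is found inside the neighbourhood of the first, which is then
   restricted to it: the common roof needs both over the same \<open>N\<close>.\<close>
 obtain N n1 nX nY nW G where 2: "N \<subseteq> N0" "B.p_datum N n1 nX nY nW G" using B.ex_p_datum[OF P1(1,2)] by (elim exE conjE)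
 note P2 = B.p_datumD[OF 2(2)]
 interpret T: two_roofs a b J s J' s' N "A.rs 1 N0 N m1" "A.rs 0 N0 N mX" "A.rs 0 N0 N mY" "A.rs 0 N0 N mW" "A.rs (-1) N0 N E" n1 nX nY nW G
  using A.p_datum_res[OF 1 P2(1,2) 2(1)] 2(2) A.resolved_axioms B.resolved_axioms by (intro two_roofs.intro roof_gen.intro roof_gen_axioms.intro)
 note rM = T.resolved_M
 let ?s = "cmap_comp s T.uJ"
 have rm: "roof_map a b J s T.M ?s T.uJ" "roof_map a b J' s' T.M ?s T.uK"
  using A.resolved_axioms B.resolved_axioms rM T.chain_uJ T.chain_uK T.homotopic_legs by (auto intro!: roof_map.intro roof_map_axioms.intro)
 have z: "O_hom (obj T.M (n + 1)) (Qsh pt) (\<lambda>U m. \<lambda>_. 0)"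
  using O_hom_zero[OF T.O_module_M O_module_qsec] by simp
 let ?f = "cmap_comp f T.uJ" and ?g = "cmap_comp f' T.uK"
 note cf = chain_map_comp[OF T.chain_uJ r1(2)] and cg = chain_map_comp[OF T.chain_uK r2(2)]
 have vf: "val T.M ?s (?f n) x" by (rule push[OF rm(1) v(1) z]) (simp add: cmap_comp_def)
 have vg: "val T.M ?s (?g n) x" by (rule push[OF rm(2) v(2) z]) (simp add: cmap_comp_def)
 let ?k = "cmap_add L ?f (cmap_scale L (-1) ?g)"
 have "val T.M ?s (cmap_scale L (-1) ?g n) ((-1) *s x)" by (rule val_scale[OF rM vg]) (simp add: cmap_scale_def)
 note va = val_add[OF rM vf this]
 have "x + (-1) *s x = 0" by (simp add: vec_eq_iff)
 with va have v0: "val T.M ?s (?k n) 0" by (simp only: cmap_add_def L_ops)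
 have ck: "chain_map T.M L ?k" by (intro chain_map_add[OF rM] chain_map_scale[OF rM] cf cg)
 have fr: "free_roof a b T.M ?s N (pr (pr (A.rs 0 N0 N mX) nX) (ratio 2 a N)) (pr (pr (A.rs 0 N0 N mY) nY) (ratio 3 a N))
   (pr (pr (A.rs 0 N0 N mW) nW) (ratio b a N)) (pr (A.rs (-1) N0 N E) G)"
  using rM T.M_obj(1) T.p_datum_M by (intro free_roof.intro free_roof_axioms.intro)
 from null[OF fr chain_map_tmap[OF rM ck] v0] obtain h where h: "O_hom (obj T.M (n + 1)) (Qsh pt) h"
  "\<forall>U m. open U --> m \<in> car (obj T.M n) U --> ?k n U m = h U (diff T.M n U m)" by (elim exE conjE)
 have "homotopic T.M L ?f ?g"
 proof (rule homotopicI[OF rM cf cg h(1)])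
  fix U m assume U: "open U" and m: "m \<in> car (obj T.M n) U"
  show "?f n U m = (\<lambda>y. ?g n U m y + h U (diff T.M n U m) y)"
  proof
   fix y
   have "?k n U m y = h U (diff T.M n U m) y" using h(2) U m by simp
   thus "?f n U m y = ?g n U m y + h U (diff T.M n U m) y"
    using L_hom_outside[OF chain_map_hom[OF cf] U m, of y] L_hom_outside[OF chain_map_hom[OF cg] U m, of y]
    by (cases "y \<in> U") (simp_all add: cmap_add_def cmap_scale_def on_set_out diff_eq_eq add.commute)
  qed
 qed
 hence c: "bounded_complex T.M \<and> chain_map T.M J T.uJ \<and> chain_map T.M J' T.uK \<and> quasi_iso T.M I ?s \<and> homotopic T.M I ?s (cmap_comp s' T.uK) \<and> homotopic T.M L ?f ?g"
  using T.bounded_M T.chain_uJ T.chain_uK T.quasi_iso_M T.homotopic_legs(2) by (intro conjI)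
 show ?thesis unfolding roof_rel_def mem_Collect_eq prod.case using r c by (intro conjI exI[of _ T.M] exI[of _ T.uJ] exI[of _ T.uK]) simp_all
qed

lemma ext_iso: "iso_to_Cn (derived_hom I L) TYPE('n)"
proof (rule iso_to_CnI[where V = "\<lambda>(J, s, f) x. val J s (f n) x" and P = R and q = q and F = "\<lambda>x i. if i = n then F x else (\<lambda>U m. \<lambda>_. 0)"])
 fix r assume r: "r \<in> roofs I L"
 obtain J s f where e: "r = (J, s, f)" by (cases r)
 note D = roofsD[OF r[unfolded e]]
 show "\<exists>!x. (case r of (J, s, f) => \<lambda>x. val J s (f n) x) x"
  unfolding e using ex[OF D(1) chain_map_tmap[OF D]] unique[OF D(1)] by auto
 fix r' x assume r': "r' \<in> roofs I L" and v: "(case r of (J, s, f) => \<lambda>x. val J s (f n) x) x"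
 obtain J' s' f' where e': "r' = (J', s', f')" by (cases r')
 note D' = roofsD[OF r'[unfolded e']]
 obtain x' where x': "val J' s' (f' n) x'" using ex[OF D'(1) chain_map_tmap[OF D']] by (elim exE)
 show "(r, r') \<in> roof_rel I L \<longleftrightarrow> (case r' of (J, s, f) => \<lambda>x. val J s (f n) x) x"
  using same_value_imp_related[of J s f J' s' f' x] related_imp_same_value[of J s f J' s' f' x x'] v x' r r' unfolding e e' by auto
next
 fix J s f g x u assume f: "(J, s, f) \<in> roofs I L" "(J, s, g) \<in> roofs I L"
  and v: "(case (J, s, f) of (J, s, f) => \<lambda>x. val J s (f n) x) x" "(case (J, s, g) of (J, s, f) => \<lambda>x. val J s (f n) x) u"
 note D = roofsD[OF f(1)]
 show "(J, s, cmap_add L f g) \<in> roofs I L \<and> (case (J, s, cmap_add L f g) of (J, s, f) => \<lambda>x. val J s (f n) x) (x + u)"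
  using roofsI[OF D(1) chain_map_add[OF D roofsD(2)[OF f(2)]]] val_add[OF D(1), of "f n" x "g n" u] v by (simp add: cmap_add_def[abs_def])
next
 fix J s f x c assume f: "(J, s, f) \<in> roofs I L" and v: "(case (J, s, f) of (J, s, f) => \<lambda>x. val J s (f n) x) x"
 note D = roofsD[OF f(1)]
 have "val J s (cmap_scale L c f n) (c *s x)" by (rule val_scale[OF D(1), of "f n"]) (use v in \<open>simp_all add: cmap_scale_def\<close>)
 thus "(J, s, cmap_scale L c f) \<in> roofs I L \<and> (case (J, s, cmap_scale L c f) of (J, s, f) => \<lambda>x. val J s (f n) x) (c *s x)"
  using roofsI[OF D(1) chain_map_scale[OF D]] by simp
next
 fix x
 let ?f = "\<lambda>i. if i = n then F x else (\<lambda>U m. \<lambda>_. 0)"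
 have "O_hom (obj R i) (obj L i) (?f i)" for i
  using F(1)[unfolded resolved.tmap_def[OF resolved_R]] O_hom_to_zero by (cases "i = n") auto
 hence "chain_map R L ?f" by (rule tmap_chain_map[OF resolved_R]) (simp add: F(1))
 thus "(R, q, ?f) \<in> roofs I L \<and> (case (R, q, ?f) of (J, s, f) => \<lambda>x. val J s (f n) x) x"
  using roofsI[OF resolved_R] F(2) by simp
qed

end

context marked_line begin

lemma tangent_iso: "iso_to_Cn (tangent_space (rho a)) TYPE(5)"
proof -
 interpret E: ext_value a b 0 "resolved.val0 a b" f0
  by unfold_locales (use resolved.ex_val0 resolved.val0_unique resolved.val0_add resolved.val0_scale roof_map.val0_push free_roof.null_homotopic_0 tmap_f0 val0_f0 in \<open>simp; blast\<close>)+
 show ?thesis using E.ext_iso by (simp add: tangent_space_def Ext_def E.L_def)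
qed

lemma obstruction_iso: "iso_to_Cn (obstruction_space (rho a)) TYPE(3)"
proof -
 interpret E: ext_value a b "-1" "resolved.val1 a b" f1
  by unfold_locales (use resolved.ex_val1 resolved.val1_unique resolved.val1_add resolved.val1_scale roof_map.val1_push free_roof.null_homotopic_1 tmap_f1 val1_f1 in \<open>simp; blast\<close>)+
 show ?thesis using E.ext_iso by (simp add: obstruction_space_def Ext_def E.L_def)
qed

end

theorem lemma5p11:
 fixes i :: 4
 assumes "i \<in> {0, 1}"
 shows "iso_to_Cn (tangent_space (rho i)) TYPE(5) \<and>
    iso_to_Cn (obstruction_space (rho i)) TYPE(3)"
proof -
 \<comment> \<open>For 0 and 1 in the type \<open>4\<close> the other coordinate of the line has the
   index \<open>1 - i\<close>.\<close>
 have "marked_line i (1 - i)" by unfold_locales (use assms in auto)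
 then show ?thesis using marked_line.tangent_iso marked_line.obstruction_iso by blast
qed

end
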